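(* Let $0 \leq \alpha < 1$ and $\theta > -\alpha$, and consider an $(\alpha,\theta)$-recursive tree on $\mathbb{Z}_+$. For $i \geq 0$, let $B^{(i)} = (B_1^{(i)}, B_2^{(i)}, \ldots)$ be the partition of $\mathbb{N} \setminus \{1,\ldots,i\}$ into the vertex sets of the connected components obtained by removing vertices $0,1,\ldots,i$ from the tree, with blocks listed in increasing order of smallest element. Then for all $i \geq 0$, the blocks $B_1^{(i)}, B_2^{(i)}, \ldots$ form an exchangeable $(\alpha, \theta+i)$ partition of $\mathbb{N} \setminus \{1,2,\ldots,i\}$. In particular, $B_1^{(i)}, B_2^{(i)}, \ldots$ possess (almost surely) asymptotic frequencies $F_1^{(i)}, F_2^{(i)}, \ldots$ such that, writing $F^{(i)} = (F_1^{(i)}, F_2^{(i)}, \ldots)$, one has $(F^{(i)})^\downarrow \in \Delta_\infty^\downarrow$ and $F^{(i)} \sim \mathrm{GEM}(\alpha, \theta+i)$ for all $i \geq 0$. Moreover, letting $G^{(i)} = (F^{(i)})^\downarrow$, the process $(G^{(i)}, i \geq 0)$ is a Markov chain such that the following statements hold: (1) For $i \geq 0$, conditional on $G^{(i)}$, $G^{(i+1)}$ has the same distribution as $\mathrm{Frag}_\alpha(G^{(i)})$. (2) For $i \geq 0$, conditional on $G^{(i+1)}$, $G^{(i)}$ has the same distribution as $\mathrm{Coag}_{\alpha,\theta+i}(G^{(i+1)})$.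
   Context: Here $\mathbb{N} = \{1,2,\ldots\}$ and $\mathbb{Z}_+ = \{0,1,2,\ldots\}$. Let $\Delta_\infty^\downarrow = \{ x = (x_1, x_2, \ldots) : x_1 \geq x_2 \geq \cdots > 0, \ \sum_{i=1}^\infty x_i = 1 \}$. A superscript $\downarrow$ on a sequence means that the sequence is put into decreasing order. $\mathrm{GEM}$ and $\mathrm{PD}$ distributions: for $0 \leq \alpha < 1$ and $\theta > -\alpha$, let $B_1, B_2, \ldots$ be independent with $B_n \sim \mathrm{Beta}(1-\alpha, \theta + n\alpha)$. Let $\tilde X_1 = B_1$ and $\tilde X_n = (1-B_1)\cdots(1-B_{n-1})B_n$ for $n \geq 2$. The law of $(\tilde X_1, \tilde X_2, \ldots)$ is $\mathrm{GEM}(\alpha,\theta)$, and the law of its decreasing rearrangement is $\mathrm{PD}(\alpha,\theta)$. Exchangeable $(\alpha,\theta)$ partition of an infinite set $A \subseteq \mathbb{N}$: generate $(Y_1,Y_2,\ldots) \sim \mathrm{PD}(\alpha,\theta)$; conditionally on this, assign each $i \in A$ to block $j$ with probability $Y_j$, independently for each $i \in A$. An exchangeable $(\alpha,\theta)$ partition is a random partition of $A$ with the law of the resulting partition. The asymptotic frequency of a block $B$ of a partition of $A$ is $\lim_{n\to\infty} |B \cap \{1,\ldots,n\}| / |A \cap \{1,\ldots,n\}|$. $(\alpha,\theta)$-recursive tree: a random rooted tree on $\mathbb{Z}_+$ with root $0$, whose labels increase along paths away from the root, constructed as follows. Start with the root $0$ and a single child labeled $1$. Vertices $2,3,\ldots$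 are added in turn, vertex $i$ being added as a child of one of the existing vertices $0,1,\ldots,i-1$: given the current tree, it is added as a child of vertex $j \geq 1$ with probability proportional to $1-\alpha+\alpha k_j$, and as a child of vertex $0$ with probability proportional to $\theta + \alpha k_0$, where $k_j$ is the current number of children of vertex $j$. Fragmentation operator: $\mathrm{Frag}_\alpha : \Delta_\infty^\downarrow \to \Delta_\infty^\downarrow$ is the random operator defined as follows. For $x \in \Delta_\infty^\downarrow$, let $I$ be a random index with $\mathbb{P}(I=i) = x_i$, $i \geq 1$, and let $\eta = (\eta_1,\eta_2,\ldots) \sim \mathrm{PD}(\alpha, 1-\alpha)$ be independent of $I$. Then $\mathrm{Frag}_\alpha(x)$ is the decreasing rearrangement of the collection consisting of all $x_j$ with $j \neq I$ and all $x_I \eta_k$, $k \geq 1$. Coagulation operator: for $0\le\alpha<1$, $\theta>-\alpha$, $\mathrm{Coag}_{\alpha,\theta} : \Delta_\infty^\downarrow \to \Delta_\infty^\downarrow$ is the random operator defined as follows. If $\alpha > 0$, let $B \sim \mathrm{Beta}((1-\alpha)/\alpha, (\theta+\alpha)/\alpha)$; if $\alpha = 0$, let $B = 1/(\theta+1)$. Let $I_1, I_2, \ldots$ be $\{0,1\}$-valued random variables which, given $B$, are i.i.d. $\mathrm{Bernoulli}(B)$. Then $\mathrm{Coag}_{\alpha,\theta}(x) = \left( \sum_{i : I_i = 1} x_i, \ (x_j : I_j = 0) \right)^\downarrow$. "Conditional on $G^{(i)}$, $G^{(i+1)}$ has the same distribution as $\mathrm{Frag}_\alpha(G^{(i)})$"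 means that the regular conditional law of $G^{(i+1)}$ given $G^{(i)} = x$ is the law of $\mathrm{Frag}_\alpha(x)$; similarly for $\mathrm{Coag}$. *)

theory Defs
  imports "HOL-Probability.Probability"
begin

text \<open>
  Sequences are indexed from 0, so \<^term>\<open>x n\<close> stands for $x_{n+1}$.  Vertex labels are not
  shifted: the vertices of the tree are the natural numbers including the root 0.
\<close>

abbreviation seq_space :: "(nat \<Rightarrow> real) measure" where
  "seq_space \<equiv> Pi\<^sub>M UNIV (\<lambda>_. borel)"

definition ranked_simplex :: "(nat \<Rightarrow> real) set" where
  "ranked_simplex = {x. decseq x \<and> (\<forall>n. x n > 0) \<and> x sums 1}"

text \<open>
  Decreasing rearrangement of the family \<open>(f a)\<close> with \<open>a \<in> A\<close>, counted with multiplicity.  The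
  sequence \<open>y\<close> is unique when it exists; otherwise (for instance if \<open>A\<close> is finite) the value is
  the zero sequence, which lies outside \<open>ranked_simplex\<close>.
\<close>
definition is_decreasing_rearrangement :: "'i set \<Rightarrow> ('i \<Rightarrow> real) \<Rightarrow> (nat \<Rightarrow> real) \<Rightarrow> bool" where
  "is_decreasing_rearrangement A f y \<longleftrightarrow>
     decseq y \<and> (\<exists>\<pi>. bij_betw \<pi> UNIV A \<and> (\<forall>n. y n = f (\<pi> n)))"

lemma is_decreasing_rearrangement_unique:
  assumes "is_decreasing_rearrangement A f y" and "is_decreasing_rearrangement A f z"
  shows "y = z"
proof -
  have le: "z n \<le> y n"
    if y: "is_decreasing_rearrangement A f y" and z: "is_decreasing_rearrangement A f z" for y z n
  proof (rule ccontr)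
    assume less: "\<not> z n \<le> y n"
    obtain \<pi> where \<pi>: "bij_betw \<pi> UNIV A" "\<And>n. y n = f (\<pi> n)" and dy: "decseq y"
      using y by (auto simp: is_decreasing_rearrangement_def)
    obtain \<rho> where \<rho>: "bij_betw \<rho> UNIV A" "\<And>n. z n = f (\<rho> n)" and dz: "decseq z"
      using z by (auto simp: is_decreasing_rearrangement_def)
    define \<sigma> where "\<sigma> = inv_into UNIV \<pi> \<circ> \<rho>"
    have \<sigma>: "bij_betw \<sigma> UNIV UNIV"
      unfolding \<sigma>_def by (rule bij_betw_trans[OF \<rho>(1) bij_betw_inv_into[OF \<pi>(1)]])
    have y\<sigma>: "y (\<sigma> k) = z k" for k
    proof -
      have "\<rho> k \<in> \<pi> ` UNIV"
        using \<pi>(1) \<rho>(1) by (auto simp: bij_betw_def)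
      then have "\<pi> (inv_into UNIV \<pi> (\<rho> k)) = \<rho> k"
        by (rule f_inv_into_f)
      then show ?thesis
        by (simp add: \<sigma>_def \<pi>(2) \<rho>(2))
    qed
    have "\<sigma> ` {..n} \<subseteq> {..<n}"
    proof clarify
      fix k assume "k \<le> n"
      then have "y (\<sigma> k) \<ge> z n"
        using dz by (simp add: y\<sigma> decseqD)
      then have "y n < y (\<sigma> k)"
        using less by simp
      then show "\<sigma> k < n"
        using decseqD[OF dy, of n "\<sigma> k"] by linarith
    qed
    then have "card (\<sigma> ` {..n}) \<le> card {..<n}"
      by (intro card_mono) auto
    moreover have "card (\<sigma> ` {..n}) = Suc n"
      using \<sigma> by (subst card_image) (auto simp: bij_betw_def inj_on_def)
    ultimately show False by simp
  qed
  show ?thesis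
    using le[OF assms] le[OF assms(2,1)] by (intro ext antisym) auto
qed

definition decreasing_rearrangement :: "'i set \<Rightarrow> ('i \<Rightarrow> real) \<Rightarrow> nat \<Rightarrow> real" where
  "decreasing_rearrangement A f =
     (if \<exists>y. is_decreasing_rearrangement A f y
      then THE y. is_decreasing_rearrangement A f y else (\<lambda>_. 0))"


subsection \<open>GEM and Poisson--Dirichlet distributions\<close>

definition beta_density :: "real \<Rightarrow> real \<Rightarrow> real \<Rightarrow> real" where
  "beta_density a b x =
     (if 0 < x \<and> x < 1 then x powr (a - 1) * (1 - x) powr (b - 1) / Beta a b else 0)"

definition beta_distribution :: "real \<Rightarrow> real \<Rightarrow> real measure" where
  "beta_distribution a b = density lborel (\<lambda>x. ennreal (beta_density a b x))"

definition stick_breaking :: "(nat \<Rightarrow> real) \<Rightarrow> nat \<Rightarrow> real" where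
  "stick_breaking b n = (\<Prod>m<n. 1 - b m) * b n"

definition GEM :: "real \<Rightarrow> real \<Rightarrow> (nat \<Rightarrow> real) measure" where
  "GEM \<alpha> \<theta> =
     distr (Pi\<^sub>M UNIV (\<lambda>n. beta_distribution (1 - \<alpha>) (\<theta> + real (Suc n) * \<alpha>)))
       seq_space stick_breaking"

definition PD :: "real \<Rightarrow> real \<Rightarrow> (nat \<Rightarrow> real) measure" where
  "PD \<alpha> \<theta> = distr (GEM \<alpha> \<theta>) seq_space (decreasing_rearrangement UNIV)"


subsection \<open>Random partitions\<close>

text \<open>Law of a random index equal to \<open>n\<close> with probability \<open>x n\<close>.  Only \<open>x \<in> ranked_simplex\<close>
  matters; the other value makes the function total and measurable.\<close>
definition index_pmf :: "(nat \<Rightarrow> real) \<Rightarrow> nat pmf" where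
  "index_pmf x = (if x \<in> ranked_simplex then embed_pmf x else return_pmf 0)"

definition partition_space :: "nat set \<Rightarrow> nat set set measure" where
  "partition_space A =
     sigma {P. partition_on A P}
       {{P. partition_on A P \<and> (\<exists>B\<in>P. i \<in> B \<and> j \<in> B)} | i j. i \<in> A \<and> j \<in> A}"

definition blocks_of_labelling :: "nat set \<Rightarrow> (nat \<Rightarrow> nat) \<Rightarrow> nat set set" where
  "blocks_of_labelling A c = (\<lambda>j. {i \<in> A. c i = j}) ` (c ` A)"

definition exchangeable_partition_law :: "real \<Rightarrow> real \<Rightarrow> nat set \<Rightarrow> nat set set measure" where
  "exchangeable_partition_law \<alpha> \<theta> A =
     distr (PD \<alpha> \<theta> \<bind> (\<lambda>y. Pi\<^sub>M A (\<lambda>_. measure_pmf (index_pmf y))))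
       (partition_space A) (blocks_of_labelling A)"

text \<open>The union has at most one member: it is the block preceded by exactly \<open>n\<close> blocks in the
  order of least elements, and it is empty if there are at most \<open>n\<close> blocks.\<close>
definition nth_block :: "nat set set \<Rightarrow> nat \<Rightarrow> nat set" where
  "nth_block P n =
     \<Union>{B \<in> P. card {C \<in> P. (LEAST v. v \<in> C) < (LEAST v. v \<in> B)} = n}"

definition relative_count :: "nat set \<Rightarrow> nat set \<Rightarrow> nat \<Rightarrow> real" where
  "relative_count A B n = real (card (B \<inter> {1..n})) / real (card (A \<inter> {1..n}))"

definition has_asymptotic_frequency :: "nat set \<Rightarrow> nat set \<Rightarrow> bool" where
  "has_asymptotic_frequency A B \<longleftrightarrow> convergent (relative_count A B)"

definition asymptotic_frequency :: "nat set \<Rightarrow> nat set \<Rightarrow> real" where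
  "asymptotic_frequency A B = lim (relative_count A B)"


subsection \<open>Recursive trees\<close>

text \<open>
  A rooted tree on the natural numbers with root 0 is encoded by its parent map \<open>p\<close>, where
  \<open>p n\<close> is the parent of \<open>n \<ge> 1\<close>; the value \<open>p 0\<close> is irrelevant.  Labels increase
  along paths away from the root iff \<open>p n < n\<close> for all \<open>n \<ge> 1\<close>; this forces \<open>p 1 = 0\<close>.
\<close>
definition num_children :: "(nat \<Rightarrow> nat) \<Rightarrow> nat \<Rightarrow> nat \<Rightarrow> nat" where
  "num_children p n j = card {m \<in> {1..<n}. p m = j}"

definition attachment_weight :: "real \<Rightarrow> real \<Rightarrow> (nat \<Rightarrow> nat) \<Rightarrow> nat \<Rightarrow> nat \<Rightarrow> real" where
  "attachment_weight \<alpha> \<theta> p n j =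
     (if j = 0 then \<theta> + \<alpha> * real (num_children p n j)
      else 1 - \<alpha> + \<alpha> * real (num_children p n j))"

definition recursive_tree ::
    "'a measure \<Rightarrow> real \<Rightarrow> real \<Rightarrow> ('a \<Rightarrow> nat \<Rightarrow> nat) \<Rightarrow> bool" where
  "recursive_tree M \<alpha> \<theta> T \<longleftrightarrow>
     prob_space M \<and>
     (\<forall>n\<ge>1. (\<lambda>\<omega>. T \<omega> n) \<in> M \<rightarrow>\<^sub>M count_space UNIV) \<and>
     (\<forall>\<omega>\<in>space M. \<forall>n\<ge>1. T \<omega> n < n) \<and>
     (\<forall>n\<ge>2. \<forall>p. \<forall>j<n.
        \<P>(\<omega> in M. \<forall>m\<in>{1..<n}. T \<omega> m = p m) > 0 \<longrightarrow>
        \<P>(\<omega> in M. T \<omega> n = j \<bar> \<forall>m\<in>{1..<n}. T \<omega> m = p m) =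
          attachment_weight \<alpha> \<theta> p n j / (\<Sum>k<n. attachment_weight \<alpha> \<theta> p n k))"

definition tree_edges :: "(nat \<Rightarrow> nat) \<Rightarrow> (nat \<times> nat) set" where
  "tree_edges p = {(u, v). (v \<ge> 1 \<and> u = p v) \<or> (u \<ge> 1 \<and> v = p u)}"

definition components_after_removing :: "nat \<Rightarrow> (nat \<Rightarrow> nat) \<Rightarrow> nat set set" where
  "components_after_removing i p =
     (let V = UNIV - {0..i} in V // (Restr (tree_edges p) V)\<^sup>*)"

definition block_frequencies :: "nat \<Rightarrow> (nat \<Rightarrow> nat) \<Rightarrow> nat \<Rightarrow> real" where
  "block_frequencies i p n =
     asymptotic_frequency {Suc i..} (nth_block (components_after_removing i p) n)"

definition ranked_frequencies :: "nat \<Rightarrow> (nat \<Rightarrow> nat) \<Rightarrow> nat \<Rightarrow> real" where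
  "ranked_frequencies i p = decreasing_rearrangement UNIV (block_frequencies i p)"


subsection \<open>Fragmentation and coagulation\<close>

definition fragment :: "(nat \<Rightarrow> real) \<Rightarrow> nat \<Rightarrow> (nat \<Rightarrow> real) \<Rightarrow> nat \<Rightarrow> real" where
  "fragment x i \<eta> =
     decreasing_rearrangement ({Inl j | j. j \<noteq> i} \<union> range Inr) (case_sum x (\<lambda>k. x i * \<eta> k))"

definition Frag_law :: "real \<Rightarrow> (nat \<Rightarrow> real) \<Rightarrow> (nat \<Rightarrow> real) measure" where
  "Frag_law \<alpha> x =
     distr (measure_pmf (index_pmf x) \<Otimes>\<^sub>M PD \<alpha> (1 - \<alpha>)) seq_space
       (\<lambda>(i, \<eta>). fragment x i \<eta>)"

definition coagulate :: "(nat \<Rightarrow> real) \<Rightarrow> (nat \<Rightarrow> bool) \<Rightarrow> nat \<Rightarrow> real" where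
  "coagulate x c =
     decreasing_rearrangement (insert None {Some j | j. \<not> c j})
       (case_option (\<Sum>i. if c i then x i else 0) x)"

definition merging_probability_law :: "real \<Rightarrow> real \<Rightarrow> real measure" where
  "merging_probability_law \<alpha> \<theta> =
     (if \<alpha> > 0 then beta_distribution ((1 - \<alpha>) / \<alpha>) ((\<theta> + \<alpha>) / \<alpha>)
      else return borel (1 / (\<theta> + 1)))"

definition Coag_law :: "real \<Rightarrow> real \<Rightarrow> (nat \<Rightarrow> real) \<Rightarrow> (nat \<Rightarrow> real) measure" where
  "Coag_law \<alpha> \<theta> x =
     distr (merging_probability_law \<alpha> \<theta> \<bind>
              (\<lambda>b. Pi\<^sub>M UNIV (\<lambda>_::nat. measure_pmf (bernoulli_pmf b))))
       seq_space (coagulate x)"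


subsection \<open>Markov chains and regular conditional laws\<close>

text \<open>The chain need not be time-homogeneous.\<close>
definition markov_chain :: "'a measure \<Rightarrow> 'b measure \<Rightarrow> (nat \<Rightarrow> 'a \<Rightarrow> 'b) \<Rightarrow> bool" where
  "markov_chain M N X \<longleftrightarrow>
     (\<forall>n. X n \<in> M \<rightarrow>\<^sub>M N) \<and>
     (\<forall>n. \<forall>A\<in>sets N. AE \<omega> in M.
        real_cond_exp M
          (vimage_algebra (space M) (\<lambda>\<omega>. \<lambda>k\<in>{..n}. X k \<omega>) (Pi\<^sub>M {..n} (\<lambda>_. N)))
          (\<lambda>\<omega>. indicator A (X (Suc n) \<omega>)) \<omega> =
        real_cond_exp M (vimage_algebra (space M) (X n) N)
          (\<lambda>\<omega>. indicator A (X (Suc n) \<omega>)) \<omega>)"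

text \<open>
  \<open>K x\<close> is a regular conditional law of \<open>Y\<close> given \<open>X = x\<close>, where \<open>X\<close> takes its values
  almost surely in \<open>S\<close>, so that \<open>K\<close> only matters on \<open>S\<close>.
\<close>
definition regular_conditional_law ::
    "'a measure \<Rightarrow> 'b measure \<Rightarrow> 'b set \<Rightarrow> ('a \<Rightarrow> 'b) \<Rightarrow> 'c measure \<Rightarrow> ('a \<Rightarrow> 'c) \<Rightarrow>
     ('b \<Rightarrow> 'c measure) \<Rightarrow> bool" where
  "regular_conditional_law M N S X N' Y K \<longleftrightarrow>
     X \<in> M \<rightarrow>\<^sub>M N \<and> Y \<in> M \<rightarrow>\<^sub>M N' \<and> (AE \<omega> in M. X \<omega> \<in> S) \<and>
     K \<in> restrict_space N S \<rightarrow>\<^sub>M prob_algebra N' \<and>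
     (\<forall>A\<in>sets N'. AE \<omega> in M.
        real_cond_exp M (vimage_algebra (space M) X N) (\<lambda>\<omega>. indicator A (Y \<omega>)) \<omega> =
        measure (K (X \<omega>)) A)"

end

theory Submission
  imports Defs
begin

text \<open>  The whole chain can be read off from two ways of building an \<open>(\<alpha>, \<theta>)\<close> tree from independent
  ingredients.  One produces the coagulation, the other the fragmentation.

  Merge vertex 1 into the root.  If the root has \<open>k\<close> children, one of which is vertex 1, and vertex 1
  has \<open>l\<close> children, then their weights \<open>\<theta> + \<alpha> k\<close> and \<open>1 - \<alpha> + \<alpha> l\<close> add up to
  \<open>\<theta> + 1 + \<alpha> (k - 1 + l)\<close>, which is the weight of a root with \<open>k - 1 + l\<close> children in an
  \<open>(\<alpha>, \<theta> + 1)\<close> tree.  Hence the merged tree is an \<open>(\<alpha>, \<theta> + 1)\<close> tree, and an urn that is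
  independent of it decides which children of the merged root belonged to vertex 1
  (\<open>tree_law_split_root\<close>).  Polya's urn is a Beta mixture of Bernoulli sequences
  (\<open>measure_urn_law_cylinder\<close>).  The tree thus arises from the merged tree by fusing those components
  below the root that the urn marks, and this is the operator Coag (\<open>coagulation_identity\<close>).
  Removing the vertices up to \<open>i\<close> amounts to merging \<open>i\<close> times and then removing the root
  (\<open>components_eq_blocks\<close>), so that statements about step \<open>i\<close> are statements about the first step of
  an \<open>(\<alpha>, \<theta> + i)\<close> tree.

  Alternatively, a new vertex first chooses the component that it joins and then its parent in this
  component.  The vertices of a component of size \<open>m\<close> have total weight \<open>m (1 - \<alpha>) + (m - 1) \<alpha> = m - \<alpha>\<close>.
  The components therefore grow like the tables of the Chinese restaurant, and inside them grow
  independent \<open>(\<alpha>, 1 - \<alpha>)\<close> trees (\<open>tree_law_assemble\<close>).  Vertex 1 is the root of the first of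
  these trees.  Its component is a size-biased pick, and its removal breaks this component into
  the components of an independent \<open>(\<alpha>, 1 - \<alpha>)\<close> tree without its root; this is the operator Frag
  (\<open>fragmentation_identity\<close>).

  The Chinese restaurant has to be compared with the GEM and PD laws.  Let the customers bring
  independent labels with the GEM weights, and let a customer open a new table when the label does not
  name an occupied one.  Integrating out the independent sticks yields the seating rule
  (\<open>seating_probability\<close>), and by the law of large numbers the frequencies of the tables are the GEM
  weights themselves (\<open>frequency_crp_law\<close>).  It remains to see that the partition by labels, which is
  the paintbox, has the same law as the partition by tables.  The probability of a seating plan depends
  on the table sizes only, so the law of the seating is not affected if the first customers are
  ignored; but late customers sit, with high probability, at the table that their label names
  (\<open>measure_label_sample_pattern\<close>).

  For the Markov property, the marks of each coagulation step are independent of all later trees.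
  Given the tree at step \<open>n\<close>, the past thus depends only on the component masses at step \<open>n\<close>
  (\<open>past_integrates_out\<close>), and the fragmentation identity then gives the law of the next step
  (\<open>masses_markov\<close>).\<close>

section \<open>Random sequences in a countable alphabet\<close>

abbreviation seqs :: "(nat \<Rightarrow> 'a::countable) measure" where
  "seqs \<equiv> Pi\<^sub>M UNIV (\<lambda>_. count_space UNIV)"

definition initial :: "nat \<Rightarrow> (nat \<Rightarrow> 'a) \<Rightarrow> 'a list" where
  "initial n x = map x [0..<n]"

definition cylinder :: "'a list \<Rightarrow> (nat \<Rightarrow> 'a) set" where
  "cylinder xs = {x. initial (length xs) x = xs}"

lemma length_initial [simp]: "length (initial n x) = n"
  by (simp add: initial_def)

lemma nth_initial [simp]: "m < n \<Longrightarrow> initial n x ! m = x m"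
  by (simp add: initial_def)

lemma initial_0 [simp]: "initial 0 x = []"
  by (simp add: initial_def)

lemma initial_Suc [simp]: "initial (Suc n) x = initial n x @ [x n]"
  by (simp add: initial_def)

lemma set_initial: "set (initial n x) = x ` {..<n}"
  by (auto simp: initial_def)

lemma take_initial: "m \<le> n \<Longrightarrow> take m (initial n x) = initial m x"
  by (rule nth_equalityI) auto

lemma initial_eq_iff: "initial (length xs) x = xs \<longleftrightarrow> (\<forall>m<length xs. x m = xs ! m)"
  by (auto simp: list_eq_iff_nth_eq)

lemma cylinder_Nil [simp]: "cylinder [] = UNIV"
  by (simp add: cylinder_def)

lemma count_list_initial: "count_list (initial n x) v = card {m. m < n \<and> x m = v}"
proof (induction n)
  case (Suc n)
  have "{m. m < Suc n \<and> x m = v} = {m. m < n \<and> x m = v} \<union> (if x n = v then {n} else {})"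
    by (auto simp: less_Suc_eq)
  then show ?case using Suc by (auto simp: card_insert_if)
qed simp

lemma space_seqs [simp]: "space seqs = UNIV"
  by (simp add: space_PiM)

lemma measurable_initial [measurable]: "initial n \<in> seqs \<rightarrow>\<^sub>M count_space (UNIV :: 'a::countable list set)"
proof -
  have "initial n -` {xs} \<inter> space seqs \<in> sets seqs" for xs :: "'a list"
  proof (cases "length xs = n")
    case True
    then have "initial n -` {xs} \<inter> space seqs = {x \<in> space seqs. \<forall>m\<in>{..<n}. x m = xs ! m}"
      using initial_eq_iff[where xs = xs] by auto
    also have "\<dots> \<in> sets seqs" by measurable
    finally show ?thesis .
  next
    case False
    then have "initial n -` {xs} = {}" by auto
    then show ?thesis by simp
  qed
  then show ?thesis
    by (subst measurable_count_space_eq_countable) auto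
qed

lemma cylinder_sets [measurable]: "cylinder xs \<in> sets seqs"
proof -
  have "{x \<in> space seqs. initial (length xs) x = xs} \<in> sets seqs" by measurable
  then show ?thesis by (simp add: cylinder_def)
qed

lemma sets_seqs_eq_cylinders:
  "sets (seqs :: (nat \<Rightarrow> 'a::countable) measure) = sigma_sets UNIV (insert {} (range cylinder))"
proof
  interpret sigma_algebra UNIV "sigma_sets UNIV (insert {} (range (cylinder :: 'a list \<Rightarrow> _)))"
    by (rule sigma_algebra_sigma_sets) simp
  have "{x. x i \<in> A} \<in> sigma_sets UNIV (insert {} (range cylinder))" for i and A :: "'a set"
  proof -
    have "{x. x i \<in> A} = (\<Union>xs \<in> {xs. length xs = Suc i \<and> xs ! i \<in> A}. cylinder xs)"
    proof (intro set_eqI iffI)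
      fix x assume "x \<in> {x. x i \<in> A}"
      then show "x \<in> (\<Union>xs \<in> {xs. length xs = Suc i \<and> xs ! i \<in> A}. cylinder xs)"
        by (intro UN_I[of "initial (Suc i) x"]) (simp_all add: cylinder_def nth_append)
    next
      fix x assume "x \<in> (\<Union>xs \<in> {xs. length xs = Suc i \<and> xs ! i \<in> A}. cylinder xs)"
      then obtain xs where "length xs = Suc i" "xs ! i \<in> A" "initial (length xs) x = xs"
        unfolding cylinder_def by blast
      then show "x \<in> {x. x i \<in> A}"
        unfolding initial_eq_iff by auto
    qed
    also have "\<dots> \<in> sigma_sets UNIV (insert {} (range cylinder))"
      by (intro countable_UN'') auto
    finally show ?thesis .
  qed
  then have "sigma_sets UNIV {{f \<in> \<Pi>\<^sub>E i\<in>UNIV. UNIV. f i \<in> A} |i (A :: 'a set). i \<in> UNIV \<and> A \<in> sets (count_space UNIV)}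
      \<subseteq> sigma_sets UNIV (insert {} (range cylinder))"
    by (intro sigma_sets_mono) auto
  then show "sets (seqs :: (nat \<Rightarrow> 'a) measure) \<subseteq> sigma_sets UNIV (insert {} (range cylinder))"
    unfolding sets_PiM_single by simp
  have "sigma_sets (space seqs) (insert {} (range (cylinder :: 'a list \<Rightarrow> _))) \<subseteq> sets seqs"
    by (rule sets.sigma_sets_subset) auto
  then show "sigma_sets UNIV (insert {} (range (cylinder :: 'a list \<Rightarrow> _))) \<subseteq> sets seqs"
    by simp
qed

lemma Int_stable_cylinders: "Int_stable (insert {} (range cylinder))"
proof -
  have *: "cylinder xs \<inter> cylinder ys \<in> insert {} (range cylinder)" if "length xs \<le> length ys" for xs ys :: "'b list"
  proof (cases "take (length xs) ys = xs")
    case True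
    then have "cylinder xs \<inter> cylinder ys = cylinder ys"
      unfolding cylinder_def using that by (metis (mono_tags, lifting) take_initial Collect_mono_iff Int_absorb1)
    then show ?thesis by auto
  next
    case False
    then have "cylinder xs \<inter> cylinder ys = {}"
      unfolding cylinder_def using that take_initial[where 'a = 'b]
      by (smt (verit) disjoint_iff mem_Collect_eq)
    then show ?thesis by auto
  qed
  show ?thesis
  proof (rule Int_stableI)
    fix a b :: "(nat \<Rightarrow> 'b) set"
    assume "a \<in> insert {} (range cylinder)" "b \<in> insert {} (range cylinder)"
    then consider "a = {} \<or> b = {}" | xs ys where "a = cylinder xs" "b = cylinder ys" by auto
    then show "a \<inter> b \<in> insert {} (range cylinder)"
    proof cases
      case (2 xs ys)
      then show ?thesis using *[of xs ys] *[of ys xs] by (cases "length xs \<le> length ys") (auto simp: Int_commute)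
    qed auto
  qed
qed

text \<open>Cylinders form a generating \<open>\<pi>\<close>-system, so laws of random sequences may be compared by the
  probabilities of initial segments; laws of random trees are identified in this way.\<close>
lemma seqs_measure_eqI:
  fixes M N :: "(nat \<Rightarrow> 'a::countable) measure"
  assumes "prob_space M" "prob_space N" and [simp]: "sets M = sets seqs" "sets N = sets seqs"
    and eq: "\<And>xs. measure M (cylinder xs) = measure N (cylinder xs)"
  shows "M = N"
proof -
  interpret M: prob_space M by fact
  interpret N: prob_space N by fact
  show ?thesis
  proof (rule measure_eqI_generator_eq[OF Int_stable_cylinders, where \<Omega> = UNIV and A = "\<lambda>_. UNIV"])
    fix X :: "(nat \<Rightarrow> 'a) set" assume "X \<in> insert {} (range cylinder)"
    then show "emeasure M X = emeasure N X"
      using eq by (auto simp: M.emeasure_eq_measure N.emeasure_eq_measure)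
  next
    show "range (\<lambda>_::nat. UNIV) \<subseteq> insert {} (range (cylinder :: 'a list \<Rightarrow> _))"
      using cylinder_Nil by blast
  qed (auto simp: sets_seqs_eq_cylinders M.emeasure_eq_measure)
qed

text \<open>There are only countably many initial segments.\<close>
lemma measurable_determined_by_initial:
  fixes f :: "(nat \<Rightarrow> 'a::countable) \<Rightarrow> 'b"
  assumes "\<And>x y. (\<And>m. m < n \<Longrightarrow> x m = y m) \<Longrightarrow> f x = f y"
  shows "f \<in> seqs \<rightarrow>\<^sub>M count_space UNIV"
proof -
  have "(\<lambda>x. (\<lambda>xs. f (\<lambda>m. xs ! m)) (initial n x)) \<in> seqs \<rightarrow>\<^sub>M count_space UNIV"
    by (rule measurable_compose[OF measurable_initial]) simp
  moreover have "f (\<lambda>m. initial n x ! m) = f x" for x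
    by (rule assms) simp
  ultimately show ?thesis by simp
qed

lemma measurable_seqs_coordinatewise:
  fixes f :: "'b \<Rightarrow> nat \<Rightarrow> 'a::countable"
  assumes "\<And>n. (\<lambda>x. f x n) \<in> M \<rightarrow>\<^sub>M count_space UNIV"
  shows "f \<in> M \<rightarrow>\<^sub>M seqs"
  by (rule measurable_PiM_single') (use assms in auto)

lemma measurable_coordinate:
  "(\<lambda>x. x n) \<in> seqs \<rightarrow>\<^sub>M count_space (UNIV :: 'a::countable set)"
  by measurable

subsection \<open>Independent identically distributed sequences\<close>

definition iid :: "'a pmf \<Rightarrow> (nat \<Rightarrow> 'a) measure" where
  "iid p = Pi\<^sub>M UNIV (\<lambda>_. measure_pmf p)"

lemma sets_iid [simp, measurable_cong]: "sets (iid (p :: 'a::countable pmf)) = sets seqs"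
  unfolding iid_def by (intro sets_PiM_cong) auto

lemma space_iid [simp]: "space (iid p) = UNIV"
  by (simp add: iid_def space_PiM)

lemma prob_space_iid: "prob_space (iid p)"
  unfolding iid_def by (intro prob_space_PiM prob_space_measure_pmf)

lemma measure_iid_box:
  "measure (iid p) {x. \<forall>m<n. x m \<in> S m} = (\<Prod>m<n. measure (measure_pmf p) (S m))"
proof -
  interpret product_prob_space "\<lambda>_. measure_pmf p" UNIV
    by standard
  have "{x. \<forall>m<n. x m \<in> S m} = prod_emb UNIV (\<lambda>_. measure_pmf p) {..<n} (Pi\<^sub>E {..<n} S)"
    by (auto simp: prod_emb_def space_PiM PiE_def Pi_def)
  then have "emeasure (iid p) {x. \<forall>m<n. x m \<in> S m} = (\<Prod>m<n. emeasure (measure_pmf p) (S m))"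
    unfolding iid_def by (simp add: emeasure_PiM_emb)
  also have "\<dots> = ennreal (\<Prod>m<n. measure (measure_pmf p) (S m))"
    by (simp add: measure_pmf.emeasure_eq_measure prod_ennreal)
  finally show ?thesis by (simp add: measure_def prod_nonneg)
qed

lemma measure_iid_cylinder:
  "measure (iid p) (cylinder xs) = (\<Prod>m<length xs. pmf p (xs ! m))"
  using measure_iid_box[of p "length xs" "\<lambda>m. {xs ! m}"]
  by (simp add: cylinder_def initial_eq_iff measure_pmf_single)

lemma iid_kernel:
  fixes f :: "'b \<Rightarrow> 'a::countable pmf"
  assumes [measurable]: "\<And>a. (\<lambda>x. pmf (f x) a) \<in> borel_measurable M"
  shows "(\<lambda>x. iid (f x)) \<in> M \<rightarrow>\<^sub>M prob_algebra seqs"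
proof (rule measurable_prob_algebra_generated[OF sets_seqs_eq_cylinders Int_stable_cylinders])
  fix A :: "(nat \<Rightarrow> 'a) set" assume A: "A \<in> insert {} (range cylinder)"
  interpret prob_space "iid p" for p :: "'a pmf" by (rule prob_space_iid)
  show "(\<lambda>a. emeasure (iid (f a)) A) \<in> borel_measurable M"
    using A by (auto simp: emeasure_eq_measure measure_iid_cylinder)
qed (auto simp: prob_space_iid)

lemma iid_reindex:
  fixes p :: "'a::countable pmf" and \<sigma> :: "nat \<Rightarrow> nat"
  assumes "inj \<sigma>"
  shows "distr (iid p) seqs (\<lambda>x n. x (\<sigma> n)) = iid p"
proof -
  have "distr (iid p) (Pi\<^sub>M UNIV (\<lambda>_. measure_pmf p)) (\<lambda>x. \<lambda>n\<in>UNIV. x (\<sigma> n)) = iid p"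
    unfolding iid_def
    by (rule distr_PiM_reindex) (use assms prob_space_measure_pmf in auto)
  moreover have "distr (iid p) (Pi\<^sub>M UNIV (\<lambda>_. measure_pmf p)) (\<lambda>x. \<lambda>n\<in>UNIV. x (\<sigma> n)) =
      distr (iid p) seqs (\<lambda>x n. x (\<sigma> n))"
    by (rule distr_cong) (auto intro!: sets_PiM_cong)
  ultimately show ?thesis by simp
qed

lemma iid_map:
  fixes p :: "'a::countable pmf" and f :: "'a \<Rightarrow> 'b::countable"
  shows "distr (iid p) seqs (\<lambda>x n. f (x n)) = iid (map_pmf f p)"
proof (rule seqs_measure_eqI)
  have [measurable]: "(\<lambda>x n. f (x n)) \<in> iid p \<rightarrow>\<^sub>M seqs"
    by (rule measurable_seqs_coordinatewise) measurable
  show "prob_space (distr (iid p) seqs (\<lambda>x n. f (x n)))"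
    by (rule prob_space.prob_space_distr[OF prob_space_iid]) measurable
  fix xs
  have "(\<lambda>x n. f (x n)) -` cylinder xs \<inter> space (iid p) = {x. \<forall>m<length xs. x m \<in> f -` {xs ! m}}"
    by (auto simp: cylinder_def initial_eq_iff)
  then have "measure (distr (iid p) seqs (\<lambda>x n. f (x n))) (cylinder xs) =
      measure (iid p) {x. \<forall>m<length xs. x m \<in> f -` {xs ! m}}"
    by (simp add: measure_distr)
  then show "measure (distr (iid p) seqs (\<lambda>x n. f (x n))) (cylinder xs) =
      measure (iid (map_pmf f p)) (cylinder xs)"
    using measure_iid_box[of p "length xs" "\<lambda>m. f -` {xs ! m}"]
    by (simp add: measure_iid_cylinder pmf_map)
qed (auto simp: prob_space_iid)

subsection \<open>Sequential constructions\<close>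

text \<open>The chain rule: \<open>s ys v\<close> is the conditional probability that \<open>v\<close> follows the initial segment \<open>ys\<close>.\<close>
definition segment_prob :: "('a list \<Rightarrow> 'a \<Rightarrow> real) \<Rightarrow> 'a list \<Rightarrow> real" where
  "segment_prob s xs = (\<Prod>m<length xs. s (take m xs) (xs ! m))"

lemma segment_prob_Nil [simp]: "segment_prob s [] = 1"
  by (simp add: segment_prob_def)

lemma segment_prob_snoc [simp]: "segment_prob s (xs @ [v]) = segment_prob s xs * s xs v"
  by (simp add: segment_prob_def nth_append)

text \<open>Every family of transition probabilities is realised: attach an independent choice to each
  finite word in advance, and follow the choices.\<close>
lemma sequential_law_exists:
  fixes \<kappa> :: "'a::countable list \<Rightarrow> 'a pmf"
  shows "\<exists>M :: (nat \<Rightarrow> 'a) measure. prob_space M \<and> sets M = sets seqs \<and>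
           (\<forall>xs. measure M (cylinder xs) = segment_prob (\<lambda>ys. pmf (\<kappa> ys)) xs)"
proof -
  define P where "P = Pi\<^sub>M UNIV (\<lambda>ys. measure_pmf (\<kappa> ys))"
  \<comment> \<open>The word written so far; the choice attached to it is appended.\<close>
  define run :: "('a list \<Rightarrow> 'a) \<Rightarrow> nat \<Rightarrow> 'a list"
    where "run \<omega> n = rec_nat [] (\<lambda>_ ys. ys @ [\<omega> ys]) n" for \<omega> n
  have run_simps [simp]: "run \<omega> 0 = []" "run \<omega> (Suc n) = run \<omega> n @ [\<omega> (run \<omega> n)]" for \<omega> n
    by (simp_all add: run_def)
  define X where "X \<omega> n = \<omega> (run \<omega> n)" for \<omega> n
  have initial_X: "initial n (X \<omega>) = run \<omega> n" for n \<omega>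
    by (induction n) (simp_all add: X_def)
  interpret P: product_prob_space "\<lambda>ys. measure_pmf (\<kappa> ys)" UNIV
    by standard
  have P_prob: "prob_space P" unfolding P_def by (rule P.prob_space_axioms)
  have coord [measurable]: "(\<lambda>\<omega>. \<omega> ys) \<in> P \<rightarrow>\<^sub>M count_space UNIV" for ys
    unfolding P_def by (rule measurable_compose[OF measurable_component_singleton]) auto
  have [measurable]: "(\<lambda>\<omega>. run \<omega> n) \<in> P \<rightarrow>\<^sub>M count_space UNIV" for n
  proof (induction n)
    case (Suc n)
    note [measurable] = Suc
    have "(\<lambda>\<omega>. (\<lambda>ys \<omega>. ys @ [\<omega> ys]) (run \<omega> n) \<omega>) \<in> P \<rightarrow>\<^sub>M count_space UNIV"
      by (rule measurable_compose_countable) measurable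
    then show ?case by simp
  qed simp
  have X [measurable]: "X \<in> P \<rightarrow>\<^sub>M seqs"
  proof (rule measurable_seqs_coordinatewise)
    fix n
    have "(\<lambda>\<omega>. (\<lambda>ys \<omega>. \<omega> ys) (run \<omega> n) \<omega>) \<in> P \<rightarrow>\<^sub>M count_space UNIV"
      by (rule measurable_compose_countable) measurable
    then show "(\<lambda>\<omega>. X \<omega> n) \<in> P \<rightarrow>\<^sub>M count_space UNIV" by (simp add: X_def)
  qed
  have cyl: "measure P {\<omega>. run \<omega> (length xs) = xs} = segment_prob (\<lambda>ys. pmf (\<kappa> ys)) xs" for xs
  proof -
    \<comment> \<open>The choices along a given word sit at distinct coordinates, so they are independent.\<close>
    let ?J = "(\<lambda>m. take m xs) ` {..<length xs}"
    have run_iff: "run \<omega> n = take n xs \<longleftrightarrow> (\<forall>m<n. \<omega> (take m xs) = xs ! m)" if "n \<le> length xs" for \<omega> n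
      using that
    proof (induction n)
      case (Suc n)
      then show ?case by (auto simp: take_Suc_conv_app_nth less_Suc_eq)
    qed simp
    have inj: "inj_on (\<lambda>m. take m xs) {..<length xs}"
      by (rule inj_onI) (metis length_take lessThan_iff min.absorb4)
    have "{\<omega>. run \<omega> (length xs) = xs} = {\<omega>. \<forall>m<length xs. \<omega> (take m xs) = xs ! m}"
      using run_iff[of "length xs"] by simp
    also have "\<dots> = prod_emb UNIV (\<lambda>ys. measure_pmf (\<kappa> ys)) ?J (Pi\<^sub>E ?J (\<lambda>ys. {xs ! length ys}))"
      by (auto simp: prod_emb_def space_PiM PiE_def Pi_def)
    finally have "emeasure P {\<omega>. run \<omega> (length xs) = xs} =
        (\<Prod>ys\<in>?J. emeasure (measure_pmf (\<kappa> ys)) {xs ! length ys})"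
      unfolding P_def by (simp add: P.emeasure_PiM_emb)
    also have "\<dots> = (\<Prod>m<length xs. ennreal (pmf (\<kappa> (take m xs)) (xs ! m)))"
      by (subst prod.reindex[OF inj]) (simp add: emeasure_pmf_single)
    also have "\<dots> = ennreal (segment_prob (\<lambda>ys. pmf (\<kappa> ys)) xs)"
      by (simp add: prod_ennreal segment_prob_def)
    finally show ?thesis by (simp add: measure_def segment_prob_def prod_nonneg)
  qed
  have "X -` cylinder xs \<inter> space P = {\<omega>. run \<omega> (length xs) = xs}" for xs
    by (auto simp: cylinder_def initial_X P_def space_PiM)
  then have "measure (distr P seqs X) (cylinder xs) = segment_prob (\<lambda>ys. pmf (\<kappa> ys)) xs" for xs
    using cyl[of xs] by (simp add: measure_distr X)
  moreover have "prob_space (distr P seqs X)"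
    by (rule prob_space.prob_space_distr[OF P_prob X])
  ultimately show ?thesis
    by (intro exI[of _ "distr P seqs X"]) auto
qed

section \<open>Decreasing rearrangements\<close>

abbreviation ranked :: "(nat \<Rightarrow> real) \<Rightarrow> nat \<Rightarrow> real" where
  "ranked \<equiv> decreasing_rearrangement UNIV"

lemma decreasing_rearrangement_eqI:
  assumes "is_decreasing_rearrangement A f y"
  shows "decreasing_rearrangement A f = y"
proof -
  have "(THE y. is_decreasing_rearrangement A f y) = y"
    by (rule the_equality[where P = "is_decreasing_rearrangement A f"])
       (use assms is_decreasing_rearrangement_unique in blast)+
  then show ?thesis
    using assms unfolding decreasing_rearrangement_def by auto
qed

lemma is_decreasing_rearrangement_reindex:
  assumes "is_decreasing_rearrangement B g y" and h: "bij_betw h B A"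
    and fg: "\<And>b. b \<in> B \<Longrightarrow> g b = f (h b)"
  shows "is_decreasing_rearrangement A f y"
proof -
  obtain \<pi> where \<pi>: "decseq y" "bij_betw \<pi> UNIV B" "\<And>n. y n = g (\<pi> n)"
    using assms(1) by (auto simp: is_decreasing_rearrangement_def)
  have "bij_betw (h \<circ> \<pi>) UNIV A"
    by (rule bij_betw_trans[OF \<pi>(2) h])
  moreover have "y n = f ((h \<circ> \<pi>) n)" for n
    using \<pi>(2,3) fg by (auto simp: bij_betw_def)
  ultimately show ?thesis
    using \<pi>(1) unfolding is_decreasing_rearrangement_def by blast
qed

text \<open>Only the family of values matters, not the way it is indexed.\<close>
lemma decreasing_rearrangement_reindex:
  assumes h: "bij_betw h B A" and fg: "\<And>b. b \<in> B \<Longrightarrow> g b = f (h b)"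
  shows "decreasing_rearrangement A f = decreasing_rearrangement B g"
proof -
  have "is_decreasing_rearrangement A f y \<longleftrightarrow> is_decreasing_rearrangement B g y" for y
  proof
    assume "is_decreasing_rearrangement A f y"
    then show "is_decreasing_rearrangement B g y"
      by (rule is_decreasing_rearrangement_reindex[OF _ bij_betw_inv_into[OF h]])
         (use h fg in \<open>auto simp: bij_betw_def inv_into_into f_inv_into_f\<close>)
  next
    assume "is_decreasing_rearrangement B g y"
    then show "is_decreasing_rearrangement A f y"
      by (rule is_decreasing_rearrangement_reindex[OF _ h]) (rule fg)
  qed
  then have eq: "is_decreasing_rearrangement A f = is_decreasing_rearrangement B g" by (rule ext)
  show ?thesis by (simp only: decreasing_rearrangement_def eq)
qed

text \<open>Ordering the indices by decreasing value, ties broken by an enumeration, gives the order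
  type of the natural numbers exactly when every index has finitely many predecessors.\<close>
lemma decreasing_rearrangement_exists_iff:
  fixes A :: "'i::countable set"
  shows "(\<exists>y. is_decreasing_rearrangement A f y) \<longleftrightarrow>
    infinite A \<and> (\<forall>a\<in>A. finite {b \<in> A. f a < f b})"
proof safe
  fix y assume "is_decreasing_rearrangement A f y"
  then obtain \<pi> where \<pi>: "decseq y" "bij_betw \<pi> UNIV A" "\<And>n. y n = f (\<pi> n)"
    by (auto simp: is_decreasing_rearrangement_def)
  show "finite A \<Longrightarrow> False"
    using bij_betw_finite[OF \<pi>(2)] by simp
  fix a assume "a \<in> A"
  then obtain n where n: "a = \<pi> n" using \<pi>(2) by (auto simp: bij_betw_def)
  have "{b \<in> A. f a < f b} \<subseteq> \<pi> ` {..<n}"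
  proof
    fix b assume b: "b \<in> {b \<in> A. f a < f b}"
    then obtain m where m: "b = \<pi> m" using \<pi>(2) by (auto simp: bij_betw_def)
    then have "y n < y m" using b n \<pi>(3) by auto
    then have "m < n" using decseqD[OF \<pi>(1), of n m] by linarith
    then show "b \<in> \<pi> ` {..<n}" using m by auto
  qed
  then show "finite {b \<in> A. f a < f b}" by (rule finite_subset) simp
next
  assume inf: "infinite A" and fin: "\<forall>a\<in>A. finite {b \<in> A. f a < f b}"
  \<comment> \<open>Predecessors of \<open>a\<close>; the number of predecessors is the position of \<open>a\<close> in the rearrangement.\<close>
  define pred where "pred a = {b \<in> A. f a < f b \<or> (f b = f a \<and> to_nat b < to_nat a)}" for a
  define rank where "rank a = card (pred a)" for a
  have fin_pred: "finite (pred a)" if "a \<in> A" for a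
  proof (rule finite_subset)
    show "pred a \<subseteq> {b \<in> A. f a < f b} \<union> from_nat ` {..<to_nat a}"
      by (auto simp: pred_def intro!: rev_image_eqI[where x = "to_nat _"])
    show "finite ({b \<in> A. f a < f b} \<union> from_nat ` {..<to_nat a})"
      using fin that by auto
  qed
  have mono: "rank b < rank a" if "a \<in> A" "b \<in> pred a" for a b
    unfolding rank_def
  proof (rule psubset_card_mono[OF fin_pred[OF that(1)]])
    have "b \<notin> pred b" by (auto simp: pred_def)
    then show "pred b \<subset> pred a" using that(2) unfolding pred_def by auto
  qed
  have total: "b \<in> pred a \<or> a \<in> pred b" if "a \<in> A" "b \<in> A" "a \<noteq> b" for a b
  proof -
    note ab = that
    have "to_nat a < to_nat b \<or> to_nat b < to_nat a"
      using ab(3) by (meson linorder_neqE_nat inj_eq inj_to_nat)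
    then show ?thesis
      using ab unfolding pred_def by (elim disjE; cases "f a" "f b" rule: linorder_cases; auto)
  qed
  have inj: "inj_on rank A"
    by (rule inj_onI) (use mono total in \<open>metis less_irrefl\<close>)
  have down: "rank ` pred a = {..<rank a}" if "a \<in> A" for a
  proof (rule card_subset_eq)
    show "rank ` pred a \<subseteq> {..<rank a}" using mono[OF that] by auto
    have "inj_on rank (pred a)" by (rule inj_on_subset[OF inj]) (auto simp: pred_def)
    then show "card (rank ` pred a) = card {..<rank a}" by (simp add: card_image) (simp add: rank_def)
  qed simp
  have "n \<in> rank ` A" for n
  proof -
    have "infinite (rank ` A)" using inf inj finite_imageD by blast
    then obtain a where a: "a \<in> A" "n < rank a"
      by (metis finite_nat_set_iff_bounded_le imageE not_le)
    then have "n \<in> rank ` pred a" using down by auto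
    then show ?thesis by (auto simp: pred_def)
  qed
  then have bij: "bij_betw rank A UNIV" using inj by (auto simp: bij_betw_def)
  define \<pi> where "\<pi> = inv_into A rank"
  have \<pi>: "bij_betw \<pi> UNIV A" unfolding \<pi>_def by (rule bij_betw_inv_into[OF bij])
  have rank_\<pi>: "rank (\<pi> n) = n" for n
    unfolding \<pi>_def using bij by (auto simp: bij_betw_def intro: f_inv_into_f)
  have "decseq (\<lambda>n. f (\<pi> n))"
  proof (rule decseq_SucI, rule ccontr)
    fix n assume "\<not> f (\<pi> (Suc n)) \<le> f (\<pi> n)"
    moreover have in_A: "\<pi> m \<in> A" for m using \<pi> by (auto simp: bij_betw_def)
    ultimately have "\<pi> (Suc n) \<in> pred (\<pi> n)" by (auto simp: pred_def)
    from mono[OF in_A this] show False by (simp add: rank_\<pi>)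
  qed
  then have "is_decreasing_rearrangement A f (\<lambda>n. f (\<pi> n))"
    using \<pi> unfolding is_decreasing_rearrangement_def by blast
  then show "\<exists>y. is_decreasing_rearrangement A f y" by blast
qed

text \<open>Lists of indices form a countable type, which makes the right-hand side suitable for proofs of
  measurability.\<close>
lemma decreasing_rearrangement_ge_iff:
  fixes A :: "'i::countable set"
  assumes y: "is_decreasing_rearrangement A f y"
  shows "c \<le> y n \<longleftrightarrow> (\<exists>l. distinct l \<and> length l = Suc n \<and> (\<forall>a. a \<in> set l \<longrightarrow> a \<in> A \<and> c \<le> f a))"
proof -
  obtain \<pi> where \<pi>: "decseq y" "bij_betw \<pi> UNIV A" "\<And>n. y n = f (\<pi> n)"
    using y by (auto simp: is_decreasing_rearrangement_def)
  have inj: "inj \<pi>" and ran: "\<And>m. \<pi> m \<in> A" using \<pi>(2) by (auto simp: bij_betw_def)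
  show ?thesis
  proof
    assume "c \<le> y n"
    then have "c \<le> y m" if "m \<le> n" for m using decseqD[OF \<pi>(1) that] by linarith
    then show "\<exists>l. distinct l \<and> length l = Suc n \<and> (\<forall>a. a \<in> set l \<longrightarrow> a \<in> A \<and> c \<le> f a)"
      using inj ran \<pi>(3)
      by (intro exI[of _ "map \<pi> [0..<Suc n]"]) (auto simp: distinct_map inj_on_def less_Suc_eq_le simp del: upt_Suc)
  next
    assume "\<exists>l. distinct l \<and> length l = Suc n \<and> (\<forall>a. a \<in> set l \<longrightarrow> a \<in> A \<and> c \<le> f a)"
    then obtain l where l: "distinct l" "length l = Suc n" "\<And>a. a \<in> set l \<Longrightarrow> a \<in> A \<and> c \<le> f a" by blast
    show "c \<le> y n"
    proof (rule ccontr)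
      assume less: "\<not> c \<le> y n"
      have "set l \<subseteq> \<pi> ` {..<n}"
      proof
        fix a assume "a \<in> set l"
        then have "a \<in> A" "c \<le> f a" using l(3) by auto
        then obtain m where m: "a = \<pi> m" "c \<le> y m" using \<pi>(2,3) by (auto simp: bij_betw_def)
        then have "m < n" using decseqD[OF \<pi>(1), of n m] less by linarith
        then show "a \<in> \<pi> ` {..<n}" using m by auto
      qed
      then have "card (set l) \<le> card (\<pi> ` {..<n})" by (intro card_mono) auto
      also have "\<dots> \<le> n" using card_image_le[of "{..<n}" \<pi>] by simp
      finally show False using l(1,2) by (simp add: distinct_card)
    qed
  qed
qed

lemma finite_iff_subset_list: "finite {b. P b} \<longleftrightarrow> (\<exists>l. \<forall>b. P b \<longrightarrow> b \<in> set l)"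
proof
  assume "finite {b. P b}"
  then show "\<exists>l. \<forall>b. P b \<longrightarrow> b \<in> set l" using finite_list by fastforce
next
  assume "\<exists>l. \<forall>b. P b \<longrightarrow> b \<in> set l"
  then obtain l where "{b. P b} \<subseteq> set l" by auto
  then show "finite {b. P b}" by (rule finite_subset) simp
qed

text \<open>Existence of the rearrangement and lower bounds on its entries only involve quantifiers over
  indices and finite lists of indices.\<close>
lemma measurable_decreasing_rearrangement:
  fixes A :: "'b \<Rightarrow> 'i::countable set" and f :: "'b \<Rightarrow> 'i \<Rightarrow> real"
  assumes [measurable]: "\<And>a. Measurable.pred M (\<lambda>x. a \<in> A x)"
    and [measurable]: "\<And>a. (\<lambda>x. f x a) \<in> borel_measurable M"
  shows "(\<lambda>x. decreasing_rearrangement (A x) (f x)) \<in> M \<rightarrow>\<^sub>M seq_space"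
proof -
  define E where "E x \<longleftrightarrow> (\<exists>y. is_decreasing_rearrangement (A x) (f x) y)" for x
  have E_eq: "E x \<longleftrightarrow> \<not> (\<exists>l. \<forall>a. a \<in> A x \<longrightarrow> a \<in> set l) \<and>
      (\<forall>a. a \<in> A x \<longrightarrow> (\<exists>l. \<forall>b. b \<in> A x \<and> f x a < f x b \<longrightarrow> b \<in> set l))" for x
    unfolding E_def decreasing_rearrangement_exists_iff
    using finite_iff_subset_list[of "\<lambda>a. a \<in> A x"] by (auto simp: finite_iff_subset_list)
  have [measurable]: "Measurable.pred M E"
    unfolding E_eq[abs_def] by measurable
  have ge: "c \<le> decreasing_rearrangement (A x) (f x) n \<longleftrightarrow>
      (E x \<and> (\<exists>l. distinct l \<and> length l = Suc n \<and> (\<forall>a. a \<in> set l \<longrightarrow> a \<in> A x \<and> c \<le> f x a))) \<or>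
      (\<not> E x \<and> c \<le> 0)" for c n x
  proof (cases "E x")
    case True
    then obtain y where "is_decreasing_rearrangement (A x) (f x) y" by (auto simp: E_def)
    then show ?thesis
      using True decreasing_rearrangement_ge_iff[of "A x" "f x" y] decreasing_rearrangement_eqI by metis
  next
    case False
    then show ?thesis unfolding E_def decreasing_rearrangement_def by auto
  qed
  have "(\<lambda>x. decreasing_rearrangement (A x) (f x) n) \<in> borel_measurable M" for n
    unfolding borel_measurable_iff_ge ge by measurable
  then show ?thesis by (intro measurable_PiM_single') (auto simp: space_PiM)
qed

text \<open>In a summable family only finitely many members exceed a given positive one.\<close>
lemma decreasing_rearrangement_in_ranked_simplex:
  fixes A :: "'i::countable set"
  assumes inf: "infinite A" and pos: "\<And>a. a \<in> A \<Longrightarrow> 0 < f a" and sum: "(f has_sum 1) A"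
  shows "is_decreasing_rearrangement A f (decreasing_rearrangement A f)"
    and "decreasing_rearrangement A f \<in> ranked_simplex"
proof -
  have "finite {b \<in> A. f a < f b}" if a: "a \<in> A" for a
  proof (rule ccontr)
    assume "infinite {b \<in> A. f a < f b}"
    then obtain F where F: "F \<subseteq> {b \<in> A. f a < f b}" "finite F" "card F = Suc (nat \<lceil>1 / f a\<rceil>)"
      using infinite_arbitrarily_large by blast
    have "1 / f a < real (card F)" using F(3) by linarith
    then have "1 < real (card F) * f a" using pos[OF a] by (simp add: field_simps)
    also have "\<dots> = (\<Sum>b\<in>F. f a)" by simp
    also have "\<dots> \<le> (\<Sum>b\<in>F. f b)" using F(1) by (intro sum_mono) auto
    also have "\<dots> \<le> 1"
      by (rule has_sum_mono_neutral[OF has_sum_finite[OF F(2)] sum]) (use F pos in \<open>auto intro: less_imp_le\<close>)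
    finally show False by simp
  qed
  then obtain y where y: "is_decreasing_rearrangement A f y"
    using decreasing_rearrangement_exists_iff[of A f] inf by auto
  then show *: "is_decreasing_rearrangement A f (decreasing_rearrangement A f)"
    by (simp add: decreasing_rearrangement_eqI)
  then obtain \<pi> where \<pi>: "decseq (decreasing_rearrangement A f)" "bij_betw \<pi> UNIV A"
      "\<And>n. decreasing_rearrangement A f n = f (\<pi> n)"
    by (auto simp: is_decreasing_rearrangement_def)
  have "((\<lambda>n. f (\<pi> n)) has_sum 1) UNIV"
    using sum has_sum_reindex_bij_betw[OF \<pi>(2)] by blast
  then have "decreasing_rearrangement A f sums 1"
    unfolding \<pi>(3)[abs_def, symmetric] by (rule has_sum_imp_sums)
  moreover have "0 < f (\<pi> n)" for n using \<pi>(2) pos by (auto simp: bij_betw_def)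
  ultimately show "decreasing_rearrangement A f \<in> ranked_simplex"
    using \<pi>(1,3) by (auto simp: ranked_simplex_def)
qed

lemma sums_nonneg_iff_has_sum:
  fixes f :: "nat \<Rightarrow> real"
  assumes "\<And>n. 0 \<le> f n"
  shows "f sums s \<longleftrightarrow> (f has_sum s) UNIV"
  using assms sums_nonneg_imp_has_sum_strong[of f s] has_sum_imp_sums[of f s] by auto

text \<open>The GEM sequences, which need not be monotone, live here.\<close>
definition prob_sequences :: "(nat \<Rightarrow> real) set" where
  "prob_sequences = {x. (\<forall>n. 0 \<le> x n) \<and> x sums 1}"

lemma prob_sequences_sets [measurable]: "prob_sequences \<in> sets seq_space"
proof -
  have lim_iff: "X \<longlonglongrightarrow> 1 \<longleftrightarrow> (\<forall>k::nat. \<exists>N::nat. \<forall>n. N \<le> n \<longrightarrow> \<bar>X n - 1\<bar> < 1 / real (Suc k))"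
    for X :: "nat \<Rightarrow> real"
  proof
    show "X \<longlonglongrightarrow> 1 \<Longrightarrow> \<forall>k::nat. \<exists>N::nat. \<forall>n. N \<le> n \<longrightarrow> \<bar>X n - 1\<bar> < 1 / real (Suc k)"
      unfolding LIMSEQ_iff real_norm_def by simp
    assume *: "\<forall>k::nat. \<exists>N::nat. \<forall>n. N \<le> n \<longrightarrow> \<bar>X n - 1\<bar> < 1 / real (Suc k)"
    show "X \<longlonglongrightarrow> 1"
      unfolding LIMSEQ_iff real_norm_def
    proof (intro allI impI)
      fix r :: real assume "0 < r"
      then obtain k where "1 / real (Suc k) < r" using nat_approx_posE by blast
      then show "\<exists>no. \<forall>n\<ge>no. \<bar>X n - 1\<bar> < r" using * by (meson less_trans)
    qed
  qed
  have "prob_sequences = {x \<in> space seq_space. (\<forall>n. 0 \<le> x n) \<and> (\<lambda>n. \<Sum>i<n. x i) \<longlonglongrightarrow> 1}"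
    by (auto simp: prob_sequences_def sums_def space_PiM)
  also have "\<dots> = {x \<in> space seq_space. (\<forall>n. 0 \<le> x n) \<and>
      (\<forall>k::nat. \<exists>N::nat. \<forall>n. N \<le> n \<longrightarrow> \<bar>(\<Sum>i<n. x i) - 1\<bar> < 1 / real (Suc k))}"
    by (simp only: lim_iff)
  also have "\<dots> \<in> sets seq_space"
    by measurable
  finally show ?thesis .
qed

lemma ranked_simplex_eq: "ranked_simplex = prob_sequences \<inter> {x. decseq x \<and> (\<forall>n. 0 < x n)}"
  by (auto simp: ranked_simplex_def prob_sequences_def less_imp_le)

lemma ranked_simplex_sets [measurable]: "ranked_simplex \<in> sets seq_space"
proof -
  have "ranked_simplex = prob_sequences \<inter> {x \<in> space seq_space. (\<forall>n. x (Suc n) - x n \<le> 0) \<and> (\<forall>n. x n > 0)}"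
    by (auto simp: ranked_simplex_eq space_PiM decseq_Suc_iff)
  also have "\<dots> \<in> sets seq_space"
    by measurable
  finally show ?thesis .
qed

lemma infinite_fragment_index: "infinite ({Inl j | j. j \<noteq> i} \<union> range (Inr :: nat \<Rightarrow> 'a + nat))"
  using range_inj_infinite[of "Inr :: nat \<Rightarrow> 'a + nat"] by auto

lemma measurable_fragment [measurable]:
  "(\<lambda>(x, i, \<eta>). fragment x i \<eta>) \<in> seq_space \<Otimes>\<^sub>M (count_space UNIV \<Otimes>\<^sub>M seq_space) \<rightarrow>\<^sub>M seq_space"
proof -
  have "(\<lambda>x. decreasing_rearrangement ({Inl j | j. j \<noteq> fst (snd x)} \<union> range Inr)
      (case_sum (fst x) (\<lambda>k. fst x (fst (snd x)) * snd (snd x) k)))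
      \<in> seq_space \<Otimes>\<^sub>M (count_space UNIV \<Otimes>\<^sub>M seq_space) \<rightarrow>\<^sub>M seq_space"
  proof (rule measurable_decreasing_rearrangement)
    fix a :: "nat + nat"
    show "Measurable.pred (seq_space \<Otimes>\<^sub>M (count_space UNIV \<Otimes>\<^sub>M seq_space))
        (\<lambda>x. a \<in> {Inl j | j. j \<noteq> fst (snd x)} \<union> range Inr)"
      by (cases a) simp_all
    have *: "(\<lambda>x. (\<lambda>i x. fst x i) (fst (snd x)) x) \<in>
        borel_measurable (seq_space \<Otimes>\<^sub>M (count_space UNIV \<Otimes>\<^sub>M seq_space))"
      by (rule measurable_compose_countable) measurable
    show "(\<lambda>x. case a of Inl j \<Rightarrow> fst x j | Inr k \<Rightarrow> fst x (fst (snd x)) * snd (snd x) k)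
        \<in> borel_measurable (seq_space \<Otimes>\<^sub>M (count_space UNIV \<Otimes>\<^sub>M seq_space))"
      using * by (cases a) simp_all
  qed
  then show ?thesis by (simp add: fragment_def[abs_def] case_prod_beta')
qed

lemma fragment_reindex:
  assumes \<sigma>: "bij \<sigma>" and \<tau>: "bij \<tau>"
  shows "fragment (\<lambda>n. x (\<sigma> n)) i (\<lambda>n. \<eta> (\<tau> n)) = fragment x (\<sigma> i) \<eta>"
  unfolding fragment_def
proof (rule decreasing_rearrangement_reindex[symmetric])
  show "bij_betw (map_sum \<sigma> \<tau>) ({Inl j | j. j \<noteq> i} \<union> range Inr) ({Inl j | j. j \<noteq> \<sigma> i} \<union> range Inr)"
  proof (rule bij_betw_imageI)
    show "inj_on (map_sum \<sigma> \<tau>) ({Inl j | j. j \<noteq> i} \<union> range Inr)"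
      using sum.inj_map[of \<sigma> \<tau>] \<sigma> \<tau> by (auto simp: bij_def intro: inj_on_subset)
    have "Inl j \<in> map_sum \<sigma> \<tau> ` ({Inl j | j. j \<noteq> i} \<union> range Inr)" if "j \<noteq> \<sigma> i" for j
    proof -
      obtain j' where "j = \<sigma> j'" using \<sigma> by (metis bij_pointE)
      then show ?thesis using that by (intro rev_image_eqI[of "Inl j'"]) auto
    qed
    moreover have "Inr k \<in> map_sum \<sigma> \<tau> ` ({Inl j | j. j \<noteq> i} \<union> range Inr)" for k
    proof -
      obtain k' where "k = \<tau> k'" using \<tau> by (metis bij_pointE)
      then show ?thesis by (intro rev_image_eqI[of "Inr k'"]) auto
    qed
    moreover have "\<sigma> j \<noteq> \<sigma> i" if "j \<noteq> i" for j
      using \<sigma> that by (auto simp: bij_def inj_eq)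
    ultimately show "map_sum \<sigma> \<tau> ` ({Inl j | j. j \<noteq> i} \<union> range Inr) = {Inl j | j. j \<noteq> \<sigma> i} \<union> range Inr"
      by auto
  qed
qed auto

lemma measurable_coagulate [measurable]:
  "(\<lambda>(x, c). coagulate x c) \<in> seq_space \<Otimes>\<^sub>M seqs \<rightarrow>\<^sub>M seq_space"
proof -
  have "(\<lambda>p. decreasing_rearrangement (insert None {Some j | j. \<not> snd p j})
      (case_option (\<Sum>i. if snd p i then fst p i else 0) (fst p))) \<in> seq_space \<Otimes>\<^sub>M seqs \<rightarrow>\<^sub>M seq_space"
  proof (rule measurable_decreasing_rearrangement)
    fix a :: "nat option"
    have [measurable]: "Measurable.pred (seq_space \<Otimes>\<^sub>M seqs) (\<lambda>p. snd p j)" for j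
      using measurable_compose[OF measurable_snd measurable_coordinate] by (simp add: pred_def)
    show "Measurable.pred (seq_space \<Otimes>\<^sub>M seqs) (\<lambda>p. a \<in> insert None {Some j | j. \<not> snd p j})"
      by (cases a) simp_all
    show "(\<lambda>p. case a of None \<Rightarrow> \<Sum>i. if snd p i then fst p i else 0 | Some j \<Rightarrow> fst p j)
        \<in> borel_measurable (seq_space \<Otimes>\<^sub>M seqs)"
      by (cases a) simp_all
  qed
  then show ?thesis by (simp add: coagulate_def[abs_def] case_prod_beta')
qed

text \<open>The merged mass is an infinite series; nonnegativity permits rearranging it.\<close>
lemma coagulate_reindex:
  assumes \<sigma>: "bij \<sigma>" and nonneg: "\<And>n. 0 \<le> x n" and sum: "x sums s"
  shows "coagulate (\<lambda>n. x (\<sigma> n)) (\<lambda>n. c (\<sigma> n)) = coagulate x c"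
  unfolding coagulate_def
proof (rule decreasing_rearrangement_reindex[symmetric])
  define g where "g i = (if c i then x i else 0)" for i
  have "summable g"
    by (rule summable_comparison_test'[OF sums_summable[OF sum], of 0]) (use nonneg in \<open>auto simp: g_def\<close>)
  then have "(g has_sum (\<Sum>i. g i)) UNIV"
    using sums_nonneg_iff_has_sum[of g "\<Sum>i. g i"] nonneg summable_sums[of g] unfolding g_def by simp
  then have "((\<lambda>n. g (\<sigma> n)) has_sum (\<Sum>i. g i)) UNIV"
    using has_sum_reindex_bij_betw[OF \<sigma>] by blast
  then have eq: "(\<Sum>i. g (\<sigma> i)) = (\<Sum>i. g i)"
    using has_sum_imp_sums sums_unique by metis
  show "bij_betw (map_option \<sigma>) (insert None {Some j | j. \<not> c (\<sigma> j)}) (insert None {Some j | j. \<not> c j})"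
  proof (rule bij_betw_imageI)
    show "inj_on (map_option \<sigma>) (insert None {Some j | j. \<not> c (\<sigma> j)})"
      using option.inj_map[of \<sigma>] \<sigma> by (auto simp: bij_def intro: inj_on_subset)
    have "Some j \<in> map_option \<sigma> ` insert None {Some j | j. \<not> c (\<sigma> j)}" if "\<not> c j" for j
    proof -
      obtain j' where "j = \<sigma> j'" using \<sigma> by (metis bij_pointE)
      then show ?thesis using that by (intro rev_image_eqI[of "Some j'"]) auto
    qed
    then show "map_option \<sigma> ` insert None {Some j | j. \<not> c (\<sigma> j)} = insert None {Some j | j. \<not> c j}"
      by auto
  qed
  show "(case b of None \<Rightarrow> \<Sum>i. if c (\<sigma> i) then x (\<sigma> i) else 0 | Some j \<Rightarrow> x (\<sigma> j)) =
      (case map_option \<sigma> b of None \<Rightarrow> \<Sum>i. if c i then x i else 0 | Some j \<Rightarrow> x j)" for b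
    using eq by (cases b) (simp_all add: g_def)
qed

section \<open>Labelled partitions of the natural numbers\<close>

definition occurrences :: "(nat \<Rightarrow> 'k) \<Rightarrow> 'k \<Rightarrow> nat \<Rightarrow> nat" where
  "occurrences K k n = card {m. m < n \<and> K m = k}"

lemma occurrences_0 [simp]: "occurrences K k 0 = 0"
  by (simp add: occurrences_def)

lemma occurrences_Suc [simp]: "occurrences K k (Suc n) = occurrences K k n + (if K n = k then 1 else 0)"
proof -
  have "{m. m < Suc n \<and> K m = k} = {m. m < n \<and> K m = k} \<union> (if K n = k then {n} else {})"
    by (auto simp: less_Suc_eq)
  then show ?thesis by (simp add: occurrences_def card_insert_if)
qed

lemma occurrences_mono: "m \<le> n \<Longrightarrow> occurrences K k m \<le> occurrences K k n"
  unfolding occurrences_def by (rule card_mono) auto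

lemma occurrences_eq_0_iff: "occurrences K k n = 0 \<longleftrightarrow> k \<notin> K ` {..<n}"
  by (auto simp: occurrences_def)

lemma occurrences_le: "occurrences K k n \<le> n"
  unfolding occurrences_def using card_mono[of "{..<n}" "{m. m < n \<and> K m = k}"] by auto

lemma occurrences_cong: "(\<And>m. m < n \<Longrightarrow> K m = k \<longleftrightarrow> K' m = k') \<Longrightarrow> occurrences K k n = occurrences K' k' n"
  unfolding occurrences_def by (rule arg_cong[where f = card]) auto

lemma count_list_initial_eq: "count_list (initial n x) v = occurrences x v n"
  by (simp add: count_list_initial occurrences_def)

definition occurrence :: "(nat \<Rightarrow> 'k) \<Rightarrow> 'k \<Rightarrow> nat \<Rightarrow> nat" where
  "occurrence K k r = (LEAST i. K i = k \<and> occurrences K k i = r)"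

lemma occurrence_exists: "r < occurrences K k n \<Longrightarrow> \<exists>i<n. K i = k \<and> occurrences K k i = r"
  by (induction n) (auto simp: less_Suc_eq split: if_splits)

lemma occurrence_spec:
  assumes "r < occurrences K k n"
  shows "occurrence K k r < n" "K (occurrence K k r) = k" "occurrences K k (occurrence K k r) = r"
proof -
  obtain i where i: "i < n" "K i = k \<and> occurrences K k i = r"
    using occurrence_exists[OF assms] by blast
  show "K (occurrence K k r) = k" "occurrences K k (occurrence K k r) = r"
    using LeastI[of "\<lambda>i. K i = k \<and> occurrences K k i = r", OF i(2)] by (auto simp: occurrence_def)
  show "occurrence K k r < n"
    using Least_le[of "\<lambda>i. K i = k \<and> occurrences K k i = r", OF i(2)] i(1) by (simp add: occurrence_def)
qed

lemma occurrences_less: "i < j \<Longrightarrow> K i = k \<Longrightarrow> occurrences K k i < occurrences K k j"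
  using occurrences_mono[of "Suc i" j K k] by simp

lemma occurrence_eqI:
  assumes "K i = k" "occurrences K k i = r"
  shows "occurrence K k r = i"
proof -
  have "r < occurrences K k (Suc i)" using assms by simp
  note spec = occurrence_spec[OF this]
  then show ?thesis
    using occurrences_less[of i "occurrence K k r" K k] occurrences_less[of "occurrence K k r" i K k] assms
    by (cases "occurrence K k r" i rule: linorder_cases) auto
qed

text \<open>These are the labellings that number the blocks in the order of their least elements.\<close>
definition restricted_growth :: "(nat \<Rightarrow> nat) \<Rightarrow> bool" where
  "restricted_growth L \<longleftrightarrow> (\<forall>n. L n \<le> card (L ` {..<n}))"

text \<open>The block of \<open>n\<close> receives the number of blocks that have appeared before its first element.\<close>
definition relabel :: "(nat \<Rightarrow> 'k) \<Rightarrow> nat \<Rightarrow> nat" where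
  "relabel K n = card (K ` {..<(LEAST m. K m = K n)})"

lemma restricted_growth_image:
  assumes "restricted_growth L"
  shows "L ` {..<n} = {..<card (L ` {..<n})}"
proof (induction n)
  case (Suc n)
  have "L n \<le> card (L ` {..<n})" using assms by (simp add: restricted_growth_def)
  then consider "L n \<in> L ` {..<n}" | "L n \<notin> L ` {..<n}" "L n = card (L ` {..<n})"
    using Suc by (metis lessThan_iff linorder_neqE_nat not_le)
  then show ?case
  proof cases
    case 1
    then show ?thesis using Suc by (simp add: lessThan_Suc insert_absorb)
  next
    case 2
    then have "card (L ` {..<Suc n}) = Suc (L n)"
      by (simp add: lessThan_Suc)
    then show ?thesis using Suc 2 by (simp add: lessThan_Suc)
  qed
qed simp

lemma restricted_growth_0 [simp]: "restricted_growth L \<Longrightarrow> L 0 = 0"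
  by (metis card.empty image_empty lessThan_0 le_zero_eq restricted_growth_def)

lemma restricted_growth_new:
  assumes "restricted_growth L" "L n \<notin> L ` {..<n}"
  shows "L n = card (L ` {..<n})"
proof -
  have "L n \<le> card (L ` {..<n})" using assms(1) by (simp add: restricted_growth_def)
  moreover have "\<not> L n < card (L ` {..<n})"
    using assms(2) restricted_growth_image[OF assms(1), of n] by auto
  ultimately show ?thesis by simp
qed

lemma relabel_eq_iff: "relabel K m = relabel K n \<longleftrightarrow> K m = K n"
proof -
  define f where "f n = (LEAST m. K m = K n)" for n
  have f: "K (f n) = K n" for n unfolding f_def by (rule LeastI) simp
  have "relabel K m < relabel K n" if "f m < f n" for m n
    unfolding relabel_def f_def[symmetric]
  proof (rule psubset_card_mono)
    have "K m \<notin> K ` {..<f m}"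
      unfolding f_def using not_less_Least by fastforce
    moreover have "K m \<in> K ` {..<f n}" using that f[of m] by (metis imageI lessThan_iff)
    ultimately show "K ` {..<f m} \<subset> K ` {..<f n}" using that by auto
  qed simp
  then have "f m = f n" if "relabel K m = relabel K n"
    using that by (metis linorder_neqE_nat less_irrefl)
  then show ?thesis using f by (metis relabel_def)
qed

lemma card_relabel_image: "card (relabel K ` A) = card (K ` A)"
proof (rule bij_betw_same_card[symmetric])
  show "bij_betw (\<lambda>k. relabel K (SOME n. n \<in> A \<and> K n = k)) (K ` A) (relabel K ` A)"
  proof (rule bij_betwI')
    have *: "relabel K (SOME n. n \<in> A \<and> K n = K m) = relabel K m" if "m \<in> A" for m
      using someI[of "\<lambda>n. n \<in> A \<and> K n = K m" m] that by (simp add: relabel_eq_iff)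
    fix k assume "k \<in> K ` A"
    then obtain m where m: "m \<in> A" "k = K m" by auto
    show "relabel K (SOME n. n \<in> A \<and> K n = k) \<in> relabel K ` A"
      unfolding m(2) *[OF m(1)] using m(1) by simp
    fix l assume "l \<in> K ` A"
    then obtain m' where m': "m' \<in> A" "l = K m'" by auto
    show "relabel K (SOME n. n \<in> A \<and> K n = k) = relabel K (SOME n. n \<in> A \<and> K n = l) \<longleftrightarrow> k = l"
      unfolding m(2) m'(2) *[OF m(1)] *[OF m'(1)] by (rule relabel_eq_iff)
  next
    have *: "relabel K (SOME n. n \<in> A \<and> K n = K m) = relabel K m" if "m \<in> A" for m
      using someI[of "\<lambda>n. n \<in> A \<and> K n = K m" m] that by (simp add: relabel_eq_iff)
    fix l assume "l \<in> relabel K ` A"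
    then obtain m where "m \<in> A" "l = relabel K m" by auto
    then show "\<exists>k\<in>K ` A. l = relabel K (SOME n. n \<in> A \<and> K n = k)"
      using *[of m] by (intro bexI[of _ "K m"]) auto
  qed
qed

lemma restricted_growth_relabel: "restricted_growth (relabel K)"
  unfolding restricted_growth_def card_relabel_image
proof
  fix n
  have "(LEAST m. K m = K n) \<le> n" by (rule Least_le) simp
  then show "relabel K n \<le> card (K ` {..<n})"
    unfolding relabel_def by (intro card_mono image_mono) auto
qed

text \<open>A label is either a repetition, determined by the partition, or the least unused number.\<close>
lemma restricted_growth_unique:
  assumes L: "restricted_growth L" and L': "restricted_growth L'"
    and eq: "\<And>m n. m < N \<Longrightarrow> n < N \<Longrightarrow> L m = L n \<longleftrightarrow> L' m = L' n"
  shows "n < N \<Longrightarrow> L n = L' n"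
proof (induction n rule: less_induct)
  case (less n)
  then have IH: "L m = L' m" if "m < n" for m using that by simp
  have im: "L ` {..<n} = L' ` {..<n}" using IH by (intro image_cong) auto
  show ?case
  proof (cases "L n \<in> L ` {..<n}")
    case True
    then obtain m where "m < n" "L n = L m" by auto
    then show ?thesis using eq[of m n] IH[of m] less.prems by auto
  next
    case False
    have "L' n \<notin> L' ` {..<n}"
    proof
      assume "L' n \<in> L' ` {..<n}"
      then obtain m where "m < n" "L' m = L' n" by fastforce
      then have "m < n" "L m = L n" using eq[of m n] less.prems by auto
      then show False using False by (metis imageI lessThan_iff)
    qed
    then show ?thesis
      using restricted_growth_new[OF L False] restricted_growth_new[OF L'] im by simp
  qed
qed

lemma relabel_eqI:
  assumes "restricted_growth L" "\<And>m n. L m = L n \<longleftrightarrow> K m = K n"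
  shows "relabel K = L"
proof
  fix n
  show "relabel K n = L n"
    by (rule restricted_growth_unique[OF restricted_growth_relabel assms(1), of "Suc n"])
       (simp_all add: relabel_eq_iff assms(2))
qed

lemma relabel_restricted_growth: "restricted_growth L \<Longrightarrow> relabel L = L"
  by (rule relabel_eqI) auto

lemma relabel_inj:
  assumes "inj f"
  shows "relabel (\<lambda>n. f (K n)) = relabel K"
  by (rule relabel_eqI[OF restricted_growth_relabel]) (use assms in \<open>auto simp: relabel_eq_iff inj_eq\<close>)

lemma restricted_growth_range:
  assumes "restricted_growth L" "infinite (range L)"
  shows "range L = UNIV"
proof -
  have "k \<in> range L" for k
  proof -
    obtain n where n: "k < L n" using assms(2) by (metis finite_nat_set_iff_bounded_le not_le rangeE)
    then have "k < card (L ` {..<n})" using assms(1) by (meson less_le_trans restricted_growth_def)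
    then have "k \<in> L ` {..<n}" using restricted_growth_image[OF assms(1), of n] by auto
    then show ?thesis by auto
  qed
  then show ?thesis by auto
qed

subsection \<open>Asymptotic frequencies\<close>

definition has_frequency :: "(nat \<Rightarrow> 'k) \<Rightarrow> 'k \<Rightarrow> real \<Rightarrow> bool" where
  "has_frequency K k c \<longleftrightarrow> (\<lambda>n. real (occurrences K k n) / real n) \<longlonglongrightarrow> c"

definition frequency :: "(nat \<Rightarrow> 'k) \<Rightarrow> 'k \<Rightarrow> real" where
  "frequency K k = lim (\<lambda>n. real (occurrences K k n) / real n)"

text \<open>Besides positivity, the last condition excludes that mass is lost in small blocks.\<close>
definition proper_frequencies :: "(nat \<Rightarrow> 'k) \<Rightarrow> bool" where
  "proper_frequencies K \<longleftrightarrow> infinite (range K) \<and>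
     (\<forall>k\<in>range K. has_frequency K k (frequency K k) \<and> 0 < frequency K k) \<and>
     (frequency K has_sum 1) (range K)"

lemma frequency_eqI: "has_frequency K k c \<Longrightarrow> frequency K k = c"
  unfolding has_frequency_def frequency_def by (rule limI)

lemma occurrences_relabel: "occurrences (relabel K) (relabel K m) = occurrences K (K m)"
  by (rule ext, rule occurrences_cong) (simp add: relabel_eq_iff)

lemma has_frequency_relabel: "has_frequency (relabel K) (relabel K m) c \<longleftrightarrow> has_frequency K (K m) c"
  by (simp add: has_frequency_def occurrences_relabel)

lemma frequency_relabel: "frequency (relabel K) (relabel K m) = frequency K (K m)"
  by (simp add: frequency_def occurrences_relabel)

lemma apply_SOME_same [simp]: "K (SOME n. K n = K m) = K m"
  by (rule someI) simp

text \<open>The bijection from the old names of the blocks to their numbers.\<close>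
lemma relabel_bij:
  "bij_betw (\<lambda>k. relabel K (SOME n. K n = k)) (range K) (range (relabel K))"
    and relabel_bij_apply: "relabel K (SOME n. K n = K m) = relabel K m"
proof -
  show *: "relabel K (SOME n. K n = K m) = relabel K m" for m
    using someI[of "\<lambda>n. K n = K m" m] by (simp add: relabel_eq_iff)
  show "bij_betw (\<lambda>k. relabel K (SOME n. K n = k)) (range K) (range (relabel K))"
    by (rule bij_betwI') (auto simp: * relabel_eq_iff)
qed

lemma infinite_range_relabel: "infinite (range (relabel K)) \<longleftrightarrow> infinite (range K)"
  using bij_betw_finite[OF relabel_bij[of K]] by simp

lemma range_relabel: "infinite (range K) \<Longrightarrow> range (relabel K) = UNIV"
  by (rule restricted_growth_range[OF restricted_growth_relabel]) (simp add: infinite_range_relabel)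

lemma proper_frequencies_relabel: "proper_frequencies (relabel K) \<longleftrightarrow> proper_frequencies K"
proof -
  have "(frequency (relabel K) has_sum 1) (range (relabel K)) \<longleftrightarrow> (frequency K has_sum 1) (range K)"
  proof -
    have "(frequency K has_sum 1) (range K) \<longleftrightarrow>
        ((\<lambda>k. frequency (relabel K) (relabel K (SOME n. K n = k))) has_sum 1) (range K)"
      by (rule has_sum_cong) (auto simp: relabel_bij_apply frequency_relabel)
    then show ?thesis using has_sum_reindex_bij_betw[OF relabel_bij[of K]] by blast
  qed
  then show ?thesis
    by (auto simp: proper_frequencies_def infinite_range_relabel has_frequency_relabel frequency_relabel)
qed

lemma ranked_frequency_relabel:
  assumes "infinite (range K)"
  shows "ranked (frequency (relabel K)) =
    decreasing_rearrangement (range K) (frequency K)"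
proof -
  have "frequency K k = frequency (relabel K) (relabel K (SOME n. K n = k))" if "k \<in> range K" for k
    using that by (auto simp: frequency_relabel)
  then show ?thesis
    using decreasing_rearrangement_reindex[OF relabel_bij[of K], of "frequency K" "frequency (relabel K)"]
    by (simp add: range_relabel[OF assms])
qed

text \<open>Dropping the first \<open>N\<close> terms changes the counts by a bounded amount.\<close>
lemma has_frequency_shift:
  "has_frequency (\<lambda>n. K (n + N)) k c \<longleftrightarrow> has_frequency K k c"
proof -
  have occ: "occurrences K k (n + N) = occurrences (\<lambda>n. K (n + N)) k n + occurrences K k N" for n
    by (induction n) auto
  have "(\<lambda>n. real (occurrences K k (n + N)) / real (n + N)) \<longlonglongrightarrow> c \<longleftrightarrow>
      (\<lambda>n. real (occurrences (\<lambda>n. K (n + N)) k n) / real n) \<longlonglongrightarrow> c"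
  proof -
    have ratio: "(\<lambda>n. real (n + N) / real n) \<longlonglongrightarrow> 1" "(\<lambda>n. real n / real (n + N)) \<longlonglongrightarrow> 1"
      by real_asymp+
    have small: "(\<lambda>n. r / real n) \<longlonglongrightarrow> 0" "(\<lambda>n. r / real (n + N)) \<longlonglongrightarrow> 0" for r :: real
      by real_asymp+
    have ev: "eventually (\<lambda>n::nat. n > 0) sequentially" by (rule eventually_gt_at_top)
    have cancel: "(x + w) / y * (y / z) - w / z = x / z" "x / y * (y / z) + w / z = (x + w) / z"
      if "y \<noteq> 0" for x y z w :: real
    proof -
      have eq: "u / y * (y / z) = u / z" for u :: real using that by simp
      show "(x + w) / y * (y / z) - w / z = x / z" "x / y * (y / z) + w / z = (x + w) / z"
        unfolding eq by (simp_all add: add_divide_distrib)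
    qed
    show ?thesis
    proof
      assume "(\<lambda>n. real (occurrences K k (n + N)) / real (n + N)) \<longlonglongrightarrow> c"
      then have "(\<lambda>n. real (occurrences K k (n + N)) / real (n + N) * (real (n + N) / real n) -
          real (occurrences K k N) / real n) \<longlonglongrightarrow> c * 1 - 0"
        by (intro tendsto_diff tendsto_mult ratio small)
      then have *: "(\<lambda>n. real (occurrences K k (n + N)) / real (n + N) * (real (n + N) / real n) -
          real (occurrences K k N) / real n) \<longlonglongrightarrow> c" by simp
      show "(\<lambda>n. real (occurrences (\<lambda>n. K (n + N)) k n) / real n) \<longlonglongrightarrow> c"
      proof (rule Lim_transform_eventually[OF * eventually_mono[OF ev]])
        fix n :: nat assume "0 < n"
        then have "real (n + N) \<noteq> 0" by simp
        from cancel(1)[OF this] show "real (occurrences K k (n + N)) / real (n + N) * (real (n + N) / real n) -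
            real (occurrences K k N) / real n = real (occurrences (\<lambda>n. K (n + N)) k n) / real n"
          unfolding occ of_nat_add[of "occurrences _ _ _"] .
      qed
    next
      assume "(\<lambda>n. real (occurrences (\<lambda>n. K (n + N)) k n) / real n) \<longlonglongrightarrow> c"
      then have "(\<lambda>n. real (occurrences (\<lambda>n. K (n + N)) k n) / real n * (real n / real (n + N)) +
          real (occurrences K k N) / real (n + N)) \<longlonglongrightarrow> c * 1 + 0"
        by (intro tendsto_add tendsto_mult ratio small)
      then have *: "(\<lambda>n. real (occurrences (\<lambda>n. K (n + N)) k n) / real n * (real n / real (n + N)) +
          real (occurrences K k N) / real (n + N)) \<longlonglongrightarrow> c" by simp
      show "(\<lambda>n. real (occurrences K k (n + N)) / real (n + N)) \<longlonglongrightarrow> c"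
        by (rule Lim_transform_eventually[OF * eventually_mono[OF ev]]) (simp add: occ cancel add_divide_distrib)
    qed
  qed
  then show ?thesis
    using LIMSEQ_ignore_initial_segment[of "\<lambda>n. real (occurrences K k n) / real n" c N]
      LIMSEQ_offset[of "\<lambda>n. real (occurrences K k n) / real n" N c]
    unfolding has_frequency_def by blast
qed

lemma frequency_pos_unbounded:
  assumes "has_frequency K k c" "0 < c"
  shows "filterlim (\<lambda>n. occurrences K k n) at_top sequentially"
proof -
  have "filterlim (\<lambda>n. real (occurrences K k n) / real n * real n) at_top sequentially"
    by (rule filterlim_tendsto_pos_mult_at_top[OF _ assms(2)])
       (use assms(1) in \<open>auto simp: has_frequency_def intro: filterlim_real_sequentially\<close>)
  then have "filterlim (\<lambda>n. real (occurrences K k n)) at_top sequentially"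
    by (rule filterlim_mono_eventually)
       (auto intro!: eventually_mono[OF eventually_gt_at_top[of 0]])
  then show ?thesis
    by (simp add: filterlim_sequentially_iff_filterlim_real)
qed

lemma measurable_frequency [measurable]:
  "(\<lambda>L. frequency L) \<in> (seqs :: (nat \<Rightarrow> nat) measure) \<rightarrow>\<^sub>M seq_space"
proof (rule measurable_PiM_single')
  fix k :: nat
  have [measurable]: "(\<lambda>L. occurrences L k n) \<in> (seqs :: (nat \<Rightarrow> nat) measure) \<rightarrow>\<^sub>M count_space UNIV" for n
    by (rule measurable_determined_by_initial[where n = n]) (auto intro: occurrences_cong)
  show "(\<lambda>L. frequency L k) \<in> borel_measurable seqs"
    unfolding frequency_def by measurable
qed auto

section \<open>Recursive trees as sequences of parents\<close>

text \<open>The tree is encoded by \<open>a\<close>, where \<open>a n\<close> is the parent of vertex \<open>n + 1\<close>; thus vertex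
  \<open>n + 1\<close> and the index \<open>n\<close> of the sequence are the same object, and the root has no index.\<close>
definition parent_sequence :: "(nat \<Rightarrow> nat) \<Rightarrow> bool" where
  "parent_sequence a \<longleftrightarrow> (\<forall>n. a n \<le> n)"

text \<open>Number of the component, in order of least elements, that contains vertex \<open>n + 1\<close> once the
  root is removed.  The disjunct \<open>n < a n\<close> makes the recursion terminate for all \<open>a\<close>.\<close>
function label :: "(nat \<Rightarrow> nat) \<Rightarrow> nat \<Rightarrow> nat" where
  "label a n = (if a n = 0 \<or> n < a n then occurrences a 0 n else label a (a n - 1))"
  by pat_completeness auto
termination by (relation "Wellfounded.measure snd") auto

declare label.simps [simp del]

text \<open>Removal of vertex 1 by merging it into the root.\<close>
definition collapse :: "(nat \<Rightarrow> nat) \<Rightarrow> nat \<Rightarrow> nat" where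
  "collapse a n = a (Suc n) - 1"

lemma label_root: "a n = 0 \<Longrightarrow> label a n = occurrences a 0 n"
  by (simp add: label.simps)

lemma parent_less: "parent_sequence a \<Longrightarrow> a n \<noteq> 0 \<Longrightarrow> a n - 1 < n"
  unfolding parent_sequence_def by (metis diff_less le_neq_implies_less less_imp_diff_less neq0_conv zero_less_one)

lemma label_child: "parent_sequence a \<Longrightarrow> a n \<noteq> 0 \<Longrightarrow> label a n = label a (a n - 1)"
  using label.simps[of a n] by (simp add: parent_sequence_def not_less[symmetric])

lemma label_less: "parent_sequence a \<Longrightarrow> label a n < occurrences a 0 (Suc n)"
proof (induction n rule: less_induct)
  case (less n)
  show ?case
  proof (cases "a n = 0")
    case False
    have le: "a n \<le> n" using less.prems by (simp add: parent_sequence_def)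
    then have "label a (a n - 1) < occurrences a 0 (Suc (a n - 1))"
      using False less.prems by (intro less.IH) auto
    also have "\<dots> \<le> occurrences a 0 (Suc n)" using le by (intro occurrences_mono) auto
    finally show ?thesis using False less.prems by (simp add: label_child)
  qed (simp add: label_root)
qed

text \<open>To recognise the components it suffices to exhibit keys that are inherited by children and
  are new at the children of the root.\<close>
lemma label_eq_relabel:
  assumes a: "parent_sequence a"
    and child: "\<And>n. a n \<noteq> 0 \<Longrightarrow> K n = K (a n - 1)"
    and root: "\<And>m n. m < n \<Longrightarrow> a n = 0 \<Longrightarrow> K m \<noteq> K n"
  shows "label a = relabel K"
proof
  have ex_root: "\<exists>r\<le>n. a r = 0 \<and> K r = K n" for n
  proof (induction n rule: less_induct)
    case (less n)
    show ?case
    proof (cases "a n = 0")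
      case False
      then have lt: "a n - 1 < n" using parent_less[OF a] by simp
      from less.IH[OF this] obtain r where "r \<le> a n - 1" "a r = 0" "K r = K (a n - 1)" by blast
      then show ?thesis using lt child[OF False] by (intro exI[of _ r]) auto
    qed auto
  qed
  fix n show "label a n = relabel K n"
  proof (induction n rule: less_induct)
    case (less n)
    show ?case
    proof (cases "a n = 0")
      case True
      have first: "(LEAST m. K m = K n) = n"
        by (rule Least_equality) (use root[OF _ True] in \<open>auto simp: not_less[symmetric]\<close>)
      have "K ` {..<n} = K ` {r. r < n \<and> a r = 0}"
      proof (intro equalityI subsetI)
        fix k assume "k \<in> K ` {..<n}"
        then obtain m where m: "m < n" "k = K m" by auto
        from ex_root[of m] obtain r where "r \<le> m" "a r = 0" "K r = K m" by blast
        then show "k \<in> K ` {r. r < n \<and> a r = 0}" using m by (intro image_eqI[of _ _ r]) auto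
      qed auto
      moreover have "inj_on K {r. r < n \<and> a r = 0}"
      proof (rule inj_onI)
        fix r s assume "r \<in> {r. r < n \<and> a r = 0}" "s \<in> {r. r < n \<and> a r = 0}" "K r = K s"
        then show "r = s" using root[of r s] root[of s r] by (cases r s rule: linorder_cases) auto
      qed
      ultimately show ?thesis
        by (simp add: relabel_def first label_root[of a n, OF True] occurrences_def card_image)
    next
      case False
      then have lt: "a n - 1 < n" using parent_less[OF a] by simp
      then have "label a n = relabel K (a n - 1)" using a False less.IH by (simp add: label_child)
      also have "\<dots> = relabel K n" using child[OF False] by (simp add: relabel_eq_iff)
      finally show ?thesis .
    qed
  qed
qed

lemma label_root_new:
  assumes "parent_sequence a" "m < n" "a n = 0"
  shows "label a m \<noteq> label a n"
  using label_less[OF assms(1), of m] occurrences_mono[of "Suc m" n a 0] assms by (simp add: label_root)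

lemma restricted_growth_label:
  assumes "parent_sequence a"
  shows "restricted_growth (label a)"
proof -
  have "label a = relabel (label a)"
    by (rule label_eq_relabel) (use assms label_child label_root_new in auto)
  then show ?thesis by (metis restricted_growth_relabel)
qed

lemma parent_sequence_collapse: "parent_sequence a \<Longrightarrow> parent_sequence (collapse a)"
  by (simp add: parent_sequence_def collapse_def le_diff_conv)

lemma parent_sequence_collapse_funpow: "parent_sequence a \<Longrightarrow> parent_sequence ((collapse ^^ i) a)"
  by (induction i) (auto intro: parent_sequence_collapse)

lemma collapse_funpow: "(collapse ^^ i) a n = a (n + i) - i"
  by (induction i arbitrary: n) (simp_all add: collapse_def)

lemma label_cong:
  assumes "\<And>m. m \<le> n \<Longrightarrow> a m = b m"
  shows "label a n = label b n"
  using assms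
proof (induction n rule: less_induct)
  case (less n)
  have "occurrences a 0 n = occurrences b 0 n"
    by (rule occurrences_cong) (use less.prems in auto)
  moreover have "a n = b n" using less.prems by simp
  moreover have "label a (a n - 1) = label b (a n - 1)" if "a n \<noteq> 0" "\<not> n < a n"
    using that by (intro less.IH less.prems) auto
  ultimately show ?case
    by (subst (1 2) label.simps) simp
qed

lemma measurable_label [measurable]: "label \<in> seqs \<rightarrow>\<^sub>M seqs"
proof (rule measurable_seqs_coordinatewise)
  show "(\<lambda>a. label a n) \<in> seqs \<rightarrow>\<^sub>M count_space UNIV" for n
    by (rule measurable_determined_by_initial[where n = "Suc n"]) (auto intro: label_cong)
qed

lemma measurable_collapse [measurable]: "collapse \<in> seqs \<rightarrow>\<^sub>M seqs"
proof (rule measurable_seqs_coordinatewise)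
  show "(\<lambda>a. collapse a n) \<in> seqs \<rightarrow>\<^sub>M count_space UNIV" for n
    by (rule measurable_determined_by_initial[where n = "Suc (Suc n)"]) (auto simp: collapse_def)
qed

subsection \<open>Components of the tree\<close>

text \<open>After \<open>i\<close> mergings the root stands for the removed vertices \<open>0, \<dots>, i\<close>.  A path that avoids these
  preserves the label, and every remaining vertex is joined by such a path to an ancestor whose parent
  has been removed; each label belongs to only one such ancestor.\<close>
lemma components_eq_blocks:
  assumes p: "\<And>n. 1 \<le> n \<Longrightarrow> p n < n"
  shows "components_after_removing i p =
    blocks_of_labelling {Suc i..} (\<lambda>v. label ((collapse ^^ i) (\<lambda>n. p (Suc n))) (v - Suc i))"
proof -
  define a where "a = (collapse ^^ i) (\<lambda>n. p (Suc n))"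
  have a: "parent_sequence a"
    unfolding a_def by (rule parent_sequence_collapse_funpow)
      (use p[of "Suc _"] in \<open>auto simp: parent_sequence_def less_Suc_eq_le\<close>)
  have a_eq: "a (v - Suc i) = p v - i" if "i < v" for v
    using that by (simp add: a_def collapse_funpow)
  define K where "K v = label a (v - Suc i)" for v
  define V where "V = {Suc i..}"
  define E where "E = Restr (tree_edges p) V"
  have K_parent: "K v = K (p v)" if "i < v" "i < p v" for v
  proof -
    have "a (v - Suc i) \<noteq> 0" using that by (simp add: a_eq)
    from label_child[OF a this] show ?thesis using that by (simp add: K_def a_eq)
  qed
  have K_edge: "K u = K v" if "(u, v) \<in> E" for u v
    using that K_parent[of v] K_parent[of u] by (fastforce simp: E_def tree_edges_def V_def)
  have K_path: "K u = K v" if "(u, v) \<in> E\<^sup>*" for u v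
    using that
  proof induction
    case (step v w)
    from step.IH K_edge[OF step.hyps(2)] show ?case by (rule trans)
  qed simp
  have "sym E" by (auto simp: sym_def E_def tree_edges_def)
  then have sym: "sym (E\<^sup>*)" by (rule sym_rtrancl)
  have ex_root: "\<exists>r>i. (v, r) \<in> E\<^sup>* \<and> p r \<le> i" if "i < v" for v
    using that
  proof (induction v rule: less_induct)
    case (less v)
    show ?case
    proof (cases "p v \<le> i")
      case False
      then have "(v, p v) \<in> E" using less.prems by (auto simp: E_def V_def tree_edges_def)
      moreover obtain r where "i < r" "(p v, r) \<in> E\<^sup>*" "p r \<le> i"
        using less.IH[of "p v"] p[of v] less.prems False by auto
      ultimately show ?thesis by (meson converse_rtrancl_into_rtrancl)
    qed (use less.prems in auto)
  qed
  \<comment> \<open>The ancestor whose parent has been removed carries a label that is new at this place.\<close>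
  have root_unique: "r = s" if "i < r" "i < s" "p r \<le> i" "p s \<le> i" "K r = K s" for r s
  proof -
    have "a (r - Suc i) = 0" "a (s - Suc i) = 0" using that by (simp_all add: a_eq)
    then have "r - Suc i = s - Suc i"
      using label_root_new[OF a, of "r - Suc i" "s - Suc i"] label_root_new[OF a, of "s - Suc i" "r - Suc i"] that(5)
      unfolding K_def by (metis linorder_neqE_nat)
    then show ?thesis using that by simp
  qed
  have path_iff: "(u, v) \<in> E\<^sup>* \<longleftrightarrow> K u = K v" if uv: "i < u" "i < v" for u v
  proof
    assume "K u = K v"
    obtain r s where r: "i < r" "(u, r) \<in> E\<^sup>*" "p r \<le> i" and s: "i < s" "(v, s) \<in> E\<^sup>*" "p s \<le> i"
      using ex_root uv by blast
    have "K r = K s" using K_path[OF r(2)] K_path[OF s(2)] \<open>K u = K v\<close> by simp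
    then have "r = s" by (rule root_unique[OF r(1) s(1) r(3) s(3)])
    then have "(r, v) \<in> E\<^sup>*" using symD[OF sym s(2)] by simp
    with r(2) show "(u, v) \<in> E\<^sup>*" by (rule rtrancl_trans)
  qed (rule K_path)
  have "E\<^sup>* `` {u} = {v \<in> V. K v = K u}" if "u \<in> V" for u
  proof -
    have "v \<in> V" if "(u, v) \<in> E\<^sup>*" for v
      using that \<open>u \<in> V\<close> by induction (auto simp: E_def)
    moreover have "(u, v) \<in> E\<^sup>* \<longleftrightarrow> K v = K u" if "v \<in> V" for v
      using path_iff[of u v] \<open>u \<in> V\<close> that by (auto simp: V_def)
    ultimately show ?thesis by blast
  qed
  then have "V // E\<^sup>* = (\<lambda>u. {v \<in> V. K v = K u}) ` V"
    by (auto simp: quotient_def)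
  also have "\<dots> = blocks_of_labelling V K"
    by (auto simp: blocks_of_labelling_def)
  finally have "V // E\<^sup>* = blocks_of_labelling V K" .
  moreover have "UNIV - {0..i} = V" by (auto simp: V_def)
  ultimately have "components_after_removing i p = blocks_of_labelling V K"
    by (simp add: components_after_removing_def Let_def E_def)
  then show ?thesis by (simp add: V_def K_def[abs_def] a_def)
qed

text \<open>The number of labels used before a label first occurs is this label itself.\<close>
lemma nth_block_blocks_of_labelling:
  assumes L: "restricted_growth L"
  shows "nth_block (blocks_of_labelling {Suc i..} (\<lambda>v. L (v - Suc i))) n = {v \<in> {Suc i..}. L (v - Suc i) = n}"
proof -
  define B where "B j = {v \<in> {Suc i..}. L (v - Suc i) = j}" for j
  define first where "first j = (LEAST m. L m = j)" for j
  have range_eq: "(\<lambda>v. L (v - Suc i)) ` {Suc i..} = range L"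
  proof safe
    fix m show "L m \<in> (\<lambda>v. L (v - Suc i)) ` {Suc i..}" by (rule image_eqI[of _ _ "m + Suc i"]) auto
  qed auto
  have blocks: "blocks_of_labelling {Suc i..} (\<lambda>v. L (v - Suc i)) = B ` range L"
    unfolding blocks_of_labelling_def B_def[symmetric] by (simp only: range_eq)
  have L_first: "L (first j) = j" if "j \<in> range L" for j
    unfolding first_def using that by (auto intro: LeastI)
  have first_le: "first (L m) \<le> m" for m unfolding first_def by (rule Least_le) simp
  have least: "(LEAST v. v \<in> B j) = first j + Suc i" if "j \<in> range L" for j
  proof (rule Least_equality)
    show "first j + Suc i \<in> B j" using L_first[OF that] by (simp add: B_def)
    show "first j + Suc i \<le> v" if "v \<in> B j" for v using that first_le[of "v - Suc i"] by (auto simp: B_def)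
  qed
  have inj: "inj_on B (range L)"
  proof (rule inj_onI)
    fix j k assume jk: "j \<in> range L" "k \<in> range L" "B j = B k"
    have "first j + Suc i \<in> B j" using L_first[OF jk(1)] by (simp add: B_def)
    then have "first j + Suc i \<in> B k" using jk(3) by simp
    then show "j = k" using L_first[OF jk(1)] by (simp add: B_def)
  qed
  have card: "card {C \<in> B ` range L. (LEAST v. v \<in> C) < (LEAST v. v \<in> B j)} = j" if j: "j \<in> range L" for j
  proof -
    have "{C \<in> B ` range L. (LEAST v. v \<in> C) < (LEAST v. v \<in> B j)} = B ` {k \<in> range L. first k < first j}"
      using least j by auto
    then have "card {C \<in> B ` range L. (LEAST v. v \<in> C) < (LEAST v. v \<in> B j)} = card {k \<in> range L. first k < first j}"
      using inj by (simp add: card_image inj_on_subset)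
    also have "{k \<in> range L. first k < first j} = L ` {..<first j}"
    proof (intro equalityI subsetI)
      fix k assume "k \<in> {k \<in> range L. first k < first j}"
      then show "k \<in> L ` {..<first j}" using L_first[of k] by (intro image_eqI[of _ _ "first k"]) auto
    next
      fix k assume "k \<in> L ` {..<first j}"
      then show "k \<in> {k \<in> range L. first k < first j}" using first_le le_less_trans by auto
    qed
    also have "card (L ` {..<first j}) = L (first j)"
    proof (rule restricted_growth_new[OF L, symmetric])
      show "L (first j) \<notin> L ` {..<first j}"
        unfolding L_first[OF j] using first_le by (metis imageE lessThan_iff not_le)
    qed
    finally show ?thesis by (simp add: L_first[OF j])
  qed
  have "{D \<in> B ` range L. card {C \<in> B ` range L. (LEAST v. v \<in> C) < (LEAST v. v \<in> D)} = n} = (if n \<in> range L then {B n} else {})"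
    using card by auto
  then have "nth_block (blocks_of_labelling {Suc i..} (\<lambda>v. L (v - Suc i))) n = \<Union> (if n \<in> range L then {B n} else {})"
    unfolding nth_block_def blocks by simp
  also have "\<dots> = B n" by (auto simp: B_def)
  finally show ?thesis by (simp add: B_def)
qed

lemma lim_shift: "lim (\<lambda>n. X (n + i)) = lim X" and convergent_shift: "convergent (\<lambda>n. X (n + i)) \<longleftrightarrow> convergent X"
  for X :: "nat \<Rightarrow> real"
proof -
  have "((\<lambda>n. X (n + i)) \<longlonglongrightarrow> c) \<longleftrightarrow> X \<longlonglongrightarrow> c" for c
    using LIMSEQ_ignore_initial_segment[of X c i] LIMSEQ_offset[of X i c] by blast
  then show "lim (\<lambda>n. X (n + i)) = lim X" "convergent (\<lambda>n. X (n + i)) \<longleftrightarrow> convergent X"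
    by (simp_all add: lim_def convergent_def)
qed

lemma relative_count_shift:
  "relative_count {Suc i..} {v \<in> {Suc i..}. L (v - Suc i) = k} (n + i) = real (occurrences L k n) / real n"
proof -
  have "{v \<in> {Suc i..}. L (v - Suc i) = k} \<inter> {1..n + i} = (\<lambda>m. m + Suc i) ` {m. m < n \<and> L m = k}"
  proof (intro equalityI subsetI)
    fix v assume "v \<in> {v \<in> {Suc i..}. L (v - Suc i) = k} \<inter> {1..n + i}"
    then show "v \<in> (\<lambda>m. m + Suc i) ` {m. m < n \<and> L m = k}" by (intro image_eqI[of _ _ "v - Suc i"]) auto
  qed auto
  then have "card ({v \<in> {Suc i..}. L (v - Suc i) = k} \<inter> {1..n + i}) = occurrences L k n"
    by (simp add: card_image inj_on_def occurrences_def)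
  moreover have "{Suc i..} \<inter> {1..n + i} = {Suc i..n + i}" by auto
  ultimately show ?thesis unfolding relative_count_def by simp
qed

lemma asymptotic_frequency_shift:
  "asymptotic_frequency {Suc i..} {v \<in> {Suc i..}. L (v - Suc i) = k} = frequency L k"
  unfolding asymptotic_frequency_def frequency_def
  using lim_shift[of "relative_count {Suc i..} {v \<in> {Suc i..}. L (v - Suc i) = k}" i]
  by (simp only: relative_count_shift)

lemma has_asymptotic_frequency_shift:
  "has_asymptotic_frequency {Suc i..} {v \<in> {Suc i..}. L (v - Suc i) = k} \<longleftrightarrow> has_frequency L k (frequency L k)"
  unfolding has_asymptotic_frequency_def has_frequency_def frequency_def
  using convergent_shift[of "relative_count {Suc i..} {v \<in> {Suc i..}. L (v - Suc i) = k}" i]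
  by (simp only: relative_count_shift convergent_LIMSEQ_iff)

subsection \<open>Undoing the merging of vertex 1 into the root\<close>

text \<open>The \<open>k\<close>-th child of the root of \<open>q\<close> becomes a child of the new vertex 1 if \<open>c k\<close> holds.\<close>
definition split_root :: "(nat \<Rightarrow> nat) \<Rightarrow> (nat \<Rightarrow> bool) \<Rightarrow> nat \<Rightarrow> nat" where
  "split_root q c n = (case n of 0 \<Rightarrow> 0
     | Suc m \<Rightarrow> if q m \<noteq> 0 then Suc (q m) else if c (occurrences q 0 m) then 1 else 0)"

text \<open>The key \<open>None\<close> marks the component of vertex 1, which has index 0 in the sequence.\<close>
definition merge_key :: "(nat \<Rightarrow> nat) \<Rightarrow> (nat \<Rightarrow> bool) \<Rightarrow> nat \<Rightarrow> nat option" where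
  "merge_key L c n = (case n of 0 \<Rightarrow> None | Suc m \<Rightarrow> if c (L m) then None else Some (L m))"

lemma split_root_0 [simp]: "split_root q c 0 = 0"
  by (simp add: split_root_def)

lemma split_root_Suc:
  "split_root q c (Suc m) = (if q m \<noteq> 0 then Suc (q m) else if c (occurrences q 0 m) then 1 else 0)"
  by (simp add: split_root_def)

lemma merge_key_0 [simp]: "merge_key L c 0 = None"
  by (simp add: merge_key_def)

lemma merge_key_Suc [simp]: "merge_key L c (Suc m) = (if c (L m) then None else Some (L m))"
  by (simp add: merge_key_def)

lemma collapse_split_root: "collapse (split_root q c) = q"
  by (rule ext) (simp add: collapse_def split_root_Suc)

lemma parent_sequence_split_root: "parent_sequence q \<Longrightarrow> parent_sequence (split_root q c)"
  unfolding parent_sequence_def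
proof
  fix n assume q: "\<forall>n. q n \<le> n"
  show "split_root q c n \<le> n" using q by (cases n) (auto simp: split_root_Suc)
qed

text \<open>A child of the root that is moved to vertex 1 takes its whole component along.\<close>
lemma label_split_root:
  assumes q: "parent_sequence q"
  shows "label (split_root q c) = relabel (merge_key (label q) c)"
proof (rule label_eq_relabel[OF parent_sequence_split_root[OF q]])
  fix n assume ne: "split_root q c n \<noteq> 0"
  then obtain m where n: "n = Suc m" by (cases n) auto
  show "merge_key (label q) c n = merge_key (label q) c (split_root q c n - 1)"
  proof (cases "q m = 0")
    case True
    then show ?thesis using ne by (auto simp: n split_root_Suc label_root split: if_splits)
  next
    case False
    then obtain r where r: "q m = Suc r" by (cases "q m") auto
    then show ?thesis using label_child[OF q, of m] by (simp add: n split_root_Suc)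
  qed
next
  fix m n assume mn: "m < n" and z: "split_root q c n = 0"
  then obtain n' where n: "n = Suc n'" by (cases n) auto
  have q0: "q n' = 0" and c: "\<not> c (label q n')"
    using z by (auto simp: n split_root_Suc label_root split: if_splits)
  show "merge_key (label q) c m \<noteq> merge_key (label q) c n"
  proof (cases m)
    case (Suc m')
    then show ?thesis using label_root_new[OF q, of m' n'] mn q0 c by (auto simp: n)
  qed (use c in \<open>simp add: n\<close>)
qed

lemma range_merge_key:
  assumes "range L = UNIV"
  shows "range (merge_key L c) = insert None {Some j | j. \<not> c j}"
proof (intro equalityI subsetI)
  fix x assume "x \<in> range (merge_key L c)"
  then obtain n where "x = merge_key L c n" by auto
  then show "x \<in> insert None {Some j | j. \<not> c j}" by (cases n) auto
next
  fix x assume x: "x \<in> insert None {Some j | j. \<not> c j}"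
  show "x \<in> range (merge_key L c)"
  proof (cases x)
    case None
    then show ?thesis by (intro range_eqI[of _ _ 0]) simp
  next
    case (Some j)
    obtain m where "L m = j" using assms by (metis surjD)
    then show ?thesis using x Some by (intro range_eqI[of _ _ "Suc m"]) auto
  qed
qed

text \<open>The merged block receives the total mass of its parts because no mass is lost, neither before
  nor after merging.\<close>
lemma ranked_frequency_split_root:
  assumes q: "parent_sequence q" and pq: "proper_frequencies (label q)"
    and pa: "proper_frequencies (label (split_root q c))"
  shows "ranked (frequency (label (split_root q c))) = coagulate (frequency (label q)) c"
proof -
  define K where "K = merge_key (label q) c"
  have pK: "proper_frequencies K"
    using pa unfolding label_split_root[OF q] proper_frequencies_relabel K_def .
  have range_q: "range (label q) = UNIV"
    using pq restricted_growth_range[OF restricted_growth_label[OF q]] by (auto simp: proper_frequencies_def)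
  have range_K: "range K = insert None {Some j | j. \<not> c j}"
    unfolding K_def by (rule range_merge_key[OF range_q])
  have freq_Some: "frequency K (Some j) = frequency (label q) j" if "\<not> c j" for j
  proof (rule frequency_eqI)
    have "has_frequency (label q) j (frequency (label q) j)"
      using pq range_q by (auto simp: proper_frequencies_def)
    moreover have "occurrences (\<lambda>n. K (n + 1)) (Some j) = occurrences (label q) j"
      by (rule ext, rule occurrences_cong) (use that in \<open>auto simp: K_def\<close>)
    ultimately show "has_frequency K (Some j) (frequency (label q) j)"
      using has_frequency_shift[of K 1 "Some j"] by (simp add: has_frequency_def)
  qed
  have sum_q: "(frequency (label q) has_sum 1) UNIV" and pos: "0 < frequency (label q) j" for j
    using pq range_q by (auto simp: proper_frequencies_def)
  have summ: "frequency (label q) summable_on A" for A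
    using sum_q by (meson has_sum_imp_summable summable_on_subset_banach subset_UNIV)
  have "(frequency K has_sum 1) (insert None {Some j | j. \<not> c j})"
    using pK by (simp add: proper_frequencies_def range_K)
  then have "(frequency K has_sum (1 - frequency K None)) (insert None {Some j | j. \<not> c j} - {None})"
    by (rule has_sum_Diff) (auto intro: has_sum_finiteI)
  moreover have "insert None {Some j | j. \<not> c j} - {None} = {Some j | j. \<not> c j}" by auto
  ultimately have "(frequency K has_sum (1 - frequency K None)) {Some j | j. \<not> c j}" by simp
  moreover have "{Some j | j. \<not> c j} = Some ` {j. \<not> c j}" by auto
  ultimately have "((frequency K \<circ> Some) has_sum (1 - frequency K None)) {j. \<not> c j}"
    using has_sum_reindex[of Some "{j. \<not> c j}" "frequency K"] by simp
  \<comment> \<open>Both partitions have total mass one, so the merged block has what the unmarked blocks leave.\<close>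
  then have 1: "(frequency (label q) has_sum (1 - frequency K None)) {j. \<not> c j}"
    by (rule has_sum_cong[THEN iffD1, rotated]) (simp add: freq_Some)
  have 2: "(frequency (label q) has_sum (\<Sum>\<^sub>\<infinity>j\<in>{j. c j}. frequency (label q) j)) {j. c j}"
    using summ by (rule has_sum_infsum)
  have "(frequency (label q) has_sum (1 - frequency K None + (\<Sum>\<^sub>\<infinity>j\<in>{j. c j}. frequency (label q) j))) ({j. \<not> c j} \<union> {j. c j})"
    by (rule has_sum_Un_disjoint[OF 1 2]) auto
  moreover have "{j. \<not> c j} \<union> {j. c j} = UNIV" by auto
  ultimately have None_eq: "frequency K None = (\<Sum>\<^sub>\<infinity>j\<in>{j. c j}. frequency (label q) j)"
    using has_sum_unique[OF sum_q] by fastforce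
  have "((\<lambda>j. if c j then frequency (label q) j else 0) has_sum frequency K None) UNIV"
    using 2 unfolding None_eq by (subst has_sum_cong_neutral[where T = "{j. c j}"]) auto
  then have freq_None: "frequency K None = (\<Sum>j. if c j then frequency (label q) j else 0)"
    using has_sum_imp_sums sums_unique by blast
  have "ranked (frequency (label (split_root q c))) =
      decreasing_rearrangement (range K) (frequency K)"
    using ranked_frequency_relabel[of K] pK by (simp add: label_split_root[OF q] K_def proper_frequencies_def)
  also have "\<dots> = coagulate (frequency (label q)) c"
    unfolding coagulate_def range_K
    by (rule decreasing_rearrangement_reindex[of id])
       (auto simp: freq_Some freq_None split: option.splits)
  finally show ?thesis .
qed

subsection \<open>Assembling a tree from its components\<close>

text \<open>The vertices are distributed over the blocks by \<open>L\<close>, and the \<open>j\<close>-th block is organised as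
  the tree \<open>e j\<close> by the order-preserving bijection.  The first vertex of a block is a child of the
  root, and it plays the part of the root of \<open>e j\<close>; this is the reason for the two shifts by one.\<close>
definition assemble :: "(nat \<Rightarrow> nat) \<Rightarrow> (nat \<Rightarrow> nat \<Rightarrow> nat) \<Rightarrow> nat \<Rightarrow> nat" where
  "assemble L e n =
     (let j = L n; r = occurrences L j n in
      if r = 0 then 0 else Suc (occurrence L j (e j (r - 1))))"

lemma assemble_parent:
  assumes e: "\<forall>j. parent_sequence (e j)" and r: "occurrences L (L n) n = Suc r"
  defines "i \<equiv> occurrence L (L n) (e (L n) r)"
  shows "assemble L e n = Suc i" "i < n" "L i = L n" "occurrences L (L n) i = e (L n) r"
proof -
  have "e (L n) r < occurrences L (L n) n"
    using e unfolding r parent_sequence_def by (simp add: le_imp_less_Suc)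
  from occurrence_spec[OF this]
  show "i < n" "L i = L n" "occurrences L (L n) i = e (L n) r" by (simp_all add: i_def)
  show "assemble L e n = Suc i" by (simp add: assemble_def Let_def r i_def)
qed

lemma parent_sequence_assemble:
  assumes "\<forall>j. parent_sequence (e j)"
  shows "parent_sequence (assemble L e)"
  unfolding parent_sequence_def
proof
  fix n show "assemble L e n \<le> n"
  proof (cases "occurrences L (L n) n")
    case 0
    then show ?thesis by (simp add: assemble_def)
  next
    case (Suc r)
    then show ?thesis using assemble_parent[OF assms Suc] by (simp add: Suc_le_eq)
  qed
qed

lemma assemble_eq_0_iff: "assemble L e n = 0 \<longleftrightarrow> L n \<notin> L ` {..<n}"
  by (auto simp: assemble_def Let_def occurrences_eq_0_iff)

lemma label_assemble:
  assumes e: "\<forall>j. parent_sequence (e j)" and L: "restricted_growth L"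
  shows "label (assemble L e) = L"
proof -
  have "label (assemble L e) = relabel L"
  proof (rule label_eq_relabel[OF parent_sequence_assemble[OF e]])
    fix n assume "assemble L e n \<noteq> 0"
    then obtain r where r: "occurrences L (L n) n = Suc r"
      by (metis assemble_eq_0_iff occurrences_eq_0_iff not0_implies_Suc)
    show "L n = L (assemble L e n - 1)" using assemble_parent[OF e r] by simp
  next
    fix m n assume "m < n" "assemble L e n = 0"
    then show "L m \<noteq> L n" by (metis assemble_eq_0_iff imageI lessThan_iff)
  qed
  then show ?thesis using relabel_restricted_growth[OF L] by simp
qed

text \<open>Keys of the blocks that remain when the first vertex of block 0 is merged into the root.\<close>
definition fragment_key :: "(nat \<Rightarrow> nat) \<Rightarrow> (nat \<Rightarrow> nat) \<Rightarrow> nat \<Rightarrow> nat + nat" where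
  "fragment_key L l n =
     (if L (Suc n) \<noteq> 0 then Inl (L (Suc n)) else Inr (l (occurrences L 0 (Suc n) - 1)))"

text \<open>Vertex 1 is the first vertex of block 0 and thus the root of \<open>e 0\<close>, so the pieces of this block are
  the components of \<open>e 0\<close>; the other blocks are unaffected.\<close>
lemma label_collapse_assemble:
  assumes e: "\<forall>j. parent_sequence (e j)" and L: "restricted_growth L"
  shows "label (collapse (assemble L e)) = relabel (fragment_key L (label (e 0)))"
proof (rule label_eq_relabel[OF parent_sequence_collapse[OF parent_sequence_assemble[OF e]]])
  have L0: "L 0 = 0" using L by simp
  have e0: "parent_sequence (e 0)" using e by simp
  have occ0: "0 < occurrences L 0 (Suc n)" for n
    by (rule le_less_trans[OF le0 occurrences_less]) (use L0 in auto)
  {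
    fix n assume "collapse (assemble L e) n \<noteq> 0"
    then have ge: "2 \<le> assemble L e (Suc n)" by (simp add: collapse_def)
    then obtain r where r: "occurrences L (L (Suc n)) (Suc n) = Suc r"
      by (metis assemble_eq_0_iff occurrences_eq_0_iff not0_implies_Suc not_numeral_le_zero)
    define i where "i = occurrence L (L (Suc n)) (e (L (Suc n)) r)"
    note par = assemble_parent[OF e r, folded i_def]
    have i: "i = Suc (i - 1)" using ge par(1) by simp
    have c: "collapse (assemble L e) n - 1 = i - 1" using par(1) by (simp add: collapse_def)
    show "fragment_key L (label (e 0)) n = fragment_key L (label (e 0)) (collapse (assemble L e) n - 1)"
    proof (cases "L (Suc n) = 0")
      case False
      then show ?thesis unfolding c fragment_key_def using par(3) i by simp
    next
      case True
      have occ: "occurrences L 0 i = e 0 r" using par(4) True by simp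
      have "e 0 r \<noteq> 0" using occ0[of "i - 1"] i occ by simp
      from label_child[OF e0 this] have "label (e 0) r = label (e 0) (occurrences L 0 i - 1)" by (simp add: occ)
      moreover have "occurrences L 0 (Suc n) - 1 = r" using r True by simp
      ultimately show ?thesis unfolding c fragment_key_def using True par(3) i by simp
    qed
  next
    fix m n assume mn: "m < n" and z: "collapse (assemble L e) n = 0"
    show "fragment_key L (label (e 0)) m \<noteq> fragment_key L (label (e 0)) n"
    proof (cases "assemble L e (Suc n) = 0")
      case True
      then have new: "L (Suc n) \<noteq> L k" if "k < Suc n" for k
        using that by (auto simp: assemble_eq_0_iff image_iff)
      then have "L (Suc n) \<noteq> 0" "L (Suc n) \<noteq> L (Suc m)" using new[of 0] new[of "Suc m"] mn L0 by auto
      then show ?thesis by (auto simp: fragment_key_def)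
    next
      case False
      then obtain r where r: "occurrences L (L (Suc n)) (Suc n) = Suc r"
        by (metis assemble_eq_0_iff occurrences_eq_0_iff not0_implies_Suc)
      define i where "i = occurrence L (L (Suc n)) (e (L (Suc n)) r)"
      note par = assemble_parent[OF e r, folded i_def]
      have "i = 0" using z par(1) by (simp add: collapse_def)
      then have Ln: "L (Suc n) = 0" and er: "e 0 r = 0" using par(3,4) L0 by simp_all
      have occ_n: "occurrences L 0 (Suc n) - 1 = r" using r Ln by simp
      show ?thesis
      proof (cases "L (Suc m) = 0")
        case True
        have "occurrences L 0 (Suc m) < occurrences L 0 (Suc n)"
          using occurrences_less[of "Suc m" "Suc n" L 0] mn True by simp
        then have "occurrences L 0 (Suc m) - 1 < r" using occ_n occ0[of m] by linarith
        from label_root_new[OF e0 this er] show ?thesis unfolding fragment_key_def True Ln occ_n by simp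
      qed (use Ln in \<open>auto simp: fragment_key_def\<close>)
    qed
  }
qed

text \<open>Within block 0, the vertices other than the first one are numbered consecutively.\<close>
lemma occurrences_fragment_key_Inr:
  assumes "L 0 = 0"
  shows "occurrences (fragment_key L l) (Inr k) n = occurrences l k (occurrences L 0 (Suc n) - 1)"
proof (induction n)
  case 0
  then show ?case using assms by simp
next
  case (Suc n)
  have "0 < occurrences L 0 (Suc n)"
    by (rule le_less_trans[OF le0 occurrences_less]) (use assms in auto)
  then obtain r where r: "occurrences L 0 (Suc n) = Suc r" by (metis not0_implies_Suc less_numeral_extra(3))
  show ?case
  proof (cases "L (Suc n) = 0")
    case True
    then have "occurrences L 0 (Suc (Suc n)) - 1 = Suc r" using r by simp
    then show ?thesis using Suc r True by (simp add: fragment_key_def del: occurrences_Suc[of L])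
  next
    case False
    then have "occurrences L 0 (Suc (Suc n)) - 1 = r" using r by simp
    then show ?thesis using Suc r False by (simp add: fragment_key_def del: occurrences_Suc[of L])
  qed
qed

lemma range_fragment_key:
  assumes L0: "L 0 = 0" and L: "range L = UNIV" and l: "range l = UNIV"
    and unbounded: "filterlim (\<lambda>n. occurrences L 0 n) at_top sequentially"
  shows "range (fragment_key L l) = {Inl j | j. j \<noteq> 0} \<union> range Inr"
proof (intro equalityI subsetI)
  fix x assume "x \<in> range (fragment_key L l)"
  then show "x \<in> {Inl j | j. j \<noteq> 0} \<union> range Inr" by (auto simp: fragment_key_def)
next
  fix x :: "nat + nat" assume x: "x \<in> {Inl j | j. j \<noteq> 0} \<union> range Inr"
  show "x \<in> range (fragment_key L l)"
  proof (cases x)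
    case (Inl j)
    then have "j \<noteq> 0" using x by auto
    obtain n where n: "L n = j" using L by (metis surjD)
    then obtain m where "n = Suc m" using \<open>j \<noteq> 0\<close> L0 by (cases n) auto
    then show ?thesis using n Inl \<open>j \<noteq> 0\<close> by (intro range_eqI[of _ _ m]) (simp add: fragment_key_def)
  next
    case (Inr k)
    obtain m where m: "l m = k" using l by (metis surjD)
    have "eventually (\<lambda>n. Suc (Suc m) \<le> occurrences L 0 n) sequentially"
      using unbounded by (simp add: filterlim_at_top)
    then obtain n where "Suc m < occurrences L 0 n" by (auto simp: eventually_sequentially Suc_le_eq)
    from occurrence_spec[OF this] obtain i where i: "L i = 0" "occurrences L 0 i = Suc m" by blast
    then obtain i' where "i = Suc i'" by (cases i) auto
    then show ?thesis using i m Inr by (intro range_eqI[of _ _ i']) (simp add: fragment_key_def del: occurrences_Suc)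
  qed
qed

text \<open>Frequencies multiply: the vertices of a piece are a fraction of those of block 0, which
  are a fraction of all vertices.\<close>
lemma ranked_frequency_collapse_assemble:
  assumes e: "\<forall>j. parent_sequence (e j)" and L: "restricted_growth L"
    and pL: "proper_frequencies L" and pe: "proper_frequencies (label (e 0))"
  shows "ranked (frequency (label (collapse (assemble L e)))) =
    fragment (frequency L) 0 (frequency (label (e 0)))"
proof -
  define K where "K = fragment_key L (label (e 0))"
  have L0: "L 0 = 0" using L by simp
  have range_L: "range L = UNIV"
    using pL restricted_growth_range[OF L] by (auto simp: proper_frequencies_def)
  have range_e: "range (label (e 0)) = UNIV"
    using pe restricted_growth_range[OF restricted_growth_label[OF e[rule_format]]] by (auto simp: proper_frequencies_def)
  have fL: "has_frequency L j (frequency L j)" and pos: "0 < frequency L j" for j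
    using pL range_L by (auto simp: proper_frequencies_def)
  have fe: "has_frequency (label (e 0)) k (frequency (label (e 0)) k)" for k
    using pe range_e by (auto simp: proper_frequencies_def)
  have unb: "filterlim (\<lambda>n. occurrences L 0 n) at_top sequentially"
    by (rule frequency_pos_unbounded[OF fL pos])
  have range_K: "range K = {Inl j | j. j \<noteq> 0} \<union> range Inr"
    unfolding K_def by (rule range_fragment_key[OF L0 range_L range_e unb])
  have Inl: "frequency K (Inl j) = frequency L j" if "j \<noteq> 0" for j
  proof (rule frequency_eqI)
    have "occurrences K (Inl j) = occurrences (\<lambda>n. L (n + 1)) j"
      by (rule ext, rule occurrences_cong) (use that in \<open>auto simp: K_def fragment_key_def\<close>)
    then show "has_frequency K (Inl j) (frequency L j)"
      using fL[of j] has_frequency_shift[of L 1 j] by (simp add: has_frequency_def)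
  qed
  have Inr: "frequency K (Inr k) = frequency L 0 * frequency (label (e 0)) k" for k
  proof (rule frequency_eqI)
    \<comment> \<open>The number of vertices of block 0 after the first one: the index reached in the tree \<open>e 0\<close>.\<close>
    define N where "N n = occurrences L 0 (Suc n) - 1" for n
    have N_eq: "N = occurrences (\<lambda>n. L (n + 1)) 0"
    proof
      fix n
      have "occurrences L 0 (Suc n) = Suc (occurrences (\<lambda>n. L (n + 1)) 0 n)"
        by (induction n) (use L0 in auto)
      then show "N n = occurrences (\<lambda>n. L (n + 1)) 0 n" unfolding N_def by simp
    qed
    have fN: "has_frequency (\<lambda>n. L (n + 1)) 0 (frequency L 0)"
      using fL[of 0] has_frequency_shift[of L 1 0] by simp
    have N_lim: "filterlim N at_top sequentially"
      unfolding N_eq by (rule frequency_pos_unbounded[OF fN pos])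
    have "(\<lambda>n. real (occurrences (label (e 0)) k (N n)) / real (N n)) \<longlonglongrightarrow> frequency (label (e 0)) k"
      using filterlim_compose[OF fe[of k, unfolded has_frequency_def] N_lim] .
    moreover have "(\<lambda>n. real (N n) / real n) \<longlonglongrightarrow> frequency L 0"
      using fN unfolding has_frequency_def N_eq .
    ultimately have *: "(\<lambda>n. real (N n) / real n * (real (occurrences (label (e 0)) k (N n)) / real (N n)))
        \<longlonglongrightarrow> frequency L 0 * frequency (label (e 0)) k"
      by (rule tendsto_mult[rotated])
    have "eventually (\<lambda>n. 0 < N n) sequentially"
      using N_lim[unfolded filterlim_at_top, rule_format, of 1] by (simp add: Suc_le_eq)
    then have "eventually (\<lambda>n. real (N n) / real n * (real (occurrences (label (e 0)) k (N n)) / real (N n)) =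
        real (occurrences K (Inr k) n) / real n) sequentially"
      by (rule eventually_mono) (simp add: K_def occurrences_fragment_key_Inr[of L, OF L0] N_def del: occurrences_Suc)
    then show "has_frequency K (Inr k) (frequency L 0 * frequency (label (e 0)) k)"
      unfolding has_frequency_def by (rule Lim_transform_eventually[OF *])
  qed
  have "infinite (range K)"
    unfolding range_K by (rule infinite_fragment_index)
  then have "ranked (frequency (label (collapse (assemble L e)))) =
      decreasing_rearrangement (range K) (frequency K)"
    using ranked_frequency_relabel[of K] by (simp add: label_collapse_assemble[OF e L] K_def)
  also have "\<dots> = fragment (frequency L) 0 (frequency (label (e 0)))"
    unfolding fragment_def range_K
    by (rule decreasing_rearrangement_reindex[of id]) (auto simp: Inl Inr)
  finally show ?thesis .
qed

section \<open>Beta distributions and the urn\<close>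

text \<open>The expectation of \<open>x ^ u * (1 - x) ^ s\<close> for a Beta distributed \<open>x\<close>.\<close>
definition beta_moment :: "real \<Rightarrow> real \<Rightarrow> nat \<Rightarrow> nat \<Rightarrow> real" where
  "beta_moment a b u s = Beta (a + real u) (b + real s) / Beta a b"

lemma Beta_pos: "0 < a \<Longrightarrow> 0 < b \<Longrightarrow> 0 < Beta a (b :: real)"
  by (simp add: Beta_def Gamma_real_pos)

lemma beta_moment_nonneg: "0 < a \<Longrightarrow> 0 < b \<Longrightarrow> 0 \<le> beta_moment a b u s"
  unfolding beta_moment_def by (intro divide_nonneg_nonneg less_imp_le Beta_pos) auto

lemma beta_moment_00: "0 < a \<Longrightarrow> 0 < b \<Longrightarrow> beta_moment a b 0 0 = 1"
  using Beta_pos[of a b] by (simp add: beta_moment_def)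

lemma beta_moment_Suc_left:
  assumes "0 < a" "0 < b"
  shows "beta_moment a b (Suc u) s = beta_moment a b u s * ((a + u) / (a + b + u + s))"
proof -
  have "a + u \<notin> \<int>\<^sub>\<le>\<^sub>0" using assms by (auto elim!: nonpos_Ints_cases)
  from Beta_plus1_left[OF this, of "b + s"]
  have "(a + b + u + s) * Beta (a + u + 1) (b + s) = (a + u) * Beta (a + u) (b + s)"
    by (simp add: add_ac)
  moreover have "a + b + u + s \<noteq> 0" using assms by simp
  ultimately have "Beta (a + u + 1) (b + s) = (a + u) / (a + b + u + s) * Beta (a + u) (b + s)"
    by (simp add: field_simps)
  then show ?thesis by (simp add: beta_moment_def add_ac mult_ac)
qed

lemma beta_moment_commute: "beta_moment a b u s = beta_moment b a s u"
  by (simp add: beta_moment_def Beta_commute)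

lemma beta_moment_Suc_right:
  assumes "0 < a" "0 < b"
  shows "beta_moment a b u (Suc s) = beta_moment a b u s * ((b + s) / (a + b + u + s))"
  using beta_moment_Suc_left[OF assms(2,1), of s u]
  by (simp add: beta_moment_commute[of a b] add_ac)

lemma beta_density_measurable [measurable]: "beta_density a b \<in> borel_measurable borel"
  unfolding beta_density_def[abs_def] by measurable

lemma sets_beta_distribution [simp, measurable_cong]: "sets (beta_distribution a b) = sets borel"
  by (simp add: beta_distribution_def)

lemma space_beta_distribution [simp]: "space (beta_distribution a b) = UNIV"
  by (simp add: beta_distribution_def)

lemma nn_integral_beta_moment:
  assumes a: "0 < a" and b: "0 < b"
  shows "(\<integral>\<^sup>+x. ennreal (x ^ u * (1 - x) ^ s) \<partial>beta_distribution a b) = ennreal (beta_moment a b u s)"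
proof -
  let ?f = "\<lambda>x::real. x powr (a + u - 1) * (1 - x) powr (b + s - 1) / Beta a b"
  have "((\<lambda>t. t powr (a + u - 1) * (1 - t) powr (b + s - 1)) has_integral Beta (a + u) (b + s)) {0..1}"
    by (rule has_integral_Beta_real) (use a b in auto)
  then have h: "(?f has_integral beta_moment a b u s) {0..1}"
    unfolding beta_moment_def by (rule has_integral_divide)
  have "(\<integral>\<^sup>+x. ennreal (indicator {0..1} x * ?f x) \<partial>lborel) = ennreal (beta_moment a b u s)"
    by (rule nn_integral_has_integral_lebesgue[OF _ h]) (use Beta_pos[OF a b] in auto)
  moreover have "ennreal (indicator {0..1} x * ?f x) = ennreal (?f x) * indicator {0..1} x" for x
    by (simp add: indicator_def)
  ultimately have I: "(\<integral>\<^sup>+x. ennreal (?f x) * indicator {0..1} x \<partial>lborel) = ennreal (beta_moment a b u s)"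
    by (simp only:)
  have eq: "ennreal (beta_density a b x) * ennreal (x ^ u * (1 - x) ^ s) = ennreal (?f x) * indicator {0..1} x" for x :: real
  proof (cases "0 < x \<and> x < 1")
    case True
    have "a + u - 1 = (a - 1) + u" "b + s - 1 = (b - 1) + s" by simp_all
    note exponents = this
    have "x powr (a + u - 1) = x powr (a - 1) * x ^ u"
      unfolding exponents using True by (simp only: powr_add powr_realpow)
    moreover have "(1 - x) powr (b + s - 1) = (1 - x) powr (b - 1) * (1 - x) ^ s"
      unfolding exponents using True by (simp only: powr_add powr_realpow diff_gt_0_iff_gt)
    ultimately have "beta_density a b x * (x ^ u * (1 - x) ^ s) = ?f x"
      using True by (simp add: beta_density_def)
    then show ?thesis
      using True Beta_pos[OF a b] by (simp add: beta_density_def flip: ennreal_mult)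
  next
    case False
    then consider "x = 0" | "x = 1" | "x < 0 \<or> 1 < x" by linarith
    then show ?thesis by cases (auto simp: beta_density_def indicator_def)
  qed
  have "(\<integral>\<^sup>+x. ennreal (x ^ u * (1 - x) ^ s) \<partial>beta_distribution a b) =
      (\<integral>\<^sup>+x. ennreal (beta_density a b x) * ennreal (x ^ u * (1 - x) ^ s) \<partial>lborel)"
    unfolding beta_distribution_def by (rule nn_integral_density) measurable
  then show ?thesis using I by (simp add: eq)
qed

lemma prob_space_beta_distribution:
  assumes "0 < a" "0 < b"
  shows "prob_space (beta_distribution a b)"
proof
  have "emeasure (beta_distribution a b) (space (beta_distribution a b)) =
      (\<integral>\<^sup>+x. ennreal (x ^ 0 * (1 - x) ^ 0) \<partial>beta_distribution a b)" by simp
  then show "emeasure (beta_distribution a b) (space (beta_distribution a b)) = 1"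
    unfolding nn_integral_beta_moment[OF assms] beta_moment_00[OF assms] by simp
qed

lemma AE_beta_distribution: "AE x in beta_distribution a b. 0 < x \<and> x < 1"
  unfolding beta_distribution_def
  by (subst AE_density) (auto simp: beta_density_def split: if_splits)

lemma sets_merging_probability_law [simp, measurable_cong]: "sets (merging_probability_law \<alpha> \<theta>) = sets borel"
  by (simp add: merging_probability_law_def)

lemma prob_space_merging_probability_law:
  assumes "0 \<le> \<alpha>" "\<alpha> < 1" "\<theta> > - \<alpha>"
  shows "prob_space (merging_probability_law \<alpha> \<theta>)"
  using assms by (auto simp: merging_probability_law_def prob_space_return intro!: prob_space_beta_distribution)

lemma measurable_bernoulli_pmf: "(\<lambda>b. pmf (bernoulli_pmf b) c) \<in> borel_measurable borel"
  unfolding bernoulli_pmf.rep_eq comp_def by (cases c) simp_all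

definition urn_law :: "real \<Rightarrow> real \<Rightarrow> (nat \<Rightarrow> bool) measure" where
  "urn_law \<alpha> \<theta> = merging_probability_law \<alpha> \<theta> \<bind> (\<lambda>b. iid (bernoulli_pmf b))"

text \<open>Predictive probabilities of Polya's urn with initial masses \<open>1 - \<alpha>\<close> and \<open>\<theta> + \<alpha>\<close> and reinforcement
  \<open>\<alpha>\<close>.\<close>
definition urn_step :: "real \<Rightarrow> real \<Rightarrow> bool list \<Rightarrow> bool \<Rightarrow> real" where
  "urn_step \<alpha> \<theta> cs c =
     ((if c then 1 - \<alpha> else \<theta> + \<alpha>) + \<alpha> * count_list cs c) / (1 + \<theta> + \<alpha> * length cs)"

lemma bernoulli_kernel:
  "(\<lambda>b. iid (bernoulli_pmf b)) \<in> merging_probability_law \<alpha> \<theta> \<rightarrow>\<^sub>M prob_algebra seqs"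
proof -
  have "(\<lambda>b. iid (bernoulli_pmf b)) \<in> borel \<rightarrow>\<^sub>M prob_algebra seqs"
    by (intro iid_kernel measurable_bernoulli_pmf)
  then show ?thesis by (simp cong: measurable_cong_sets)
qed

lemma space_merging_probability_law [simp]: "space (merging_probability_law \<alpha> \<theta>) = UNIV"
  by (simp add: merging_probability_law_def)

lemma sets_urn_law [simp, measurable_cong]: "sets (urn_law \<alpha> \<theta>) = sets seqs"
  unfolding urn_law_def by (rule sets_bind) auto

lemma prob_space_urn_law:
  assumes "0 \<le> \<alpha>" "\<alpha> < 1" "\<theta> > - \<alpha>"
  shows "prob_space (urn_law \<alpha> \<theta>)"
  unfolding urn_law_def
  by (rule prob_space.prob_space_bind[OF prob_space_merging_probability_law[OF assms]])
     (use measurable_prob_algebraD[OF bernoulli_kernel] in \<open>auto simp: prob_space_iid\<close>)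

lemma AE_merging_probability_law:
  assumes "0 \<le> \<alpha>" "\<alpha> < 1" "\<theta> > - \<alpha>"
  shows "AE b in merging_probability_law \<alpha> \<theta>. 0 \<le> b \<and> b \<le> 1"
proof (cases "\<alpha> > 0")
  case True
  then have "merging_probability_law \<alpha> \<theta> = beta_distribution ((1 - \<alpha>) / \<alpha>) ((\<theta> + \<alpha>) / \<alpha>)"
    by (simp add: merging_probability_law_def)
  then show ?thesis
    using AE_beta_distribution by (metis (mono_tags, lifting) eventually_mono less_imp_le)
next
  case False
  then have "merging_probability_law \<alpha> \<theta> = return borel (1 / (\<theta> + 1))"
    by (simp add: merging_probability_law_def)
  moreover have "0 \<le> 1 / (\<theta> + 1) \<and> 1 / (\<theta> + 1) \<le> 1" using False assms by simp
  ultimately show ?thesis by (simp only:, subst AE_return) auto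
qed

text \<open>The ratios of consecutive Beta moments are the predictive probabilities of Polya's urn.  For
  \<open>\<alpha> = 0\<close> nothing is reinforced, and the urn is a Bernoulli sequence.\<close>
lemma measure_urn_law_cylinder:
  assumes \<alpha>: "0 \<le> \<alpha>" "\<alpha> < 1" and \<theta>: "\<theta> > - \<alpha>"
  shows "measure (urn_law \<alpha> \<theta>) (cylinder cs) = segment_prob (urn_step \<alpha> \<theta>) cs"
proof -
  define u s where "u = count_list cs True" and "s = count_list cs False"
  let ?R = "merging_probability_law \<alpha> \<theta>"
  have cyl: "measure (iid (bernoulli_pmf b)) (cylinder cs) = b ^ count_list cs True * (1 - b) ^ count_list cs False"
    if "0 \<le> b" "b \<le> 1" for b and cs
    unfolding measure_iid_cylinder
    by (induction cs rule: rev_induct) (use that in \<open>auto simp: nth_append split: if_splits\<close>)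
  have "emeasure (urn_law \<alpha> \<theta>) (cylinder cs) = (\<integral>\<^sup>+b. emeasure (iid (bernoulli_pmf b)) (cylinder cs) \<partial>?R)"
    unfolding urn_law_def
    by (rule emeasure_bind[OF _ measurable_prob_algebraD[OF bernoulli_kernel]]) auto
  also have "\<dots> = (\<integral>\<^sup>+b. ennreal (b ^ u * (1 - b) ^ s) \<partial>?R)"
  proof (rule nn_integral_cong_AE)
    have "emeasure (iid (bernoulli_pmf b)) (cylinder cs) = ennreal (b ^ u * (1 - b) ^ s)" if "0 \<le> b" "b \<le> 1" for b
      using cyl[OF that] finite_measure.emeasure_eq_measure[OF prob_space.finite_measure[OF prob_space_iid[of "bernoulli_pmf b"]]]
      by (simp add: u_def s_def)
    then show "AE b in ?R. emeasure (iid (bernoulli_pmf b)) (cylinder cs) = ennreal (b ^ u * (1 - b) ^ s)"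
      using AE_merging_probability_law[OF assms] by (auto elim: eventually_mono)
  qed
  also have "\<dots> = ennreal (segment_prob (urn_step \<alpha> \<theta>) cs)"
  proof (cases "\<alpha> > 0")
    case True
    define A B where "A = (1 - \<alpha>) / \<alpha>" and "B = (\<theta> + \<alpha>) / \<alpha>"
    have AB: "0 < A" "0 < B" using True assms by (auto simp: A_def B_def)
    have "beta_moment A B (count_list cs True) (count_list cs False) = segment_prob (urn_step \<alpha> \<theta>) cs"
    proof (induction cs rule: rev_induct)
      case (snoc c cs)
      have len: "length cs = count_list cs True + count_list cs False"
        by (induction cs) auto
      \<comment> \<open>Multiplication by \<open>\<alpha>\<close> turns the Beta parameters into the masses of the urn.\<close>
      have denom: "A + B + count_list cs True + count_list cs False = (1 + \<theta> + \<alpha> * length cs) / \<alpha>"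
        using True unfolding len by (simp add: A_def B_def field_simps)
      have num: "A + count_list cs True = (1 - \<alpha> + \<alpha> * count_list cs True) / \<alpha>"
        "B + count_list cs False = (\<theta> + \<alpha> + \<alpha> * count_list cs False) / \<alpha>"
        using True by (simp_all add: A_def B_def field_simps)
      have step: "(A + count_list cs True) / (A + B + count_list cs True + count_list cs False) = urn_step \<alpha> \<theta> cs True"
        "(B + count_list cs False) / (A + B + count_list cs True + count_list cs False) = urn_step \<alpha> \<theta> cs False"
        unfolding denom num using True by (simp_all add: urn_step_def)
      show ?case
        by (cases c) (simp_all add: beta_moment_Suc_left[OF AB] beta_moment_Suc_right[OF AB] step snoc.IH)
    qed (simp add: beta_moment_00[OF AB])
    then show ?thesis
      using True nn_integral_beta_moment[OF AB, of u s]
      by (simp add: merging_probability_law_def A_def B_def u_def s_def)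
  next
    case False
    then have "\<alpha> = 0" using assms by simp
    define p where "p = 1 / (\<theta> + 1)"
    have "p ^ count_list cs True * (1 - p) ^ count_list cs False = segment_prob (urn_step \<alpha> \<theta>) cs"
    proof (induction cs rule: rev_induct)
      case (snoc c cs)
      have "1 - p = \<theta> / (1 + \<theta>)" using \<theta> \<open>\<alpha> = 0\<close> by (simp add: p_def field_simps)
      then have "urn_step \<alpha> \<theta> cs c = (if c then p else 1 - p)"
        using \<open>\<alpha> = 0\<close> by (simp add: urn_step_def p_def add_ac)
      then show ?case using snoc.IH[symmetric] by (cases c) simp_all
    qed simp
    then show ?thesis
      using \<open>\<alpha> = 0\<close> by (simp add: merging_probability_law_def nn_integral_return p_def u_def s_def)
  qed
  finally have "emeasure (urn_law \<alpha> \<theta>) (cylinder cs) = ennreal (segment_prob (urn_step \<alpha> \<theta>) cs)" .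
  moreover have "0 \<le> segment_prob (urn_step \<alpha> \<theta>) cs"
    unfolding segment_prob_def urn_step_def
    using assms by (intro prod_nonneg) (auto intro!: divide_nonneg_nonneg add_nonneg_nonneg mult_nonneg_nonneg)
  ultimately show ?thesis by (simp add: measure_def)
qed

section \<open>The law of the recursive tree\<close>

text \<open>The first vertex is attached to the root with certainty; for \<open>\<theta> = 0\<close> the quotient would be \<open>0 / 0\<close>.\<close>
definition tree_step :: "real \<Rightarrow> real \<Rightarrow> nat list \<Rightarrow> nat \<Rightarrow> real" where
  "tree_step \<alpha> \<theta> xs v =
     (if xs = [] then if v = 0 then 1 else 0
      else if v \<le> length xs
      then ((if v = 0 then \<theta> else 1 - \<alpha>) + \<alpha> * count_list xs v) / (\<theta> + length xs) else 0)"

definition parent_list :: "nat list \<Rightarrow> bool" where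
  "parent_list xs \<longleftrightarrow> (\<forall>m<length xs. xs ! m \<le> m)"

lemma parent_list_Nil [simp]: "parent_list []"
  by (simp add: parent_list_def)

lemma parent_list_snoc [simp]: "parent_list (xs @ [v]) \<longleftrightarrow> parent_list xs \<and> v \<le> length xs"
  by (auto simp: parent_list_def nth_append less_Suc_eq)

lemma segment_prob_tree_step_0: "segment_prob (tree_step \<alpha> \<theta>) [0] = 1"
  using segment_prob_snoc[of "tree_step \<alpha> \<theta>" "[]" 0] by (simp add: tree_step_def)

lemma segment_prob_tree_step_eq_0: "\<not> parent_list xs \<Longrightarrow> segment_prob (tree_step \<alpha> \<theta>) xs = 0"
  by (induction xs rule: rev_induct) (auto simp: tree_step_def)

lemma sum_tree_weights:
  fixes \<alpha> \<theta> :: real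
  assumes "parent_list xs"
  shows "(\<Sum>v\<le>length xs. (if v = 0 then \<theta> else 1 - \<alpha>) + \<alpha> * count_list xs v) = \<theta> + real (length xs)"
proof -
  have "set xs \<subseteq> {..length xs}"
    using assms by (auto simp: parent_list_def in_set_conv_nth) (meson le_trans less_imp_le)
  then have "(\<Sum>v\<le>length xs. count_list xs v) = length xs"
    by (subst sum.mono_neutral_right[of "{..length xs}" "set xs"]) (auto simp: sum_count_set)
  then have "(\<Sum>v\<le>length xs. \<alpha> * count_list xs v) = \<alpha> * length xs"
    by (metis of_nat_sum sum_distrib_left)
  moreover have "(\<Sum>v\<le>n. if v = 0 then \<theta> else 1 - \<alpha>) = \<theta> + (1 - \<alpha>) * n" for n :: nat
    by (induction n) (auto simp: algebra_simps)
  ultimately show ?thesis by (simp add: sum.distrib algebra_simps)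
qed

lemma count_list_0_pos: "parent_list xs \<Longrightarrow> xs \<noteq> [] \<Longrightarrow> 1 \<le> count_list xs 0"
proof -
  assume "parent_list xs" "xs \<noteq> []"
  then have "xs ! 0 = 0" "0 < length xs" by (auto simp: parent_list_def)
  then have "0 \<in> set xs" by (metis nth_mem)
  then show ?thesis by (metis Suc_leI One_nat_def count_list_0_iff neq0_conv)
qed

lemma tree_step_nonneg:
  assumes "0 \<le> \<alpha>" "\<alpha> < 1" "\<theta> > - \<alpha>" "parent_list xs"
  shows "0 \<le> tree_step \<alpha> \<theta> xs v"
proof (cases "xs = [] \<or> length xs < v")
  case False
  then have "1 \<le> count_list xs 0" using assms count_list_0_pos by blast
  then have "\<alpha> * 1 \<le> \<alpha> * count_list xs 0" using assms by (intro mult_left_mono) auto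
  then have "0 \<le> \<theta> + \<alpha> * count_list xs 0" using assms by simp
  moreover have "1 \<le> real (length xs)" using False by (cases xs) auto
  ultimately show ?thesis
    using assms False by (auto simp: tree_step_def intro!: divide_nonneg_nonneg add_nonneg_nonneg)
qed (auto simp: tree_step_def)

lemma tree_step_sum:
  assumes "0 \<le> \<alpha>" "\<alpha> < 1" "\<theta> > - \<alpha>" "parent_list xs"
  shows "(\<Sum>v\<le>length xs. tree_step \<alpha> \<theta> xs v) = 1"
proof (cases "xs = []")
  case False
  then have "\<theta> + length xs \<noteq> 0" using assms by (cases xs) auto
  moreover have "(\<Sum>v\<le>length xs. tree_step \<alpha> \<theta> xs v) =
      (\<Sum>v\<le>length xs. (if v = 0 then \<theta> else 1 - \<alpha>) + \<alpha> * count_list xs v) / (\<theta> + length xs)"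
    unfolding sum_divide_distrib using False by (intro sum.cong) (auto simp: tree_step_def)
  ultimately show ?thesis by (simp add: sum_tree_weights[OF assms(4)])
qed (simp add: tree_step_def)

text \<open>Such a law exists by \<open>sequential_law_exists\<close> and is unique by \<open>seqs_measure_eqI\<close>.\<close>
definition tree_law :: "real \<Rightarrow> real \<Rightarrow> (nat \<Rightarrow> nat) measure" where
  "tree_law \<alpha> \<theta> = (SOME M. prob_space M \<and> sets M = sets seqs \<and>
     (\<forall>xs. measure M (cylinder xs) = segment_prob (tree_step \<alpha> \<theta>) xs))"

context
  fixes \<alpha> \<theta> :: real
  assumes \<alpha>: "0 \<le> \<alpha>" "\<alpha> < 1" and \<theta>: "\<theta> > - \<alpha>"
begin

lemma tree_law_spec:
  "prob_space (tree_law \<alpha> \<theta>) \<and> sets (tree_law \<alpha> \<theta>) = sets seqs \<and>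
     (\<forall>xs. measure (tree_law \<alpha> \<theta>) (cylinder xs) = segment_prob (tree_step \<alpha> \<theta>) xs)"
proof -
  \<comment> \<open>On words that are not parent lists any transition will do, since they are never reached.\<close>
  define \<kappa> where "\<kappa> xs = (if parent_list xs then embed_pmf (tree_step \<alpha> \<theta> xs) else return_pmf 0)" for xs
  have pmf_\<kappa>: "pmf (\<kappa> xs) v = tree_step \<alpha> \<theta> xs v" if xs: "parent_list xs" for xs v
  proof -
    have "(\<integral>\<^sup>+v. ennreal (tree_step \<alpha> \<theta> xs v) \<partial>count_space UNIV) = (\<Sum>v\<le>length xs. ennreal (tree_step \<alpha> \<theta> xs v))"
      by (rule nn_integral_count_space') (use xs in \<open>auto simp: tree_step_def\<close>)
    also have "\<dots> = 1"
      using tree_step_nonneg[OF \<alpha> \<theta> xs] tree_step_sum[OF \<alpha> \<theta> xs] by (subst sum_ennreal) auto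
    finally show ?thesis
      using xs tree_step_nonneg[OF \<alpha> \<theta> xs] by (simp add: \<kappa>_def pmf_embed_pmf)
  qed
  have "segment_prob (\<lambda>ys. pmf (\<kappa> ys)) xs = segment_prob (tree_step \<alpha> \<theta>) xs" for xs
  proof (induction xs rule: rev_induct)
    case (snoc v xs)
    then show ?case
      using segment_prob_tree_step_eq_0[of xs \<alpha> \<theta>] pmf_\<kappa>[of xs v] by (cases "parent_list xs") auto
  qed simp
  then have "\<exists>M. prob_space M \<and> sets M = sets seqs \<and>
     (\<forall>xs. measure M (cylinder xs) = segment_prob (tree_step \<alpha> \<theta>) xs)"
    using sequential_law_exists[of \<kappa>] by simp
  then show ?thesis unfolding tree_law_def by (rule someI_ex)
qed

lemma prob_space_tree_law: "prob_space (tree_law \<alpha> \<theta>)"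
  and sets_tree_law: "sets (tree_law \<alpha> \<theta>) = sets seqs"
  and measure_tree_law_cylinder: "measure (tree_law \<alpha> \<theta>) (cylinder xs) = segment_prob (tree_step \<alpha> \<theta>) xs"
  using tree_law_spec by auto

lemma AE_parent_sequence: "AE a in tree_law \<alpha> \<theta>. parent_sequence a"
proof -
  interpret prob_space "tree_law \<alpha> \<theta>" by (rule prob_space_tree_law)
  have cyl: "AE a in tree_law \<alpha> \<theta>. a \<notin> cylinder xs" if "\<not> parent_list xs" for xs
  proof (rule AE_I[where N = "cylinder xs"])
    show "emeasure (tree_law \<alpha> \<theta>) (cylinder xs) = 0"
      using that by (simp add: emeasure_eq_measure measure_tree_law_cylinder segment_prob_tree_step_eq_0)
  qed (auto simp: sets_tree_law)
  then have "AE a in tree_law \<alpha> \<theta>. \<forall>xs. \<not> parent_list xs \<longrightarrow> a \<notin> cylinder xs"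
    by (subst AE_all_countable) auto
  then show ?thesis
  proof (rule eventually_mono)
    fix a assume *: "\<forall>xs. \<not> parent_list xs \<longrightarrow> a \<notin> cylinder xs"
    have "parent_list (initial (Suc n) a)" for n
      using *[rule_format, of "initial (Suc n) a"] by (auto simp: cylinder_def simp del: initial_Suc)
    then show "parent_sequence a" by (auto simp: parent_sequence_def)
  qed
qed

end

text \<open>The merging of vertex 1 into the root in terms of initial segments: the new parents, and the
  record of which children of the new root were children of vertex 1.\<close>
definition collapsed_parents :: "nat list \<Rightarrow> nat list" where
  "collapsed_parents zs = map (\<lambda>v. v - 1) zs"

definition merge_record :: "nat list \<Rightarrow> bool list" where
  "merge_record zs = map (\<lambda>v. v = 1) (filter (\<lambda>v. v \<le> 1) zs)"

lemma length_collapsed_parents [simp]: "length (collapsed_parents zs) = length zs"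
  by (simp add: collapsed_parents_def)

lemma collapsed_parents_snoc [simp]: "collapsed_parents (zs @ [v]) = collapsed_parents zs @ [v - 1]"
  and merge_record_snoc [simp]: "merge_record (zs @ [v]) = merge_record zs @ (if v \<le> 1 then [v = 1] else [])"
  and collapsed_parents_Nil [simp]: "collapsed_parents [] = []"
  and merge_record_Nil [simp]: "merge_record [] = []"
  by (simp_all add: collapsed_parents_def merge_record_def)

lemma count_collapsed_parents:
  "count_list (collapsed_parents zs) 0 = length (merge_record zs)"
  "v \<noteq> 0 \<Longrightarrow> count_list (collapsed_parents zs) v = count_list zs (Suc v)"
  "count_list (merge_record zs) True = count_list zs 1"
  "count_list (merge_record zs) False = count_list zs 0"
  by (induction zs rule: rev_induct) (auto simp: le_Suc_eq)

lemma initial_split_root_iff: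
  "initial (Suc (length zs)) (split_root q c) = 0 # zs \<longleftrightarrow>
    initial (length zs) q = collapsed_parents zs \<and> initial (length (merge_record zs)) c = merge_record zs"
proof (induction zs rule: rev_induct)
  case (snoc v zs)
  let ?n = "length zs" and ?k = "length (merge_record zs)"
  have "initial (Suc (length (zs @ [v]))) (split_root q c) = 0 # zs @ [v] \<longleftrightarrow>
      initial (Suc ?n) (split_root q c) = 0 # zs \<and> split_root q c (Suc ?n) = v"
    by (simp add: initial_Suc[of "Suc _"] del: initial_Suc flip: append_Cons)
  also have "\<dots> \<longleftrightarrow> (initial ?n q = collapsed_parents zs \<and> initial ?k c = merge_record zs) \<and> split_root q c (Suc ?n) = v"
    using snoc by simp
  also have "\<dots> \<longleftrightarrow> (initial ?n q = collapsed_parents zs \<and> initial ?k c = merge_record zs) \<and>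
      (q ?n = v - 1 \<and> (v \<le> 1 \<longrightarrow> c ?k = (v = 1)))"
  proof (intro conj_cong refl)
    assume "initial ?n q = collapsed_parents zs \<and> initial ?k c = merge_record zs"
    then have "occurrences q 0 ?n = ?k"
      using count_list_initial_eq[of ?n q 0] by (simp add: count_collapsed_parents)
    then show "split_root q c (Suc ?n) = v \<longleftrightarrow> q ?n = v - 1 \<and> (v \<le> 1 \<longrightarrow> c ?k = (v = 1))"
      by (cases "v \<le> 1") (auto simp: split_root_Suc le_Suc_eq)
  qed
  finally show ?case by auto
qed simp

text \<open>A vertex that is attached to 0 or 1 is, after the merging, attached to the root, whose weight is the
  sum of the weights of 0 and 1; the urn chooses one of the two in proportion to their weights.\<close>
lemma split_root_probability:
  assumes \<alpha>: "0 \<le> \<alpha>" "\<alpha> < 1" and \<theta>: "\<theta> > - \<alpha>"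
  shows "segment_prob (tree_step \<alpha> (\<theta> + 1)) (collapsed_parents zs) * segment_prob (urn_step \<alpha> \<theta>) (merge_record zs) =
    segment_prob (tree_step \<alpha> \<theta>) (0 # zs)"
proof (induction zs rule: rev_induct)
  case Nil
  show ?case by (simp add: segment_prob_tree_step_0)
next
  case (snoc v zs)
  have snoc': "segment_prob (tree_step \<alpha> \<theta>) (0 # zs @ [v]) = segment_prob (tree_step \<alpha> \<theta>) (0 # zs) * tree_step \<alpha> \<theta> (0 # zs) v"
    using segment_prob_snoc[of "tree_step \<alpha> \<theta>" "0 # zs" v] by simp
  show ?case
  proof (cases "v \<le> 1")
    case True
    have pos: "1 + \<theta> + \<alpha> * length (merge_record zs) \<noteq> 0"
      using assms by (smt (verit) mult_nonneg_nonneg of_nat_0_le_iff)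
    have "tree_step \<alpha> (\<theta> + 1) (collapsed_parents zs) 0 =
        (1 + \<theta> + \<alpha> * length (merge_record zs)) / (\<theta> + 1 + length zs)"
    proof (cases "zs = []")
      case False
      then have "collapsed_parents zs \<noteq> []" by (simp add: collapsed_parents_def)
      then show ?thesis by (simp add: tree_step_def count_collapsed_parents add_ac)
    qed (use assms in \<open>simp add: tree_step_def add_ac\<close>)
    then have "tree_step \<alpha> (\<theta> + 1) (collapsed_parents zs) 0 * urn_step \<alpha> \<theta> (merge_record zs) (v = 1) =
        ((if v = 1 then 1 - \<alpha> else \<theta> + \<alpha>) + \<alpha> * count_list (merge_record zs) (v = 1)) / (\<theta> + 1 + length zs)"
      using pos by (simp add: urn_step_def)
    also have "\<dots> = tree_step \<alpha> \<theta> (0 # zs) v"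
      using True by (auto simp: tree_step_def count_collapsed_parents le_Suc_eq Suc_le_eq algebra_simps)
    finally show ?thesis
      using True snoc.IH by (simp add: snoc' algebra_simps)
  next
    case False
    have "tree_step \<alpha> (\<theta> + 1) (collapsed_parents zs) (v - 1) = tree_step \<alpha> \<theta> (0 # zs) v"
    proof (cases "zs = []")
      case False
      then have "collapsed_parents zs \<noteq> []" by (simp add: collapsed_parents_def)
      then show ?thesis using \<open>\<not> v \<le> 1\<close> by (auto simp: tree_step_def count_collapsed_parents add_ac)
    qed (use False in \<open>simp add: tree_step_def\<close>)
    then show ?thesis using False snoc.IH by (simp add: snoc' algebra_simps)
  qed
qed

lemma measurable_split_root [measurable]: "(\<lambda>(q, c). split_root q c) \<in> seqs \<Otimes>\<^sub>M seqs \<rightarrow>\<^sub>M seqs"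
proof (rule measurable_seqs_coordinatewise)
  fix n
  have [measurable]: "(\<lambda>q. occurrences q 0 m) \<in> (seqs :: (nat \<Rightarrow> nat) measure) \<rightarrow>\<^sub>M count_space UNIV" for m
    by (rule measurable_determined_by_initial[where n = m]) (auto intro: occurrences_cong)
  show "(\<lambda>x. (case x of (q, c) \<Rightarrow> split_root q c) n) \<in> seqs \<Otimes>\<^sub>M seqs \<rightarrow>\<^sub>M count_space UNIV"
  proof (cases n)
    case (Suc m)
    have [measurable]: "(\<lambda>x. fst x m) \<in> (seqs :: (nat \<Rightarrow> nat) measure) \<Otimes>\<^sub>M (seqs :: (nat \<Rightarrow> bool) measure) \<rightarrow>\<^sub>M count_space UNIV" for m
      by (rule measurable_compose[OF measurable_fst measurable_coordinate])
    have [measurable]: "(\<lambda>x. snd x m) \<in> (seqs :: (nat \<Rightarrow> nat) measure) \<Otimes>\<^sub>M (seqs :: (nat \<Rightarrow> bool) measure) \<rightarrow>\<^sub>M count_space UNIV" for m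
      by (rule measurable_compose[OF measurable_snd measurable_coordinate])
    have [measurable]: "(\<lambda>x. (\<lambda>i x. snd x i) (occurrences (fst x) 0 m) x) \<in>
        (seqs :: (nat \<Rightarrow> nat) measure) \<Otimes>\<^sub>M (seqs :: (nat \<Rightarrow> bool) measure) \<rightarrow>\<^sub>M count_space UNIV"
      by (rule measurable_compose_countable) measurable
    show ?thesis unfolding Suc case_prod_beta split_root_Suc by measurable
  qed (simp add: case_prod_beta)
qed

text \<open>The parents in the split tree determine, and are determined by, the merged tree and the marks; for
  initial segments the probabilities multiply.\<close>
lemma tree_law_split_root:
  assumes \<alpha>: "0 \<le> \<alpha>" "\<alpha> < 1" and \<theta>: "\<theta> > - \<alpha>"
  shows "distr (tree_law \<alpha> (\<theta> + 1) \<Otimes>\<^sub>M urn_law \<alpha> \<theta>) seqs (\<lambda>(q, c). split_root q c) = tree_law \<alpha> \<theta>"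
proof (rule seqs_measure_eqI)
  have \<theta>1: "\<theta> + 1 > - \<alpha>" using \<theta> by simp
  interpret Q: prob_space "tree_law \<alpha> (\<theta> + 1)" by (rule prob_space_tree_law[OF \<alpha> \<theta>1])
  interpret U: prob_space "urn_law \<alpha> \<theta>" by (rule prob_space_urn_law[OF assms])
  interpret P: pair_prob_space "tree_law \<alpha> (\<theta> + 1)" "urn_law \<alpha> \<theta>" ..
  note [simp, measurable_cong] = sets_tree_law[OF \<alpha> \<theta>1] sets_tree_law[OF \<alpha> \<theta>]
  have meas: "(\<lambda>(q, c). split_root q c) \<in> tree_law \<alpha> (\<theta> + 1) \<Otimes>\<^sub>M urn_law \<alpha> \<theta> \<rightarrow>\<^sub>M seqs"
    by measurable
  show prob: "prob_space (distr (tree_law \<alpha> (\<theta> + 1) \<Otimes>\<^sub>M urn_law \<alpha> \<theta>) seqs (\<lambda>(q, c). split_root q c))"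
    by (rule P.prob_space_distr[OF meas])
  show "prob_space (tree_law \<alpha> \<theta>)" by (rule prob_space_tree_law[OF assms])
  have sp: "space (tree_law \<alpha> (\<theta> + 1)) = UNIV" "space (urn_law \<alpha> \<theta>) = UNIV"
    by (auto simp: sets_eq_imp_space_eq[OF sets_tree_law[OF \<alpha> \<theta>1]] sets_eq_imp_space_eq[OF sets_urn_law])
  fix xs :: "nat list"
  let ?M = "distr (tree_law \<alpha> (\<theta> + 1) \<Otimes>\<^sub>M urn_law \<alpha> \<theta>) seqs (\<lambda>(q, c). split_root q c)"
  have "(\<lambda>(q, c). split_root q c) -` cylinder xs \<inter> space (tree_law \<alpha> (\<theta> + 1) \<Otimes>\<^sub>M urn_law \<alpha> \<theta>) =
      {(q, c). initial (length xs) (split_root q c) = xs}"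
    by (auto simp: cylinder_def space_pair_measure sp)
  then have M: "measure ?M (cylinder xs) =
      measure (tree_law \<alpha> (\<theta> + 1) \<Otimes>\<^sub>M urn_law \<alpha> \<theta>) {(q, c). initial (length xs) (split_root q c) = xs}"
    by (simp add: measure_distr[OF meas])
  show "measure ?M (cylinder xs) = measure (tree_law \<alpha> \<theta>) (cylinder xs)"
  proof (cases xs)
    case Nil
    then show ?thesis
      using prob_space.prob_space[OF prob] prob_space.prob_space[OF prob_space_tree_law[OF assms]]
      by (simp add: sets_eq_imp_space_eq[OF sets_tree_law[OF \<alpha> \<theta>]])
  next
    case (Cons x zs)
    show ?thesis
    proof (cases "x = 0")
      case False
      have "initial (length xs) (split_root q c) \<noteq> xs" for q c
        using False unfolding Cons initial_eq_iff by auto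
      moreover have "\<not> parent_list xs" using False by (auto simp: Cons parent_list_def)
      ultimately show ?thesis
        unfolding M by (simp add: measure_tree_law_cylinder[OF assms] segment_prob_tree_step_eq_0)
    next
      case True
      have "{(q, c). initial (length xs) (split_root q c) = xs} =
          cylinder (collapsed_parents zs) \<times> cylinder (merge_record zs)"
        using initial_split_root_iff[of zs] by (auto simp: Cons True cylinder_def simp del: initial_Suc)
      then have "measure ?M (cylinder xs) =
          measure (tree_law \<alpha> (\<theta> + 1)) (cylinder (collapsed_parents zs)) * measure (urn_law \<alpha> \<theta>) (cylinder (merge_record zs))"
        unfolding M by (simp add: measure_def U.emeasure_pair_measure_Times enn2real_mult)
      then show ?thesis
        unfolding measure_tree_law_cylinder[OF \<alpha> \<theta>1] measure_urn_law_cylinder[OF assms]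
          measure_tree_law_cylinder[OF assms] Cons True
        using split_root_probability[OF assms] by simp
    qed
  qed
qed (simp_all add: sets_tree_law[OF \<alpha> \<theta>])

text \<open>By the chain rule, the conditional attachment probabilities give the probabilities of initial
  segments.  When the conditioning event is null, so is every continuation of the segment.\<close>
lemma recursive_tree_law:
  assumes \<alpha>: "0 \<le> \<alpha>" "\<alpha> < 1" and \<theta>: "\<theta> > - \<alpha>" and T: "recursive_tree M \<alpha> \<theta> T"
  shows "(\<lambda>\<omega> n. T \<omega> (Suc n)) \<in> M \<rightarrow>\<^sub>M seqs"
    and "distr M seqs (\<lambda>\<omega> n. T \<omega> (Suc n)) = tree_law \<alpha> \<theta>"
proof -
  interpret prob_space M using T by (simp add: recursive_tree_def)
  have T_meas: "(\<lambda>\<omega>. T \<omega> n) \<in> M \<rightarrow>\<^sub>M count_space UNIV" if "1 \<le> n" for n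
    using T that by (simp add: recursive_tree_def)
  have T_less: "T \<omega> n < n" if "\<omega> \<in> space M" "1 \<le> n" for \<omega> n
    using T that by (simp add: recursive_tree_def)
  define X where "X \<omega> n = T \<omega> (Suc n)" for \<omega> n
  have X [measurable]: "X \<in> M \<rightarrow>\<^sub>M seqs"
    by (rule measurable_seqs_coordinatewise) (simp add: X_def T_meas)
  have X_le: "X \<omega> n \<le> n" if "\<omega> \<in> space M" for \<omega> n
    using T_less[OF that, of "Suc n"] by (simp add: X_def)
  have prob_X: "prob {\<omega> \<in> space M. initial (length xs) (X \<omega>) = xs} = segment_prob (tree_step \<alpha> \<theta>) xs" for xs
  proof (induction xs rule: rev_induct)
    case Nil
    then show ?case by (simp add: prob_space)
  next
    case (snoc v xs)
    let ?N = "length xs"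
    define p where "p m = xs ! (m - 1)" for m
    define E where "E = {\<omega> \<in> space M. initial ?N (X \<omega>) = xs}"
    have E_eq: "E = {\<omega> \<in> space M. \<forall>m\<in>{1..<Suc ?N}. T \<omega> m = p m}"
    proof -
      have "initial ?N (X \<omega>) = xs \<longleftrightarrow> (\<forall>m\<in>{1..<Suc ?N}. T \<omega> m = p m)" for \<omega>
      proof
        assume "initial ?N (X \<omega>) = xs"
        then have "X \<omega> m = xs ! m" if "m < ?N" for m using that by (simp add: initial_eq_iff)
        then show "\<forall>m\<in>{1..<Suc ?N}. T \<omega> m = p m"
          unfolding X_def p_def by (metis One_nat_def Suc_le_D Suc_less_eq atLeastLessThan_iff diff_Suc_1)
      next
        assume *: "\<forall>m\<in>{1..<Suc ?N}. T \<omega> m = p m"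
        show "initial ?N (X \<omega>) = xs"
          unfolding initial_eq_iff X_def using * by (auto simp: p_def dest: bspec[of _ _ "Suc _"])
      qed
      then show ?thesis by (auto simp: E_def)
    qed
    have IH: "prob E = segment_prob (tree_step \<alpha> \<theta>) xs" using snoc by (simp add: E_def)
    have goal: "{\<omega> \<in> space M. initial (length (xs @ [v])) (X \<omega>) = xs @ [v]} = {\<omega> \<in> space M. X \<omega> ?N = v \<and> \<omega> \<in> E}"
      by (auto simp: E_def)
    have meas_E: "E \<in> events" unfolding E_def by measurable
    show ?case
    proof (cases "prob E = 0")
      case True
      have "prob {\<omega> \<in> space M. X \<omega> ?N = v \<and> \<omega> \<in> E} \<le> prob E"
        by (rule finite_measure_mono[OF _ meas_E]) auto
      then show ?thesis using True IH unfolding goal by (simp add: measure_le_0_iff)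
    next
      case False
      then have pos: "prob E > 0" by (simp add: zero_less_measure_iff)
      then have xs: "parent_list xs" using IH segment_prob_tree_step_eq_0[of xs \<alpha> \<theta>] by fastforce
      consider "?N < v" | "xs = []" "v = 0" | "xs \<noteq> []" "v \<le> ?N" by fastforce
      then show ?thesis
      proof cases
        case 1
        then have empty: "{\<omega> \<in> space M. X \<omega> ?N = v \<and> \<omega> \<in> E} = {}" using X_le[of _ ?N] by force
        have "tree_step \<alpha> \<theta> xs v = 0" using 1 by (auto simp: tree_step_def)
        then show ?thesis unfolding goal empty by simp
      next
        case 2
        then have "{\<omega> \<in> space M. X \<omega> ?N = v \<and> \<omega> \<in> E} = E" using X_le by (auto simp: E_def)
        then show ?thesis unfolding goal using 2 IH by (simp add: segment_prob_tree_step_0)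
      next
        case 3
        have children: "num_children p (Suc ?N) j = count_list xs j" for j
        proof -
          have "{m \<in> {1..<Suc ?N}. p m = j} = Suc ` {m. m < ?N \<and> xs ! m = j}"
          proof (intro equalityI subsetI)
            fix m assume "m \<in> {m \<in> {1..<Suc ?N}. p m = j}"
            then show "m \<in> Suc ` {m. m < ?N \<and> xs ! m = j}"
              by (intro image_eqI[of _ _ "m - 1"]) (auto simp: p_def)
          qed (auto simp: p_def)
          then have "num_children p (Suc ?N) j = card {m. m < ?N \<and> xs ! m = j}"
            by (simp add: num_children_def card_image)
          also have "\<dots> = count_list (initial ?N (\<lambda>m. xs ! m)) j" by (simp add: count_list_initial)
          also have "initial ?N (\<lambda>m. xs ! m) = xs" by (simp add: initial_eq_iff)
          finally show ?thesis .
        qed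
        have weight: "attachment_weight \<alpha> \<theta> p (Suc ?N) j = (if j = 0 then \<theta> else 1 - \<alpha>) + \<alpha> * count_list xs j" for j
          by (simp add: attachment_weight_def children)
        have total: "(\<Sum>k<Suc ?N. attachment_weight \<alpha> \<theta> p (Suc ?N) k) = \<theta> + ?N"
          using sum_tree_weights[OF xs, of \<theta> \<alpha>] by (simp only: weight lessThan_Suc_atMost)
        have "cond_prob M (\<lambda>\<omega>. T \<omega> (Suc ?N) = v) (\<lambda>\<omega>. \<forall>m\<in>{1..<Suc ?N}. T \<omega> m = p m) =
            attachment_weight \<alpha> \<theta> p (Suc ?N) v / (\<Sum>k<Suc ?N. attachment_weight \<alpha> \<theta> p (Suc ?N) k)"
          using T 3 pos unfolding recursive_tree_def E_eq by (auto simp: Suc_le_eq)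
        also have "\<dots> = attachment_weight \<alpha> \<theta> p (Suc ?N) v / (\<theta> + ?N)" by (simp only: total)
        also have "\<dots> = tree_step \<alpha> \<theta> xs v" using 3 by (simp add: weight tree_step_def)
        finally have "cond_prob M (\<lambda>\<omega>. T \<omega> (Suc ?N) = v) (\<lambda>\<omega>. \<forall>m\<in>{1..<Suc ?N}. T \<omega> m = p m) = tree_step \<alpha> \<theta> xs v" .
        moreover have "prob {\<omega> \<in> space M. X \<omega> ?N = v \<and> \<omega> \<in> E} / prob E = tree_step \<alpha> \<theta> xs v"
          if "cond_prob M (\<lambda>\<omega>. T \<omega> (Suc ?N) = v) (\<lambda>\<omega>. \<forall>m\<in>{1..<Suc ?N}. T \<omega> m = p m) = tree_step \<alpha> \<theta> xs v"
        proof -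
          have "{\<omega> \<in> space M. X \<omega> ?N = v \<and> \<omega> \<in> E} =
              {\<omega> \<in> space M. T \<omega> (Suc ?N) = v \<and> (\<forall>m\<in>{1..<Suc ?N}. T \<omega> m = p m)}"
            by (auto simp: X_def E_eq)
          then show ?thesis using that by (simp add: cond_prob_def E_eq)
        qed
        ultimately have "prob {\<omega> \<in> space M. X \<omega> ?N = v \<and> \<omega> \<in> E} = prob E * tree_step \<alpha> \<theta> xs v"
          using False by (simp add: field_simps)
        then show ?thesis unfolding goal using IH by simp
      qed
    qed
  qed
  show "(\<lambda>\<omega> n. T \<omega> (Suc n)) \<in> M \<rightarrow>\<^sub>M seqs" using X by (simp add: X_def[abs_def])
  have "distr M seqs X = tree_law \<alpha> \<theta>"
  proof (rule seqs_measure_eqI)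
    show "prob_space (distr M seqs X)" by (rule prob_space_distr[OF X])
    show "prob_space (tree_law \<alpha> \<theta>)" by (rule prob_space_tree_law[OF \<alpha> \<theta>])
    fix xs
    have "X -` cylinder xs \<inter> space M = {\<omega> \<in> space M. initial (length xs) (X \<omega>) = xs}"
      by (auto simp: cylinder_def)
    then show "measure (distr M seqs X) (cylinder xs) = measure (tree_law \<alpha> \<theta>) (cylinder xs)"
      using prob_X[of xs] by (simp add: measure_distr measure_tree_law_cylinder[OF \<alpha> \<theta>])
  qed (auto simp: sets_tree_law[OF \<alpha> \<theta>])
  then show "distr M seqs (\<lambda>\<omega> n. T \<omega> (Suc n)) = tree_law \<alpha> \<theta>" by (simp add: X_def[abs_def])
qed

section \<open>Stick breaking\<close>

definition sticks :: "real \<Rightarrow> real \<Rightarrow> (nat \<Rightarrow> real) measure" where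
  "sticks \<alpha> \<theta> = Pi\<^sub>M UNIV (\<lambda>n. beta_distribution (1 - \<alpha>) (\<theta> + real (Suc n) * \<alpha>))"

lemma GEM_sticks: "GEM \<alpha> \<theta> = distr (sticks \<alpha> \<theta>) seq_space stick_breaking"
  by (simp add: GEM_def sticks_def)

lemma sets_sticks [simp, measurable_cong]: "sets (sticks \<alpha> \<theta>) = sets seq_space"
  unfolding sticks_def by (intro sets_PiM_cong) auto

lemma measurable_stick_breaking [measurable]: "stick_breaking \<in> seq_space \<rightarrow>\<^sub>M seq_space"
proof (rule measurable_PiM_single')
  show "(\<lambda>b. stick_breaking b n) \<in> borel_measurable seq_space" for n
    unfolding stick_breaking_def by measurable
qed (auto simp: space_PiM)

lemma sets_GEM [simp, measurable_cong]: "sets (GEM \<alpha> \<theta>) = sets seq_space"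
  by (simp add: GEM_def)

lemma sets_PD [simp, measurable_cong]: "sets (PD \<alpha> \<theta>) = sets seq_space"
  by (simp add: PD_def)

lemma space_seq_space [simp]: "space seq_space = UNIV"
  by (simp add: space_PiM)

lemma space_GEM [simp]: "space (GEM \<alpha> \<theta>) = UNIV" and space_PD [simp]: "space (PD \<alpha> \<theta>) = UNIV"
  by (simp_all add: GEM_def PD_def)

lemma measurable_ranked [measurable]: "ranked \<in> seq_space \<rightarrow>\<^sub>M seq_space"
  by (rule measurable_decreasing_rearrangement[where A = "\<lambda>_. UNIV" and f = "\<lambda>x. x"]) measurable

lemma sum_stick_breaking: "(\<Sum>m<n. stick_breaking b m) = 1 - (\<Prod>m<n. 1 - b m)"
  by (induction n) (simp_all add: stick_breaking_def algebra_simps)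

lemma pmf_of_seq:
  assumes "x \<in> prob_sequences"
  shows "pmf (embed_pmf x) n = x n"
proof (rule pmf_embed_pmf)
  show "0 \<le> x n" for n using assms by (simp add: prob_sequences_def)
  have "(\<integral>\<^sup>+n. ennreal (x n) \<partial>count_space UNIV) = (\<Sum>n. ennreal (x n))"
    by (rule nn_integral_count_space_nat)
  also have "\<dots> = 1"
    using assms by (subst suminf_ennreal2) (auto simp: prob_sequences_def sums_summable sums_unique[symmetric])
  finally show "(\<integral>\<^sup>+n. ennreal (x n) \<partial>count_space UNIV) = 1" .
qed

text \<open>As \<^const>\<open>index_pmf\<close>, but for probabilities in any order.\<close>
definition label_pmf :: "(nat \<Rightarrow> real) \<Rightarrow> nat pmf" where
  "label_pmf x = (if x \<in> prob_sequences then embed_pmf x else return_pmf 0)"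

lemma pmf_label_pmf: "x \<in> prob_sequences \<Longrightarrow> pmf (label_pmf x) n = x n"
  by (simp add: label_pmf_def pmf_of_seq)

lemma index_pmf_eq_label_pmf: "x \<in> ranked_simplex \<Longrightarrow> index_pmf x = label_pmf x"
  by (simp add: index_pmf_def label_pmf_def ranked_simplex_eq)

lemma measurable_label_pmf: "(\<lambda>x. pmf (label_pmf x) n) \<in> borel_measurable seq_space"
proof -
  have "pmf (label_pmf x) n = (if x \<in> prob_sequences then x n else pmf (return_pmf 0) n)" for x
    by (simp add: label_pmf_def pmf_of_seq)
  moreover have "(\<lambda>x. if x \<in> prob_sequences then x n else pmf (return_pmf 0) n) \<in> borel_measurable seq_space"
    by measurable
  ultimately show ?thesis by simp
qed

lemma measurable_index_pmf: "(\<lambda>x. pmf (index_pmf x) n) \<in> borel_measurable seq_space"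
proof -
  have "pmf (index_pmf x) n = (if x \<in> ranked_simplex then x n else pmf (return_pmf 0) n)" for x
    by (auto simp: index_pmf_def ranked_simplex_eq pmf_of_seq)
  moreover have "(\<lambda>x. if x \<in> ranked_simplex then x n else pmf (return_pmf 0) n) \<in> borel_measurable seq_space"
    by measurable
  ultimately show ?thesis by simp
qed

lemma label_kernel: "(\<lambda>x. iid (label_pmf x)) \<in> seq_space \<rightarrow>\<^sub>M prob_algebra seqs"
  and index_kernel: "(\<lambda>x. iid (index_pmf x)) \<in> seq_space \<rightarrow>\<^sub>M prob_algebra seqs"
  by (intro iid_kernel measurable_label_pmf measurable_index_pmf)+

context
  fixes \<alpha> \<theta> :: real
  assumes \<alpha>: "0 \<le> \<alpha>" "\<alpha> < 1" and \<theta>: "\<theta> > - \<alpha>"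
begin

lemma stick_parameters: "0 < 1 - \<alpha>" "0 < \<theta> + real (Suc n) * \<alpha>"
proof -
  have "\<alpha> \<le> real (Suc n) * \<alpha>" using \<alpha> by (simp add: algebra_simps)
  then show "0 < 1 - \<alpha>" "0 < \<theta> + real (Suc n) * \<alpha>" using \<alpha> \<theta> by linarith+
qed

lemma prob_space_stick: "prob_space (beta_distribution (1 - \<alpha>) (\<theta> + real (Suc n) * \<alpha>))"
  by (rule prob_space_beta_distribution[OF stick_parameters])

lemma prob_space_sticks: "prob_space (sticks \<alpha> \<theta>)"
  unfolding sticks_def by (rule prob_space_PiM) (rule prob_space_stick)

lemma prob_space_GEM: "prob_space (GEM \<alpha> \<theta>)"
  unfolding GEM_sticks by (rule prob_space.prob_space_distr[OF prob_space_sticks]) measurable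

lemma prob_space_PD: "prob_space (PD \<alpha> \<theta>)"
  unfolding PD_def by (rule prob_space.prob_space_distr[OF prob_space_GEM]) measurable

lemma AE_sticks: "AE b in sticks \<alpha> \<theta>. \<forall>n. 0 < b n \<and> b n < 1"
  unfolding sticks_def AE_all_countable
proof
  fix n
  show "AE b in Pi\<^sub>M UNIV (\<lambda>n. beta_distribution (1 - \<alpha>) (\<theta> + real (Suc n) * \<alpha>)). 0 < b n \<and> b n < 1"
    by (rule AE_PiM_component[where P = "\<lambda>x. 0 < x \<and> x < 1"]) (use prob_space_stick AE_beta_distribution in auto)
qed

lemma nn_integral_sticks_moments:
  "(\<integral>\<^sup>+b. ennreal (\<Prod>i<n. b i ^ u i * (1 - b i) ^ s i) \<partial>sticks \<alpha> \<theta>) =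
    ennreal (\<Prod>i<n. beta_moment (1 - \<alpha>) (\<theta> + real (Suc i) * \<alpha>) (u i) (s i))"
proof -
  let ?B = "\<lambda>i. beta_distribution (1 - \<alpha>) (\<theta> + real (Suc i) * \<alpha>)"
  interpret product_prob_space ?B UNIV
    by (intro product_prob_spaceI prob_space_stick)
  let ?f = "\<lambda>i x. ennreal (x ^ u i * (1 - x) ^ s i)"
  have "(\<integral>\<^sup>+b. ennreal (\<Prod>i<n. b i ^ u i * (1 - b i) ^ s i) \<partial>sticks \<alpha> \<theta>) =
      (\<integral>\<^sup>+b. (\<Prod>i<n. ?f i (b i)) \<partial>sticks \<alpha> \<theta>)"
  proof (rule nn_integral_cong_AE)
    show "AE b in sticks \<alpha> \<theta>. ennreal (\<Prod>i<n. b i ^ u i * (1 - b i) ^ s i) = (\<Prod>i<n. ?f i (b i))"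
      using AE_sticks by (rule eventually_mono) (auto intro!: prod_ennreal[symmetric] mult_nonneg_nonneg less_imp_le)
  qed
  also have "\<dots> = (\<integral>\<^sup>+b. (\<Prod>i\<in>{..<n}. ?f i (b i)) \<partial>distr (Pi\<^sub>M UNIV ?B) (Pi\<^sub>M {..<n} ?B) (\<lambda>x. restrict x {..<n}))"
    unfolding sticks_def by (subst nn_integral_distr) (auto intro!: nn_integral_cong)
  also have "\<dots> = (\<integral>\<^sup>+b. (\<Prod>i\<in>{..<n}. ?f i (b i)) \<partial>Pi\<^sub>M {..<n} ?B)"
    by (subst distr_PiM_restrict_finite) auto
  also have "\<dots> = (\<Prod>i\<in>{..<n}. \<integral>\<^sup>+x. ?f i x \<partial>?B i)"
    by (rule product_nn_integral_prod) auto
  also have "\<dots> = (\<Prod>i<n. ennreal (beta_moment (1 - \<alpha>) (\<theta> + real (Suc i) * \<alpha>) (u i) (s i)))"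
    by (intro prod.cong refl nn_integral_beta_moment stick_parameters)
  also have "\<dots> = ennreal (\<Prod>i<n. beta_moment (1 - \<alpha>) (\<theta> + real (Suc i) * \<alpha>) (u i) (s i))"
    by (intro prod_ennreal beta_moment_nonneg stick_parameters)
  finally show ?thesis .
qed

text \<open>The mass left after \<open>n\<close> breaks has mean \<open>\<Prod> (1 - (1 - \<alpha>) / (1 + \<theta> + m \<alpha>))\<close>, which tends to zero
  because the harmonic series diverges.\<close>
lemma remaining_mass_tendsto_0:
  "(\<lambda>n. \<Prod>m<n. (\<theta> + real (Suc m) * \<alpha>) / (1 + \<theta> + real m * \<alpha>)) \<longlonglongrightarrow> 0"
proof -
  \<comment> \<open>Chosen such that the \<open>m\<close>-th factor is at most \<open>1 - c / (m + 1)\<close>.\<close>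
  define c where "c = (1 - \<alpha>) / (1 + \<theta> + \<alpha>)"
  have c: "0 < c" using \<alpha> \<theta> by (simp add: c_def)
  have le: "(\<theta> + real (Suc m) * \<alpha>) / (1 + \<theta> + real m * \<alpha>) \<le> exp (- (c / real (Suc m)))" for m
  proof -
    have D: "0 < 1 + \<theta> + real m * \<alpha>" using stick_parameters(2)[of m] \<alpha> by (simp add: algebra_simps)
    have "1 + \<theta> + real m * \<alpha> \<le> (1 + \<theta> + \<alpha>) * real (Suc m)"
    proof -
      have "0 \<le> 1 + \<theta>" using \<alpha> \<theta> by simp
      then have "0 \<le> (1 + \<theta>) * real m" by simp
      then show ?thesis using \<alpha> by (simp add: algebra_simps)
    qed
    moreover have "0 < 1 + \<theta> + \<alpha>" using \<alpha> \<theta> by simp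
    ultimately have "(1 - \<alpha>) / ((1 + \<theta> + \<alpha>) * real (Suc m)) \<le> (1 - \<alpha>) / (1 + \<theta> + real m * \<alpha>)"
      using D \<alpha> by (intro divide_left_mono mult_pos_pos) auto
    then have "c / real (Suc m) \<le> (1 - \<alpha>) / (1 + \<theta> + real m * \<alpha>)" by (simp add: c_def)
    moreover have "(\<theta> + real (Suc m) * \<alpha>) / (1 + \<theta> + real m * \<alpha>) = 1 - (1 - \<alpha>) / (1 + \<theta> + real m * \<alpha>)"
      using D by (simp add: field_simps)
    ultimately show ?thesis using exp_ge_add_one_self[of "- (c / real (Suc m))"] by linarith
  qed
  have nonneg: "0 \<le> (\<theta> + real (Suc m) * \<alpha>) / (1 + \<theta> + real m * \<alpha>)" for m
    using stick_parameters(2)[of m] \<alpha> by (intro divide_nonneg_nonneg) (auto simp: algebra_simps)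
  have upper: "(\<Prod>m<n. (\<theta> + real (Suc m) * \<alpha>) / (1 + \<theta> + real m * \<alpha>)) \<le> exp (- c * harm n)" for n
  proof -
    have "(\<Prod>m<n. (\<theta> + real (Suc m) * \<alpha>) / (1 + \<theta> + real m * \<alpha>)) \<le> (\<Prod>m<n. exp (- (c / real (Suc m))))"
      by (intro prod_mono conjI nonneg le)
    also have "\<dots> = exp (\<Sum>m<n. - (c / real (Suc m)))" by (simp add: exp_sum)
    also have "(\<Sum>m<n. - (c / real (Suc m))) = - c * harm n"
    proof (induction n)
      case (Suc n)
      then show ?case by (simp add: harm_Suc field_simps)
    qed (simp add: harm_def)
    finally show ?thesis .
  qed
  have lim: "(\<lambda>n. exp (- c * harm n)) \<longlonglongrightarrow> 0"
  proof -
    have "filterlim (\<lambda>n. c * harm n) at_top sequentially"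
      by (rule filterlim_tendsto_pos_mult_at_top[OF tendsto_const c harm_at_top])
    then have "filterlim (\<lambda>n. - (c * harm n)) at_bot sequentially"
      by (subst (asm) filterlim_uminus_at_top)
    from filterlim_compose[OF exp_at_bot this] show ?thesis by simp
  qed
  have lower: "0 \<le> (\<Prod>m<n. (\<theta> + real (Suc m) * \<alpha>) / (1 + \<theta> + real m * \<alpha>))" for n
    by (rule prod_nonneg) (rule nonneg)
  show ?thesis
    by (rule tendsto_sandwich[OF always_eventually[OF allI[OF lower]] always_eventually[OF allI[OF upper]] tendsto_const lim])
qed

text \<open>The mass left decreases, and its mean tends to zero.\<close>
lemma AE_sticks_remaining_mass: "AE b in sticks \<alpha> \<theta>. (\<lambda>n. \<Prod>m<n. 1 - b m) \<longlonglongrightarrow> 0"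
proof -
  let ?R = "\<lambda>b n. ennreal (\<Prod>m<n. 1 - b m)"
  let ?m = "\<lambda>n. \<Prod>m<n. (\<theta> + real (Suc m) * \<alpha>) / (1 + \<theta> + real m * \<alpha>)"
  have moment: "beta_moment (1 - \<alpha>) (\<theta> + real (Suc m) * \<alpha>) 0 1 = (\<theta> + real (Suc m) * \<alpha>) / (1 + \<theta> + real m * \<alpha>)" for m
    using beta_moment_Suc_right[OF stick_parameters(1) stick_parameters(2)[of m], of 0 0]
      beta_moment_00[OF stick_parameters(1) stick_parameters(2)[of m]] by (simp add: algebra_simps)
  have mean: "(\<integral>\<^sup>+b. ?R b n \<partial>sticks \<alpha> \<theta>) = ennreal (?m n)" for n
    using nn_integral_sticks_moments[where n = n and u = "\<lambda>_. 0" and s = "\<lambda>_. 1"] by (simp only: moment power_0 power_one_right mult_1)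
  have meas: "(\<lambda>b. ?R b n) \<in> borel_measurable (sticks \<alpha> \<theta>)" for n
    by measurable
  have le: "(\<integral>\<^sup>+b. (INF n. ?R b n) \<partial>sticks \<alpha> \<theta>) \<le> ennreal (?m n)" for n
    unfolding mean[symmetric] by (rule nn_integral_mono) (rule INF_lower, simp)
  have "(\<lambda>n. ennreal (?m n)) \<longlonglongrightarrow> ennreal 0"
    by (rule tendsto_ennrealI[OF remaining_mass_tendsto_0])
  then have "(\<integral>\<^sup>+b. (INF n. ?R b n) \<partial>sticks \<alpha> \<theta>) \<le> ennreal 0"
    by (rule LIMSEQ_le_const) (use le in blast)
  then have "AE b in sticks \<alpha> \<theta>. (INF n. ?R b n) = 0"
    by (simp add: nn_integral_0_iff_AE borel_measurable_INF meas)
  with AE_sticks show ?thesis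
  proof eventually_elim
    fix b :: "nat \<Rightarrow> real" assume b: "\<forall>n. 0 < b n \<and> b n < 1" and inf: "(INF n. ?R b n) = 0"
    have nonneg: "0 \<le> (\<Prod>m<n. 1 - b m)" for n using b by (intro prod_nonneg) (auto simp: less_imp_le)
    have "decseq (?R b)"
      by (rule decseq_SucI, rule ennreal_leI) (use nonneg b in \<open>auto intro!: mult_left_le simp: less_imp_le\<close>)
    from LIMSEQ_INF[OF this] have "?R b \<longlonglongrightarrow> ennreal 0" by (simp add: inf)
    then show "(\<lambda>n. \<Prod>m<n. 1 - b m) \<longlonglongrightarrow> 0"
      by (subst (asm) tendsto_ennreal_iff) (auto intro: always_eventually nonneg)
  qed
qed

lemma AE_sticks_prob_sequence:
  "AE b in sticks \<alpha> \<theta>. (\<forall>n. 0 < b n \<and> b n < 1) \<and> stick_breaking b \<in> prob_sequences \<and> (\<forall>n. 0 < stick_breaking b n)"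
  using AE_sticks AE_sticks_remaining_mass
proof eventually_elim
  fix b :: "nat \<Rightarrow> real" assume b: "\<forall>n. 0 < b n \<and> b n < 1" and lim: "(\<lambda>n. \<Prod>m<n. 1 - b m) \<longlonglongrightarrow> 0"
  have pos: "0 < stick_breaking b n" for n
    unfolding stick_breaking_def using b by (intro mult_pos_pos prod_pos) auto
  have "(\<lambda>n. 1 - (\<Prod>m<n. 1 - b m)) \<longlonglongrightarrow> 1 - 0" by (intro tendsto_diff tendsto_const lim)
  then have "stick_breaking b sums 1" by (simp add: sums_def sum_stick_breaking)
  then show "(\<forall>n. 0 < b n \<and> b n < 1) \<and> stick_breaking b \<in> prob_sequences \<and> (\<forall>n. 0 < stick_breaking b n)"
    using b pos by (auto simp: prob_sequences_def less_imp_le)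
qed

lemma AE_GEM: "AE x in GEM \<alpha> \<theta>. x \<in> prob_sequences \<and> (\<forall>n. 0 < x n)"
  unfolding GEM_sticks
proof (subst AE_distr_iff)
  show "AE b in sticks \<alpha> \<theta>. stick_breaking b \<in> prob_sequences \<and> (\<forall>n. 0 < stick_breaking b n)"
    using AE_sticks_prob_sequence by (rule eventually_mono) auto
qed measurable

end

section \<open>The Chinese restaurant process\<close>

text \<open>The seating rule of the Chinese restaurant.  The type of the labels is arbitrary because only
  equality of labels matters.\<close>
definition seat_weight :: "real \<Rightarrow> real \<Rightarrow> 'a list \<Rightarrow> 'a \<Rightarrow> real" where
  "seat_weight \<alpha> \<theta> xs v =
     (if xs = [] then 1
      else (if v \<in> set xs then real (count_list xs v) - \<alpha> else \<theta> + \<alpha> * real (card (set xs))) /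
        (\<theta> + real (length xs)))"

definition growth_list :: "nat list \<Rightarrow> bool" where
  "growth_list xs \<longleftrightarrow> (\<forall>m<length xs. xs ! m \<le> card (set (take m xs)))"

lemma growth_list_Nil [simp]: "growth_list []"
  by (simp add: growth_list_def)

lemma growth_list_snoc [simp]: "growth_list (xs @ [v]) \<longleftrightarrow> growth_list xs \<and> v \<le> card (set xs)"
  by (auto simp: growth_list_def nth_append less_Suc_eq)

lemma growth_list_set: "growth_list xs \<Longrightarrow> set xs = {..<card (set xs)}"
proof (induction xs rule: rev_induct)
  case (snoc v xs)
  then have IH: "set xs = {..<card (set xs)}" and v: "v \<le> card (set xs)" by auto
  show ?case
  proof (cases "v \<in> set xs")
    case True
    then show ?thesis using IH by (simp add: insert_absorb)
  next
    case False
    then have "v = card (set xs)" using IH v by (metis lessThan_iff le_neq_implies_less)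
    then show ?thesis using IH False by (simp add: lessThan_Suc)
  qed
qed simp

lemma growth_list_initial: "restricted_growth L \<Longrightarrow> growth_list (initial n L)"
  by (simp add: growth_list_def restricted_growth_def take_initial set_initial)

text \<open>Customer \<open>n\<close> brings an independent label \<open>X n\<close> and opens a new table whenever the label
  does not denote a table that is already occupied.\<close>
primrec occupied :: "(nat \<Rightarrow> nat) \<Rightarrow> nat \<Rightarrow> nat" where
  "occupied X 0 = 0"
| "occupied X (Suc n) = (if X n < occupied X n then occupied X n else Suc (occupied X n))"

definition seat :: "(nat \<Rightarrow> nat) \<Rightarrow> nat \<Rightarrow> nat" where
  "seat X n = min (X n) (occupied X n)"

lemma seat_image: "seat X ` {..<n} = {..<occupied X n}"
proof (induction n)
  case (Suc n)
  then show ?case by (auto simp: lessThan_Suc seat_def min_def)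
qed simp

lemma restricted_growth_seat: "restricted_growth (seat X)"
  by (simp add: restricted_growth_def seat_image) (simp add: seat_def)

lemma measurable_seat [measurable]: "seat \<in> seqs \<rightarrow>\<^sub>M seqs"
proof (rule measurable_seqs_coordinatewise)
  fix n
  have occ: "occupied X m = occupied Y m" if "\<And>k. k < m \<Longrightarrow> X k = Y k" for X Y m
    using that by (induction m) auto
  show "(\<lambda>X. seat X n) \<in> seqs \<rightarrow>\<^sub>M count_space UNIV"
    by (rule measurable_determined_by_initial[where n = "Suc n"]) (auto simp: seat_def intro!: arg_cong2[where f = min] occ)
qed

lemma initial_seat_iff:
  assumes "growth_list xs"
  shows "initial (length xs) (seat X) = xs \<longleftrightarrow>
    (\<forall>m<length xs. X m \<in> (let k = card (set (take m xs)) in if xs ! m < k then {xs ! m} else {k..}))"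
  using assms
proof (induction xs rule: rev_induct)
  case (snoc v xs)
  let ?k = "card (set xs)"
  have v: "v \<le> ?k" and IH: "initial (length xs) (seat X) = xs \<longleftrightarrow>
    (\<forall>m<length xs. X m \<in> (let k = card (set (take m xs)) in if xs ! m < k then {xs ! m} else {k..}))"
    using snoc by auto
  have "initial (length (xs @ [v])) (seat X) = xs @ [v] \<longleftrightarrow>
      initial (length xs) (seat X) = xs \<and> seat X (length xs) = v" by auto
  also have "\<dots> \<longleftrightarrow> initial (length xs) (seat X) = xs \<and> X (length xs) \<in> (if v < ?k then {v} else {?k..})"
  proof (intro conj_cong refl)
    assume "initial (length xs) (seat X) = xs"
    then have "occupied X (length xs) = ?k"
      using set_initial[of "length xs" "seat X"] by (simp add: seat_image)
    then show "seat X (length xs) = v \<longleftrightarrow> X (length xs) \<in> (if v < ?k then {v} else {?k..})"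
      using v by (auto simp: seat_def min_def)
  qed
  also have "\<dots> \<longleftrightarrow> (\<forall>m<length (xs @ [v]). X m \<in>
      (let k = card (set (take m (xs @ [v]))) in if (xs @ [v]) ! m < k then {(xs @ [v]) ! m} else {k..}))"
  proof -
    let ?P = "\<lambda>xs m. X m \<in> (let k = card (set (take m xs)) in if xs ! m < k then {xs ! m} else {k..})"
    have "?P (xs @ [v]) m \<longleftrightarrow> ?P xs m" if "m < length xs" for m
      using that by (simp add: nth_append Let_def)
    then have "(\<forall>m<length (xs @ [v]). ?P (xs @ [v]) m) \<longleftrightarrow> (\<forall>m<length xs. ?P xs m) \<and> ?P (xs @ [v]) (length xs)"
      unfolding length_append_singleton All_less_Suc by blast
    then show ?thesis unfolding IH by (simp add: Let_def)
  qed
  finally show ?case .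
qed simp

text \<open>The label \<open>v\<close> has probability \<open>b v\<close> times the product of \<open>1 - b i\<close> over \<open>i < v\<close>.  The customer who
  opens table \<open>v\<close> may bring any label from \<open>v\<close> on, which has the probability of this product alone;
  hence the exponent of \<open>b v\<close> is one less than the size of the table.\<close>
definition stick_exponents :: "nat list \<Rightarrow> nat \<Rightarrow> nat \<times> nat" where
  "stick_exponents xs i = (count_list xs i - 1, length (filter (\<lambda>v. i < v) xs))"

lemma prod_less_restrict:
  fixes g :: "nat \<Rightarrow> 'a::comm_monoid_mult"
  assumes "v \<le> n"
  shows "(\<Prod>i<n. if i < v then g i else 1) = (\<Prod>i<v. g i)"
  by (subst prod.mono_neutral_right[of "{..<n}" "{..<v}"]) (use assms in auto)

lemma seating_probability_sticks:
  assumes xs: "growth_list xs" and b: "\<forall>n. 0 < b n \<and> b n < 1" and x: "stick_breaking b \<in> prob_sequences"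
    and N: "length xs \<le> N"
  shows "measure (iid (label_pmf (stick_breaking b))) {X. initial (length xs) (seat X) = xs} =
    (\<Prod>i<N. b i ^ fst (stick_exponents xs i) * (1 - b i) ^ snd (stick_exponents xs i))"
proof -
  let ?p = "label_pmf (stick_breaking b)"
  have tail: "measure (measure_pmf ?p) {k..} = (\<Prod>i<k. 1 - b i)" for k
  proof -
    have "measure (measure_pmf ?p) {..<k} = (\<Sum>i<k. stick_breaking b i)"
      by (simp add: measure_measure_pmf_finite pmf_label_pmf[OF x])
    moreover have "measure (measure_pmf ?p) {k..} = 1 - measure (measure_pmf ?p) {..<k}"
      using measure_pmf.prob_compl[of "{..<k}" ?p] by (simp add: Compl_lessThan[symmetric] Compl_eq_Diff_UNIV)
    ultimately show ?thesis by (simp add: sum_stick_breaking)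
  qed
  have "measure (iid ?p) {X. initial (length xs) (seat X) = xs} =
      (\<Prod>m<length xs. measure (measure_pmf ?p) (let k = card (set (take m xs)) in if xs ! m < k then {xs ! m} else {k..}))"
    unfolding initial_seat_iff[OF xs] by (rule measure_iid_box)
  also have "\<dots> = segment_prob (\<lambda>ys v. if v < card (set ys) then stick_breaking b v else \<Prod>i<card (set ys). 1 - b i) xs"
    unfolding segment_prob_def
    by (intro prod.cong) (auto simp: Let_def tail measure_pmf_single pmf_label_pmf[OF x])
  also have "\<dots> = (\<Prod>i<N. b i ^ fst (stick_exponents xs i) * (1 - b i) ^ snd (stick_exponents xs i))"
    using xs N
  proof (induction xs rule: rev_induct)
    case (snoc v xs)
    define k where "k = card (set xs)"
    have set_xs: "set xs = {..<k}" and v: "v \<le> k"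
      using snoc.prems growth_list_set[of xs] by (auto simp: k_def)
    have k_le: "k \<le> length xs" by (simp add: k_def card_length)
    let ?f = "\<lambda>xs i. b i ^ fst (stick_exponents xs i) * (1 - b i) ^ snd (stick_exponents xs i)"
    have step: "?f (xs @ [v]) i = ?f xs i * ((if i = v then (if v < k then b i else 1) else 1) * (if i < v then 1 - b i else 1))" for i
    proof -
      have "count_list xs v = 0 \<longleftrightarrow> \<not> v < k" using set_xs by (simp add: count_list_0_iff)
      then show ?thesis by (cases "count_list xs v") (auto simp: stick_exponents_def)
    qed
    have main: "(\<Prod>i<N. ?f (xs @ [v]) i) = (\<Prod>i<N. ?f xs i) * ((\<Prod>i<N. if i = v then (if v < k then b i else 1) else 1) * (\<Prod>i<N. if i < v then 1 - b i else 1))"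
      unfolding step prod.distrib by simp
    have stick_v: "(\<Prod>i<N. if i = v then (if v < k then b i else 1) else 1) = (if v < k then b v else 1)"
      using v k_le snoc.prems by (subst prod.delta) auto
    have before_v: "(\<Prod>i<N. if i < v then 1 - b i else 1) = (\<Prod>i<v. 1 - b i)"
      by (rule prod_less_restrict) (use v k_le snoc.prems in auto)
    have "segment_prob (\<lambda>ys v. if v < card (set ys) then stick_breaking b v else \<Prod>i<card (set ys). 1 - b i) xs =
        (\<Prod>i<N. ?f xs i)" using snoc by simp
    then show ?case
      unfolding main stick_v before_v using v by (auto simp: stick_breaking_def k_def[symmetric])
  qed (simp add: stick_exponents_def)
  finally show ?thesis .
qed

lemma prod_telescope_quotient:
  fixes D :: "nat \<Rightarrow> real"
  assumes "\<And>i. i < v \<Longrightarrow> D i \<noteq> 0"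
  shows "(\<Prod>i<v. D (Suc i) / D i) = (if v = 0 then 1 else D v / D 0)"
  using assms by (induction v) (auto split: if_splits)

text \<open>Here \<open>D i\<close> stands for the total weight of the tables from \<open>i\<close> on and of a new table.\<close>
lemma seat_weight_eq_quotient:
  assumes set_xs: "set xs = {..<k}" and v: "v \<le> k"
    and D: "\<And>i. i < k \<Longrightarrow> 0 < D i" "D 0 = \<theta> + real (length xs)" "D k = \<theta> + \<alpha> * real k"
  shows "(if v < k then (real (count_list xs v) - \<alpha>) / D v else 1) * (if v = 0 then 1 else D v / D 0) =
    seat_weight \<alpha> \<theta> xs v"
proof (cases "v < k")
  case True
  then have "v \<in> set xs" by (simp add: set_xs)
  moreover from this have "xs \<noteq> []" by auto
  moreover have "0 < D v" using D(1) True by simp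
  ultimately show ?thesis using True D(2) by (cases "v = 0") (simp_all add: seat_weight_def)
next
  case False
  then have vk: "v = k" using v by simp
  show ?thesis
  proof (cases "k = 0")
    case True
    then have "xs = []" using set_xs by simp
    then show ?thesis using vk True by (simp add: seat_weight_def)
  next
    case False
    then have "0 \<in> set xs" by (simp add: set_xs)
    then have ne: "xs \<noteq> []" by auto
    have notin: "k \<notin> set xs" and card: "card (set xs) = k" by (simp_all add: set_xs)
    have "seat_weight \<alpha> \<theta> xs k = D k / D 0"
      unfolding seat_weight_def D(2,3) card using ne notin by simp
    then show ?thesis unfolding vk using False by simp
  qed
qed

text \<open>Integrating out the sticks gives the seating rule of the Chinese restaurant.  When a customer
  chooses table \<open>v\<close>, the factors contributed by the sticks before \<open>v\<close> telescope.\<close>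
lemma seating_probability:
  assumes \<alpha>: "0 \<le> \<alpha>" "\<alpha> < 1" and \<theta>: "\<theta> > - \<alpha>" and "growth_list xs" "length xs \<le> N"
  shows "(\<Prod>i<N. beta_moment (1 - \<alpha>) (\<theta> + real (Suc i) * \<alpha>) (fst (stick_exponents xs i)) (snd (stick_exponents xs i))) =
    segment_prob (seat_weight \<alpha> \<theta>) xs"
  using assms(4,5)
proof (induction xs rule: rev_induct)
  case Nil
  then show ?case
    by (simp add: stick_exponents_def beta_moment_00[OF stick_parameters[OF \<alpha> \<theta>]] del: of_nat_Suc)
next
  case (snoc v xs)
  define k where "k = card (set xs)"
  have set_xs: "set xs = {..<k}" and v: "v \<le> k"
    using snoc.prems growth_list_set[of xs] by (auto simp: k_def)
  have k_le: "k \<le> length xs" by (simp add: k_def card_length)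
  \<comment> \<open>The number of customers at the tables from \<open>i\<close> on; \<open>D i\<close> is the weight of these tables and a new one.\<close>
  define t where "t i = length (filter (\<lambda>w. i \<le> w) xs)" for i
  define D where "D i = \<theta> + real i * \<alpha> + real (t i)" for i
  have t_Suc: "length (filter (\<lambda>w. i < w) xs) = t (Suc i)" for i by (simp add: t_def Suc_le_eq)
  have t_split: "count_list xs i + t (Suc i) = t i" for i
    unfolding t_def by (induction xs) auto
  have count_pos: "1 \<le> count_list xs i" if "i < k" for i
    using that set_xs count_list_0_iff[of xs i] by (simp add: Suc_le_eq)
  have D_pos: "0 < D i" if "i < k" for i
  proof -
    have "1 \<le> real (t i)" using count_pos[OF that] t_split[of i] by linarith
    moreover have "0 \<le> real i * \<alpha>" using \<alpha> by simp
    ultimately show ?thesis unfolding D_def using \<alpha> \<theta> by linarith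
  qed
  let ?m = "\<lambda>xs i. beta_moment (1 - \<alpha>) (\<theta> + real (Suc i) * \<alpha>) (fst (stick_exponents xs i)) (snd (stick_exponents xs i))"
  have step: "?m (xs @ [v]) i = ?m xs i *
      ((if i = v then (if v < k then (count_list xs v - \<alpha>) / D v else 1) else 1) * (if i < v then D (Suc i) / D i else 1))" for i
  proof -
    note par = stick_parameters(1)[OF \<alpha> \<theta>] stick_parameters(2)[OF \<alpha> \<theta>, of i]
    have denom: "1 - \<alpha> + (\<theta> + real (Suc i) * \<alpha>) + real (count_list xs i - 1) + real (t (Suc i)) = D i" if ik: "i < k"
    proof -
      obtain c where c: "count_list xs i = Suc c" using count_pos[OF ik] by (cases "count_list xs i") auto
      then have "real (t i) = 1 + real c + real (t (Suc i))" using t_split[of i] by linarith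
      then show ?thesis unfolding D_def c by (simp add: algebra_simps)
    qed
    have "v < k \<or> v = k" using v by auto
    then consider "i < v" | "i = v" "v < k" | "i = v" "v = k" | "v < i"
      by (cases i v rule: linorder_cases) blast+
    then show ?thesis
    proof cases
      case 1
      then have ik: "i < k" using v by simp
      have "?m (xs @ [v]) i = beta_moment (1 - \<alpha>) (\<theta> + real (Suc i) * \<alpha>) (count_list xs i - 1) (Suc (t (Suc i)))"
        using 1 by (simp add: stick_exponents_def t_Suc)
      also have "\<dots> = ?m xs i * ((\<theta> + real (Suc i) * \<alpha> + real (t (Suc i))) / D i)"
        unfolding beta_moment_Suc_right[OF par] denom[OF ik] by (simp add: stick_exponents_def t_Suc)
      finally show ?thesis using 1 by (simp add: D_def)
    next
      case 2
      then obtain c where c: "count_list xs v = Suc c" using count_pos[of v] by (cases "count_list xs v") auto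
      have "?m (xs @ [v]) i = beta_moment (1 - \<alpha>) (\<theta> + real (Suc i) * \<alpha>) (Suc c) (t (Suc i))"
        using 2 c by (simp add: stick_exponents_def t_Suc)
      also have "\<dots> = ?m xs i * ((1 - \<alpha> + real c) / D i)"
        using denom 2 c unfolding beta_moment_Suc_left[OF par] by (simp add: stick_exponents_def t_Suc)
      finally show ?thesis using 2 c by (simp add: add_ac)
    next
      case 3
      then have "count_list xs v = 0" using set_xs by (simp add: count_list_0_iff)
      then show ?thesis using 3 by (simp add: stick_exponents_def)
    qed (simp add: stick_exponents_def)
  qed
  have main: "(\<Prod>i<N. ?m (xs @ [v]) i) = (\<Prod>i<N. ?m xs i) *
      ((\<Prod>i<N. if i = v then (if v < k then (count_list xs v - \<alpha>) / D v else 1) else 1) * (\<Prod>i<N. if i < v then D (Suc i) / D i else 1))"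
    unfolding step prod.distrib by simp
  have stick_v: "(\<Prod>i<N. if i = v then (if v < k then (count_list xs v - \<alpha>) / D v else 1) else 1) = (if v < k then (count_list xs v - \<alpha>) / D v else 1)"
    using v k_le snoc.prems by (subst prod.delta) auto
  have "(\<Prod>i<v. D (Suc i) / D i) = (if v = 0 then 1 else D v / D 0)"
    by (rule prod_telescope_quotient) (use D_pos v in \<open>simp add: less_imp_neq[symmetric]\<close>)
  then have before_v: "(\<Prod>i<N. if i < v then D (Suc i) / D i else 1) = (if v = 0 then 1 else D v / D 0)"
    using prod_less_restrict[of v N "\<lambda>i. D (Suc i) / D i"] v k_le snoc.prems by simp
  have t_k: "t k = 0" unfolding t_def using set_xs by (simp add: filter_empty_conv subset_eq flip: not_less)
  have weight: "(if v < k then (count_list xs v - \<alpha>) / D v else 1) * (if v = 0 then 1 else D v / D 0) = seat_weight \<alpha> \<theta> xs v"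
    by (rule seat_weight_eq_quotient[OF set_xs v])
       (use D_pos t_k in \<open>auto simp: D_def t_def mult.commute\<close>)
  have "(\<Prod>i<N. ?m xs i) = segment_prob (seat_weight \<alpha> \<theta>) xs" using snoc by simp
  then show ?case unfolding main stick_v before_v weight segment_prob_snoc by (rule arg_cong)
qed

subsection \<open>Law of large numbers\<close>

lemma has_frequency_eventually_cong:
  assumes "eventually (\<lambda>m. K m = k \<longleftrightarrow> K' m = k') sequentially"
  shows "has_frequency K k c \<longleftrightarrow> has_frequency K' k' c"
proof -
  obtain N where N: "\<And>m. N \<le> m \<Longrightarrow> K m = k \<longleftrightarrow> K' m = k'"
    using assms by (auto simp: eventually_sequentially)
  have "occurrences (\<lambda>n. K (n + N)) k = occurrences (\<lambda>n. K' (n + N)) k'"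
    by (rule ext, rule occurrences_cong) (use N in simp)
  then have "has_frequency (\<lambda>n. K (n + N)) k c \<longleftrightarrow> has_frequency (\<lambda>n. K' (n + N)) k' c"
    by (simp add: has_frequency_def)
  then show ?thesis by (simp add: has_frequency_shift)
qed

lemma distr_iid_coordinate: "distr (iid (p :: 'a::countable pmf)) (count_space UNIV) (\<lambda>x. x i) = measure_pmf p"
proof -
  have "distr (iid p) (measure_pmf p) (\<lambda>x. x i) = measure_pmf p"
    unfolding iid_def by (rule distr_PiM_component) (auto simp: prob_space_measure_pmf)
  moreover have "distr (iid p) (count_space UNIV) (\<lambda>x. x i) = distr (iid p) (measure_pmf p) (\<lambda>x. x i)"
    by (rule distr_cong) auto
  ultimately show ?thesis by simp
qed

lemma measurable_iid_coordinate: "(\<lambda>x. x i) \<in> iid (p :: 'a::countable pmf) \<rightarrow>\<^sub>M count_space UNIV"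
  using measurable_coordinate by (simp cong: measurable_cong_sets)

lemma indep_vars_iid:
  "prob_space.indep_vars (iid (p :: 'a::countable pmf)) (\<lambda>_. count_space UNIV) (\<lambda>i x. x i) {..<n}"
proof (cases "n = 0")
  case True
  then show ?thesis
    by (simp add: prob_space.indep_vars_def[OF prob_space_iid] prob_space.indep_sets_def[OF prob_space_iid])
next
  case False
  interpret prob_space "iid p" by (rule prob_space_iid)
  interpret P: product_prob_space "\<lambda>_::nat. measure_pmf p" UNIV by standard
  have "distr (iid p) (Pi\<^sub>M {..<n} (\<lambda>_. count_space UNIV)) (\<lambda>x. \<lambda>i\<in>{..<n}. x i) =
      distr (iid p) (Pi\<^sub>M {..<n} (\<lambda>_. measure_pmf p)) (\<lambda>x. restrict x {..<n})"
    by (rule distr_cong) (auto intro!: sets_PiM_cong)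
  also have "\<dots> = Pi\<^sub>M {..<n} (\<lambda>_. measure_pmf p)"
    unfolding iid_def by (rule P.distr_PiM_restrict_finite) auto
  also have "\<dots> = Pi\<^sub>M {..<n} (\<lambda>i. distr (iid p) (count_space UNIV) (\<lambda>x. x i))"
    by (simp add: distr_iid_coordinate)
  finally show ?thesis
    using False by (subst indep_vars_iff_distr_eq_PiM) (auto simp: measurable_iid_coordinate)
qed

lemma measurable_occurrences [measurable]:
  "(\<lambda>x. occurrences x k n) \<in> (seqs :: (nat \<Rightarrow> 'a::countable) measure) \<rightarrow>\<^sub>M count_space UNIV"
  by (rule measurable_determined_by_initial[where n = n]) (auto intro: occurrences_cong)

text \<open>Hoeffding's inequality for the indicators of the label \<open>k\<close>.\<close>
lemma iid_frequency_bound: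
  fixes p :: "'a::countable pmf"
  assumes "0 < \<epsilon>" "0 < n"
  shows "measure (iid p) {x. \<epsilon> \<le> \<bar>real (occurrences x k n) / real n - pmf p k\<bar>} \<le> 2 * exp (- 2 * real n * \<epsilon>\<^sup>2)"
proof -
  interpret prob_space "iid p" by (rule prob_space_iid)
  note [measurable] = measurable_iid_coordinate
  let ?f = "\<lambda>v. indicat_real {k} v"
  have indep: "indep_vars (\<lambda>_. borel) (\<lambda>i x. ?f (x i)) {..<n}"
    by (rule indep_vars_compose2[OF indep_vars_iid]) auto
  have coord: "distr (iid p) borel (\<lambda>x. ?f (x i)) = distr (measure_pmf p) borel ?f" for i
  proof -
    have "distr (distr (iid p) (count_space UNIV) (\<lambda>x. x i)) borel ?f = distr (iid p) borel (?f \<circ> (\<lambda>x. x i))"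
      by (rule distr_distr) auto
    then show ?thesis by (simp add: distr_iid_coordinate comp_def)
  qed
  have mean: "expectation (\<lambda>x. ?f (x 0)) = pmf p k"
  proof -
    have "expectation (\<lambda>x. ?f (x 0)) = integral\<^sup>L (distr (iid p) (count_space UNIV) (\<lambda>x. x 0)) ?f"
      by (rule integral_distr[symmetric]) auto
    then show ?thesis by (simp add: distr_iid_coordinate measure_pmf_single)
  qed
  interpret H: Hoeffding_ineq_iid "iid p" "{..<n}" "\<lambda>i x. ?f (x i)" "\<lambda>x. ?f (x 0)" 0 1 "expectation (\<lambda>x. ?f (x 0))"
  proof unfold_locales
    show "indep_vars (\<lambda>_. borel) (\<lambda>i x. ?f (x i)) {..<n}" by (rule indep)
    show "distr (iid p) borel (\<lambda>x. ?f (x i)) = distr (iid p) borel (\<lambda>x. ?f (x 0))" for i by (simp only: coord)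
    show "random_variable borel (\<lambda>x. ?f (x 0))" by measurable
    show "AE x in iid p. ?f (x 0) \<in> {0..1}" by (auto simp: indicator_def)
  qed simp_all
  have sum: "(\<Sum>i<n. ?f (x i)) = real (occurrences x k n)" for x
    by (induction n) auto
  have "{..<n} \<noteq> {}" using assms by auto
  from H.Hoeffding_ineq_abs_ge'[OF less_imp_le[OF assms(1)] _ this] show ?thesis
    using assms by (simp add: mean sum)
qed

text \<open>The exponential bounds are summable, so that the Borel--Cantelli lemma applies.\<close>
lemma AE_iid_frequency:
  fixes p :: "'a::countable pmf"
  shows "AE x in iid p. \<forall>k. has_frequency x k (pmf p k)"
  unfolding AE_all_countable
proof
  fix k
  interpret prob_space "iid p" by (rule prob_space_iid)
  let ?d = "\<lambda>x n. \<bar>real (occurrences x k n) / real n - pmf p k\<bar>"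
  have "AE x in iid p. eventually (\<lambda>n. ?d x n < 1 / real (Suc j)) sequentially" for j
  proof -
    define \<epsilon> where "\<epsilon> = 1 / real (Suc j)"
    have \<epsilon>: "0 < \<epsilon>" by (simp add: \<epsilon>_def)
    let ?A = "\<lambda>n. {x \<in> space (iid p). \<epsilon> \<le> ?d x n}"
    have "summable (\<lambda>n. 2 * exp (- 2 * \<epsilon>\<^sup>2) ^ n)"
      using \<epsilon> by (intro summable_mult summable_geometric) auto
    then have "summable (\<lambda>n. prob (?A n))"
    proof (rule summable_comparison_test_ev[rotated])
      show "eventually (\<lambda>n. norm (prob (?A n)) \<le> 2 * exp (- 2 * \<epsilon>\<^sup>2) ^ n) sequentially"
        using eventually_gt_at_top[of "0::nat"]
      proof eventually_elim
        fix n :: nat assume "0 < n"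
        from iid_frequency_bound[OF \<epsilon> this, of p k]
        show "norm (prob (?A n)) \<le> 2 * exp (- 2 * \<epsilon>\<^sup>2) ^ n"
          by (simp add: exp_of_nat_mult[symmetric] mult_ac)
      qed
    qed
    moreover have "?A n \<in> events" for n by measurable
    ultimately have "AE x in iid p. eventually (\<lambda>n. x \<in> space (iid p) - ?A n) sequentially"
      by (intro borel_cantelli_AE1) (simp_all add: emeasure_eq_measure)
    then show ?thesis
      by (rule eventually_mono) (auto simp: \<epsilon>_def not_le elim!: eventually_mono)
  qed
  then have "AE x in iid p. \<forall>j. eventually (\<lambda>n. ?d x n < 1 / real (Suc j)) sequentially"
    by (simp only: AE_all_countable) blast
  then show "AE x in iid p. has_frequency x k (pmf p k)"
  proof (rule eventually_mono)
    fix x assume *: "\<forall>j. eventually (\<lambda>n. ?d x n < 1 / real (Suc j)) sequentially"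
    show "has_frequency x k (pmf p k)"
      unfolding has_frequency_def
    proof (rule tendstoI)
      fix e :: real assume "0 < e"
      then obtain j where j: "1 / real (Suc j) < e" using nat_approx_posE by blast
      show "eventually (\<lambda>n. dist (real (occurrences x k n) / real n) (pmf p k) < e) sequentially"
        using *[rule_format, of j] by (rule eventually_mono) (use j in \<open>auto simp: dist_real_def\<close>)
    qed
  qed
qed

lemma occupied_mono: "m \<le> n \<Longrightarrow> occupied X m \<le> occupied X n"
  by (rule lift_Suc_mono_le) simp_all

text \<open>If every label occurs infinitely often, each customer with label \<open>j\<close> that comes late enough
  finds table \<open>j\<close> occupied.\<close>
lemma seat_eventually:
  assumes inf: "\<And>j N. \<exists>m\<ge>N. X m = j"
  shows "eventually (\<lambda>m. seat X m = j \<longleftrightarrow> X m = j) sequentially"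
proof -
  have "\<exists>m. j \<le> occupied X m" for j
  proof (induction j)
    case (Suc j)
    then obtain m where m: "j \<le> occupied X m" by blast
    obtain m' where m': "m \<le> m'" "X m' = j" using inf by blast
    have "j \<le> occupied X m'" using m occupied_mono[OF m'(1), of X] by simp
    then have "Suc j \<le> occupied X (Suc m')" using m'(2) by auto
    then show ?case by blast
  qed simp
  then obtain m where m: "Suc j \<le> occupied X m" by blast
  have "seat X n = j \<longleftrightarrow> X n = j" if "m \<le> n" for n
    using m occupied_mono[OF that, of X] by (auto simp: seat_def)
  then show ?thesis by (auto simp: eventually_sequentially)
qed

lemma frequency_not_in_range: "k \<notin> range K \<Longrightarrow> frequency K k = 0"
proof -
  assume "k \<notin> range K"
  then have "occurrences K k n = 0" for n by (auto simp: occurrences_eq_0_iff)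
  then have "has_frequency K k 0" by (simp add: has_frequency_def)
  then show ?thesis by (rule frequency_eqI)
qed

lemma proper_frequenciesI:
  fixes L :: "nat \<Rightarrow> nat"
  assumes "\<And>k. has_frequency L k (frequency L k)" "frequency L \<in> prob_sequences" "\<And>k. 0 < frequency L k"
  shows "proper_frequencies L"
proof -
  have "range L = UNIV" using assms(3) frequency_not_in_range[of _ L] by (metis UNIV_eq_I less_irrefl)
  moreover have "(frequency L has_sum 1) UNIV"
    using assms(2) sums_nonneg_iff_has_sum[of "frequency L" 1] by (simp add: prob_sequences_def)
  ultimately show ?thesis using assms by (simp add: proper_frequencies_def)
qed

lemma measurable_has_frequency [measurable]:
  "Measurable.pred (seqs :: (nat \<Rightarrow> nat) measure) (\<lambda>L. has_frequency L k (frequency L k))"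
proof -
  have "has_frequency L k (frequency L k) \<longleftrightarrow> Cauchy (\<lambda>n. real (occurrences L k n) / real n)" for L
    unfolding has_frequency_def frequency_def convergent_LIMSEQ_iff[symmetric] Cauchy_convergent_iff ..
  then show ?thesis
    using sets_Collect_Cauchy[of "\<lambda>n L. real (occurrences L k n) / real n" "seqs :: (nat \<Rightarrow> nat) measure"]
    by (simp add: pred_def)
qed

text \<open>The properties of almost every label sequence, in a form that makes their measurability evident.\<close>
definition regular_labels :: "(nat \<Rightarrow> nat) \<Rightarrow> bool" where
  "regular_labels L \<longleftrightarrow> (\<forall>k. has_frequency L k (frequency L k)) \<and>
     frequency L \<in> prob_sequences \<and> (\<forall>k. 0 < frequency L k)"

lemma measurable_frequency_coordinate [measurable]:
  "(\<lambda>L. frequency L k) \<in> borel_measurable (seqs :: (nat \<Rightarrow> nat) measure)"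
  using measurable_compose[OF measurable_frequency measurable_component_singleton[of k UNIV "\<lambda>_. borel"]] by simp

lemma measurable_regular_labels [measurable]: "Measurable.pred (seqs :: (nat \<Rightarrow> nat) measure) regular_labels"
  unfolding regular_labels_def[abs_def] by measurable

lemma regular_labels_proper: "regular_labels L \<Longrightarrow> proper_frequencies L"
  by (rule proper_frequenciesI) (auto simp: regular_labels_def)

definition label_sample :: "real \<Rightarrow> real \<Rightarrow> (nat \<Rightarrow> nat) measure" where
  "label_sample \<alpha> \<theta> = GEM \<alpha> \<theta> \<bind> (\<lambda>x. iid (label_pmf x))"

text \<open>The Chinese restaurant is constructed from labels because its table frequencies can then be
  identified; the seating rule is derived.\<close>
definition crp_law :: "real \<Rightarrow> real \<Rightarrow> (nat \<Rightarrow> nat) measure" where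
  "crp_law \<alpha> \<theta> = distr (label_sample \<alpha> \<theta>) seqs seat"

lemma label_kernel_GEM: "(\<lambda>x. iid (label_pmf x)) \<in> GEM \<alpha> \<theta> \<rightarrow>\<^sub>M subprob_algebra seqs"
  using measurable_prob_algebraD[OF label_kernel] by (simp cong: measurable_cong_sets)

lemma sets_label_sample [simp, measurable_cong]: "sets (label_sample \<alpha> \<theta>) = sets seqs"
  unfolding label_sample_def by (rule sets_bind) auto

lemma space_label_sample [simp]: "space (label_sample \<alpha> \<theta>) = UNIV"
  using sets_eq_imp_space_eq[OF sets_label_sample] by simp

lemma sets_crp_law [simp, measurable_cong]: "sets (crp_law \<alpha> \<theta>) = sets seqs"
  by (simp add: crp_law_def)

lemma space_crp_law [simp]: "space (crp_law \<alpha> \<theta>) = UNIV"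
  by (simp add: crp_law_def)

lemma AE_iid_label_sample:
  assumes x: "x \<in> prob_sequences" "\<forall>n. 0 < x n"
  shows "AE X in iid (label_pmf x). (\<forall>k. has_frequency X k (x k)) \<and>
    (\<forall>j. eventually (\<lambda>m. seat X m = j \<longleftrightarrow> X m = j) sequentially)"
  using AE_iid_frequency[of "label_pmf x"]
proof (rule eventually_mono)
  fix X assume "\<forall>k. has_frequency X k (pmf (label_pmf x) k)"
  then have freq: "\<forall>k. has_frequency X k (x k)" using x by (simp add: pmf_label_pmf)
  have "\<exists>m\<ge>N. X m = j" for j N
  proof -
    have "eventually (\<lambda>n. Suc N \<le> occurrences X j n) sequentially"
      using frequency_pos_unbounded[of X j "x j"] freq x by (simp add: filterlim_at_top)
    then obtain n where "N < occurrences X j n" by (auto simp: eventually_sequentially Suc_le_eq)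
    from occurrence_exists[OF this] obtain i where i: "X i = j" "occurrences X j i = N" by blast
    then have "N \<le> i" using occurrences_le[of X j i] by simp
    then show ?thesis using i by blast
  qed
  then show "(\<forall>k. has_frequency X k (x k)) \<and> (\<forall>j. eventually (\<lambda>m. seat X m = j \<longleftrightarrow> X m = j) sequentially)"
    using freq seat_eventually by blast
qed

lemma AE_iid_frequency_seat:
  assumes x: "x \<in> prob_sequences" "\<forall>n. 0 < x n"
  shows "AE X in iid (label_pmf x). frequency (seat X) = x \<and> regular_labels (seat X)"
  using AE_iid_label_sample[OF x]
proof (rule eventually_mono)
  fix X assume X: "(\<forall>k. has_frequency X k (x k)) \<and> (\<forall>j. eventually (\<lambda>m. seat X m = j \<longleftrightarrow> X m = j) sequentially)"
  then have freq: "has_frequency (seat X) k (x k)" for k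
    using has_frequency_eventually_cong[of "seat X" k X k "x k"] by blast
  have "frequency (seat X) = x" by (rule ext) (rule frequency_eqI[OF freq])
  then show "frequency (seat X) = x \<and> regular_labels (seat X)"
    using freq x by (simp add: regular_labels_def)
qed

context
  fixes \<alpha> \<theta> :: real
  assumes \<alpha>: "0 \<le> \<alpha>" "\<alpha> < 1" and \<theta>: "\<theta> > - \<alpha>"
begin

lemma prob_space_label_sample: "prob_space (label_sample \<alpha> \<theta>)"
  unfolding label_sample_def
  by (rule prob_space.prob_space_bind[OF prob_space_GEM[OF \<alpha> \<theta>] _ label_kernel_GEM])
     (simp add: prob_space_iid)

lemma prob_space_crp_law: "prob_space (crp_law \<alpha> \<theta>)"
  unfolding crp_law_def by (rule prob_space.prob_space_distr[OF prob_space_label_sample]) measurable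

text \<open>Given the sticks the labels are independent; the sticks are then integrated out.\<close>
lemma measure_label_sample_seating:
  assumes xs: "growth_list xs"
  shows "measure (label_sample \<alpha> \<theta>) {X. initial (length xs) (seat X) = xs} = segment_prob (seat_weight \<alpha> \<theta>) xs"
proof -
  let ?E = "{X. initial (length xs) (seat X) = xs}"
  let ?f = "\<lambda>b::nat \<Rightarrow> real. \<Prod>i<length xs. b i ^ fst (stick_exponents xs i) * (1 - b i) ^ snd (stick_exponents xs i)"
  have meas: "?E \<in> sets seqs"
  proof -
    have "{X \<in> space seqs. initial (length xs) (seat X) = xs} \<in> sets seqs" by measurable
    then show ?thesis by simp
  qed
  have kernel: "(\<lambda>x. emeasure (iid (label_pmf x)) ?E) \<in> borel_measurable seq_space"
    using measurable_prob_algebraD[OF label_kernel] meas by (rule measurable_emeasure_kernel)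
  have "emeasure (label_sample \<alpha> \<theta>) ?E = (\<integral>\<^sup>+x. emeasure (iid (label_pmf x)) ?E \<partial>GEM \<alpha> \<theta>)"
    unfolding label_sample_def by (rule emeasure_bind[OF _ label_kernel_GEM meas]) simp
  also have "\<dots> = (\<integral>\<^sup>+b. emeasure (iid (label_pmf (stick_breaking b))) ?E \<partial>sticks \<alpha> \<theta>)"
    unfolding GEM_sticks by (rule nn_integral_distr) (use kernel in simp_all)
  also have "\<dots> = (\<integral>\<^sup>+b. ennreal (?f b) \<partial>sticks \<alpha> \<theta>)"
  proof (rule nn_integral_cong_AE)
    show "AE b in sticks \<alpha> \<theta>. emeasure (iid (label_pmf (stick_breaking b))) ?E = ennreal (?f b)"
      using AE_sticks_prob_sequence[OF \<alpha> \<theta>]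
    proof (rule eventually_mono)
      fix b assume b: "(\<forall>n. 0 < b n \<and> b n < 1) \<and> stick_breaking b \<in> prob_sequences \<and> (\<forall>n. 0 < stick_breaking b n)"
      have "measure (iid (label_pmf (stick_breaking b))) ?E = ?f b"
        by (rule seating_probability_sticks[OF xs]) (use b in auto)
      then show "emeasure (iid (label_pmf (stick_breaking b))) ?E = ennreal (?f b)"
        using finite_measure.emeasure_eq_measure[OF prob_space.finite_measure[OF prob_space_iid[of "label_pmf (stick_breaking b)"]]]
        by simp
    qed
  qed
  also have "\<dots> = ennreal (segment_prob (seat_weight \<alpha> \<theta>) xs)"
    unfolding nn_integral_sticks_moments[OF \<alpha> \<theta>] seating_probability[OF \<alpha> \<theta> xs order_refl] ..
  finally have *: "emeasure (label_sample \<alpha> \<theta>) ?E = ennreal (segment_prob (seat_weight \<alpha> \<theta>) xs)" .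
  have "0 \<le> segment_prob (seat_weight \<alpha> \<theta>) xs"
    unfolding seating_probability[OF \<alpha> \<theta> xs order_refl, symmetric]
    by (intro prod_nonneg beta_moment_nonneg stick_parameters[OF \<alpha> \<theta>])
  then show ?thesis using * by (simp add: measure_def)
qed

lemma measure_crp_law_cylinder:
  "measure (crp_law \<alpha> \<theta>) (cylinder xs) = (if growth_list xs then segment_prob (seat_weight \<alpha> \<theta>) xs else 0)"
proof -
  have "seat -` cylinder xs \<inter> space (label_sample \<alpha> \<theta>) = {X. initial (length xs) (seat X) = xs}"
    by (auto simp: cylinder_def)
  then have *: "measure (crp_law \<alpha> \<theta>) (cylinder xs) = measure (label_sample \<alpha> \<theta>) {X. initial (length xs) (seat X) = xs}"
    unfolding crp_law_def by (subst measure_distr) auto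
  show ?thesis
  proof (cases "growth_list xs")
    case False
    then have "{X. initial (length xs) (seat X) = xs} = {}"
      using growth_list_initial[OF restricted_growth_seat] by (metis (mono_tags, lifting) empty_Collect_eq)
    then show ?thesis using False unfolding * by simp
  qed (simp add: * measure_label_sample_seating)
qed

lemma AE_crp_law: "AE L in crp_law \<alpha> \<theta>. restricted_growth L \<and> regular_labels L"
proof -
  have rg: "Measurable.pred (seqs :: (nat \<Rightarrow> nat) measure) restricted_growth"
  proof -
    have [measurable]: "Measurable.pred (seqs :: (nat \<Rightarrow> nat) measure) (\<lambda>L. L n \<le> card (L ` {..<n}))" for n
      unfolding pred_def
    proof -
      have "(\<lambda>L. L n \<le> card (L ` {..<n})) \<in> (seqs :: (nat \<Rightarrow> nat) measure) \<rightarrow>\<^sub>M count_space UNIV"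
      proof (rule measurable_determined_by_initial[where n = "Suc n"])
        fix x y :: "nat \<Rightarrow> nat" assume eq: "\<And>m. m < Suc n \<Longrightarrow> x m = y m"
        then have "x ` {..<n} = y ` {..<n}" by (intro image_cong) auto
        then show "(x n \<le> card (x ` {..<n})) = (y n \<le> card (y ` {..<n}))" using eq by simp
      qed
      then show "{x \<in> space (seqs :: (nat \<Rightarrow> nat) measure). x n \<le> card (x ` {..<n})} \<in> sets seqs"
        by (simp add: pred_def)
    qed
    show ?thesis unfolding restricted_growth_def[abs_def] by measurable
  qed
  have "AE X in label_sample \<alpha> \<theta>. regular_labels (seat X)"
    unfolding label_sample_def
  proof (subst AE_bind[OF label_kernel_GEM])
    show "Measurable.pred seqs (\<lambda>X. regular_labels (seat X))" by measurable
    show "AE x in GEM \<alpha> \<theta>. AE X in iid (label_pmf x). regular_labels (seat X)"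
      using AE_GEM[OF \<alpha> \<theta>]
      by (rule eventually_mono) (use AE_iid_frequency_seat in \<open>auto elim!: eventually_mono\<close>)
  qed
  moreover have "Measurable.pred (seqs :: (nat \<Rightarrow> nat) measure) (\<lambda>L. restricted_growth L \<and> regular_labels L)"
    using rg by measurable
  ultimately show ?thesis
    unfolding crp_law_def by (subst AE_distr_iff) (auto simp: restricted_growth_seat pred_def)
qed

text \<open>Given the GEM weights, these are the frequencies of the labels, and table \<open>j\<close> is eventually used by the
  customers with label \<open>j\<close> only.\<close>
lemma frequency_crp_law: "distr (crp_law \<alpha> \<theta>) seq_space frequency = GEM \<alpha> \<theta>"
proof (rule measure_eqI)
  fix A assume "A \<in> sets (distr (crp_law \<alpha> \<theta>) seq_space frequency)"
  then have A [measurable]: "A \<in> sets seq_space" by simp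
  have B: "(\<lambda>X. frequency (seat X)) -` A \<in> sets seqs"
  proof -
    have "(\<lambda>X. frequency (seat X)) -` A \<inter> space seqs \<in> sets seqs" by measurable
    then show ?thesis by simp
  qed
  have "emeasure (distr (crp_law \<alpha> \<theta>) seq_space frequency) A =
      emeasure (label_sample \<alpha> \<theta>) ((\<lambda>X. frequency (seat X)) -` A)"
    unfolding crp_law_def by (subst distr_distr) (auto simp: emeasure_distr comp_def)
  also have "\<dots> = (\<integral>\<^sup>+x. emeasure (iid (label_pmf x)) ((\<lambda>X. frequency (seat X)) -` A) \<partial>GEM \<alpha> \<theta>)"
    unfolding label_sample_def by (rule emeasure_bind[OF _ label_kernel_GEM B]) simp
  also have "\<dots> = (\<integral>\<^sup>+x. indicator A x \<partial>GEM \<alpha> \<theta>)"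
  proof (rule nn_integral_cong_AE)
    show "AE x in GEM \<alpha> \<theta>. emeasure (iid (label_pmf x)) ((\<lambda>X. frequency (seat X)) -` A) = indicator A x"
      using AE_GEM[OF \<alpha> \<theta>]
    proof (rule eventually_mono)
      fix x assume x: "x \<in> prob_sequences \<and> (\<forall>n. 0 < x n)"
      interpret prob_space "iid (label_pmf x)" by (rule prob_space_iid)
      have "AE X in iid (label_pmf x). X \<in> (\<lambda>X. frequency (seat X)) -` A \<longleftrightarrow> X \<in> (if x \<in> A then UNIV else {})"
        using AE_iid_frequency_seat[of x] x by (auto elim!: eventually_mono)
      then have "emeasure (iid (label_pmf x)) ((\<lambda>X. frequency (seat X)) -` A) = emeasure (iid (label_pmf x)) (if x \<in> A then UNIV else {})"
        using B sets.top[of "seqs :: (nat \<Rightarrow> nat) measure"] by (intro emeasure_eq_AE) auto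
      then show "emeasure (iid (label_pmf x)) ((\<lambda>X. frequency (seat X)) -` A) = indicator A x"
        using emeasure_space_1 by auto
    qed
  qed
  also have "\<dots> = emeasure (GEM \<alpha> \<theta>) A" by simp
  finally show "emeasure (distr (crp_law \<alpha> \<theta>) seq_space frequency) A = emeasure (GEM \<alpha> \<theta>) A" .
qed simp

end

section \<open>Exchangeability\<close>

text \<open>Pitman's exchangeable partition probability function.\<close>
definition closed_form :: "real \<Rightarrow> real \<Rightarrow> 'a list \<Rightarrow> real" where
  "closed_form \<alpha> \<theta> xs = (\<Prod>i\<in>{1..<card (set xs)}. \<theta> + \<alpha> * real i) *
     (\<Prod>v\<in>set xs. \<Prod>l\<in>{1..<count_list xs v}. real l - \<alpha>) / (\<Prod>m\<in>{1..<length xs}. \<theta> + real m)"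

lemma prod_Suc_above: "1 \<le> n \<Longrightarrow> (\<Prod>i\<in>{1..<Suc n}. f i) = (\<Prod>i\<in>{1..<n}. f i) * (f n :: real)"
  by (simp add: prod.atLeastLessThan_Suc)

lemma segment_prob_seat_weight: "segment_prob (seat_weight \<alpha> \<theta>) xs = closed_form \<alpha> \<theta> xs"
proof (induction xs rule: rev_induct)
  case (snoc v xs)
  have "closed_form \<alpha> \<theta> (xs @ [v]) = closed_form \<alpha> \<theta> xs * seat_weight \<alpha> \<theta> xs v"
  proof (cases "xs = []")
    case False
    let ?c = "\<lambda>xs v. \<Prod>l\<in>{1..<count_list xs v}. real l - \<alpha>"
    have len: "(\<Prod>m\<in>{1..<length (xs @ [v])}. \<theta> + real m) = (\<Prod>m\<in>{1..<length xs}. \<theta> + real m) * (\<theta> + real (length xs))"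
      using False prod_Suc_above[of "length xs" "\<lambda>m. \<theta> + real m"] by (simp add: Suc_le_eq)
    show ?thesis
    proof (cases "v \<in> set xs")
      case True
      have "(\<Prod>w\<in>set (xs @ [v]). ?c (xs @ [v]) w) = (\<Prod>w\<in>set xs. ?c (xs @ [v]) w)"
        using True by (simp add: insert_absorb)
      also have "\<dots> = ?c (xs @ [v]) v * (\<Prod>w\<in>set xs - {v}. ?c (xs @ [v]) w)"
        using True by (simp add: prod.remove)
      also have "?c (xs @ [v]) v = ?c xs v * (real (count_list xs v) - \<alpha>)"
        using True prod_Suc_above[of "count_list xs v" "\<lambda>l. real l - \<alpha>"]
        by (simp add: Suc_le_eq neq0_conv[symmetric] count_list_0_iff del: neq0_conv)
      also have "(\<Prod>w\<in>set xs - {v}. ?c (xs @ [v]) w) = (\<Prod>w\<in>set xs - {v}. ?c xs w)"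
        by (intro prod.cong) auto
      also have "?c xs v * (real (count_list xs v) - \<alpha>) * (\<Prod>w\<in>set xs - {v}. ?c xs w) =
          (\<Prod>w\<in>set xs. ?c xs w) * (real (count_list xs v) - \<alpha>)"
        using True by (simp add: prod.remove[of "set xs" v])
      finally have cnt: "(\<Prod>w\<in>set (xs @ [v]). ?c (xs @ [v]) w) = (\<Prod>w\<in>set xs. ?c xs w) * (real (count_list xs v) - \<alpha>)" .
      have "card (set (xs @ [v])) = card (set xs)" using True by (simp add: insert_absorb)
      then show ?thesis
        unfolding closed_form_def cnt len using True False by (simp add: seat_weight_def)
    next
      case new: False
      have "(\<Prod>w\<in>set (xs @ [v]). ?c (xs @ [v]) w) = ?c (xs @ [v]) v * (\<Prod>w\<in>set xs. ?c (xs @ [v]) w)"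
        using new by simp
      also have "?c (xs @ [v]) v = 1" using new by (simp add: count_list_0_iff[THEN iffD2])
      also have "(\<Prod>w\<in>set xs. ?c (xs @ [v]) w) = (\<Prod>w\<in>set xs. ?c xs w)"
        using new by (intro prod.cong) auto
      finally have cnt: "(\<Prod>w\<in>set (xs @ [v]). ?c (xs @ [v]) w) = (\<Prod>w\<in>set xs. ?c xs w)" by simp
      have "1 \<le> card (set xs)" using False by (simp add: Suc_le_eq card_gt_0_iff)
      then have "(\<Prod>i\<in>{1..<card (set (xs @ [v]))}. \<theta> + \<alpha> * real i) =
          (\<Prod>i\<in>{1..<card (set xs)}. \<theta> + \<alpha> * real i) * (\<theta> + \<alpha> * real (card (set xs)))"
        using new prod_Suc_above[of "card (set xs)" "\<lambda>i. \<theta> + \<alpha> * real i"] by simp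
      then show ?thesis
        unfolding closed_form_def cnt len using new False by (simp add: seat_weight_def)
    qed
  qed (simp add: closed_form_def seat_weight_def)
  then show ?case using snoc by simp
qed (simp add: closed_form_def)

text \<open>The closed form is symmetric in the positions.\<close>
lemma segment_prob_seat_weight_rotate:
  "segment_prob (seat_weight \<alpha> \<theta>) (v # xs) = segment_prob (seat_weight \<alpha> \<theta>) (xs @ [v])"
proof -
  have "count_list (v # xs) = count_list (xs @ [v])" by (rule ext) simp
  then show ?thesis unfolding segment_prob_seat_weight closed_form_def by simp
qed

lemma count_list_map_inj:
  assumes "inj_on f (insert v (set xs))"
  shows "count_list (map f xs) (f v) = count_list xs v"
  using assms by (induction xs) (auto simp: inj_on_def)

lemma segment_prob_seat_weight_map:
  assumes "inj_on f (set xs)"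
  shows "segment_prob (seat_weight \<alpha> \<theta>) (map f xs) = segment_prob (seat_weight \<alpha> \<theta>) xs"
  using assms
proof (induction xs rule: rev_induct)
  case (snoc v xs)
  have inj: "inj_on f (insert v (set xs))" using snoc.prems by simp
  then have "seat_weight \<alpha> \<theta> (map f xs) (f v) = seat_weight \<alpha> \<theta> xs v"
    using count_list_map_inj[OF inj] card_image[OF inj_on_subset[OF inj, of "set xs"]]
    by (auto simp: seat_weight_def inj_on_def)
  then show ?case using snoc.IH inj_on_subset[OF inj, of "set xs"] by auto
qed simp

lemma sum_seat_weight:
  assumes \<alpha>: "0 \<le> \<alpha>" "\<alpha> < 1" and \<theta>: "\<theta> > - \<alpha>" and new: "f \<notin> set xs"
  shows "(\<Sum>v\<in>insert f (set xs). seat_weight \<alpha> \<theta> xs v) = 1"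
proof (cases "xs = []")
  case False
  have pos: "\<theta> + real (length xs) \<noteq> 0"
    using False \<alpha> \<theta> by (cases xs) auto
  have "(\<Sum>v\<in>set xs. real (count_list xs v) - \<alpha>) = real (\<Sum>v\<in>set xs. count_list xs v) - real (card (set xs)) * \<alpha>"
    by (simp add: sum_subtractf)
  also have "(\<Sum>v\<in>set xs. count_list xs v) = length xs" by (rule sum_count_set) auto
  finally have "(\<Sum>v\<in>set xs. real (count_list xs v) - \<alpha>) + (\<theta> + \<alpha> * real (card (set xs))) = \<theta> + real (length xs)"
    by (simp add: algebra_simps)
  moreover have "(\<Sum>v\<in>insert f (set xs). seat_weight \<alpha> \<theta> xs v) =
      ((\<Sum>v\<in>set xs. real (count_list xs v) - \<alpha>) + (\<theta> + \<alpha> * real (card (set xs)))) / (\<theta> + real (length xs))"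
    using new False by (simp add: seat_weight_def sum_divide_distrib add_divide_distrib)
  ultimately show ?thesis using pos by simp
qed (simp add: seat_weight_def)

text \<open>Equalities between positions, rather than labels, describe a partition without naming its blocks.\<close>
definition pattern :: "'a list \<Rightarrow> (nat \<Rightarrow> 'b) set" where
  "pattern xs = {x. \<forall>i<length xs. \<forall>j<length xs. x i = x j \<longleftrightarrow> xs ! i = xs ! j}"

lemma pattern_sets [measurable]: "pattern xs \<in> sets (seqs :: (nat \<Rightarrow> nat) measure)"
proof -
  have "(\<lambda>x. x \<in> pattern xs) \<in> (seqs :: (nat \<Rightarrow> nat) measure) \<rightarrow>\<^sub>M count_space UNIV"
    by (rule measurable_determined_by_initial[where n = "length xs"]) (simp add: pattern_def)
  then show ?thesis by (simp add: pred_def)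
qed

lemma pattern_Cons_iff:
  "x \<in> pattern (v # xs) \<longleftrightarrow> (\<lambda>n. x (Suc n)) \<in> pattern xs \<and> (\<forall>i<length xs. x 0 = x (Suc i) \<longleftrightarrow> v = xs ! i)"
  unfolding pattern_def by (auto simp: All_less_Suc2)

text \<open>Dropping the first position: it either shares a label with a later position or has a fresh one.\<close>
lemma pattern_shift_split:
  assumes new: "f \<notin> set xs"
  shows "{x :: nat \<Rightarrow> 'b. (\<lambda>n. x (Suc n)) \<in> pattern xs} = (\<Union>v\<in>insert f (set xs). pattern (v # xs))"
    and "disjoint_family_on (\<lambda>v. pattern (v # xs) :: (nat \<Rightarrow> 'b) set) (insert f (set xs))"
proof -
  show "{x :: nat \<Rightarrow> 'b. (\<lambda>n. x (Suc n)) \<in> pattern xs} = (\<Union>v\<in>insert f (set xs). pattern (v # xs))"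
  proof (intro equalityI subsetI)
    fix x :: "nat \<Rightarrow> 'b" assume x: "x \<in> {x. (\<lambda>n. x (Suc n)) \<in> pattern xs}"
    show "x \<in> (\<Union>v\<in>insert f (set xs). pattern (v # xs))"
    proof (cases "\<exists>i<length xs. x 0 = x (Suc i)")
      case True
      then obtain i where i: "i < length xs" "x 0 = x (Suc i)" by blast
      then have "x \<in> pattern (xs ! i # xs)" using x by (auto simp: pattern_Cons_iff) (auto simp: pattern_def)
      then show ?thesis using i by (intro UN_I[of "xs ! i"]) auto
    next
      case False
      then have "x \<in> pattern (f # xs)" using x new by (auto simp: pattern_Cons_iff in_set_conv_nth)
      then show ?thesis by blast
    qed
  qed (auto simp: pattern_Cons_iff)
  show "disjoint_family_on (\<lambda>v. pattern (v # xs) :: (nat \<Rightarrow> 'b) set) (insert f (set xs))"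
    unfolding disjoint_family_on_def
  proof (intro ballI impI, rule ccontr)
    fix v w assume vw: "v \<in> insert f (set xs)" "w \<in> insert f (set xs)" "v \<noteq> w"
      and ne: "pattern (v # xs) \<inter> pattern (w # xs) \<noteq> ({} :: (nat \<Rightarrow> 'b) set)"
    then obtain x :: "nat \<Rightarrow> 'b" where x: "x \<in> pattern (v # xs)" "x \<in> pattern (w # xs)" by auto
    then have "v = xs ! i \<longleftrightarrow> w = xs ! i" if "i < length xs" for i
      using that by (simp add: pattern_Cons_iff)
    then show False using vw by (metis in_set_conv_nth insertE)
  qed
qed

lemma initial_restricted_growth_iff:
  assumes L: "restricted_growth L"
  shows "initial (length xs) L = initial (length xs) (relabel (\<lambda>i. xs ! i)) \<longleftrightarrow> L \<in> pattern xs"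
proof
  assume "initial (length xs) L = initial (length xs) (relabel (\<lambda>i. xs ! i))"
  then have "L i = relabel (\<lambda>i. xs ! i) i" if "i < length xs" for i
    using that by (metis nth_initial)
  then show "L \<in> pattern xs" by (auto simp: pattern_def relabel_eq_iff)
next
  assume "L \<in> pattern xs"
  then have "L i = relabel (\<lambda>i. xs ! i) i" if "i < length xs" for i
    by (intro restricted_growth_unique[OF L restricted_growth_relabel _ that]) (auto simp: pattern_def relabel_eq_iff)
  then show "initial (length xs) L = initial (length xs) (relabel (\<lambda>i. xs ! i))"
    by (intro nth_equalityI) auto
qed

lemma segment_prob_initial_relabel:
  "segment_prob (seat_weight \<alpha> \<theta>) (initial (length xs) (relabel (\<lambda>i. xs ! i))) = segment_prob (seat_weight \<alpha> \<theta>) xs"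
proof -
  define g where "g k = relabel (\<lambda>i. xs ! i) (SOME n. xs ! n = k)" for k
  have g: "g (xs ! i) = relabel (\<lambda>i. xs ! i) i" for i
    unfolding g_def by (rule relabel_bij_apply)
  have "initial (length xs) (relabel (\<lambda>i. xs ! i)) = map g xs"
    by (rule nth_equalityI) (simp_all add: g)
  moreover have "inj_on g (set xs)"
    by (auto simp: inj_on_def in_set_conv_nth g relabel_eq_iff)
  ultimately show ?thesis by (simp add: segment_prob_seat_weight_map)
qed

context
  fixes \<alpha> \<theta> :: real
  assumes \<alpha>: "0 \<le> \<alpha>" "\<alpha> < 1" and \<theta>: "\<theta> > - \<alpha>"
begin

lemma measure_seat_pattern:
  "measure (label_sample \<alpha> \<theta>) {X. seat X \<in> pattern xs} = segment_prob (seat_weight \<alpha> \<theta>) xs"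
proof -
  let ?ys = "initial (length xs) (relabel (\<lambda>i. xs ! i))"
  have "{X. seat X \<in> pattern xs} = {X. initial (length ?ys) (seat X) = ?ys}"
    using initial_restricted_growth_iff[OF restricted_growth_seat, of xs] by simp
  then show ?thesis
    using measure_label_sample_seating[OF \<alpha> \<theta> growth_list_initial[OF restricted_growth_relabel]]
      segment_prob_initial_relabel by metis
qed

text \<open>The seating probabilities depend on the block sizes only, so the first customer may as well
  come last; hence the partition has the same law when the first customers are ignored.\<close>
lemma measure_seat_pattern_shift:
  "measure (label_sample \<alpha> \<theta>) {X. (\<lambda>n. seat X (n + N)) \<in> pattern (xs :: nat list)} = segment_prob (seat_weight \<alpha> \<theta>) xs"
proof (induction N arbitrary: xs)
  case 0
  then show ?case by (simp add: measure_seat_pattern)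
next
  case (Suc N)
  interpret prob_space "label_sample \<alpha> \<theta>" by (rule prob_space_label_sample[OF \<alpha> \<theta>])
  \<comment> \<open>A fresh label stands for a first customer who sits alone.\<close>
  obtain f :: nat where f: "f \<notin> set xs" using ex_new_if_finite[of "set xs"] by auto
  let ?S = "\<lambda>X n. seat X (n + N)"
  have [measurable]: "?S \<in> seqs \<rightarrow>\<^sub>M seqs"
    by (rule measurable_seqs_coordinatewise) (rule measurable_compose[OF measurable_seat measurable_coordinate])
  have sets: "{X. ?S X \<in> pattern ys} \<in> sets seqs" for ys :: "nat list"
  proof -
    have "{X \<in> space seqs. ?S X \<in> pattern ys} \<in> sets seqs" by measurable
    then show ?thesis by simp
  qed
  have "{X. (\<lambda>n. seat X (n + Suc N)) \<in> pattern xs} = {X. (\<lambda>n. ?S X (Suc n)) \<in> pattern xs}" by simp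
  also have "\<dots> = (\<Union>v\<in>insert f (set xs). {X. ?S X \<in> pattern (v # xs)})"
  proof -
    have "?S X \<in> {x. (\<lambda>n. x (Suc n)) \<in> pattern xs} \<longleftrightarrow> ?S X \<in> (\<Union>v\<in>insert f (set xs). pattern (v # xs))" for X
      by (simp only: pattern_shift_split(1)[OF f])
    then show ?thesis by auto
  qed
  finally have "prob {X. (\<lambda>n. seat X (n + Suc N)) \<in> pattern xs} = (\<Sum>v\<in>insert f (set xs). prob {X. ?S X \<in> pattern (v # xs)})"
  proof (simp only:, intro finite_measure_finite_Union)
    show "disjoint_family_on (\<lambda>v. {X. ?S X \<in> pattern (v # xs)}) (insert f (set xs))"
      using pattern_shift_split(2)[OF f, where 'b = nat] by (fastforce simp: disjoint_family_on_def)
  qed (use sets in auto)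
  also have "\<dots> = (\<Sum>v\<in>insert f (set xs). segment_prob (seat_weight \<alpha> \<theta>) xs * seat_weight \<alpha> \<theta> xs v)"
    by (simp only: Suc.IH segment_prob_seat_weight_rotate segment_prob_snoc)
  also have "\<dots> = segment_prob (seat_weight \<alpha> \<theta>) xs"
    unfolding sum_distrib_left[symmetric] sum_seat_weight[OF \<alpha> \<theta> f] by simp
  finally show ?case .
qed

lemma label_sample_shift: "distr (label_sample \<alpha> \<theta>) seqs (\<lambda>X n. X (n + N)) = label_sample \<alpha> \<theta>"
proof -
  have [measurable]: "(\<lambda>X n. X (n + N)) \<in> (seqs :: (nat \<Rightarrow> nat) measure) \<rightarrow>\<^sub>M seqs"
    by (rule measurable_seqs_coordinatewise) (rule measurable_coordinate)
  have "distr (label_sample \<alpha> \<theta>) seqs (\<lambda>X n. X (n + N)) =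
      GEM \<alpha> \<theta> \<bind> (\<lambda>x. distr (iid (label_pmf x)) seqs (\<lambda>X n. X (n + N)))"
    unfolding label_sample_def by (rule distr_bind[OF label_kernel_GEM]) auto
  also have "\<dots> = label_sample \<alpha> \<theta>"
    unfolding label_sample_def by (intro bind_cong refl iid_reindex) (auto simp: inj_on_def)
  finally show ?thesis .
qed

lemma label_sample_seat_eventually:
  "AE X in label_sample \<alpha> \<theta>. \<forall>j. eventually (\<lambda>m. seat X m = j \<longleftrightarrow> X m = j) sequentially"
proof -
  have [measurable]: "(\<lambda>X. X m) \<in> (seqs :: (nat \<Rightarrow> nat) measure) \<rightarrow>\<^sub>M count_space UNIV" for m
    by (rule measurable_coordinate)
  have [measurable]: "(\<lambda>X. seat X m) \<in> (seqs :: (nat \<Rightarrow> nat) measure) \<rightarrow>\<^sub>M count_space UNIV" for m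
    by (rule measurable_compose[OF measurable_seat measurable_coordinate])
  show ?thesis
    unfolding label_sample_def eventually_sequentially
  proof (subst AE_bind[OF label_kernel_GEM])
    show "Measurable.pred seqs (\<lambda>X. \<forall>j. \<exists>N. \<forall>m\<ge>N. seat X m = j \<longleftrightarrow> X m = j)" by measurable
    show "AE x in GEM \<alpha> \<theta>. AE X in iid (label_pmf x). \<forall>j. \<exists>N. \<forall>m\<ge>N. seat X m = j \<longleftrightarrow> X m = j"
      using AE_GEM[OF \<alpha> \<theta>]
    proof (rule eventually_mono)
      fix x assume "x \<in> prob_sequences \<and> (\<forall>n. 0 < x n)"
      then have "AE X in iid (label_pmf x). (\<forall>k. has_frequency X k (x k)) \<and>
          (\<forall>j. eventually (\<lambda>m. seat X m = j \<longleftrightarrow> X m = j) sequentially)"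
        using AE_iid_label_sample by blast
      then show "AE X in iid (label_pmf x). \<forall>j. \<exists>N. \<forall>m\<ge>N. seat X m = j \<longleftrightarrow> X m = j"
        by (rule eventually_mono) (simp add: eventually_sequentially)
    qed
  qed
qed

text \<open>A late customer sits at the table of his label unless the label is rare.\<close>
lemma prob_seat_differs_tendsto_0:
  "(\<lambda>m. measure (label_sample \<alpha> \<theta>) {X. seat X m \<noteq> X m}) \<longlonglongrightarrow> 0"
proof -
  interpret prob_space "label_sample \<alpha> \<theta>" by (rule prob_space_label_sample[OF \<alpha> \<theta>])
  have [measurable]: "(\<lambda>X. X m) \<in> (seqs :: (nat \<Rightarrow> nat) measure) \<rightarrow>\<^sub>M count_space UNIV" for m
    by (rule measurable_coordinate)
  have [measurable]: "(\<lambda>X. seat X m) \<in> (seqs :: (nat \<Rightarrow> nat) measure) \<rightarrow>\<^sub>M count_space UNIV" for m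
    by (rule measurable_compose[OF measurable_seat measurable_coordinate])
  have ev [measurable]: "{X. P (seat X m) (X m)} \<in> sets seqs" for P :: "nat \<Rightarrow> nat \<Rightarrow> bool" and m
  proof -
    have "{X \<in> space seqs. P (seat X m) (X m)} \<in> sets seqs" by measurable
    then show ?thesis by simp
  qed
  \<comment> \<open>Stationarity bounds the probability of a rare label uniformly in \<open>m\<close>.\<close>
  have tail: "prob {X. J \<le> X m} = prob {X. J \<le> X 0}" for J m
  proof -
    have sh: "(\<lambda>X n. X (n + m)) \<in> label_sample \<alpha> \<theta> \<rightarrow>\<^sub>M seqs"
      by (rule measurable_seqs_coordinatewise) measurable
    have "prob {X. J \<le> X 0} = measure (distr (label_sample \<alpha> \<theta>) seqs (\<lambda>X n. X (n + m))) {X. J \<le> X 0}"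
      by (simp add: label_sample_shift)
    also have "\<dots> = prob {X. J \<le> X m}"
      using ev[of "\<lambda>_ v. J \<le> v" 0] by (subst measure_distr[OF sh]) auto
    finally show ?thesis by simp
  qed
  have "(\<lambda>J. prob {X. J \<le> X 0}) \<longlonglongrightarrow> prob (\<Inter>J. {X. J \<le> X 0})"
    using ev[of "\<lambda>_ v. _ \<le> v" 0] by (intro finite_Lim_measure_decseq) (auto simp: decseq_def)
  moreover have "(\<Inter>J. {X :: nat \<Rightarrow> nat. J \<le> X 0}) = {}"
  proof -
    have "\<not> Suc (X 0) \<le> X 0" for X :: "nat \<Rightarrow> nat" by simp
    then show ?thesis by blast
  qed
  ultimately have tail0: "(\<lambda>J. prob {X. J \<le> X 0}) \<longlonglongrightarrow> 0" by simp
  \<comment> \<open>Finitely many labels: each table is occupied in the end.\<close>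
  have small: "(\<lambda>m. prob {X. seat X m \<noteq> X m \<and> X m < J}) \<longlonglongrightarrow> 0" for J
  proof -
    have "(\<lambda>m. \<integral>X. indicat_real {X. seat X m \<noteq> X m \<and> X m < J} X \<partial>label_sample \<alpha> \<theta>) \<longlonglongrightarrow> (\<integral>X. 0 \<partial>label_sample \<alpha> \<theta>)"
    proof (rule integral_dominated_convergence[where w = "\<lambda>_. 1"])
      show "AE X in label_sample \<alpha> \<theta>. (\<lambda>m. indicat_real {X. seat X m \<noteq> X m \<and> X m < J} X) \<longlonglongrightarrow> 0"
        using label_sample_seat_eventually
      proof (rule eventually_mono)
        fix X assume X: "\<forall>j. eventually (\<lambda>m. seat X m = j \<longleftrightarrow> X m = j) sequentially"
        have "eventually (\<lambda>m. \<forall>j\<in>{..<J}. seat X m = j \<longleftrightarrow> X m = j) sequentially"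
          using X by (intro eventually_ball_finite) auto
        then have "eventually (\<lambda>m. indicat_real {X. seat X m \<noteq> X m \<and> X m < J} X = 0) sequentially"
          by (rule eventually_mono) (auto simp: indicator_def)
        then show "(\<lambda>m. indicat_real {X. seat X m \<noteq> X m \<and> X m < J} X) \<longlonglongrightarrow> 0"
          by (rule tendsto_eventually)
      qed
    qed (use ev[of "\<lambda>s v. s \<noteq> v \<and> v < J"] in \<open>auto simp: indicator_def\<close>)
    then show ?thesis using ev[of "\<lambda>s v. s \<noteq> v \<and> v < J"] by simp
  qed
  show ?thesis
  proof (rule LIMSEQ_I)
    fix r :: real assume r: "0 < r"
    obtain J where J: "prob {X. J \<le> X 0} < r / 2"
      using LIMSEQ_D[OF tail0, of "r / 2"] r by auto
    obtain N where N: "\<And>m. N \<le> m \<Longrightarrow> prob {X. seat X m \<noteq> X m \<and> X m < J} < r / 2"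
      using LIMSEQ_D[OF small[of J], of "r / 2"] r by auto
    have "prob {X. seat X m \<noteq> X m} < r" if "N \<le> m" for m
    proof -
      have "{X. seat X m \<noteq> X m} \<subseteq> {X. seat X m \<noteq> X m \<and> X m < J} \<union> {X. J \<le> X m}" by auto
      then have "prob {X. seat X m \<noteq> X m} \<le> prob ({X. seat X m \<noteq> X m \<and> X m < J} \<union> {X. J \<le> X m})"
        using ev[of "\<lambda>s v. s \<noteq> v \<and> v < J"] ev[of "\<lambda>_ v. J \<le> v"] by (intro finite_measure_mono) auto
      also have "\<dots> \<le> prob {X. seat X m \<noteq> X m \<and> X m < J} + prob {X. J \<le> X m}"
        using ev[of "\<lambda>s v. s \<noteq> v \<and> v < J"] ev[of "\<lambda>_ v. J \<le> v"] by (intro measure_Un_le) auto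
      also have "\<dots> < r" using N[OF that] J tail[of J m] by simp
      finally show ?thesis .
    qed
    then show "\<exists>N. \<forall>m\<ge>N. norm (prob {X. seat X m \<noteq> X m} - 0) < r" by auto
  qed
qed

text \<open>The labels are stationary, and so is the partition by tables.  Far out both induce the same
  partition on the given number of positions, except on an event of small probability.\<close>
lemma measure_label_sample_pattern:
  "measure (label_sample \<alpha> \<theta>) (pattern (xs :: nat list)) = segment_prob (seat_weight \<alpha> \<theta>) xs"
proof -
  interpret prob_space "label_sample \<alpha> \<theta>" by (rule prob_space_label_sample[OF \<alpha> \<theta>])
  let ?n = "length xs" and ?c = "segment_prob (seat_weight \<alpha> \<theta>) xs"
  let ?D = "\<lambda>m. {X. seat X m \<noteq> X m}"
  have [measurable]: "(\<lambda>X. X m) \<in> (seqs :: (nat \<Rightarrow> nat) measure) \<rightarrow>\<^sub>M count_space UNIV" for m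
    by (rule measurable_coordinate)
  have [measurable]: "(\<lambda>X. seat X m) \<in> (seqs :: (nat \<Rightarrow> nat) measure) \<rightarrow>\<^sub>M count_space UNIV" for m
    by (rule measurable_compose[OF measurable_seat measurable_coordinate])
  have D: "?D m \<in> events" for m
  proof -
    have "{X \<in> space seqs. seat X m \<noteq> X m} \<in> sets seqs" by measurable
    then show ?thesis by simp
  qed
  have sh [measurable]: "(\<lambda>X n. X (n + N)) \<in> (seqs :: (nat \<Rightarrow> nat) measure) \<rightarrow>\<^sub>M seqs"
    "(\<lambda>X n. seat X (n + N)) \<in> (seqs :: (nat \<Rightarrow> nat) measure) \<rightarrow>\<^sub>M seqs" for N
    by (rule measurable_seqs_coordinatewise, measurable)+
  have A: "{X. (\<lambda>n. X (n + N)) \<in> pattern xs} \<in> events" and B: "{X. (\<lambda>n. seat X (n + N)) \<in> pattern xs} \<in> events" for N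
  proof -
    have "{X \<in> space seqs. (\<lambda>n. X (n + N)) \<in> pattern xs} \<in> sets (seqs :: (nat \<Rightarrow> nat) measure)"
      "{X \<in> space seqs. (\<lambda>n. seat X (n + N)) \<in> pattern xs} \<in> sets (seqs :: (nat \<Rightarrow> nat) measure)"
      by measurable
    then show "{X. (\<lambda>n. X (n + N)) \<in> pattern xs} \<in> events" "{X. (\<lambda>n. seat X (n + N)) \<in> pattern xs} \<in> events"
      by simp_all
  qed
  have stat: "prob {X. (\<lambda>n. X (n + N)) \<in> pattern xs} = prob (pattern xs)" for N
  proof -
    have "prob (pattern xs) = measure (distr (label_sample \<alpha> \<theta>) seqs (\<lambda>X n. X (n + N))) (pattern xs)"
      by (simp add: label_sample_shift)
    also have "\<dots> = prob {X. (\<lambda>n. X (n + N)) \<in> pattern xs}"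
      by (subst measure_distr) (auto simp: vimage_def)
    finally show ?thesis by simp
  qed
  have union: "prob (\<Union>i<?n. ?D (i + N)) \<le> (\<Sum>i<?n. prob (?D (i + N)))" for N
    using D by (intro finite_measure_subadditive_finite) auto
  have UD: "(\<Union>i<?n. ?D (i + N)) \<in> events" for N using D by auto
  have same: "(\<lambda>n. X (n + N)) \<in> pattern xs \<longleftrightarrow> (\<lambda>n. seat X (n + N)) \<in> pattern xs"
    if "X \<notin> (\<Union>i<?n. ?D (i + N))" for X N
    using that by (auto simp: pattern_def)
  \<comment> \<open>Positions \<open>N, N + 1, \<dots>\<close> are compared, and \<open>N\<close> tends to infinity.\<close>
  have le1: "prob (pattern xs) \<le> ?c + (\<Sum>i<?n. prob (?D (i + N)))" for N
  proof -
    have "prob (pattern xs) \<le> prob ({X. (\<lambda>n. seat X (n + N)) \<in> pattern xs} \<union> (\<Union>i<?n. ?D (i + N)))"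
      unfolding stat[of N, symmetric] using same B UD by (intro finite_measure_mono) auto
    also have "\<dots> \<le> prob {X. (\<lambda>n. seat X (n + N)) \<in> pattern xs} + prob (\<Union>i<?n. ?D (i + N))"
      using B UD by (intro measure_Un_le) auto
    finally show ?thesis using union[of N] by (simp add: measure_seat_pattern_shift)
  qed
  have le2: "?c \<le> prob (pattern xs) + (\<Sum>i<?n. prob (?D (i + N)))" for N
  proof -
    have "?c \<le> prob ({X. (\<lambda>n. X (n + N)) \<in> pattern xs} \<union> (\<Union>i<?n. ?D (i + N)))"
      unfolding measure_seat_pattern_shift[of N, symmetric] using same A UD by (intro finite_measure_mono) auto
    also have "\<dots> \<le> prob {X. (\<lambda>n. X (n + N)) \<in> pattern xs} + prob (\<Union>i<?n. ?D (i + N))"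
      using A UD by (intro measure_Un_le) auto
    finally show ?thesis using union[of N] by (simp add: stat)
  qed
  have "(\<lambda>N. \<Sum>i<?n. prob (?D (i + N))) \<longlonglongrightarrow> (\<Sum>i<?n. 0)"
    by (intro tendsto_sum) (use LIMSEQ_ignore_initial_segment[OF prob_seat_differs_tendsto_0] in \<open>simp add: add.commute\<close>)
  then have lim: "(\<lambda>N. \<Sum>i<?n. prob (?D (i + N))) \<longlonglongrightarrow> 0" by simp
  show ?thesis
  proof (rule antisym)
    have "(\<lambda>N. ?c + (\<Sum>i<?n. prob (?D (i + N)))) \<longlonglongrightarrow> ?c + 0" by (intro tendsto_add tendsto_const lim)
    then show "prob (pattern xs) \<le> ?c" using le1 by (intro LIMSEQ_le_const) auto
    have "(\<lambda>N. prob (pattern xs) + (\<Sum>i<?n. prob (?D (i + N)))) \<longlonglongrightarrow> prob (pattern xs) + 0"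
      by (intro tendsto_add tendsto_const lim)
    then show "?c \<le> prob (pattern xs)" using le2 by (intro LIMSEQ_le_const) auto
  qed
qed

end

lemma measurable_relabel [measurable]: "relabel \<in> (seqs :: (nat \<Rightarrow> nat) measure) \<rightarrow>\<^sub>M seqs"
proof (rule measurable_seqs_coordinatewise)
  fix n
  show "(\<lambda>K. relabel K n) \<in> (seqs :: (nat \<Rightarrow> nat) measure) \<rightarrow>\<^sub>M count_space UNIV"
  proof (rule measurable_determined_by_initial[where n = "Suc n"])
    fix x y :: "nat \<Rightarrow> nat" assume xy: "\<And>m. m < Suc n \<Longrightarrow> x m = y m"
    have le: "(LEAST m. z m = z n) \<le> n" for z :: "nat \<Rightarrow> nat" by (rule Least_le) simp
    have "(LEAST m. x m = x n) = (LEAST m. y m = y n)"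
    proof (rule antisym)
      have "x (LEAST m. y m = y n) = x n"
        using LeastI[of "\<lambda>m. y m = y n" n] xy le[of y] by (simp add: le_imp_less_Suc)
      then show "(LEAST m. x m = x n) \<le> (LEAST m. y m = y n)" by (rule Least_le)
      have "y (LEAST m. x m = x n) = y n"
        using LeastI[of "\<lambda>m. x m = x n" n] xy le[of x] by (simp add: le_imp_less_Suc)
      then show "(LEAST m. y m = y n) \<le> (LEAST m. x m = x n)" by (rule Least_le)
    qed
    then show "relabel x n = relabel y n"
      unfolding relabel_def using le[of y] xy by (intro arg_cong[where f = card] image_cong) auto
  qed
qed

lemma relabel_label_sample:
  assumes \<alpha>: "0 \<le> \<alpha>" "\<alpha> < 1" and \<theta>: "\<theta> > - \<alpha>"
  shows "distr (label_sample \<alpha> \<theta>) seqs relabel = crp_law \<alpha> \<theta>"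
proof (rule seqs_measure_eqI)
  show "prob_space (distr (label_sample \<alpha> \<theta>) seqs relabel)"
    by (rule prob_space.prob_space_distr[OF prob_space_label_sample[OF assms]]) measurable
  show "prob_space (crp_law \<alpha> \<theta>)" by (rule prob_space_crp_law[OF assms])
  fix xs
  have eq: "relabel -` cylinder xs \<inter> space (label_sample \<alpha> \<theta>) = (if growth_list xs then pattern xs else {})"
  proof (cases "growth_list xs")
    case True
    have nth: "restricted_growth (\<lambda>i. if i < length xs then xs ! i else 0)"
      unfolding restricted_growth_def
    proof
      fix n
      show "(if n < length xs then xs ! n else 0) \<le> card ((\<lambda>i. if i < length xs then xs ! i else 0) ` {..<n})"
      proof (cases "n < length xs")
        case n: True
        then have "(\<lambda>i. if i < length xs then xs ! i else 0) ` {..<n} = set (take n xs)"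
          by (auto simp: nth_image[symmetric])
        then show ?thesis using True n by (simp add: growth_list_def)
      qed simp
    qed
    have "relabel X \<in> cylinder xs \<longleftrightarrow> X \<in> pattern xs" for X :: "nat \<Rightarrow> nat"
    proof
      assume "relabel X \<in> cylinder xs"
      then have r: "relabel X i = xs ! i" if "i < length xs" for i
        using that by (simp add: cylinder_def initial_eq_iff)
      have "X i = X j \<longleftrightarrow> xs ! i = xs ! j" if "i < length xs" "j < length xs" for i j
        using r[OF that(1)] r[OF that(2)] relabel_eq_iff[of X i j] by simp
      then show "X \<in> pattern xs" by (simp add: pattern_def)
    next
      assume X: "X \<in> pattern xs"
      have "relabel X i = (if i < length xs then xs ! i else 0)" if "i < length xs" for i
        by (rule restricted_growth_unique[OF restricted_growth_relabel nth _ that])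
           (use X in \<open>auto simp: relabel_eq_iff pattern_def\<close>)
      then show "relabel X \<in> cylinder xs" by (simp add: cylinder_def initial_eq_iff)
    qed
    then show ?thesis using True by auto
  next
    case False
    have "relabel X \<notin> cylinder xs" for X :: "nat \<Rightarrow> nat"
    proof
      assume "relabel X \<in> cylinder xs"
      then have "initial (length xs) (relabel X) = xs" by (simp add: cylinder_def)
      then show False using False growth_list_initial[OF restricted_growth_relabel, of "length xs" X] by simp
    qed
    then show ?thesis using False by auto
  qed
  have "measure (distr (label_sample \<alpha> \<theta>) seqs relabel) (cylinder xs) =
      measure (label_sample \<alpha> \<theta>) (if growth_list xs then pattern xs else {})"
    unfolding eq[symmetric] by (rule measure_distr) auto
  then show "measure (distr (label_sample \<alpha> \<theta>) seqs relabel) (cylinder xs) = measure (crp_law \<alpha> \<theta>) (cylinder xs)"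
    by (simp add: measure_crp_law_cylinder[OF assms] measure_label_sample_pattern[OF assms])
qed auto

lemma ranked_prob_sequence:
  assumes "x \<in> prob_sequences" "\<forall>n. 0 < x n"
  obtains \<pi> where "bij \<pi>" "ranked x = (\<lambda>n. x (\<pi> n))" "ranked x \<in> ranked_simplex"
proof -
  have "(x has_sum 1) UNIV"
    using assms sums_nonneg_iff_has_sum[of x 1] by (auto simp: prob_sequences_def)
  then have r: "is_decreasing_rearrangement UNIV x (ranked x)" "ranked x \<in> ranked_simplex"
    using decreasing_rearrangement_in_ranked_simplex[of "UNIV :: nat set" x] assms by auto
  from r(1) obtain \<pi> where "bij_betw \<pi> UNIV UNIV" "\<forall>n. ranked x n = x (\<pi> n)"
    unfolding is_decreasing_rearrangement_def by blast
  then show ?thesis using that[of \<pi>] r(2) by (simp add: fun_eq_iff)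
qed

lemma ranked_ranked_simplex: "y \<in> ranked_simplex \<Longrightarrow> ranked y = y"
  by (rule decreasing_rearrangement_eqI)
     (auto simp: ranked_simplex_def is_decreasing_rearrangement_def intro: exI[of _ id])

definition paintbox :: "real \<Rightarrow> real \<Rightarrow> (nat \<Rightarrow> nat) measure" where
  "paintbox \<alpha> \<theta> = PD \<alpha> \<theta> \<bind> (\<lambda>y. iid (index_pmf y))"

lemma index_kernel_PD: "(\<lambda>x. iid (index_pmf x)) \<in> PD \<alpha> \<theta> \<rightarrow>\<^sub>M subprob_algebra seqs"
  using measurable_prob_algebraD[OF index_kernel] by (simp cong: measurable_cong_sets)

lemma sets_paintbox [simp, measurable_cong]: "sets (paintbox \<alpha> \<theta>) = sets seqs"
  unfolding paintbox_def by (rule sets_bind) auto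

lemma space_paintbox [simp]: "space (paintbox \<alpha> \<theta>) = UNIV"
  using sets_eq_imp_space_eq[OF sets_paintbox] by simp

text \<open>Renaming the labels does not affect the partition.\<close>
lemma relabel_iid_ranked:
  assumes x: "x \<in> prob_sequences" "\<forall>n. 0 < x n"
  shows "distr (iid (index_pmf (ranked x))) seqs relabel = distr (iid (label_pmf x)) seqs relabel"
proof -
  obtain \<pi> where \<pi>: "bij \<pi>" "ranked x = (\<lambda>n. x (\<pi> n))" "ranked x \<in> ranked_simplex"
    using ranked_prob_sequence[OF x] .
  have rank_prob: "ranked x \<in> prob_sequences" using \<pi>(3) by (simp add: ranked_simplex_eq)
  have "label_pmf x = map_pmf \<pi> (index_pmf (ranked x))"
  proof (rule pmf_eqI)
    fix k
    obtain n where n: "k = \<pi> n" using \<pi>(1) by (metis bij_pointE)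
    have "pmf (map_pmf \<pi> (index_pmf (ranked x))) (\<pi> n) = pmf (index_pmf (ranked x)) n"
      by (rule pmf_map_inj') (use \<pi>(1) in \<open>simp add: bij_def\<close>)
    also have "\<dots> = ranked x n" unfolding index_pmf_eq_label_pmf[OF \<pi>(3)] by (rule pmf_label_pmf[OF rank_prob])
    also have "\<dots> = x (\<pi> n)" by (simp only: \<pi>(2))
    finally show "pmf (label_pmf x) k = pmf (map_pmf \<pi> (index_pmf (ranked x))) k"
      by (simp add: n pmf_label_pmf[OF x(1)])
  qed
  then have "iid (label_pmf x) = distr (iid (index_pmf (ranked x))) seqs (\<lambda>X n. \<pi> (X n))"
    by (simp add: iid_map)
  then have "distr (iid (label_pmf x)) seqs relabel = distr (iid (index_pmf (ranked x))) seqs (relabel \<circ> (\<lambda>X n. \<pi> (X n)))"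
  proof (simp only:, intro distr_distr)
    show "(\<lambda>X n. \<pi> (X n)) \<in> iid (index_pmf (ranked x)) \<rightarrow>\<^sub>M seqs"
      by (rule measurable_seqs_coordinatewise) (rule measurable_compose[OF measurable_iid_coordinate], simp)
  qed measurable
  also have "relabel \<circ> (\<lambda>X n. \<pi> (X n)) = relabel"
    using relabel_inj[of \<pi>] \<pi>(1) by (auto simp: bij_def fun_eq_iff)
  finally show ?thesis by simp
qed

text \<open>Kingman's paintbox: the order of the PD weights is irrelevant for the partition, so GEM weights serve
  as well, and for these \<open>relabel_label_sample\<close> applies.\<close>
lemma relabel_paintbox:
  assumes \<alpha>: "0 \<le> \<alpha>" "\<alpha> < 1" and \<theta>: "\<theta> > - \<alpha>"
  shows "distr (paintbox \<alpha> \<theta>) seqs relabel = crp_law \<alpha> \<theta>"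
proof -
  have "distr (paintbox \<alpha> \<theta>) seqs relabel = distr (label_sample \<alpha> \<theta>) seqs relabel"
  proof (rule measure_eqI)
    fix A :: "(nat \<Rightarrow> nat) set" assume "A \<in> sets (distr (paintbox \<alpha> \<theta>) seqs relabel)"
    then have A [measurable]: "A \<in> sets seqs" by simp
    let ?B = "relabel -` A :: (nat \<Rightarrow> nat) set"
    have B: "?B \<in> sets seqs" using measurable_sets[OF measurable_relabel A] by simp
    have m: "(\<lambda>y. emeasure (iid (index_pmf y)) ?B) \<in> borel_measurable seq_space"
      using measurable_prob_algebraD[OF index_kernel] B by (rule measurable_emeasure_kernel)
    have "emeasure (distr (paintbox \<alpha> \<theta>) seqs relabel) A = emeasure (paintbox \<alpha> \<theta>) ?B"
      by (simp add: emeasure_distr)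
    also have "\<dots> = (\<integral>\<^sup>+y. emeasure (iid (index_pmf y)) ?B \<partial>PD \<alpha> \<theta>)"
      unfolding paintbox_def by (rule emeasure_bind[OF _ index_kernel_PD B]) simp
    also have "\<dots> = (\<integral>\<^sup>+x. emeasure (iid (index_pmf (ranked x))) ?B \<partial>GEM \<alpha> \<theta>)"
      unfolding PD_def by (rule nn_integral_distr) (use m in simp_all)
    also have "\<dots> = (\<integral>\<^sup>+x. emeasure (iid (label_pmf x)) ?B \<partial>GEM \<alpha> \<theta>)"
    proof (rule nn_integral_cong_AE)
      show "AE x in GEM \<alpha> \<theta>. emeasure (iid (index_pmf (ranked x))) ?B = emeasure (iid (label_pmf x)) ?B"
        using AE_GEM[OF \<alpha> \<theta>]
      proof (rule eventually_mono)
        fix x assume "x \<in> prob_sequences \<and> (\<forall>n. 0 < x n)"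
        then have "emeasure (distr (iid (index_pmf (ranked x))) seqs relabel) A = emeasure (distr (iid (label_pmf x)) seqs relabel) A"
          using relabel_iid_ranked[of x] by simp
        then show "emeasure (iid (index_pmf (ranked x))) ?B = emeasure (iid (label_pmf x)) ?B"
          by (simp add: emeasure_distr)
      qed
    qed
    also have "\<dots> = emeasure (label_sample \<alpha> \<theta>) ?B"
      unfolding label_sample_def by (rule emeasure_bind[OF _ label_kernel_GEM B, symmetric]) simp
    also have "\<dots> = emeasure (distr (label_sample \<alpha> \<theta>) seqs relabel) A"
      by (simp add: emeasure_distr)
    finally show "emeasure (distr (paintbox \<alpha> \<theta>) seqs relabel) A = emeasure (distr (label_sample \<alpha> \<theta>) seqs relabel) A" .
  qed simp
  then show ?thesis by (simp add: relabel_label_sample[OF \<alpha> \<theta>])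
qed

lemma AE_PD:
  assumes \<alpha>: "0 \<le> \<alpha>" "\<alpha> < 1" and \<theta>: "\<theta> > - \<alpha>"
  shows "AE y in PD \<alpha> \<theta>. y \<in> ranked_simplex"
proof -
  have "AE x in GEM \<alpha> \<theta>. ranked x \<in> ranked_simplex"
    using AE_GEM[OF assms] by (rule eventually_mono) (metis ranked_prob_sequence)
  then show ?thesis
    unfolding PD_def by (subst AE_distr_iff) auto
qed

text \<open>The first block, in the order of appearance, is the one chosen by the first sample.  In this way
  block 0 becomes a size-biased pick.\<close>
lemma paintbox_sample:
  assumes y: "y \<in> ranked_simplex" and freq: "\<forall>k. has_frequency X k (y k)"
  shows "ranked (frequency (relabel X)) = y"
    and "fragment (frequency (relabel X)) 0 \<eta> = fragment y (X 0) \<eta>"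
proof -
  have F: "frequency X = y" using freq by (intro ext frequency_eqI) auto
  have range: "range X = UNIV"
    using frequency_not_in_range[of _ X] y by (auto simp: F ranked_simplex_def) (metis less_irrefl UNIV_I rangeI)
  show "ranked (frequency (relabel X)) = y"
    using ranked_frequency_relabel[of X] by (simp add: range F ranked_ranked_simplex[OF y])
  define \<sigma> where "\<sigma> k = relabel X (SOME n. X n = k)" for k
  have \<sigma>_X: "\<sigma> (X m) = relabel X m" for m unfolding \<sigma>_def by (rule relabel_bij_apply)
  have bij: "bij \<sigma>"
    using relabel_bij[of X] range_relabel[of X] unfolding \<sigma>_def by (simp add: range)
  have "frequency (relabel X) (\<sigma> k) = y k" for k
  proof -
    obtain m where "X m = k" using range by (metis surjD)
    then show ?thesis using \<sigma>_X[of m] frequency_relabel[of X m] by (simp add: F)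
  qed
  moreover have "\<sigma> (X 0) = 0" using \<sigma>_X[of 0] restricted_growth_0[OF restricted_growth_relabel, of X] by simp
  ultimately show "fragment (frequency (relabel X)) 0 \<eta> = fragment y (X 0) \<eta>"
    using fragment_reindex[OF bij bij_id, of "frequency (relabel X)" "X 0" \<eta>] by (simp add: id_def)
qed

section \<open>Assembling the tree from independent parts\<close>

text \<open>Reads an initial segment of the parents from left to right and keeps track of the block labels and of
  the parents within each block, counted in the numbering of the block.\<close>
definition decode_step :: "nat list \<times> (nat \<Rightarrow> nat list) \<Rightarrow> nat \<Rightarrow> nat list \<times> (nat \<Rightarrow> nat list)" where
  "decode_step s v = (case s of (ls, E) \<Rightarrow>
     if v = 0 then (ls @ [card (set ls)], E)
     else let j = ls ! (v - 1) in (ls @ [j], E(j := E j @ [occurrences (\<lambda>m. ls ! m) j (v - 1)])))"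

definition decode :: "nat list \<Rightarrow> nat list \<times> (nat \<Rightarrow> nat list)" where
  "decode xs = foldl decode_step ([], \<lambda>_. []) xs"

abbreviation "block_labels xs \<equiv> fst (decode xs)"
abbreviation "block_trees xs \<equiv> snd (decode xs)"

lemma decode_Nil [simp]: "decode [] = ([], \<lambda>_. [])"
  by (simp add: decode_def)

lemma block_labels_snoc:
  "block_labels (xs @ [v]) = block_labels xs @ [if v = 0 then card (set (block_labels xs)) else block_labels xs ! (v - 1)]"
  by (simp add: decode_def decode_step_def Let_def split: prod.split)

lemma block_trees_snoc_0: "block_trees (xs @ [0]) = block_trees xs"
  by (simp add: decode_def decode_step_def Let_def split: prod.split)

lemma block_trees_snoc_Suc:
  "block_trees (xs @ [Suc i]) = (block_trees xs)(block_labels xs ! i :=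
     block_trees xs (block_labels xs ! i) @ [occurrences (\<lambda>m. block_labels xs ! m) (block_labels xs ! i) i])"
  by (simp add: decode_def decode_step_def Let_def split: prod.split)

lemma length_block_labels [simp]: "length (block_labels xs) = length xs"
  by (induction xs rule: rev_induct) (simp_all add: block_labels_snoc)

lemma count_list_eq_occurrences: "count_list xs v = occurrences (\<lambda>m. xs ! m) v (length xs)"
proof -
  have "initial (length xs) (\<lambda>m. xs ! m) = xs" by (rule nth_equalityI) auto
  then show ?thesis using count_list_initial_eq[of "length xs" "\<lambda>m. xs ! m" v] by simp
qed

lemma occurrences_nth_append: "i \<le> length xs \<Longrightarrow> occurrences (\<lambda>m. (xs @ ys) ! m) v i = occurrences (\<lambda>m. xs ! m) v i"
  by (rule occurrences_cong) (simp add: nth_append)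

lemma decode_invariants:
  assumes "parent_list xs"
  shows "growth_list (block_labels xs)"
    and "length (block_trees xs j) = count_list (block_labels xs) j - 1"
    and "parent_list (block_trees xs j)"
    and "count_list xs 0 = card (set (block_labels xs))"
proof -
  have "growth_list (block_labels xs) \<and> (\<forall>j. length (block_trees xs j) = count_list (block_labels xs) j - 1) \<and>
      (\<forall>j. parent_list (block_trees xs j)) \<and> count_list xs 0 = card (set (block_labels xs))"
    using assms
  proof (induction xs rule: rev_induct)
    case (snoc v xs)
    let ?ls = "block_labels xs"
    have IH: "growth_list ?ls" "\<And>j. length (block_trees xs j) = count_list ?ls j - 1"
      "\<And>j. parent_list (block_trees xs j)" "count_list xs 0 = card (set ?ls)" and v: "v \<le> length xs"
      using snoc by auto
    show ?case
    proof (cases v)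
      case 0
      have new: "card (set ?ls) \<notin> set ?ls" using growth_list_set[OF IH(1)] by (metis lessThan_iff less_irrefl)
      then have "count_list ?ls (card (set ?ls)) = 0" by (simp add: count_list_0_iff)
      then show ?thesis using 0 IH new by (auto simp: block_labels_snoc block_trees_snoc_0)
    next
      case (Suc i)
      then have i: "i < length xs" using v by simp
      let ?j = "?ls ! i"
      have mem: "?j \<in> set ?ls" using i by simp
      have less: "occurrences (\<lambda>m. ?ls ! m) ?j i < count_list ?ls ?j"
        using i by (simp add: count_list_eq_occurrences occurrences_less)
      have "?j \<le> card (set ?ls)" using mem growth_list_set[OF IH(1)] by (metis lessThan_iff less_imp_le)
      moreover have "parent_list (block_trees xs ?j @ [occurrences (\<lambda>m. ?ls ! m) ?j i])"
        using IH(3)[of ?j] less IH(2)[of ?j] by simp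
      ultimately show ?thesis
        using Suc IH mem less by (auto simp: block_labels_snoc block_trees_snoc_Suc insert_absorb)
    qed
  qed (simp add: parent_list_def)
  then show "growth_list (block_labels xs)" "length (block_trees xs j) = count_list (block_labels xs) j - 1"
    "parent_list (block_trees xs j)" "count_list xs 0 = card (set (block_labels xs))" by auto
qed

lemma parent_list_bound: "parent_list xs \<Longrightarrow> v \<in> set xs \<Longrightarrow> v < length xs"
  by (metis in_set_conv_nth le_less_trans parent_list_def)

text \<open>Children of a vertex lie in its own block; this is why its weight can be computed inside the block.\<close>
lemma count_list_block_trees:
  assumes "parent_list xs" "i < length xs"
  shows "count_list xs (Suc i) =
    count_list (block_trees xs (block_labels xs ! i)) (occurrences (\<lambda>m. block_labels xs ! m) (block_labels xs ! i) i)"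
  using assms
proof (induction xs arbitrary: i rule: rev_induct)
  case (snoc v xs)
  let ?ls = "block_labels xs" and ?ls' = "block_labels (xs @ [v])"
  have xs: "parent_list xs" and v: "v \<le> length xs" using snoc.prems by auto
  have occ: "occurrences (\<lambda>m. ?ls' ! m) j k = occurrences (\<lambda>m. ?ls ! m) j k" if "k \<le> length xs" for j k
    unfolding block_labels_snoc using that by (intro occurrences_nth_append) simp
  show ?case
  proof (cases "i = length xs")
    case True
    let ?j = "?ls' ! i"
    have "Suc i \<notin> set (xs @ [v])" using parent_list_bound[OF snoc.prems(1), of "Suc i"] True by auto
    then have "count_list (xs @ [v]) (Suc i) = 0" by (rule count_list_0_iff[THEN iffD2])
    moreover have "occurrences (\<lambda>m. ?ls' ! m) ?j i = length (block_trees (xs @ [v]) ?j)"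
    proof -
      have "occurrences (\<lambda>m. ?ls' ! m) ?j i = count_list ?ls ?j"
        using True by (simp add: occ count_list_eq_occurrences)
      moreover have "count_list ?ls' ?j = Suc (count_list ?ls ?j)"
        using True by (simp add: block_labels_snoc nth_append)
      ultimately show ?thesis using decode_invariants(2)[OF snoc.prems(1), of ?j] by simp
    qed
    then have "occurrences (\<lambda>m. ?ls' ! m) ?j i \<notin> set (block_trees (xs @ [v]) ?j)"
      using parent_list_bound[OF decode_invariants(3)[OF snoc.prems(1)]] by (metis less_irrefl)
    then have "count_list (block_trees (xs @ [v]) ?j) (occurrences (\<lambda>m. ?ls' ! m) ?j i) = 0"
      by (rule count_list_0_iff[THEN iffD2])
    ultimately show ?thesis by simp
  next
    case False
    then have i: "i < length xs" using snoc.prems by simp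
    have lab: "?ls' ! i = ?ls ! i" using i by (simp add: block_labels_snoc nth_append)
    have IH: "count_list xs (Suc i) = count_list (block_trees xs (?ls ! i)) (occurrences (\<lambda>m. ?ls ! m) (?ls ! i) i)"
      by (rule snoc.IH[OF xs i])
    show ?thesis
    proof (cases v)
      case 0
      then show ?thesis using IH occ[of i] i unfolding lab by (simp add: block_trees_snoc_0)
    next
      case (Suc k)
      then have k: "k < length xs" using v by simp
      have rank_eq: "occurrences (\<lambda>m. ?ls ! m) (?ls ! i) k = occurrences (\<lambda>m. ?ls ! m) (?ls ! i) i \<longleftrightarrow> k = i"
        if "?ls ! k = ?ls ! i"
      proof (cases i k rule: linorder_cases)
        case less
        have "occurrences (\<lambda>m. ?ls ! m) (?ls ! i) i < occurrences (\<lambda>m. ?ls ! m) (?ls ! i) k"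
          by (rule occurrences_less[OF less]) simp
        then show ?thesis using less by simp
      next
        case greater
        then show ?thesis using occurrences_less[OF greater, of "\<lambda>m. ?ls ! m" "?ls ! i", OF that] by simp
      qed simp
      show ?thesis
        unfolding lab occ[OF less_imp_le[OF i]] using IH rank_eq Suc
        by (auto simp: block_trees_snoc_Suc)
    qed
  qed
qed simp

text \<open>Decoding inverts the assembling of a tree, on initial segments.\<close>
lemma initial_assemble_iff:
  assumes L: "restricted_growth L" and e: "\<forall>j. parent_sequence (e j)" and "parent_list xs"
  shows "initial (length xs) (assemble L e) = xs \<longleftrightarrow> initial (length xs) L = block_labels xs \<and>
    (\<forall>j. initial (length (block_trees xs j)) (e j) = block_trees xs j)"
  using assms(3)
proof (induction xs rule: rev_induct)
  case (snoc v xs)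
  let ?n = "length xs" and ?ls = "block_labels xs" and ?E = "block_trees xs"
  have xs: "parent_list xs" and v: "v \<le> ?n" using snoc.prems by auto
  have IH: "initial ?n (assemble L e) = xs \<longleftrightarrow> initial ?n L = ?ls \<and> (\<forall>j. initial (length (?E j)) (e j) = ?E j)"
    by (rule snoc.IH[OF xs])
  have "initial (length (xs @ [v])) (assemble L e) = xs @ [v] \<longleftrightarrow>
      (initial ?n L = ?ls \<and> (\<forall>j. initial (length (?E j)) (e j) = ?E j)) \<and> assemble L e ?n = v"
    using IH by auto
  also have "\<dots> \<longleftrightarrow> initial (length (xs @ [v])) L = block_labels (xs @ [v]) \<and>
    (\<forall>j. initial (length (block_trees (xs @ [v]) j)) (e j) = block_trees (xs @ [v]) j)"
  proof (cases "initial ?n L = ?ls")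
    case False
    then have "initial (length (xs @ [v])) L \<noteq> block_labels (xs @ [v])" by (simp add: block_labels_snoc)
    then show ?thesis using False by blast
  next
    case True
    have occ: "occurrences L j i = occurrences (\<lambda>m. ?ls ! m) j i" if "i \<le> ?n" for i j
      by (rule occurrences_cong) (use that True nth_initial[of _ ?n L] in auto)
    have L_eq: "L i = ?ls ! i" if "i < ?n" for i using True nth_initial[OF that, of L] by simp
    have init: "initial (length (xs @ [v])) L = block_labels (xs @ [v]) \<longleftrightarrow>
        L ?n = (if v = 0 then card (set ?ls) else ?ls ! (v - 1))"
      using True by (simp add: block_labels_snoc)
    have set_ls: "set ?ls = L ` {..<?n}" using True set_initial[of ?n L] by simp
    show ?thesis
    proof (cases v)
      case 0
      have "assemble L e ?n = 0 \<longleftrightarrow> L ?n = card (set ?ls)"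
        unfolding assemble_eq_0_iff set_ls
        using restricted_growth_new[OF L, of ?n] restricted_growth_image[OF L, of ?n]
        by (metis lessThan_iff less_irrefl)
      then show ?thesis using 0 True init by (auto simp: block_trees_snoc_0)
    next
      case (Suc i)
      then have i: "i < ?n" using v by simp
      let ?j = "?ls ! i"
      have pos: "0 < occurrences L ?j ?n"
        using occurrences_less[OF i, of L ?j] L_eq[OF i] by simp
      then obtain r where r: "occurrences L ?j ?n = Suc r" by (cases "occurrences L ?j ?n") auto
      have len: "length (?E ?j) = r"
        using decode_invariants(2)[OF xs, of ?j] r by (simp add: count_list_eq_occurrences occ)
      have "assemble L e ?n = Suc i \<longleftrightarrow> L ?n = ?j \<and> e ?j r = occurrences L ?j i"
      proof
        assume as: "assemble L e ?n = Suc i"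
        then obtain r' where r': "occurrences L (L ?n) ?n = Suc r'"
          by (metis assemble_eq_0_iff nat.distinct(1) not0_implies_Suc occurrences_eq_0_iff)
        note par = assemble_parent[OF e r']
        have "occurrence L (L ?n) (e (L ?n) r') = i" using as par(1) by simp
        then have "L ?n = ?j" "occurrences L (L ?n) i = e (L ?n) r'" using par(3,4) L_eq[OF i] by auto
        then show "L ?n = ?j \<and> e ?j r = occurrences L ?j i" using r r' by simp
      next
        assume "L ?n = ?j \<and> e ?j r = occurrences L ?j i"
        moreover from this have "occurrence L ?j (e ?j r) = i" using L_eq[OF i] by (intro occurrence_eqI) auto
        ultimately show "assemble L e ?n = Suc i" using r by (simp add: assemble_def Let_def)
      qed
      then have as_iff: "assemble L e ?n = v \<longleftrightarrow> L ?n = ?j \<and> e ?j (length (?E ?j)) = occurrences (\<lambda>m. ?ls ! m) ?j i"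
        using Suc len occ[of i ?j] i by simp
      show ?thesis
        unfolding as_iff init using True Suc by (auto simp: block_trees_snoc_Suc)
    qed
  qed
  finally show ?case .
qed simp

text \<open>A vertex joins a block of size \<open>m\<close> with a probability proportional to \<open>m - \<alpha>\<close>, which is the total
  weight in the \<open>(\<alpha>, 1 - \<alpha>)\<close> tree inside the block; the two factors cancel.\<close>
lemma assemble_probability:
  assumes \<alpha>: "0 \<le> \<alpha>" "\<alpha> < 1" and \<theta>: "\<theta> > - \<alpha>" and "parent_list xs" "length xs \<le> N"
  shows "segment_prob (seat_weight \<alpha> \<theta>) (block_labels xs) * (\<Prod>j<N. segment_prob (tree_step \<alpha> (1 - \<alpha>)) (block_trees xs j)) =
    segment_prob (tree_step \<alpha> \<theta>) xs"
  using assms(4,5)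
proof (induction xs rule: rev_induct)
  case (snoc v xs)
  let ?n = "length xs" and ?ls = "block_labels xs" and ?E = "block_trees xs"
  let ?P = "\<lambda>E. \<Prod>j<N. segment_prob (tree_step \<alpha> (1 - \<alpha>)) (E j)"
  have xs: "parent_list xs" and v: "v \<le> ?n" using snoc.prems by auto
  note inv = decode_invariants[OF xs]
  have IH: "segment_prob (seat_weight \<alpha> \<theta>) ?ls * ?P ?E = segment_prob (tree_step \<alpha> \<theta>) xs"
    using snoc by simp
  show ?case
  proof (cases v)
    case 0
    have new: "card (set ?ls) \<notin> set ?ls" using growth_list_set[OF inv(1)] by (metis lessThan_iff less_irrefl)
    have "seat_weight \<alpha> \<theta> ?ls (card (set ?ls)) = tree_step \<alpha> \<theta> xs 0"
    proof (cases "xs = []")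
      case False
      then have "?ls \<noteq> []" using length_block_labels[of xs] by (metis length_0_conv)
      then show ?thesis using False new inv(4) by (simp add: seat_weight_def tree_step_def)
    qed (simp add: seat_weight_def tree_step_def)
    then show ?thesis using 0 IH by (simp add: block_labels_snoc block_trees_snoc_0 mult_ac)
  next
    case (Suc i)
    then have i: "i < ?n" and ne: "xs \<noteq> []" using v by auto
    let ?j = "?ls ! i"
    let ?r = "occurrences (\<lambda>m. ?ls ! m) ?j i"
    have mem: "?j \<in> set ?ls" using i by simp
    have ne': "?ls \<noteq> []" using mem by auto
    have "?j < card (set ?ls)" using mem growth_list_set[OF inv(1)] by blast
    also have "\<dots> \<le> ?n" using card_length[of ?ls] by simp
    finally have jN: "?j < N" using snoc.prems by simp
    have cnt: "count_list ?ls ?j = Suc (length (?E ?j))"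
      using inv(2)[of ?j] mem count_list_0_iff[of ?ls ?j] by simp
    have less: "?r \<le> length (?E ?j)"
      using i cnt occurrences_less[of i ?n "\<lambda>m. ?ls ! m" ?j] by (simp add: count_list_eq_occurrences)
    have step: "tree_step \<alpha> (1 - \<alpha>) (?E ?j) ?r = (1 - \<alpha> + \<alpha> * count_list (?E ?j) ?r) / (1 - \<alpha> + length (?E ?j))"
    proof (cases "?E ?j = []")
      case True
      then show ?thesis using less \<alpha> by (simp add: tree_step_def)
    next
      case False
      then show ?thesis using less by (simp add: tree_step_def)
    qed
    have "seat_weight \<alpha> \<theta> ?ls ?j * tree_step \<alpha> (1 - \<alpha>) (?E ?j) ?r =
        (1 - \<alpha> + \<alpha> * count_list (?E ?j) ?r) / (\<theta> + real ?n)"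
    proof -
      have "1 - \<alpha> + real (length (?E ?j)) \<noteq> 0" using \<alpha> by simp
      moreover have "seat_weight \<alpha> \<theta> ?ls ?j = (1 - \<alpha> + real (length (?E ?j))) / (\<theta> + real ?n)"
        using mem ne' cnt by (simp add: seat_weight_def algebra_simps)
      ultimately show ?thesis unfolding step by simp
    qed
    also have "\<dots> = tree_step \<alpha> \<theta> xs v"
      using Suc v ne count_list_block_trees[OF xs i] by (simp add: tree_step_def)
    finally have weight: "seat_weight \<alpha> \<theta> ?ls ?j * tree_step \<alpha> (1 - \<alpha>) (?E ?j) ?r = tree_step \<alpha> \<theta> xs v" .
    have "?P (block_trees (xs @ [v])) = ?P ?E * tree_step \<alpha> (1 - \<alpha>) (?E ?j) ?r"
    proof -
      have "segment_prob (tree_step \<alpha> (1 - \<alpha>)) (block_trees (xs @ [v]) k) =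
          segment_prob (tree_step \<alpha> (1 - \<alpha>)) (?E k) * (if k = ?j then tree_step \<alpha> (1 - \<alpha>) (?E ?j) ?r else 1)" for k
        using Suc by (simp add: block_trees_snoc_Suc)
      then show ?thesis using jN by (simp add: prod.distrib)
    qed
    moreover have "segment_prob (seat_weight \<alpha> \<theta>) (block_labels (xs @ [v])) =
        segment_prob (seat_weight \<alpha> \<theta>) ?ls * seat_weight \<alpha> \<theta> ?ls ?j"
      using Suc by (simp add: block_labels_snoc)
    ultimately have "segment_prob (seat_weight \<alpha> \<theta>) (block_labels (xs @ [v])) * ?P (block_trees (xs @ [v])) =
        (segment_prob (seat_weight \<alpha> \<theta>) ?ls * ?P ?E) * (seat_weight \<alpha> \<theta> ?ls ?j * tree_step \<alpha> (1 - \<alpha>) (?E ?j) ?r)"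
      by (simp only: mult_ac)
    then show ?thesis by (simp only: IH weight segment_prob_snoc)
  qed
qed simp

lemma space_PiM_seqs [simp]: "space (Pi\<^sub>M UNIV (\<lambda>_::nat. seqs :: (nat \<Rightarrow> nat) measure)) = UNIV"
  by (simp add: space_PiM)

lemma measurable_assemble [measurable]:
  "(\<lambda>(L, e). assemble L e) \<in> seqs \<Otimes>\<^sub>M Pi\<^sub>M UNIV (\<lambda>_::nat. seqs) \<rightarrow>\<^sub>M seqs"
proof (rule measurable_seqs_coordinatewise)
  fix n
  let ?M = "(seqs :: (nat \<Rightarrow> nat) measure) \<Otimes>\<^sub>M Pi\<^sub>M UNIV (\<lambda>_::nat. seqs :: (nat \<Rightarrow> nat) measure)"
  have L [measurable]: "(\<lambda>x. fst x m) \<in> ?M \<rightarrow>\<^sub>M count_space UNIV" for m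
    by (rule measurable_compose[OF measurable_fst measurable_coordinate])
  have e [measurable]: "(\<lambda>x. snd x j m) \<in> ?M \<rightarrow>\<^sub>M count_space UNIV" for j m
  proof -
    have "(\<lambda>x. snd x j) \<in> ?M \<rightarrow>\<^sub>M seqs"
      by (rule measurable_compose[OF measurable_snd measurable_component_singleton]) simp
    then show ?thesis by (rule measurable_compose[OF _ measurable_coordinate])
  qed
  have occs [measurable]: "(\<lambda>x. occurrences (fst x) j m) \<in> ?M \<rightarrow>\<^sub>M count_space UNIV" for j m
    by (rule measurable_compose[OF measurable_fst measurable_occurrences])
  have occ [measurable]: "(\<lambda>x. occurrence (fst x) j r) \<in> ?M \<rightarrow>\<^sub>M count_space UNIV" for j r
    unfolding occurrence_def by measurable
  have 1 [measurable]: "(\<lambda>x. (\<lambda>r x. snd x j (r - 1)) (occurrences (fst x) j n) x) \<in> ?M \<rightarrow>\<^sub>M count_space UNIV" for j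
    by (rule measurable_compose_countable) measurable
  have 2 [measurable]: "(\<lambda>x. (\<lambda>s x. occurrence (fst x) j s) (snd x j (occurrences (fst x) j n - 1)) x) \<in> ?M \<rightarrow>\<^sub>M count_space UNIV" for j
    by (rule measurable_compose_countable) (use 1 in measurable)
  have "(\<lambda>x. (\<lambda>j x. if occurrences (fst x) j n = 0 then 0
      else Suc (occurrence (fst x) j (snd x j (occurrences (fst x) j n - 1)))) (fst x n) x) \<in> ?M \<rightarrow>\<^sub>M count_space UNIV"
    by (rule measurable_compose_countable) (use 2 in measurable)
  then show "(\<lambda>x. (case x of (L, e) \<Rightarrow> assemble L e) n) \<in> ?M \<rightarrow>\<^sub>M count_space UNIV"
    by (simp add: case_prod_beta assemble_def Let_def)
qed

lemma AE_pair_fst: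
  assumes "prob_space M" "prob_space N" "AE x in M. P x"
  shows "AE z in M \<Otimes>\<^sub>M N. P (fst z)"
proof -
  interpret N: prob_space N by fact
  have "AE x in distr (M \<Otimes>\<^sub>M N) M fst. P x"
    unfolding N.distr_pair_fst by (rule assms(3))
  then show ?thesis by (rule AE_distrD[rotated]) simp
qed

lemma distr_pair_snd_prob:
  assumes "prob_space M" "prob_space N"
  shows "distr (M \<Otimes>\<^sub>M N) N snd = N"
proof (rule measure_eqI)
  interpret M: prob_space M by fact
  interpret N: prob_space N by fact
  fix A assume A: "A \<in> sets (distr (M \<Otimes>\<^sub>M N) N snd)"
  then have "emeasure (distr (M \<Otimes>\<^sub>M N) N snd) A = emeasure (M \<Otimes>\<^sub>M N) (space M \<times> A)"
    using sets.sets_into_space by (subst emeasure_distr) (auto intro!: arg_cong[where f = "emeasure _"] simp: space_pair_measure)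
  then show "emeasure (distr (M \<Otimes>\<^sub>M N) N snd) A = emeasure N A"
    using A by (simp add: N.emeasure_pair_measure_Times M.emeasure_space_1)
qed simp

lemma AE_pair_snd:
  assumes "prob_space M" "prob_space N" "AE x in N. P x"
  shows "AE z in M \<Otimes>\<^sub>M N. P (snd z)"
proof -
  have "AE x in distr (M \<Otimes>\<^sub>M N) N snd. P x"
    unfolding distr_pair_snd_prob[OF assms(1,2)] by (rule assms(3))
  then show ?thesis by (rule AE_distrD[rotated]) simp
qed

definition component_masses :: "(nat \<Rightarrow> nat) \<Rightarrow> nat \<Rightarrow> real" where
  "component_masses a = ranked (frequency (label a))"

lemma measurable_component_masses [measurable]: "component_masses \<in> seqs \<rightarrow>\<^sub>M seq_space"
  unfolding component_masses_def[abs_def] by measurable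

definition block_tree_law :: "real \<Rightarrow> (nat \<Rightarrow> nat \<Rightarrow> nat) measure" where
  "block_tree_law \<alpha> = Pi\<^sub>M UNIV (\<lambda>_::nat. tree_law \<alpha> (1 - \<alpha>))"

lemma inner_parameter: "1 - \<alpha> > - \<alpha>" for \<alpha> :: real
  by simp

context
  fixes \<alpha> \<theta> :: real
  assumes \<alpha>: "0 \<le> \<alpha>" "\<alpha> < 1" and \<theta>: "\<theta> > - \<alpha>"
begin

lemma sets_block_tree_law [simp, measurable_cong]: "sets (block_tree_law \<alpha>) = sets (Pi\<^sub>M UNIV (\<lambda>_::nat. seqs))"
  unfolding block_tree_law_def by (intro sets_PiM_cong) (auto simp: sets_tree_law[OF \<alpha> inner_parameter])

lemma space_block_tree_law [simp]: "space (block_tree_law \<alpha>) = UNIV"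
  using sets_eq_imp_space_eq[OF sets_block_tree_law] by simp

lemma prob_space_block_tree_law: "prob_space (block_tree_law \<alpha>)"
  unfolding block_tree_law_def by (intro prob_space_PiM prob_space_tree_law[OF \<alpha> inner_parameter])

lemma AE_block_tree_law: "AE e in block_tree_law \<alpha>. \<forall>j. parent_sequence (e j)"
  unfolding AE_all_countable block_tree_law_def
  by (intro allI AE_PiM_component prob_space_tree_law AE_parent_sequence \<alpha> inner_parameter) simp

lemma measure_block_tree_law_box:
  "emeasure (block_tree_law \<alpha>) {e. \<forall>j<N. e j \<in> cylinder (E j)} =
    ennreal (\<Prod>j<N. segment_prob (tree_step \<alpha> (1 - \<alpha>)) (E j))"
proof -
  interpret T: prob_space "tree_law \<alpha> (1 - \<alpha>)" by (rule prob_space_tree_law[OF \<alpha> inner_parameter])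
  interpret product_prob_space "\<lambda>_::nat. tree_law \<alpha> (1 - \<alpha>)" UNIV by standard
  have sp: "space (tree_law \<alpha> (1 - \<alpha>)) = UNIV"
    using sets_eq_imp_space_eq[OF sets_tree_law[OF \<alpha> inner_parameter]] by simp
  have "{e. \<forall>j<N. e j \<in> cylinder (E j)} =
      prod_emb UNIV (\<lambda>_. tree_law \<alpha> (1 - \<alpha>)) {..<N} (Pi\<^sub>E {..<N} (\<lambda>j. cylinder (E j)))"
    by (auto simp: prod_emb_def space_PiM sp PiE_def Pi_def)
  then have "emeasure (block_tree_law \<alpha>) {e. \<forall>j<N. e j \<in> cylinder (E j)} =
      (\<Prod>j<N. emeasure (tree_law \<alpha> (1 - \<alpha>)) (cylinder (E j)))"
    unfolding block_tree_law_def by (simp add: emeasure_PiM_emb sets_tree_law[OF \<alpha> inner_parameter])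
  also have "\<dots> = (\<Prod>j<N. ennreal (segment_prob (tree_step \<alpha> (1 - \<alpha>)) (E j)))"
    by (simp add: T.emeasure_eq_measure measure_tree_law_cylinder[OF \<alpha> inner_parameter])
  also have "\<dots> = ennreal (\<Prod>j<N. segment_prob (tree_step \<alpha> (1 - \<alpha>)) (E j))"
    by (rule prod_ennreal) (simp add: measure_tree_law_cylinder[OF \<alpha> inner_parameter, symmetric])
  finally show ?thesis .
qed

text \<open>A new vertex is attached in two stages: it chooses a block as in the Chinese restaurant, and then
  its parent within the block.  Hence the trees inside the blocks are independent.\<close>
lemma tree_law_assemble:
  "distr (crp_law \<alpha> \<theta> \<Otimes>\<^sub>M block_tree_law \<alpha>) seqs (\<lambda>(L, e). assemble L e) = tree_law \<alpha> \<theta>"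
proof (rule seqs_measure_eqI)
  interpret C: prob_space "crp_law \<alpha> \<theta>" by (rule prob_space_crp_law[OF \<alpha> \<theta>])
  interpret B: prob_space "block_tree_law \<alpha>" by (rule prob_space_block_tree_law)
  interpret P: pair_prob_space "crp_law \<alpha> \<theta>" "block_tree_law \<alpha>" ..
  let ?M = "crp_law \<alpha> \<theta> \<Otimes>\<^sub>M block_tree_law \<alpha>"
  have meas [measurable]: "(\<lambda>(L, e). assemble L e) \<in> ?M \<rightarrow>\<^sub>M seqs" by measurable
  show "prob_space (distr ?M seqs (\<lambda>(L, e). assemble L e))" by (rule P.prob_space_distr[OF meas])
  show "prob_space (tree_law \<alpha> \<theta>)" by (rule prob_space_tree_law[OF \<alpha> \<theta>])
  show "sets (tree_law \<alpha> \<theta>) = sets seqs" by (rule sets_tree_law[OF \<alpha> \<theta>])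
  fix xs :: "nat list"
  let ?S = "{(L, e). initial (length xs) (assemble L e) = xs}"
  let ?n = "length xs"
  have space: "space ?M = UNIV" by (simp add: space_pair_measure)
  have pre: "(\<lambda>(L, e). assemble L e) -` cylinder xs \<inter> space ?M = ?S"
    by (auto simp: cylinder_def space)
  have S: "?S \<in> sets ?M"
    unfolding pre[symmetric] by (rule measurable_sets[OF meas]) simp
  have distr: "measure (distr ?M seqs (\<lambda>(L, e). assemble L e)) (cylinder xs) = measure ?M ?S"
    unfolding pre[symmetric] by (rule measure_distr[OF meas]) simp
  have "AE z in ?M. restricted_growth (fst z)"
    by (rule AE_pair_fst[OF C.prob_space_axioms B.prob_space_axioms])
       (use AE_crp_law[OF \<alpha> \<theta>] in \<open>auto elim: eventually_mono\<close>)
  moreover have "AE z in ?M. \<forall>j. parent_sequence (snd z j)"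
    by (rule AE_pair_snd[OF C.prob_space_axioms B.prob_space_axioms AE_block_tree_law])
  ultimately have good: "AE z in ?M. restricted_growth (fst z) \<and> (\<forall>j. parent_sequence (snd z j))"
    by eventually_elim simp
  show "measure (distr ?M seqs (\<lambda>(L, e). assemble L e)) (cylinder xs) = measure (tree_law \<alpha> \<theta>) (cylinder xs)"
  proof (cases "parent_list xs")
    case False
    have "AE z in ?M. z \<in> ?S \<longleftrightarrow> z \<in> {}"
      using good
    proof (rule eventually_mono)
      fix z :: "(nat \<Rightarrow> nat) \<times> (nat \<Rightarrow> nat \<Rightarrow> nat)" assume z: "restricted_growth (fst z) \<and> (\<forall>j. parent_sequence (snd z j))"
      have "parent_sequence (assemble (fst z) (snd z))" by (rule parent_sequence_assemble) (use z in simp)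
      then have "parent_list (initial ?n (assemble (fst z) (snd z)))"
        by (simp add: parent_list_def parent_sequence_def)
      then show "z \<in> ?S \<longleftrightarrow> z \<in> {}" using False by (auto simp: case_prod_beta)
    qed
    then have "emeasure ?M ?S = emeasure ?M {}" by (rule emeasure_eq_AE[OF _ S]) simp
    then show ?thesis
      unfolding distr using False
      by (simp add: measure_def segment_prob_tree_step_eq_0 measure_tree_law_cylinder[OF \<alpha> \<theta>, unfolded measure_def])
  next
    case True
    note inv = decode_invariants[OF True]
    let ?R = "cylinder (block_labels xs) \<times> {e. \<forall>j<?n. e j \<in> cylinder (block_trees xs j)}"
    have box: "{e. \<forall>j<?n. e j \<in> cylinder (block_trees xs j)} \<in> sets (block_tree_law \<alpha>)"
    proof -
      have "{e \<in> space (Pi\<^sub>M UNIV (\<lambda>_::nat. seqs)). \<forall>j\<in>{..<?n}. e j \<in> cylinder (block_trees xs j)} \<in> sets (Pi\<^sub>M UNIV (\<lambda>_::nat. seqs))"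
        by measurable
      then show ?thesis by (simp add: Ball_def)
    qed
    have empty: "block_trees xs j = []" if "?n \<le> j" for j
    proof -
      have "card (set (block_labels xs)) \<le> ?n" using card_length[of "block_labels xs"] by simp
      then have "j \<notin> {..<card (set (block_labels xs))}" using that by simp
      then have "j \<notin> set (block_labels xs)" using growth_list_set[OF inv(1)] by blast
      then show ?thesis using inv(2)[of j] by (simp add: count_list_0_iff[THEN iffD2])
    qed
    have all: "(\<forall>j. initial (length (block_trees xs j)) (e j) = block_trees xs j) \<longleftrightarrow>
        (\<forall>j<?n. e j \<in> cylinder (block_trees xs j))" for e
    proof
      assume *: "\<forall>j<?n. e j \<in> cylinder (block_trees xs j)"
      show "\<forall>j. initial (length (block_trees xs j)) (e j) = block_trees xs j"
      proof
        fix j show "initial (length (block_trees xs j)) (e j) = block_trees xs j"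
        proof (cases "j < ?n")
          case True then show ?thesis using * by (simp add: cylinder_def)
        next
          case False then show ?thesis using empty[of j] by simp
        qed
      qed
    qed (simp add: cylinder_def)
    have "AE z in ?M. z \<in> ?S \<longleftrightarrow> z \<in> ?R"
      using good
    proof (rule eventually_mono)
      fix z :: "(nat \<Rightarrow> nat) \<times> (nat \<Rightarrow> nat \<Rightarrow> nat)" assume "restricted_growth (fst z) \<and> (\<forall>j. parent_sequence (snd z j))"
      then have "initial ?n (assemble (fst z) (snd z)) = xs \<longleftrightarrow> initial ?n (fst z) = block_labels xs \<and>
          (\<forall>j. initial (length (block_trees xs j)) (snd z j) = block_trees xs j)"
        by (intro initial_assemble_iff True) auto
      then show "z \<in> ?S \<longleftrightarrow> z \<in> ?R" unfolding all by (cases z) (simp add: cylinder_def)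
    qed
    then have "emeasure ?M ?S = emeasure ?M ?R"
      by (rule emeasure_eq_AE[OF _ S]) (use box in \<open>simp add: pair_measureI\<close>)
    also have "\<dots> = emeasure (crp_law \<alpha> \<theta>) (cylinder (block_labels xs)) * ennreal (\<Prod>j<?n. segment_prob (tree_step \<alpha> (1 - \<alpha>)) (block_trees xs j))"
      by (subst B.emeasure_pair_measure_Times) (use box in \<open>simp_all add: measure_block_tree_law_box\<close>)
    also have "\<dots> = ennreal (segment_prob (tree_step \<alpha> \<theta>) xs)"
      unfolding C.emeasure_eq_measure measure_crp_law_cylinder[OF \<alpha> \<theta>] assemble_probability[OF \<alpha> \<theta> True order_refl, symmetric]
      using measure_nonneg[of "crp_law \<alpha> \<theta>" "cylinder (block_labels xs)"] inv(1)
      by (simp add: measure_crp_law_cylinder[OF \<alpha> \<theta>] ennreal_mult')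
    finally have "emeasure ?M ?S = ennreal (segment_prob (tree_step \<alpha> \<theta>) xs)" .
    moreover have "0 \<le> segment_prob (tree_step \<alpha> \<theta>) xs"
      unfolding measure_tree_law_cylinder[OF \<alpha> \<theta>, symmetric] by simp
    ultimately show ?thesis
      unfolding distr measure_tree_law_cylinder[OF \<alpha> \<theta>] by (simp add: measure_def)
  qed
qed simp

text \<open>The labels are the first of the two ingredients.\<close>
lemma label_tree_law: "distr (tree_law \<alpha> \<theta>) seqs label = crp_law \<alpha> \<theta>"
proof -
  interpret C: prob_space "crp_law \<alpha> \<theta>" by (rule prob_space_crp_law[OF \<alpha> \<theta>])
  interpret B: prob_space "block_tree_law \<alpha>" by (rule prob_space_block_tree_law)
  let ?M = "crp_law \<alpha> \<theta> \<Otimes>\<^sub>M block_tree_law \<alpha>"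
  have "AE z in ?M. restricted_growth (fst z)"
    by (rule AE_pair_fst[OF C.prob_space_axioms B.prob_space_axioms])
       (use AE_crp_law[OF \<alpha> \<theta>] in \<open>auto elim: eventually_mono\<close>)
  moreover have "AE z in ?M. \<forall>j. parent_sequence (snd z j)"
    by (rule AE_pair_snd[OF C.prob_space_axioms B.prob_space_axioms AE_block_tree_law])
  ultimately have *: "AE z in ?M. (label \<circ> (\<lambda>(L, e). assemble L e)) z = fst z"
    by eventually_elim (simp add: case_prod_beta label_assemble)
  have "distr (tree_law \<alpha> \<theta>) seqs label = distr ?M seqs (label \<circ> (\<lambda>(L, e). assemble L e))"
    unfolding tree_law_assemble[symmetric] by (rule distr_distr) measurable
  also have "\<dots> = distr ?M (crp_law \<alpha> \<theta>) fst"
    by (rule distr_cong_AE) (use * in \<open>auto simp: comp_def\<close>)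
  also have "\<dots> = crp_law \<alpha> \<theta>" by (rule B.distr_pair_fst)
  finally show ?thesis .
qed

lemma AE_regular_labels: "AE a in tree_law \<alpha> \<theta>. regular_labels (label a)"
proof -
  have [measurable_cong]: "sets (tree_law \<alpha> \<theta>) = sets seqs" by (rule sets_tree_law[OF \<alpha> \<theta>])
  have "AE L in distr (tree_law \<alpha> \<theta>) seqs label. regular_labels L"
    unfolding label_tree_law using AE_crp_law[OF \<alpha> \<theta>] by (auto elim: eventually_mono)
  then show ?thesis by (rule AE_distrD[rotated]) measurable
qed

lemma frequency_tree_law: "distr (tree_law \<alpha> \<theta>) seq_space (\<lambda>a. frequency (label a)) = GEM \<alpha> \<theta>"
proof -
  have [measurable_cong]: "sets (tree_law \<alpha> \<theta>) = sets seqs" by (rule sets_tree_law[OF \<alpha> \<theta>])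
  have "distr (distr (tree_law \<alpha> \<theta>) seqs label) seq_space frequency = distr (tree_law \<alpha> \<theta>) seq_space (frequency \<circ> label)"
    by (rule distr_distr) measurable
  then show ?thesis by (simp add: label_tree_law frequency_crp_law[OF \<alpha> \<theta>] comp_def)
qed

lemma component_masses_tree_law: "distr (tree_law \<alpha> \<theta>) seq_space component_masses = PD \<alpha> \<theta>"
proof -
  have [measurable_cong]: "sets (tree_law \<alpha> \<theta>) = sets seqs" by (rule sets_tree_law[OF \<alpha> \<theta>])
  have "distr (distr (tree_law \<alpha> \<theta>) seq_space (\<lambda>a. frequency (label a))) seq_space ranked =
      distr (tree_law \<alpha> \<theta>) seq_space (ranked \<circ> (\<lambda>a. frequency (label a)))"
    by (rule distr_distr) measurable
  then show ?thesis by (simp add: frequency_tree_law PD_def component_masses_def[abs_def] comp_def)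
qed

end

lemma prob_space_in_subprob_algebra: "prob_space M \<Longrightarrow> sets M = sets N \<Longrightarrow> M \<in> space (subprob_algebra N)"
  by (simp add: space_subprob_algebra prob_space_imp_subprob_space)

section \<open>Coagulation\<close>

lemma Coag_law_eq: "Coag_law \<alpha> \<theta> x = distr (urn_law \<alpha> \<theta>) seq_space (coagulate x)"
  by (simp add: Coag_law_def urn_law_def iid_def)

lemma space_urn_law [simp]: "space (urn_law \<alpha> \<theta>) = UNIV"
  using sets_eq_imp_space_eq[OF sets_urn_law] by simp

lemma measurable_coagulate_marks: "coagulate x \<in> seqs \<rightarrow>\<^sub>M seq_space"
proof -
  have "(\<lambda>c. (\<lambda>(x, c). coagulate x c) (x, c)) \<in> seqs \<rightarrow>\<^sub>M seq_space"
    by (rule measurable_compose[OF _ measurable_coagulate]) simp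
  then show ?thesis by simp
qed

lemma measurable_fragment_pair: "(\<lambda>(i, \<eta>). fragment x i \<eta>) \<in> count_space UNIV \<Otimes>\<^sub>M seq_space \<rightarrow>\<^sub>M seq_space"
proof -
  have "(\<lambda>p. (\<lambda>(x, i, \<eta>). fragment x i \<eta>) (x, p)) \<in> count_space UNIV \<Otimes>\<^sub>M seq_space \<rightarrow>\<^sub>M seq_space"
    by (rule measurable_compose[OF _ measurable_fragment]) simp
  then show ?thesis by simp
qed

text \<open>The urn is a mixture of independent identically distributed sequences.\<close>
lemma urn_law_reindex:
  fixes \<sigma> :: "nat \<Rightarrow> nat"
  assumes \<alpha>: "0 \<le> \<alpha>" "\<alpha> < 1" and \<theta>: "\<theta> > - \<alpha>" and \<sigma>: "inj \<sigma>"
  shows "distr (urn_law \<alpha> \<theta>) seqs (\<lambda>c n. c (\<sigma> n)) = urn_law \<alpha> \<theta>"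
proof -
  interpret prob_space "merging_probability_law \<alpha> \<theta>" by (rule prob_space_merging_probability_law[OF \<alpha> \<theta>])
  have "distr (urn_law \<alpha> \<theta>) seqs (\<lambda>c n. c (\<sigma> n)) =
      merging_probability_law \<alpha> \<theta> \<bind> (\<lambda>b. distr (iid (bernoulli_pmf b)) seqs (\<lambda>c n. c (\<sigma> n)))"
    unfolding urn_law_def
    by (rule distr_bind[OF measurable_prob_algebraD[OF bernoulli_kernel] not_empty])
       (rule measurable_seqs_coordinatewise, rule measurable_coordinate)
  then show ?thesis by (simp add: iid_reindex[OF \<sigma>] urn_law_def)
qed

text \<open>As the marks are exchangeable, they may be attached to the masses in any order.\<close>
lemma Coag_law_ranked:
  assumes \<alpha>: "0 \<le> \<alpha>" "\<alpha> < 1" and \<theta>: "\<theta> > - \<alpha>" and x: "x \<in> prob_sequences" "\<forall>n. 0 < x n"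
  shows "Coag_law \<alpha> \<theta> (ranked x) = distr (urn_law \<alpha> \<theta>) seq_space (coagulate x)"
proof -
  obtain \<pi> where \<pi>: "bij \<pi>" "ranked x = (\<lambda>n. x (\<pi> n))" using ranked_prob_sequence[OF x] .
  have sums: "x sums 1" and nonneg: "\<And>n. 0 \<le> x n" using x by (auto simp: prob_sequences_def)
  have coordinates: "(\<lambda>c n. c (\<pi> n)) \<in> seqs \<rightarrow>\<^sub>M (seqs :: (nat \<Rightarrow> bool) measure)"
    by (rule measurable_seqs_coordinatewise) (rule measurable_coordinate)
  have "Coag_law \<alpha> \<theta> (ranked x) = distr (distr (urn_law \<alpha> \<theta>) seqs (\<lambda>c n. c (\<pi> n))) seq_space (coagulate (ranked x))"
    using \<pi>(1) by (simp add: Coag_law_eq urn_law_reindex[OF \<alpha> \<theta>] bij_def)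
  also have "\<dots> = distr (urn_law \<alpha> \<theta>) seq_space (coagulate (ranked x) \<circ> (\<lambda>c n. c (\<pi> n)))"
    by (rule distr_distr) (use coordinates measurable_coagulate_marks in simp_all)
  also have "coagulate (ranked x) \<circ> (\<lambda>c n. c (\<pi> n)) = coagulate x"
    unfolding \<pi>(2) comp_def using coagulate_reindex[OF \<pi>(1) nonneg sums] by (intro ext) simp
  finally show ?thesis .
qed

lemma Coag_law_kernel:
  assumes \<alpha>: "0 \<le> \<alpha>" "\<alpha> < 1" and \<theta>: "\<theta> > - \<alpha>"
  shows "Coag_law \<alpha> \<theta> \<in> seq_space \<rightarrow>\<^sub>M prob_algebra seq_space"
proof (rule measurable_prob_algebraI)
  interpret U: prob_space "urn_law \<alpha> \<theta>" by (rule prob_space_urn_law[OF \<alpha> \<theta>])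
  show "prob_space (Coag_law \<alpha> \<theta> x)" for x
    unfolding Coag_law_eq by (rule U.prob_space_distr) (simp add: measurable_coagulate_marks)
  have "(\<lambda>x. distr (urn_law \<alpha> \<theta>) seq_space (coagulate x)) \<in> seq_space \<rightarrow>\<^sub>M subprob_algebra seq_space"
    by (rule measurable_distr2[where M = seqs])
       (simp_all add: measurable_coagulate prob_space_in_subprob_algebra U.prob_space_axioms)
  then show "Coag_law \<alpha> \<theta> \<in> seq_space \<rightarrow>\<^sub>M subprob_algebra seq_space"
    unfolding Coag_law_eq[abs_def] .
qed

text \<open>The marks that decide which components are fused are independent of the merged tree.  Testing
  against functions of the whole merged tree, rather than of its masses only, is what the Markov
  property needs.\<close>
lemma coagulation_identity:
  fixes \<phi> :: "(nat \<Rightarrow> nat) \<Rightarrow> ennreal" and \<psi> :: "(nat \<Rightarrow> real) \<Rightarrow> ennreal"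
  assumes \<alpha>: "0 \<le> \<alpha>" "\<alpha> < 1" and \<theta>: "\<theta> > - \<alpha>"
    and \<phi> [measurable]: "\<phi> \<in> borel_measurable seqs" and \<psi> [measurable]: "\<psi> \<in> borel_measurable seq_space"
  shows "(\<integral>\<^sup>+a. \<phi> (collapse a) * \<psi> (component_masses a) \<partial>tree_law \<alpha> \<theta>) =
    (\<integral>\<^sup>+q. \<phi> q * (\<integral>\<^sup>+y. \<psi> y \<partial>Coag_law \<alpha> \<theta> (component_masses q)) \<partial>tree_law \<alpha> (\<theta> + 1))"
proof -
  have \<theta>1: "\<theta> + 1 > - \<alpha>" using \<theta> by simp
  let ?Q = "tree_law \<alpha> (\<theta> + 1)" and ?U = "urn_law \<alpha> \<theta>"
  interpret Q: prob_space ?Q by (rule prob_space_tree_law[OF \<alpha> \<theta>1])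
  interpret U: prob_space ?U by (rule prob_space_urn_law[OF \<alpha> \<theta>])
  have [measurable_cong]: "sets ?Q = sets seqs" by (rule sets_tree_law[OF \<alpha> \<theta>1])
  have [measurable]: "(\<lambda>(q, c). split_root q c) \<in> ?Q \<Otimes>\<^sub>M ?U \<rightarrow>\<^sub>M seqs" by measurable
  have coag [measurable]: "(\<lambda>z. coagulate (frequency (label (fst z))) (snd z)) \<in> ?Q \<Otimes>\<^sub>M ?U \<rightarrow>\<^sub>M seq_space"
  proof -
    have "(\<lambda>z. (\<lambda>(x, c). coagulate x c) (frequency (label (fst z)), snd z)) \<in> ?Q \<Otimes>\<^sub>M ?U \<rightarrow>\<^sub>M seq_space"
      by (rule measurable_compose[OF _ measurable_coagulate]) measurable
    then show ?thesis by simp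
  qed
  have Q_good: "AE q in ?Q. parent_sequence q \<and> regular_labels (label q)"
    using AE_parent_sequence[OF \<alpha> \<theta>1] AE_regular_labels[OF \<alpha> \<theta>1] by eventually_elim simp
  have "AE a in distr (?Q \<Otimes>\<^sub>M ?U) seqs (\<lambda>(q, c). split_root q c). regular_labels (label a)"
    unfolding tree_law_split_root[OF \<alpha> \<theta>] by (rule AE_regular_labels[OF \<alpha> \<theta>])
  then have "AE z in ?Q \<Otimes>\<^sub>M ?U. regular_labels (label ((\<lambda>(q, c). split_root q c) z))"
    by (rule AE_distrD[rotated]) measurable
  moreover have "AE z in ?Q \<Otimes>\<^sub>M ?U. parent_sequence (fst z) \<and> regular_labels (label (fst z))"
    by (rule AE_pair_fst[OF Q.prob_space_axioms U.prob_space_axioms Q_good])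
  ultimately have split: "AE z in ?Q \<Otimes>\<^sub>M ?U. component_masses ((\<lambda>(q, c). split_root q c) z) =
      coagulate (frequency (label (fst z))) (snd z)"
    by eventually_elim (auto simp: component_masses_def regular_labels_proper intro!: ranked_frequency_split_root)
  have "(\<integral>\<^sup>+a. \<phi> (collapse a) * \<psi> (component_masses a) \<partial>tree_law \<alpha> \<theta>) =
      (\<integral>\<^sup>+z. \<phi> (collapse ((\<lambda>(q, c). split_root q c) z)) * \<psi> (component_masses ((\<lambda>(q, c). split_root q c) z)) \<partial>(?Q \<Otimes>\<^sub>M ?U))"
    unfolding tree_law_split_root[OF \<alpha> \<theta>, symmetric] by (rule nn_integral_distr) measurable
  also have "\<dots> = (\<integral>\<^sup>+z. \<phi> (fst z) * \<psi> (coagulate (frequency (label (fst z))) (snd z)) \<partial>(?Q \<Otimes>\<^sub>M ?U))"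
    by (rule nn_integral_cong_AE, use split in eventually_elim) (simp add: case_prod_beta collapse_split_root)
  also have "\<dots> = (\<integral>\<^sup>+q. \<integral>\<^sup>+c. \<phi> q * \<psi> (coagulate (frequency (label q)) c) \<partial>?U \<partial>?Q)"
    by (subst U.nn_integral_fst[symmetric]) simp_all
  also have "\<dots> = (\<integral>\<^sup>+q. \<phi> q * (\<integral>\<^sup>+y. \<psi> y \<partial>Coag_law \<alpha> \<theta> (component_masses q)) \<partial>?Q)"
  proof (rule nn_integral_cong_AE, use Q_good in eventually_elim)
    fix q assume q: "parent_sequence q \<and> regular_labels (label q)"
    have meas: "(\<lambda>c. \<psi> (coagulate x c)) \<in> borel_measurable ?U" for x
      by (rule measurable_compose[OF _ \<psi>]) (simp add: measurable_coagulate_marks)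
    have "(\<integral>\<^sup>+y. \<psi> y \<partial>Coag_law \<alpha> \<theta> (component_masses q)) = (\<integral>\<^sup>+c. \<psi> (coagulate (frequency (label q)) c) \<partial>?U)"
      unfolding component_masses_def using q
      by (subst Coag_law_ranked[OF \<alpha> \<theta>]) (auto simp: regular_labels_def nn_integral_distr measurable_coagulate_marks)
    then show "(\<integral>\<^sup>+c. \<phi> q * \<psi> (coagulate (frequency (label q)) c) \<partial>?U) =
        \<phi> q * (\<integral>\<^sup>+y. \<psi> y \<partial>Coag_law \<alpha> \<theta> (component_masses q))"
      by (simp add: nn_integral_cmult[OF meas])
  qed
  finally show ?thesis .
qed

lemma distr_collapse_tree_law:
  assumes \<alpha>: "0 \<le> \<alpha>" "\<alpha> < 1" and \<theta>: "\<theta> > - \<alpha>"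
  shows "distr (tree_law \<alpha> \<theta>) seqs collapse = tree_law \<alpha> (\<theta> + 1)"
proof -
  have \<theta>1: "\<theta> + 1 > - \<alpha>" using \<theta> by simp
  let ?Q = "tree_law \<alpha> (\<theta> + 1)" and ?U = "urn_law \<alpha> \<theta>"
  interpret Q: prob_space ?Q by (rule prob_space_tree_law[OF \<alpha> \<theta>1])
  interpret U: prob_space ?U by (rule prob_space_urn_law[OF \<alpha> \<theta>])
  have [measurable_cong]: "sets ?Q = sets seqs" by (rule sets_tree_law[OF \<alpha> \<theta>1])
  have "distr (tree_law \<alpha> \<theta>) seqs collapse = distr (?Q \<Otimes>\<^sub>M ?U) seqs (collapse \<circ> (\<lambda>(q, c). split_root q c))"
    unfolding tree_law_split_root[OF \<alpha> \<theta>, symmetric] by (rule distr_distr) measurable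
  also have "\<dots> = distr (?Q \<Otimes>\<^sub>M ?U) ?Q fst"
    by (rule distr_cong) (auto simp: collapse_split_root sets_tree_law[OF \<alpha> \<theta>1])
  also have "\<dots> = ?Q" by (rule U.distr_pair_fst)
  finally show ?thesis .
qed

lemma measurable_collapse_funpow [measurable]: "collapse ^^ i \<in> seqs \<rightarrow>\<^sub>M seqs"
  by (induction i) (auto intro: measurable_comp[OF _ measurable_collapse])

lemma distr_collapse_funpow_tree_law:
  assumes \<alpha>: "0 \<le> \<alpha>" "\<alpha> < 1" and \<theta>: "\<theta> > - \<alpha>"
  shows "distr (tree_law \<alpha> \<theta>) seqs (collapse ^^ i) = tree_law \<alpha> (\<theta> + real i)"
proof (induction i)
  case 0
  show ?case using sets_tree_law[OF \<alpha> \<theta>] by (simp add: distr_id2)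
next
  case (Suc i)
  have [measurable_cong]: "sets (tree_law \<alpha> \<theta>) = sets seqs" by (rule sets_tree_law[OF \<alpha> \<theta>])
  have \<theta>i: "\<theta> + real i > - \<alpha>" using \<theta> by simp
  have "distr (tree_law \<alpha> \<theta>) seqs (collapse ^^ Suc i) = distr (distr (tree_law \<alpha> \<theta>) seqs (collapse ^^ i)) seqs collapse"
    by (subst distr_distr) simp_all
  then show ?case by (simp add: Suc distr_collapse_tree_law[OF \<alpha> \<theta>i] add_ac comp_def)
qed

section \<open>Fragmentation\<close>

lemma index_pmf_kernel: "(\<lambda>x. measure_pmf (index_pmf x)) \<in> seq_space \<rightarrow>\<^sub>M subprob_algebra (count_space UNIV)"
proof -
  have "(\<lambda>x. distr (iid (index_pmf x)) (count_space UNIV) (\<lambda>X. X 0)) \<in> seq_space \<rightarrow>\<^sub>M subprob_algebra (count_space UNIV)"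
    by (rule measurable_compose[OF measurable_prob_algebraD[OF index_kernel]])
       (rule measurable_distr, rule measurable_coordinate)
  then show ?thesis by (simp add: distr_iid_coordinate)
qed

lemma Frag_law_kernel:
  assumes \<alpha>: "0 \<le> \<alpha>" "\<alpha> < 1"
  shows "Frag_law \<alpha> \<in> seq_space \<rightarrow>\<^sub>M prob_algebra seq_space"
proof (rule measurable_prob_algebraI)
  interpret D: prob_space "PD \<alpha> (1 - \<alpha>)" by (rule prob_space_PD[OF \<alpha> inner_parameter])
  show "prob_space (Frag_law \<alpha> x)" for x
  proof -
    interpret P: pair_prob_space "measure_pmf (index_pmf x)" "PD \<alpha> (1 - \<alpha>)" ..
    show ?thesis
      unfolding Frag_law_def by (rule P.prob_space_distr) (use measurable_fragment_pair[of x] in simp)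
  qed
  have "(\<lambda>x. measure_pmf (index_pmf x) \<Otimes>\<^sub>M PD \<alpha> (1 - \<alpha>)) \<in> seq_space \<rightarrow>\<^sub>M subprob_algebra (count_space UNIV \<Otimes>\<^sub>M seq_space)"
    by (rule measurable_pair_measure[OF index_pmf_kernel])
       (simp add: prob_space_in_subprob_algebra D.prob_space_axioms)
  then show "Frag_law \<alpha> \<in> seq_space \<rightarrow>\<^sub>M subprob_algebra seq_space"
    unfolding Frag_law_def[abs_def]
    by (rule measurable_distr2[rotated]) (use measurable_fragment in \<open>simp add: case_prod_beta\<close>)
qed

text \<open>The fragments are ranked in the end, so their masses may come in the order of the GEM law.\<close>
lemma nn_integral_Frag_law:
  fixes \<phi> :: "(nat \<Rightarrow> real) \<Rightarrow> ennreal"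
  assumes \<alpha>: "0 \<le> \<alpha>" "\<alpha> < 1" and \<phi> [measurable]: "\<phi> \<in> borel_measurable seq_space"
  shows "(\<integral>\<^sup>+z. \<phi> z \<partial>Frag_law \<alpha> y) =
    (\<integral>\<^sup>+i. \<integral>\<^sup>+\<eta>. \<phi> (fragment y i \<eta>) \<partial>GEM \<alpha> (1 - \<alpha>) \<partial>measure_pmf (index_pmf y))"
proof -
  interpret D: prob_space "PD \<alpha> (1 - \<alpha>)" by (rule prob_space_PD[OF \<alpha> inner_parameter])
  let ?I = "measure_pmf (index_pmf y)"
  have meas: "(\<lambda>(i, \<eta>). fragment y i \<eta>) \<in> ?I \<Otimes>\<^sub>M PD \<alpha> (1 - \<alpha>) \<rightarrow>\<^sub>M seq_space"
    using measurable_fragment_pair[of y] by simp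
  have frag: "fragment y i \<in> seq_space \<rightarrow>\<^sub>M seq_space" for i
  proof -
    have "(\<lambda>\<eta>. (\<lambda>(i, \<eta>). fragment y i \<eta>) (i, \<eta>)) \<in> seq_space \<rightarrow>\<^sub>M seq_space"
      by (rule measurable_compose[OF _ measurable_fragment_pair]) simp
    then show ?thesis by simp
  qed
  have \<phi>_frag: "(\<lambda>\<eta>. \<phi> (fragment y i \<eta>)) \<in> borel_measurable seq_space" for i
    by (rule measurable_compose[OF frag \<phi>])
  have "(\<integral>\<^sup>+z. \<phi> z \<partial>Frag_law \<alpha> y) = (\<integral>\<^sup>+p. \<phi> ((\<lambda>(i, \<eta>). fragment y i \<eta>) p) \<partial>(?I \<Otimes>\<^sub>M PD \<alpha> (1 - \<alpha>)))"
    unfolding Frag_law_def by (rule nn_integral_distr[OF meas]) simp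
  also have "\<dots> = (\<integral>\<^sup>+i. \<integral>\<^sup>+\<eta>. \<phi> (fragment y i \<eta>) \<partial>PD \<alpha> (1 - \<alpha>) \<partial>?I)"
    by (subst D.nn_integral_fst[symmetric]) (use measurable_compose[OF meas \<phi>] in \<open>simp_all add: case_prod_beta\<close>)
  also have "\<dots> = (\<integral>\<^sup>+i. \<integral>\<^sup>+\<eta>. \<phi> (fragment y i \<eta>) \<partial>GEM \<alpha> (1 - \<alpha>) \<partial>?I)"
  proof (rule nn_integral_cong)
    fix i
    have "(\<integral>\<^sup>+\<eta>. \<phi> (fragment y i \<eta>) \<partial>PD \<alpha> (1 - \<alpha>)) = (\<integral>\<^sup>+\<eta>. \<phi> (fragment y i (ranked \<eta>)) \<partial>GEM \<alpha> (1 - \<alpha>))"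
      unfolding PD_def by (rule nn_integral_distr) (use \<phi>_frag in simp_all)
    also have "\<dots> = (\<integral>\<^sup>+\<eta>. \<phi> (fragment y i \<eta>) \<partial>GEM \<alpha> (1 - \<alpha>))"
    proof (rule nn_integral_cong_AE, use AE_GEM[OF \<alpha> inner_parameter] in eventually_elim)
      fix \<eta> :: "nat \<Rightarrow> real" assume "\<eta> \<in> prob_sequences \<and> (\<forall>n. 0 < \<eta> n)"
      then obtain \<pi> where \<pi>: "bij \<pi>" "ranked \<eta> = (\<lambda>n. \<eta> (\<pi> n))" using ranked_prob_sequence[of \<eta>] by blast
      show "\<phi> (fragment y i (ranked \<eta>)) = \<phi> (fragment y i \<eta>)"
        unfolding \<pi>(2) using fragment_reindex[OF bij_id \<pi>(1), of y i \<eta>] by simp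
    qed
    finally show "(\<integral>\<^sup>+\<eta>. \<phi> (fragment y i \<eta>) \<partial>PD \<alpha> (1 - \<alpha>)) = (\<integral>\<^sup>+\<eta>. \<phi> (fragment y i \<eta>) \<partial>GEM \<alpha> (1 - \<alpha>))" .
  qed
  finally show ?thesis .
qed

lemma distr_first_block_masses:
  assumes \<alpha>: "0 \<le> \<alpha>" "\<alpha> < 1"
  shows "distr (block_tree_law \<alpha>) seq_space (\<lambda>e. frequency (label (e 0))) = GEM \<alpha> (1 - \<alpha>)"
proof -
  let ?T = "tree_law \<alpha> (1 - \<alpha>)"
  have [measurable_cong]: "sets ?T = sets seqs" by (rule sets_tree_law[OF \<alpha> inner_parameter])
  interpret T: prob_space ?T by (rule prob_space_tree_law[OF \<alpha> inner_parameter])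
  interpret product_prob_space "\<lambda>_::nat. ?T" UNIV by standard
  have proj: "(\<lambda>e. e 0) \<in> block_tree_law \<alpha> \<rightarrow>\<^sub>M ?T"
    unfolding block_tree_law_def by (rule measurable_component_singleton) simp
  have "distr (distr (block_tree_law \<alpha>) ?T (\<lambda>e. e 0)) seq_space (\<lambda>a. frequency (label a)) =
      distr (block_tree_law \<alpha>) seq_space ((\<lambda>a. frequency (label a)) \<circ> (\<lambda>e. e 0))"
    by (rule distr_distr[OF _ proj]) measurable
  moreover have "distr (block_tree_law \<alpha>) ?T (\<lambda>e. e 0) = ?T"
    unfolding block_tree_law_def by (rule PiM_component) simp
  ultimately show ?thesis by (simp add: frequency_tree_law[OF \<alpha> inner_parameter] comp_def)
qed

text \<open>The block of vertex 1 is a size-biased pick, because in the paintbox it is the block chosen by the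
  first sample; the tree inside this block is independent of the partition.\<close>
lemma fragmentation_identity:
  fixes \<phi> \<psi> :: "(nat \<Rightarrow> real) \<Rightarrow> ennreal"
  assumes \<alpha>: "0 \<le> \<alpha>" "\<alpha> < 1" and \<theta>: "\<theta> > - \<alpha>"
    and \<phi> [measurable]: "\<phi> \<in> borel_measurable seq_space" and \<psi> [measurable]: "\<psi> \<in> borel_measurable seq_space"
  shows "(\<integral>\<^sup>+a. \<psi> (component_masses a) * \<phi> (component_masses (collapse a)) \<partial>tree_law \<alpha> \<theta>) =
    (\<integral>\<^sup>+y. \<psi> y * (\<integral>\<^sup>+z. \<phi> z \<partial>Frag_law \<alpha> y) \<partial>PD \<alpha> \<theta>)"
proof -
  let ?C = "crp_law \<alpha> \<theta>" and ?B = "block_tree_law \<alpha>" and ?G = "GEM \<alpha> (1 - \<alpha>)"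
  let ?as = "\<lambda>(L, e). assemble L e"
  interpret C: prob_space ?C by (rule prob_space_crp_law[OF \<alpha> \<theta>])
  interpret B: prob_space ?B by (rule prob_space_block_tree_law[OF \<alpha> \<theta>])
  interpret G: prob_space ?G by (rule prob_space_GEM[OF \<alpha> inner_parameter])
  have [measurable_cong]: "sets ?B = sets (Pi\<^sub>M UNIV (\<lambda>_::nat. seqs :: (nat \<Rightarrow> nat) measure))"
    by (rule sets_block_tree_law[OF \<alpha> \<theta>])
  have as [measurable]: "?as \<in> ?C \<Otimes>\<^sub>M ?B \<rightarrow>\<^sub>M seqs" by measurable
  have first [measurable]: "(\<lambda>e. frequency (label (e 0))) \<in> ?B \<rightarrow>\<^sub>M seq_space" by measurable
  have frag0: "(\<lambda>(x, \<eta>). fragment x 0 \<eta>) \<in> seq_space \<Otimes>\<^sub>M seq_space \<rightarrow>\<^sub>M seq_space"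
  proof -
    have "(\<lambda>z. (\<lambda>(x, i, \<eta>). fragment x i \<eta>) (fst z, 0, snd z)) \<in> seq_space \<Otimes>\<^sub>M seq_space \<rightarrow>\<^sub>M seq_space"
      by (rule measurable_compose[OF _ measurable_fragment]) measurable
    then show ?thesis by (simp add: case_prod_beta)
  qed
  have \<phi>_frag: "(\<lambda>z. \<phi> (fragment (fst z) 0 (snd z))) \<in> borel_measurable (seq_space \<Otimes>\<^sub>M seq_space)"
    using measurable_compose[OF frag0 \<phi>] by (simp add: case_prod_beta)
  have \<phi>_frag_B: "(\<lambda>z. \<phi> (fragment (frequency (fst z)) 0 (frequency (label (snd z 0))))) \<in> borel_measurable (?C \<Otimes>\<^sub>M ?B)"
  proof -
    have "(\<lambda>z. (frequency (fst z), frequency (label (snd z 0)))) \<in> ?C \<Otimes>\<^sub>M ?B \<rightarrow>\<^sub>M seq_space \<Otimes>\<^sub>M seq_space"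
      by (intro measurable_Pair measurable_compose[OF measurable_snd first]) measurable
    from measurable_compose[OF this \<phi>_frag] show ?thesis by simp
  qed
  define H where "H x i = (\<integral>\<^sup>+\<eta>. \<phi> (fragment x i \<eta>) \<partial>?G)" for x i
  have H [measurable]: "(\<lambda>x. H x 0) \<in> borel_measurable seq_space"
    unfolding H_def by (rule G.borel_measurable_nn_integral) (use \<phi>_frag in \<open>simp add: case_prod_beta\<close>)
  have first_GEM: "(\<integral>\<^sup>+e. \<phi> (fragment x 0 (frequency (label (e 0)))) \<partial>?B) = H x 0" for x
  proof -
    have "(\<lambda>\<eta>. (\<lambda>z. \<phi> (fragment (fst z) 0 (snd z))) (x, \<eta>)) \<in> borel_measurable seq_space"
      by (rule measurable_compose[OF _ \<phi>_frag]) simp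
    then show ?thesis
      unfolding H_def distr_first_block_masses[OF \<alpha>, symmetric] by (subst nn_integral_distr) (use first in simp_all)
  qed
  have C_good: "AE L in ?C. restricted_growth L \<and> regular_labels L" by (rule AE_crp_law[OF \<alpha> \<theta>])
  have "AE z in ?C \<Otimes>\<^sub>M ?B. restricted_growth (fst z) \<and> regular_labels (fst z)"
    by (rule AE_pair_fst[OF C.prob_space_axioms B.prob_space_axioms C_good])
  moreover have "AE z in ?C \<Otimes>\<^sub>M ?B. \<forall>j. parent_sequence (snd z j)"
    by (rule AE_pair_snd[OF C.prob_space_axioms B.prob_space_axioms AE_block_tree_law[OF \<alpha> \<theta>]])
  moreover have "AE z in ?C \<Otimes>\<^sub>M ?B. regular_labels (label (snd z 0))"
  proof (rule AE_pair_snd[OF C.prob_space_axioms B.prob_space_axioms])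
    show "AE e in ?B. regular_labels (label (e 0))"
      unfolding block_tree_law_def
      by (rule AE_PiM_component) (auto intro: prob_space_tree_law AE_regular_labels simp: \<alpha>)
  qed
  ultimately have assembled: "AE z in ?C \<Otimes>\<^sub>M ?B. component_masses (?as z) = ranked (frequency (fst z)) \<and>
      component_masses (collapse (?as z)) = fragment (frequency (fst z)) 0 (frequency (label (snd z 0)))"
    by eventually_elim (simp add: case_prod_beta component_masses_def label_assemble
        ranked_frequency_collapse_assemble regular_labels_proper)
  have "(\<integral>\<^sup>+a. \<psi> (component_masses a) * \<phi> (component_masses (collapse a)) \<partial>tree_law \<alpha> \<theta>) =
      (\<integral>\<^sup>+z. \<psi> (component_masses (?as z)) * \<phi> (component_masses (collapse (?as z))) \<partial>(?C \<Otimes>\<^sub>M ?B))"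
    unfolding tree_law_assemble[OF \<alpha> \<theta>, symmetric] by (rule nn_integral_distr) measurable
  also have "\<dots> = (\<integral>\<^sup>+z. \<psi> (ranked (frequency (fst z))) * \<phi> (fragment (frequency (fst z)) 0 (frequency (label (snd z 0)))) \<partial>(?C \<Otimes>\<^sub>M ?B))"
    by (rule nn_integral_cong_AE, use assembled in eventually_elim) simp
  also have "\<dots> = (\<integral>\<^sup>+L. \<integral>\<^sup>+e. \<psi> (ranked (frequency L)) * \<phi> (fragment (frequency L) 0 (frequency (label (e 0)))) \<partial>?B \<partial>?C)"
    by (subst B.nn_integral_fst[symmetric]) (use \<phi>_frag_B in simp_all)
  also have "\<dots> = (\<integral>\<^sup>+L. \<psi> (ranked (frequency L)) * H (frequency L) 0 \<partial>?C)"
  proof (rule nn_integral_cong)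
    fix L
    have "(\<lambda>e. (\<lambda>z. \<phi> (fragment (fst z) 0 (snd z))) (frequency L, frequency (label (e 0)))) \<in> borel_measurable ?B"
      by (rule measurable_compose[OF _ \<phi>_frag]) (use first in simp)
    then show "(\<integral>\<^sup>+e. \<psi> (ranked (frequency L)) * \<phi> (fragment (frequency L) 0 (frequency (label (e 0)))) \<partial>?B) =
        \<psi> (ranked (frequency L)) * H (frequency L) 0"
      by (simp add: nn_integral_cmult first_GEM)
  qed
  also have "\<dots> = (\<integral>\<^sup>+X. \<psi> (ranked (frequency (relabel X))) * H (frequency (relabel X)) 0 \<partial>paintbox \<alpha> \<theta>)"
    unfolding relabel_paintbox[OF \<alpha> \<theta>, symmetric] by (rule nn_integral_distr) measurable
  also have "\<dots> = (\<integral>\<^sup>+y. \<integral>\<^sup>+X. \<psi> (ranked (frequency (relabel X))) * H (frequency (relabel X)) 0 \<partial>iid (index_pmf y) \<partial>PD \<alpha> \<theta>)"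
    unfolding paintbox_def by (rule nn_integral_bind[OF _ index_kernel_PD]) measurable
  also have "\<dots> = (\<integral>\<^sup>+y. \<psi> y * (\<integral>\<^sup>+z. \<phi> z \<partial>Frag_law \<alpha> y) \<partial>PD \<alpha> \<theta>)"
  proof (rule nn_integral_cong_AE, use AE_PD[OF \<alpha> \<theta>] in eventually_elim)
    fix y assume y: "y \<in> ranked_simplex"
    have "pmf (index_pmf y) k = y k" for k
      using y pmf_label_pmf[of y k] by (simp add: index_pmf_eq_label_pmf ranked_simplex_eq)
    then have freq: "AE X in iid (index_pmf y). \<forall>k. has_frequency X k (y k)"
      using AE_iid_frequency[of "index_pmf y"] by simp
    have "(\<integral>\<^sup>+X. \<psi> (ranked (frequency (relabel X))) * H (frequency (relabel X)) 0 \<partial>iid (index_pmf y)) =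
        (\<integral>\<^sup>+X. \<psi> y * H y (X 0) \<partial>iid (index_pmf y))"
      by (rule nn_integral_cong_AE, use freq in eventually_elim) (simp add: paintbox_sample[OF y] H_def)
    also have "\<dots> = (\<integral>\<^sup>+i. \<psi> y * H y i \<partial>distr (iid (index_pmf y)) (count_space UNIV) (\<lambda>X. X 0))"
      by (subst nn_integral_distr) (simp_all add: measurable_coordinate)
    also have "\<dots> = \<psi> y * (\<integral>\<^sup>+i. H y i \<partial>measure_pmf (index_pmf y))"
      by (simp add: distr_iid_coordinate nn_integral_cmult)
    also have "(\<integral>\<^sup>+i. H y i \<partial>measure_pmf (index_pmf y)) = (\<integral>\<^sup>+z. \<phi> z \<partial>Frag_law \<alpha> y)"
      unfolding H_def by (rule nn_integral_Frag_law[OF \<alpha> \<phi>, symmetric])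
    finally show "(\<integral>\<^sup>+X. \<psi> (ranked (frequency (relabel X))) * H (frequency (relabel X)) 0 \<partial>iid (index_pmf y)) =
      \<psi> y * (\<integral>\<^sup>+z. \<phi> z \<partial>Frag_law \<alpha> y)" .
  qed
  finally show ?thesis .
qed

section \<open>Laws of random partitions\<close>

lemma partition_on_blocks_of_labelling: "partition_on A (blocks_of_labelling A c)"
  by (rule partition_onI) (auto simp: blocks_of_labelling_def disjnt_def)

lemma same_block_iff:
  assumes "j \<in> A" "k \<in> A"
  shows "(\<exists>B\<in>blocks_of_labelling A c. j \<in> B \<and> k \<in> B) \<longleftrightarrow> c j = c k"
  using assms by (auto simp: blocks_of_labelling_def)

lemma measurable_blocks_of_labelling:
  assumes c: "\<And>v. v \<in> A \<Longrightarrow> (\<lambda>x. c x v) \<in> M \<rightarrow>\<^sub>M count_space (UNIV :: nat set)"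
  shows "(\<lambda>x. blocks_of_labelling A (c x)) \<in> M \<rightarrow>\<^sub>M partition_space A"
  unfolding partition_space_def
proof (rule measurable_measure_of)
  fix S assume "S \<in> {{P. partition_on A P \<and> (\<exists>B\<in>P. i \<in> B \<and> j \<in> B)} |i j. i \<in> A \<and> j \<in> A}"
  then obtain i j where S: "S = {P. partition_on A P \<and> (\<exists>B\<in>P. i \<in> B \<and> j \<in> B)}" and ij: "i \<in> A" "j \<in> A"
    by blast
  have [measurable]: "(\<lambda>x. c x i) \<in> M \<rightarrow>\<^sub>M count_space UNIV" "(\<lambda>x. c x j) \<in> M \<rightarrow>\<^sub>M count_space UNIV"
    using c ij by auto
  have "(\<lambda>x. blocks_of_labelling A (c x)) -` S \<inter> space M = {x \<in> space M. \<exists>k. c x i = k \<and> c x j = k}"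
    using same_block_iff[OF ij] partition_on_blocks_of_labelling by (auto simp: S)
  also have "\<dots> \<in> sets M" by measurable
  finally show "(\<lambda>x. blocks_of_labelling A (c x)) -` S \<inter> space M \<in> sets M" .
qed (auto simp: partition_on_blocks_of_labelling)

lemma blocks_of_labelling_cong:
  assumes "\<And>j k. j \<in> A \<Longrightarrow> k \<in> A \<Longrightarrow> c j = c k \<longleftrightarrow> d j = d k"
  shows "blocks_of_labelling A c = blocks_of_labelling A d"
proof -
  have "{v \<in> A. c v = c j} = {v \<in> A. d v = d j}" if "j \<in> A" for j using assms that by auto
  then show ?thesis unfolding blocks_of_labelling_def image_image by (intro image_cong) auto
qed

definition shifted_blocks :: "nat \<Rightarrow> (nat \<Rightarrow> nat) \<Rightarrow> nat set set" where
  "shifted_blocks i L = blocks_of_labelling {Suc i..} (\<lambda>v. L (v - Suc i))"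

lemma measurable_shifted_blocks [measurable]: "shifted_blocks i \<in> seqs \<rightarrow>\<^sub>M partition_space {Suc i..}"
  unfolding shifted_blocks_def[abs_def]
  by (rule measurable_blocks_of_labelling) (rule measurable_coordinate)

text \<open>The paintbox on an infinite set is the paintbox on the natural numbers, transported by a
  bijection.\<close>
lemma exchangeable_partition_law_eq:
  assumes \<alpha>: "0 \<le> \<alpha>" "\<alpha> < 1" and \<theta>: "\<theta> > - \<alpha>"
  shows "exchangeable_partition_law \<alpha> \<theta> {Suc i..} = distr (crp_law \<alpha> \<theta>) (partition_space {Suc i..}) (shifted_blocks i)"
proof -
  let ?A = "{Suc i..}"
  let ?N = "Pi\<^sub>M ?A (\<lambda>_. count_space UNIV) :: (nat \<Rightarrow> nat) measure"
  define g where "g X = (\<lambda>v\<in>?A. X (v - Suc i))" for X :: "nat \<Rightarrow> nat"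
  have g: "g \<in> seqs \<rightarrow>\<^sub>M ?N"
    unfolding g_def[abs_def] by (rule measurable_restrict) (rule measurable_coordinate)
  have blocks: "blocks_of_labelling ?A \<in> ?N \<rightarrow>\<^sub>M partition_space ?A"
    by (rule measurable_blocks_of_labelling[where c = "\<lambda>X. X"]) (rule measurable_component_singleton)
  have "Pi\<^sub>M ?A (\<lambda>_. measure_pmf p) = distr (iid p) ?N g" for p :: "nat pmf"
  proof -
    have "distr (Pi\<^sub>M UNIV (\<lambda>_. measure_pmf p)) (Pi\<^sub>M ?A (\<lambda>_. measure_pmf p)) (\<lambda>X. \<lambda>v\<in>?A. X (v - Suc i)) =
        Pi\<^sub>M ?A (\<lambda>_. measure_pmf p)"
      by (rule distr_PiM_reindex) (auto simp: inj_on_def prob_space_measure_pmf)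
    moreover have "distr (iid p) ?N g = distr (iid p) (Pi\<^sub>M ?A (\<lambda>_. measure_pmf p)) g"
    proof (rule distr_cong)
      show "sets ?N = sets (Pi\<^sub>M ?A (\<lambda>_. measure_pmf p))" by (rule sets_PiM_cong) simp_all
    qed simp_all
    ultimately show ?thesis by (simp add: iid_def g_def[abs_def])
  qed
  then have "PD \<alpha> \<theta> \<bind> (\<lambda>y. Pi\<^sub>M ?A (\<lambda>_. measure_pmf (index_pmf y))) =
      PD \<alpha> \<theta> \<bind> (\<lambda>y. distr (iid (index_pmf y)) ?N g)" by simp
  also have "\<dots> = distr (paintbox \<alpha> \<theta>) ?N g"
    unfolding paintbox_def by (rule distr_bind[OF index_kernel_PD _ g, symmetric]) simp
  finally have "exchangeable_partition_law \<alpha> \<theta> ?A = distr (distr (paintbox \<alpha> \<theta>) ?N g) (partition_space ?A) (blocks_of_labelling ?A)"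
    by (simp add: exchangeable_partition_law_def)
  also have "\<dots> = distr (paintbox \<alpha> \<theta>) (partition_space ?A) (blocks_of_labelling ?A \<circ> g)"
    by (rule distr_distr[OF blocks]) (use g in simp)
  also have "blocks_of_labelling ?A \<circ> g = shifted_blocks i \<circ> relabel"
    by (auto simp: fun_eq_iff g_def shifted_blocks_def relabel_eq_iff intro!: blocks_of_labelling_cong)
  also have "distr (paintbox \<alpha> \<theta>) (partition_space ?A) (shifted_blocks i \<circ> relabel) =
      distr (distr (paintbox \<alpha> \<theta>) seqs relabel) (partition_space ?A) (shifted_blocks i)"
    by (rule distr_distr[symmetric]) measurable
  finally show ?thesis by (simp add: relabel_paintbox[OF \<alpha> \<theta>])
qed

section \<open>Conditional laws and the Markov property\<close>

lemma (in prob_space) real_cond_exp_indicator_eq: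
  assumes Z: "Z \<in> M \<rightarrow>\<^sub>M L" and Y: "Y \<in> M \<rightarrow>\<^sub>M N" and A: "A \<in> sets N"
    and f: "f \<in> borel_measurable L" "\<forall>x. 0 \<le> f x \<and> f x \<le> (1::real)"
    and eq: "\<And>B. B \<in> sets L \<Longrightarrow>
      (\<integral>\<^sup>+\<omega>. indicator B (Z \<omega>) * indicator A (Y \<omega>) \<partial>M) = (\<integral>\<^sup>+\<omega>. indicator B (Z \<omega>) * ennreal (f (Z \<omega>)) \<partial>M)"
  shows "AE \<omega> in M. real_cond_exp M (vimage_algebra (space M) Z L) (\<lambda>\<omega>. indicator A (Y \<omega>)) \<omega> = f (Z \<omega>)"
proof -
  let ?F = "vimage_algebra (space M) Z L"
  have Z_space: "Z \<in> space M \<rightarrow> space L" using measurable_space[OF Z] by blast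
  have ZF: "Z \<in> ?F \<rightarrow>\<^sub>M L" by (rule measurable_vimage_algebra1[OF Z_space])
  have "subalgebra M ?F"
    unfolding subalgebra_def using sets_image_in_sets[OF refl Z] by simp
  then interpret finite_measure_subalgebra M ?F by unfold_locales
  note [measurable] = Z Y A f(1)
  show ?thesis
  proof (rule real_cond_exp_charact)
    show int1: "integrable M (\<lambda>\<omega>. indicator A (Y \<omega>) :: real)"
      by (rule integrable_const_bound[where B = 1]) (auto simp: indicator_def)
    show int2: "integrable M (\<lambda>\<omega>. f (Z \<omega>))"
      by (rule integrable_const_bound[where B = 1]) (use f(2) in auto)
    show "(\<lambda>\<omega>. f (Z \<omega>)) \<in> borel_measurable ?F" by (rule measurable_compose[OF ZF f(1)])
    fix S assume "S \<in> sets ?F"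
    then obtain B where B [measurable]: "B \<in> sets L" and S: "S = Z -` B \<inter> space M"
      by (auto simp: sets_vimage_algebra2[OF Z_space])
    have "(\<integral>\<omega>\<in>S. indicator A (Y \<omega>) \<partial>M) = (\<integral>\<omega>. (indicator B (Z \<omega>) * indicator A (Y \<omega>) :: real) \<partial>M)"
      unfolding set_lebesgue_integral_def by (rule Bochner_Integration.integral_cong) (auto simp: S indicator_def)
    also have "\<dots> = enn2real (\<integral>\<^sup>+\<omega>. ennreal (indicator B (Z \<omega>) * indicator A (Y \<omega>) :: real) \<partial>M)"
      by (rule integral_eq_nn_integral) auto
    also have "(\<integral>\<^sup>+\<omega>. ennreal (indicator B (Z \<omega>) * indicator A (Y \<omega>) :: real) \<partial>M) = (\<integral>\<^sup>+\<omega>. indicator B (Z \<omega>) * indicator A (Y \<omega>) \<partial>M)"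
      by (rule nn_integral_cong) (auto simp: indicator_def)
    also have "\<dots> = (\<integral>\<^sup>+\<omega>. ennreal (indicator B (Z \<omega>) * f (Z \<omega>)) \<partial>M)"
      unfolding eq[OF B] by (rule nn_integral_cong) (auto simp: indicator_def)
    also have "enn2real \<dots> = (\<integral>\<omega>. indicator B (Z \<omega>) * f (Z \<omega>) \<partial>M)"
      by (rule integral_eq_nn_integral[symmetric]) (use f(2) in auto)
    also have "\<dots> = (\<integral>\<omega>\<in>S. f (Z \<omega>) \<partial>M)"
      unfolding set_lebesgue_integral_def by (rule Bochner_Integration.integral_cong) (auto simp: S indicator_def)
    finally show "(\<integral>\<omega>\<in>S. indicator A (Y \<omega>) \<partial>M) = (\<integral>\<omega>\<in>S. f (Z \<omega>) \<partial>M)" .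
  qed
qed

lemma measurable_nn_integral_kernel:
  assumes "K \<in> M \<rightarrow>\<^sub>M prob_algebra N" "f \<in> borel_measurable N"
  shows "(\<lambda>x. \<integral>\<^sup>+y. f y \<partial>K x) \<in> borel_measurable M"
  by (rule measurable_compose[OF measurable_prob_algebraD[OF assms(1)] nn_integral_measurable_subprob_algebra[OF assms(2)]])

definition masses :: "nat \<Rightarrow> (nat \<Rightarrow> nat) \<Rightarrow> nat \<Rightarrow> real" where
  "masses i a = component_masses ((collapse ^^ i) a)"

lemma measurable_masses [measurable]: "masses i \<in> seqs \<rightarrow>\<^sub>M seq_space"
  unfolding masses_def[abs_def] by measurable

context
  fixes \<alpha> \<theta> :: real
  assumes \<alpha>: "0 \<le> \<alpha>" "\<alpha> < 1" and \<theta>: "\<theta> > - \<alpha>"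
begin

lemma shifted_parameter: "\<theta> + real n > - \<alpha>"
  using \<theta> by simp

lemma sets_tree_law_shifted [measurable_cong, simp]: "sets (tree_law \<alpha> (\<theta> + real n)) = sets seqs"
  by (rule sets_tree_law[OF \<alpha> shifted_parameter])

lemma sets_tree_law_cong [measurable_cong, simp]: "sets (tree_law \<alpha> \<theta>) = sets seqs"
  by (rule sets_tree_law[OF \<alpha> \<theta>])

text \<open>Each coagulation step uses marks that are independent of the tree that remains.  Integrating out
  these marks one step after the other leaves a function of the masses at step \<open>n\<close>, whatever functional
  of the remaining tree is being averaged.\<close>
lemma past_integrates_out:
  assumes A: "\<And>m. A m \<in> sets seq_space"
  obtains H :: "(nat \<Rightarrow> real) \<Rightarrow> ennreal" where "H \<in> borel_measurable seq_space"
    and "\<forall>\<phi>\<in>borel_measurable seqs.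
      (\<integral>\<^sup>+a. (\<Prod>m<n. indicator (A m) (masses m a)) * \<phi> ((collapse ^^ n) a) \<partial>tree_law \<alpha> \<theta>) =
      (\<integral>\<^sup>+q. H (component_masses q) * \<phi> q \<partial>tree_law \<alpha> (\<theta> + real n))"
proof -
  have "\<exists>H :: (nat \<Rightarrow> real) \<Rightarrow> ennreal. H \<in> borel_measurable seq_space \<and> (\<forall>\<phi>\<in>borel_measurable seqs.
      (\<integral>\<^sup>+a. (\<Prod>m<n. indicator (A m) (masses m a)) * \<phi> ((collapse ^^ n) a) \<partial>tree_law \<alpha> \<theta>) =
      (\<integral>\<^sup>+q. H (component_masses q) * \<phi> q \<partial>tree_law \<alpha> (\<theta> + real n)))"
  proof (induction n)
    case 0
    show ?case by (rule exI[of _ "\<lambda>_. 1"]) simp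
  next
    case (Suc n)
    then obtain H :: "(nat \<Rightarrow> real) \<Rightarrow> ennreal" where H [measurable]: "H \<in> borel_measurable seq_space"
      and IH: "\<forall>\<phi>\<in>borel_measurable seqs.
        (\<integral>\<^sup>+a. (\<Prod>m<n. indicator (A m) (masses m a)) * \<phi> ((collapse ^^ n) a) \<partial>tree_law \<alpha> \<theta>) =
        (\<integral>\<^sup>+q. H (component_masses q) * \<phi> q \<partial>tree_law \<alpha> (\<theta> + real n))"
      by blast
    note [measurable] = A
    define \<psi> where "\<psi> x = H x * indicator (A n) x" for x
    have \<psi> [measurable]: "\<psi> \<in> borel_measurable seq_space" unfolding \<psi>_def[abs_def] by measurable
    define H' where "H' x = (\<integral>\<^sup>+y. \<psi> y \<partial>Coag_law \<alpha> (\<theta> + real n) x)" for x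
    have H' [measurable]: "H' \<in> borel_measurable seq_space"
      unfolding H'_def[abs_def] by (rule measurable_nn_integral_kernel[OF Coag_law_kernel[OF \<alpha> shifted_parameter] \<psi>])
    have "(\<integral>\<^sup>+a. (\<Prod>m<Suc n. indicator (A m) (masses m a)) * \<phi> ((collapse ^^ Suc n) a) \<partial>tree_law \<alpha> \<theta>) =
        (\<integral>\<^sup>+q. H' (component_masses q) * \<phi> q \<partial>tree_law \<alpha> (\<theta> + real (Suc n)))"
      if \<phi> [measurable]: "\<phi> \<in> borel_measurable seqs" for \<phi>
    proof -
      \<comment> \<open>The \<open>n\<close>-th factor is a function of the tree at step \<open>n\<close>, as is the remaining tree \<open>collapse q\<close>.\<close>
      define \<phi>' where "\<phi>' q = indicator (A n) (component_masses q) * \<phi> (collapse q)" for q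
      have \<phi>': "\<phi>' \<in> borel_measurable seqs" unfolding \<phi>'_def[abs_def] by measurable
      have "(\<integral>\<^sup>+a. (\<Prod>m<Suc n. indicator (A m) (masses m a)) * \<phi> ((collapse ^^ Suc n) a) \<partial>tree_law \<alpha> \<theta>) =
          (\<integral>\<^sup>+a. (\<Prod>m<n. indicator (A m) (masses m a)) * \<phi>' ((collapse ^^ n) a) \<partial>tree_law \<alpha> \<theta>)"
        by (rule nn_integral_cong) (simp add: \<phi>'_def masses_def mult.assoc)
      also have "\<dots> = (\<integral>\<^sup>+q. H (component_masses q) * \<phi>' q \<partial>tree_law \<alpha> (\<theta> + real n))"
        using IH \<phi>' by blast
      also have "\<dots> = (\<integral>\<^sup>+q. \<phi> (collapse q) * \<psi> (component_masses q) \<partial>tree_law \<alpha> (\<theta> + real n))"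
        by (rule nn_integral_cong) (simp add: \<phi>'_def \<psi>_def mult_ac)
      also have "\<dots> = (\<integral>\<^sup>+q. \<phi> q * H' (component_masses q) \<partial>tree_law \<alpha> (\<theta> + real n + 1))"
        unfolding H'_def by (rule coagulation_identity[OF \<alpha> shifted_parameter \<phi> \<psi>])
      finally show ?thesis by (simp add: mult.commute add_ac)
    qed
    then show ?case using H' by blast
  qed
  then show ?thesis using that by blast
qed

text \<open>The past is replaced by a function of the present masses, the fragmentation identity is applied,
  and the past is restored.\<close>
lemma masses_markov_rectangle:
  assumes A: "\<And>m. A m \<in> sets seq_space" and \<xi> [measurable]: "\<xi> \<in> borel_measurable seq_space"
  shows "(\<integral>\<^sup>+a. (\<Prod>m<Suc n. indicator (A m) (masses m a)) * \<xi> (masses (Suc n) a) \<partial>tree_law \<alpha> \<theta>) =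
    (\<integral>\<^sup>+a. (\<Prod>m<Suc n. indicator (A m) (masses m a)) * (\<integral>\<^sup>+z. \<xi> z \<partial>Frag_law \<alpha> (masses n a)) \<partial>tree_law \<alpha> \<theta>)"
proof -
  obtain H :: "(nat \<Rightarrow> real) \<Rightarrow> ennreal" where H [measurable]: "H \<in> borel_measurable seq_space"
    and past_all: "\<forall>\<phi>\<in>borel_measurable seqs.
      (\<integral>\<^sup>+a. (\<Prod>m<n. indicator (A m) (masses m a)) * \<phi> ((collapse ^^ n) a) \<partial>tree_law \<alpha> \<theta>) =
      (\<integral>\<^sup>+q. H (component_masses q) * \<phi> q \<partial>tree_law \<alpha> (\<theta> + real n))"
    by (rule past_integrates_out[of A n, OF A])
  note past = bspec[OF past_all]
  note [measurable] = A
  define F where "F x = (\<integral>\<^sup>+z. \<xi> z \<partial>Frag_law \<alpha> x)" for x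
  have F [measurable]: "F \<in> borel_measurable seq_space"
    unfolding F_def[abs_def] by (rule measurable_nn_integral_kernel[OF Frag_law_kernel[OF \<alpha>] \<xi>])
  define \<psi> where "\<psi> x = H x * indicator (A n) x" for x
  have \<psi> [measurable]: "\<psi> \<in> borel_measurable seq_space" unfolding \<psi>_def[abs_def] by measurable
  let ?Q = "tree_law \<alpha> (\<theta> + real n)"
  have "(\<integral>\<^sup>+a. (\<Prod>m<Suc n. indicator (A m) (masses m a)) * \<xi> (masses (Suc n) a) \<partial>tree_law \<alpha> \<theta>) =
      (\<integral>\<^sup>+a. (\<Prod>m<n. indicator (A m) (masses m a)) * (\<lambda>q. indicator (A n) (component_masses q) * \<xi> (component_masses (collapse q))) ((collapse ^^ n) a) \<partial>tree_law \<alpha> \<theta>)"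
    by (rule nn_integral_cong) (simp add: masses_def mult.assoc)
  also have "\<dots> = (\<integral>\<^sup>+q. H (component_masses q) * (indicator (A n) (component_masses q) * \<xi> (component_masses (collapse q))) \<partial>?Q)"
    by (rule past) measurable
  also have "\<dots> = (\<integral>\<^sup>+q. \<psi> (component_masses q) * \<xi> (component_masses (collapse q)) \<partial>?Q)"
    by (rule nn_integral_cong) (simp add: \<psi>_def mult.assoc)
  also have "\<dots> = (\<integral>\<^sup>+y. \<psi> y * F y \<partial>PD \<alpha> (\<theta> + real n))"
    unfolding F_def by (rule fragmentation_identity[OF \<alpha> shifted_parameter \<xi> \<psi>])
  also have "\<dots> = (\<integral>\<^sup>+q. \<psi> (component_masses q) * F (component_masses q) \<partial>?Q)"
    unfolding component_masses_tree_law[OF \<alpha> shifted_parameter, symmetric] by (rule nn_integral_distr) measurable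
  also have "\<dots> = (\<integral>\<^sup>+q. H (component_masses q) * (\<lambda>q. indicator (A n) (component_masses q) * F (component_masses q)) q \<partial>?Q)"
    by (rule nn_integral_cong) (simp add: \<psi>_def mult.assoc)
  also have "\<dots> = (\<integral>\<^sup>+a. (\<Prod>m<n. indicator (A m) (masses m a)) * (\<lambda>q. indicator (A n) (component_masses q) * F (component_masses q)) ((collapse ^^ n) a) \<partial>tree_law \<alpha> \<theta>)"
    by (rule past[symmetric]) measurable
  also have "\<dots> = (\<integral>\<^sup>+a. (\<Prod>m<Suc n. indicator (A m) (masses m a)) * F (masses n a) \<partial>tree_law \<alpha> \<theta>)"
    by (rule nn_integral_cong) (simp add: masses_def mult.assoc)
  finally show ?thesis by (simp add: F_def)
qed

text \<open>Both sides are finite measures of \<open>B\<close> that agree on rectangles.\<close>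
lemma masses_markov:
  assumes \<xi> [measurable]: "\<xi> \<in> borel_measurable seq_space" and \<xi>_le: "\<And>x. \<xi> x \<le> 1"
    and B: "B \<in> sets (Pi\<^sub>M {..n} (\<lambda>_. seq_space))"
  shows "(\<integral>\<^sup>+a. indicator B (\<lambda>m\<in>{..n}. masses m a) * \<xi> (masses (Suc n) a) \<partial>tree_law \<alpha> \<theta>) =
    (\<integral>\<^sup>+a. indicator B (\<lambda>m\<in>{..n}. masses m a) * (\<integral>\<^sup>+z. \<xi> z \<partial>Frag_law \<alpha> (masses n a)) \<partial>tree_law \<alpha> \<theta>)"
proof -
  let ?P = "tree_law \<alpha> \<theta>" and ?L = "Pi\<^sub>M {..n} (\<lambda>_. seq_space)" and ?Z = "\<lambda>a. \<lambda>m\<in>{..n}. masses m a"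
  interpret P: prob_space ?P by (rule prob_space_tree_law[OF \<alpha> \<theta>])
  define F where "F x = (\<integral>\<^sup>+z. \<xi> z \<partial>Frag_law \<alpha> x)" for x
  have F [measurable]: "F \<in> borel_measurable seq_space"
    unfolding F_def[abs_def] by (rule measurable_nn_integral_kernel[OF Frag_law_kernel[OF \<alpha>] \<xi>])
  have Z [measurable]: "?Z \<in> seqs \<rightarrow>\<^sub>M ?L" by (rule measurable_restrict) measurable
  let ?\<mu> = "distr (density ?P (\<lambda>a. \<xi> (masses (Suc n) a))) ?L ?Z"
  let ?\<nu> = "distr (density ?P (\<lambda>a. F (masses n a))) ?L ?Z"
  have weigh: "emeasure (distr (density ?P w) ?L ?Z) S = (\<integral>\<^sup>+a. indicator S (?Z a) * w a \<partial>?P)"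
    if [measurable]: "w \<in> borel_measurable seqs" "S \<in> sets ?L" for w S
  proof -
    have "emeasure (distr (density ?P w) ?L ?Z) S = emeasure (density ?P w) (?Z -` S \<inter> space (density ?P w))"
      by (rule emeasure_distr) simp_all
    also have "\<dots> = (\<integral>\<^sup>+a. w a * indicator (?Z -` S \<inter> space ?P) a \<partial>?P)"
      by (subst emeasure_density) (auto simp: measurable_sets)
    also have "\<dots> = (\<integral>\<^sup>+a. indicator S (?Z a) * w a \<partial>?P)"
      by (rule nn_integral_cong) (auto simp: indicator_def)
    finally show ?thesis .
  qed
  \<comment> \<open>The two sides of the claim, as functions of the set \<open>B\<close>.\<close>
  have "?\<mu> = ?\<nu>"
  proof (rule measure_eqI_PiM_finite[where I = "{..n}" and M = "\<lambda>_. seq_space" and A = "\<lambda>_. space ?L"])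
    fix A :: "nat \<Rightarrow> (nat \<Rightarrow> real) set" assume A: "\<And>i. i \<in> {..n} \<Longrightarrow> A i \<in> sets seq_space"
    define A' where "A' m = (if m \<le> n then A m else {})" for m
    have A': "A' m \<in> sets seq_space" for m using A[of m] by (simp add: A'_def)
    have box: "Pi\<^sub>E {..n} A \<in> sets ?L" by (rule sets_PiM_I_finite) (use A in auto)
    have ind: "indicator (Pi\<^sub>E {..n} A) (?Z a) = (\<Prod>m<Suc n. indicator (A' m) (masses m a) :: ennreal)" for a
    proof -
      have "?Z a \<in> Pi\<^sub>E {..n} A \<longleftrightarrow> (\<forall>m\<in>{..<Suc n}. masses m a \<in> A' m)"
        by (auto simp: A'_def PiE_iff less_Suc_eq_le)
      moreover have "(\<Prod>m<Suc n. indicator (A' m) (masses m a) :: ennreal) = of_bool (\<forall>m\<in>{..<Suc n}. masses m a \<in> A' m)"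
      proof (cases "\<forall>m\<in>{..<Suc n}. masses m a \<in> A' m")
        case True
        then show ?thesis by (simp del: prod.lessThan_Suc add: prod.neutral)
      next
        case False
        then obtain m where "m \<in> {..<Suc n}" "masses m a \<notin> A' m" by blast
        then have "(\<Prod>m<Suc n. indicator (A' m) (masses m a) :: ennreal) = 0"
          by (intro prod_zero bexI[of _ m]) auto
        then show ?thesis using False by (simp del: prod.lessThan_Suc)
      qed
      ultimately show ?thesis by (simp del: prod.lessThan_Suc add: indicator_def)
    qed
    show "emeasure ?\<mu> (Pi\<^sub>E {..n} A) = emeasure ?\<nu> (Pi\<^sub>E {..n} A)"
      using masses_markov_rectangle[of A' \<xi> n, OF A' \<xi>] box unfolding F_def[symmetric]
      by (simp add: weigh ind del: prod.lessThan_Suc)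
  next
    show "range (\<lambda>_::nat. space ?L) \<subseteq> prod_algebra {..n} (\<lambda>_. seq_space)"
      using sets.top[of seq_space] by (auto simp: space_PiM intro!: prod_algebraI_finite)
    show "emeasure ?\<mu> (space ?L) \<noteq> \<infinity>"
    proof -
      have "emeasure ?\<mu> (space ?L) \<le> (\<integral>\<^sup>+a. 1 \<partial>?P)"
        unfolding weigh[OF measurable_compose[OF measurable_masses \<xi>] sets.top]
        by (rule nn_integral_mono) (use \<xi>_le in \<open>auto simp: indicator_def\<close>)
      also have "\<dots> = 1" by (simp add: P.emeasure_space_1)
      finally show ?thesis by (auto simp: top_unique)
    qed
  qed simp_all
  then have "emeasure ?\<mu> B = emeasure ?\<nu> B" by simp
  then show ?thesis using B unfolding F_def[symmetric] by (simp add: weigh)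
qed

end

lemma nn_integral_indicator_kernel:
  assumes K: "K \<in> M \<rightarrow>\<^sub>M prob_algebra N" and x: "x \<in> space M" and A: "A \<in> sets N"
  shows "(\<integral>\<^sup>+z. indicator A z \<partial>K x) = ennreal (measure (K x) A)" and "measure (K x) A \<le> 1"
proof -
  have "K x \<in> space (prob_algebra N)" by (rule measurable_space[OF K x])
  then have sets: "sets (K x) = sets N" and "prob_space (K x)" by (auto simp: space_prob_algebra)
  interpret prob_space "K x" by fact
  show "(\<integral>\<^sup>+z. indicator A z \<partial>K x) = ennreal (measure (K x) A)"
    using A by (simp add: sets emeasure_eq_measure)
  show "measure (K x) A \<le> 1" by (rule prob_le_1)
qed

lemma borel_measurable_kernel_measure:
  "K \<in> M \<rightarrow>\<^sub>M prob_algebra N \<Longrightarrow> A \<in> sets N \<Longrightarrow> (\<lambda>x. measure (K x) A) \<in> borel_measurable M"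
  by (rule measurable_compose[OF _ measurable_measure_prob_algebra])

theorem theorem5p1:
  fixes \<alpha> \<theta> :: real and M :: "'a measure" and T :: "'a \<Rightarrow> nat \<Rightarrow> nat"
  assumes "0 \<le> \<alpha>" and "\<alpha> < 1" and "\<theta> > - \<alpha>"
    and "recursive_tree M \<alpha> \<theta> T"
  shows
    "(\<forall>i.
        (\<lambda>\<omega>. components_after_removing i (T \<omega>)) \<in> M \<rightarrow>\<^sub>M partition_space {Suc i..} \<and>
        distr M (partition_space {Suc i..}) (\<lambda>\<omega>. components_after_removing i (T \<omega>)) =
          exchangeable_partition_law \<alpha> (\<theta> + real i) {Suc i..}) \<and>
     (\<forall>i. AE \<omega> in M. \<forall>n.
        has_asymptotic_frequency {Suc i..} (nth_block (components_after_removing i (T \<omega>)) n)) \<and>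
     (\<forall>i. AE \<omega> in M. ranked_frequencies i (T \<omega>) \<in> ranked_simplex) \<and>
     (\<forall>i.
        (\<lambda>\<omega>. block_frequencies i (T \<omega>)) \<in> M \<rightarrow>\<^sub>M seq_space \<and>
        distr M seq_space (\<lambda>\<omega>. block_frequencies i (T \<omega>)) = GEM \<alpha> (\<theta> + real i)) \<and>
     markov_chain M seq_space (\<lambda>i \<omega>. ranked_frequencies i (T \<omega>)) \<and>
     (\<forall>i. regular_conditional_law M seq_space ranked_simplex
        (\<lambda>\<omega>. ranked_frequencies i (T \<omega>))
        seq_space (\<lambda>\<omega>. ranked_frequencies (Suc i) (T \<omega>))
        (Frag_law \<alpha>)) \<and>
     (\<forall>i. regular_conditional_law M seq_space ranked_simplex
        (\<lambda>\<omega>. ranked_frequencies (Suc i) (T \<omega>))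
        seq_space (\<lambda>\<omega>. ranked_frequencies i (T \<omega>))
        (Coag_law \<alpha> (\<theta> + real i)))"
proof -
  interpret prob_space M using assms(4) by (simp add: recursive_tree_def)
  note \<alpha> = assms(1,2) and \<theta> = assms(3)
  have \<theta>i: "\<theta> + real i > - \<alpha>" for i using \<theta> by simp
  have T_less: "T \<omega> n < n" if "\<omega> \<in> space M" "1 \<le> n" for \<omega> n
    using assms(4) that by (simp add: recursive_tree_def)
  define a where "a \<omega> = (\<lambda>n. T \<omega> (Suc n))" for \<omega>
  have a [measurable]: "a \<in> M \<rightarrow>\<^sub>M seqs" and a_law: "distr M seqs a = tree_law \<alpha> \<theta>"
    using recursive_tree_law[OF \<alpha> \<theta> assms(4)] by (simp_all add: a_def[abs_def])
  have parents: "parent_sequence (a \<omega>)" if "\<omega> \<in> space M" for \<omega>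
    using T_less[OF that, of "Suc _"] by (auto simp: parent_sequence_def a_def less_Suc_eq_le)
  \<comment> \<open>The tree in which the vertices \<open>0, \<dots>, i\<close> have been merged into the root.\<close>
  define b where "b i \<omega> = (collapse ^^ i) (a \<omega>)" for i \<omega>
  have b [measurable]: "b i \<in> M \<rightarrow>\<^sub>M seqs" for i unfolding b_def[abs_def] by measurable
  have b_law: "distr M seqs (b i) = tree_law \<alpha> (\<theta> + real i)" for i
  proof -
    have "distr (distr M seqs a) seqs (collapse ^^ i) = distr M seqs (collapse ^^ i \<circ> a)"
      by (rule distr_distr) measurable
    then show ?thesis by (simp add: a_law distr_collapse_funpow_tree_law[OF \<alpha> \<theta>] b_def[abs_def] comp_def)
  qed
  define L where "L i \<omega> = label (b i \<omega>)" for i \<omega>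
  have L [measurable]: "L i \<in> M \<rightarrow>\<^sub>M seqs" for i unfolding L_def[abs_def] by measurable
  have L_law: "distr M seqs (L i) = crp_law \<alpha> (\<theta> + real i)" for i
  proof -
    have "distr (distr M seqs (b i)) seqs label = distr M seqs (label \<circ> b i)"
      by (rule distr_distr) measurable
    then show ?thesis by (simp add: b_law label_tree_law[OF \<alpha> \<theta>i] L_def[abs_def] comp_def)
  qed
  have L_growth: "restricted_growth (L i \<omega>)" if "\<omega> \<in> space M" for i \<omega>
    unfolding L_def b_def
    by (rule restricted_growth_label[OF parent_sequence_collapse_funpow[OF parents[OF that]]])
  have components: "components_after_removing i (T \<omega>) = shifted_blocks i (L i \<omega>)" if "\<omega> \<in> space M" for i \<omega>
    using components_eq_blocks[of "T \<omega>" i, OF T_less[OF that]]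
    by (simp add: shifted_blocks_def L_def b_def a_def)
  have nth_component: "nth_block (components_after_removing i (T \<omega>)) n = {v \<in> {Suc i..}. L i \<omega> (v - Suc i) = n}"
    if "\<omega> \<in> space M" for i \<omega> n
    using nth_block_blocks_of_labelling[OF L_growth[OF that]] by (simp add: components[OF that] shifted_blocks_def)
  have frequencies: "block_frequencies i (T \<omega>) = frequency (L i \<omega>)" if "\<omega> \<in> space M" for i \<omega>
    by (rule ext) (simp only: block_frequencies_def nth_component[OF that] asymptotic_frequency_shift)
  have ranks: "ranked_frequencies i (T \<omega>) = masses i (a \<omega>)" if "\<omega> \<in> space M" for i \<omega>
    by (simp add: ranked_frequencies_def frequencies[OF that] masses_def component_masses_def L_def b_def)
  have regular: "AE \<omega> in M. regular_labels (L i \<omega>)" for i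
  proof -
    have "AE x in distr M seqs (L i). regular_labels x"
      unfolding L_law using AE_crp_law[OF \<alpha> \<theta>i] by eventually_elim simp
    then show ?thesis by (rule AE_distrD[rotated]) measurable
  qed
  define R where "R i \<omega> = ranked_frequencies i (T \<omega>)" for i \<omega>
  have R [measurable]: "R i \<in> M \<rightarrow>\<^sub>M seq_space" for i
  proof -
    have "(\<lambda>\<omega>. masses i (a \<omega>)) \<in> M \<rightarrow>\<^sub>M seq_space" by measurable
    then show ?thesis using measurable_cong[of M "R i" "\<lambda>\<omega>. masses i (a \<omega>)"] ranks by (simp add: R_def)
  qed
  have R_simplex: "AE \<omega> in M. R i \<omega> \<in> ranked_simplex" for i
    using regular[of i] AE_space
  proof eventually_elim
    fix \<omega> assume "regular_labels (L i \<omega>)" and \<omega>: "\<omega> \<in> space M"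
    then have "frequency (L i \<omega>) \<in> prob_sequences" "\<forall>n. 0 < frequency (L i \<omega>) n"
      by (auto simp: regular_labels_def)
    then have "ranked (frequency (L i \<omega>)) \<in> ranked_simplex" by (rule ranked_prob_sequence)
    then show "R i \<omega> \<in> ranked_simplex" by (simp only: R_def ranked_frequencies_def frequencies[OF \<omega>])
  qed

  have partition: "(\<lambda>\<omega>. components_after_removing i (T \<omega>)) \<in> M \<rightarrow>\<^sub>M partition_space {Suc i..} \<and>
      distr M (partition_space {Suc i..}) (\<lambda>\<omega>. components_after_removing i (T \<omega>)) =
        exchangeable_partition_law \<alpha> (\<theta> + real i) {Suc i..}" for i
  proof
    have "(\<lambda>\<omega>. shifted_blocks i (L i \<omega>)) \<in> M \<rightarrow>\<^sub>M partition_space {Suc i..}" by measurable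
    then show "(\<lambda>\<omega>. components_after_removing i (T \<omega>)) \<in> M \<rightarrow>\<^sub>M partition_space {Suc i..}"
      by (simp cong: measurable_cong add: components)
    have "distr M (partition_space {Suc i..}) (\<lambda>\<omega>. components_after_removing i (T \<omega>)) =
        distr M (partition_space {Suc i..}) (shifted_blocks i \<circ> L i)"
      by (rule distr_cong) (simp_all add: components)
    also have "\<dots> = distr (distr M seqs (L i)) (partition_space {Suc i..}) (shifted_blocks i)"
      by (rule distr_distr[symmetric]) measurable
    finally show "distr M (partition_space {Suc i..}) (\<lambda>\<omega>. components_after_removing i (T \<omega>)) =
        exchangeable_partition_law \<alpha> (\<theta> + real i) {Suc i..}"
      by (simp add: L_law exchangeable_partition_law_eq[OF \<alpha> \<theta>i])
  qed
  have asymptotic: "AE \<omega> in M. \<forall>n. has_asymptotic_frequency {Suc i..} (nth_block (components_after_removing i (T \<omega>)) n)" for i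
    using regular[of i] AE_space
    by eventually_elim (simp only: nth_component has_asymptotic_frequency_shift regular_labels_def simp_thms)
  have size_biased: "(\<lambda>\<omega>. block_frequencies i (T \<omega>)) \<in> M \<rightarrow>\<^sub>M seq_space \<and>
      distr M seq_space (\<lambda>\<omega>. block_frequencies i (T \<omega>)) = GEM \<alpha> (\<theta> + real i)" for i
  proof
    have "(\<lambda>\<omega>. frequency (L i \<omega>)) \<in> M \<rightarrow>\<^sub>M seq_space" by measurable
    then show "(\<lambda>\<omega>. block_frequencies i (T \<omega>)) \<in> M \<rightarrow>\<^sub>M seq_space"
      by (simp cong: measurable_cong add: frequencies)
    have "distr M seq_space (\<lambda>\<omega>. block_frequencies i (T \<omega>)) = distr M seq_space (frequency \<circ> L i)"
      by (rule distr_cong) (simp_all add: frequencies)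
    also have "\<dots> = distr (distr M seqs (L i)) seq_space frequency"
      by (rule distr_distr[symmetric]) measurable
    finally show "distr M seq_space (\<lambda>\<omega>. block_frequencies i (T \<omega>)) = GEM \<alpha> (\<theta> + real i)"
      by (simp add: L_law frequency_crp_law[OF \<alpha> \<theta>i])
  qed

  have R_b: "R i \<omega> = component_masses (b i \<omega>)" if "\<omega> \<in> space M" for i \<omega>
    by (simp add: R_def ranks[OF that] masses_def b_def)
  have b_Suc: "b (Suc i) \<omega> = collapse (b i \<omega>)" for i \<omega> by (simp add: b_def)
  note Frag = Frag_law_kernel[OF \<alpha>] and Coag = Coag_law_kernel[OF \<alpha> \<theta>i]
  let ?frag = "\<lambda>A x. measure (Frag_law \<alpha> x) A"
  have frag_eq: "(\<integral>\<^sup>+z. indicator A z \<partial>Frag_law \<alpha> x) = ennreal (?frag A x)" "?frag A x \<le> 1"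
    and frag_meas: "?frag A \<in> borel_measurable seq_space" if "A \<in> sets seq_space" for A x
    using nn_integral_indicator_kernel[OF Frag _ that, of x] borel_measurable_kernel_measure[OF Frag that] by auto
  let ?coag = "\<lambda>i A x. measure (Coag_law \<alpha> (\<theta> + real i) x) A"
  have coag_eq: "(\<integral>\<^sup>+z. indicator A z \<partial>Coag_law \<alpha> (\<theta> + real i) x) = ennreal (?coag i A x)" "?coag i A x \<le> 1"
    and coag_meas: "?coag i A \<in> borel_measurable seq_space" if "A \<in> sets seq_space" for i A x
    using nn_integral_indicator_kernel[OF Coag _ that, of x] borel_measurable_kernel_measure[OF Coag that] by auto

  have fragmentation: "AE \<omega> in M. real_cond_exp M (vimage_algebra (space M) (R i) seq_space)
      (\<lambda>\<omega>. indicator A (R (Suc i) \<omega>)) \<omega> = ?frag A (R i \<omega>)" if A [measurable]: "A \<in> sets seq_space" for i A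
  proof (rule real_cond_exp_indicator_eq[OF R R A frag_meas[OF A]])
    show "\<forall>x. 0 \<le> ?frag A x \<and> ?frag A x \<le> 1" using frag_eq(2)[OF A] by simp
    fix B :: "(nat \<Rightarrow> real) set" assume B [measurable]: "B \<in> sets seq_space"
    have [measurable]: "?frag A \<in> borel_measurable seq_space" by (rule frag_meas[OF A])
    let ?Q = "tree_law \<alpha> (\<theta> + real i)"
    have "(\<integral>\<^sup>+\<omega>. indicator B (R i \<omega>) * indicator A (R (Suc i) \<omega>) \<partial>M) =
        (\<integral>\<^sup>+\<omega>. indicator B (component_masses (b i \<omega>)) * indicator A (component_masses (collapse (b i \<omega>))) \<partial>M)"
      by (rule nn_integral_cong) (simp add: R_b b_Suc)
    also have "\<dots> = (\<integral>\<^sup>+q. indicator B (component_masses q) * indicator A (component_masses (collapse q)) \<partial>?Q)"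
      unfolding b_law[symmetric] by (rule nn_integral_distr[symmetric]) measurable
    also have "\<dots> = (\<integral>\<^sup>+y. indicator B y * ennreal (?frag A y) \<partial>PD \<alpha> (\<theta> + real i))"
      by (subst fragmentation_identity[OF \<alpha> \<theta>i]) (simp_all add: frag_eq)
    also have "\<dots> = (\<integral>\<^sup>+q. indicator B (component_masses q) * ennreal (?frag A (component_masses q)) \<partial>?Q)"
      unfolding component_masses_tree_law[OF \<alpha> \<theta>i, symmetric]
      by (rule nn_integral_distr) (simp_all cong: measurable_cong_sets add: sets_tree_law[OF \<alpha> \<theta>i])
    also have "\<dots> = (\<integral>\<^sup>+\<omega>. indicator B (component_masses (b i \<omega>)) * ennreal (?frag A (component_masses (b i \<omega>))) \<partial>M)"
      unfolding b_law[symmetric] by (rule nn_integral_distr) measurable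
    also have "\<dots> = (\<integral>\<^sup>+\<omega>. indicator B (R i \<omega>) * ennreal (?frag A (R i \<omega>)) \<partial>M)"
      by (rule nn_integral_cong) (simp add: R_b b_Suc)
    finally show "(\<integral>\<^sup>+\<omega>. indicator B (R i \<omega>) * indicator A (R (Suc i) \<omega>) \<partial>M) =
        (\<integral>\<^sup>+\<omega>. indicator B (R i \<omega>) * ennreal (?frag A (R i \<omega>)) \<partial>M)" .
  qed
  have coagulation: "AE \<omega> in M. real_cond_exp M (vimage_algebra (space M) (R (Suc i)) seq_space)
      (\<lambda>\<omega>. indicator A (R i \<omega>)) \<omega> = ?coag i A (R (Suc i) \<omega>)" if A [measurable]: "A \<in> sets seq_space" for i A
  proof (rule real_cond_exp_indicator_eq[OF R R A coag_meas[OF A]])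
    show "\<forall>x. 0 \<le> ?coag i A x \<and> ?coag i A x \<le> 1" using coag_eq(2)[OF A] by simp
    fix B :: "(nat \<Rightarrow> real) set" assume B [measurable]: "B \<in> sets seq_space"
    have [measurable]: "?coag i A \<in> borel_measurable seq_space" by (rule coag_meas[OF A])
    have "(\<integral>\<^sup>+\<omega>. indicator B (R (Suc i) \<omega>) * indicator A (R i \<omega>) \<partial>M) =
        (\<integral>\<^sup>+\<omega>. indicator B (component_masses (collapse (b i \<omega>))) * indicator A (component_masses (b i \<omega>)) \<partial>M)"
      by (rule nn_integral_cong) (simp add: R_b b_Suc)
    also have "\<dots> = (\<integral>\<^sup>+q. indicator B (component_masses (collapse q)) * indicator A (component_masses q) \<partial>tree_law \<alpha> (\<theta> + real i))"
      unfolding b_law[symmetric] by (rule nn_integral_distr[symmetric]) measurable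
    also have "\<dots> = (\<integral>\<^sup>+q. indicator B (component_masses q) * ennreal (?coag i A (component_masses q)) \<partial>tree_law \<alpha> (\<theta> + real i + 1))"
      by (subst coagulation_identity[OF \<alpha> \<theta>i, of "\<lambda>q. indicator B (component_masses q)"]) (simp_all add: coag_eq)
    also have "tree_law \<alpha> (\<theta> + real i + 1) = distr M seqs (b (Suc i))" by (simp add: b_law add_ac)
    also have "(\<integral>\<^sup>+q. indicator B (component_masses q) * ennreal (?coag i A (component_masses q)) \<partial>distr M seqs (b (Suc i))) =
        (\<integral>\<^sup>+\<omega>. indicator B (component_masses (b (Suc i) \<omega>)) * ennreal (?coag i A (component_masses (b (Suc i) \<omega>))) \<partial>M)"
      by (rule nn_integral_distr) measurable
    also have "\<dots> = (\<integral>\<^sup>+\<omega>. indicator B (R (Suc i) \<omega>) * ennreal (?coag i A (R (Suc i) \<omega>)) \<partial>M)"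
      by (rule nn_integral_cong) (simp add: R_b)
    finally show "(\<integral>\<^sup>+\<omega>. indicator B (R (Suc i) \<omega>) * indicator A (R i \<omega>) \<partial>M) =
        (\<integral>\<^sup>+\<omega>. indicator B (R (Suc i) \<omega>) * ennreal (?coag i A (R (Suc i) \<omega>)) \<partial>M)" .
  qed
  \<comment> \<open>Both conditional laws are given by Frag of the present state, so the past adds nothing.\<close>
  have markov: "AE \<omega> in M. real_cond_exp M
      (vimage_algebra (space M) (\<lambda>\<omega>. \<lambda>k\<in>{..n}. R k \<omega>) (Pi\<^sub>M {..n} (\<lambda>_. seq_space)))
      (\<lambda>\<omega>. indicator A (R (Suc n) \<omega>)) \<omega> = ?frag A (R n \<omega>)" if A [measurable]: "A \<in> sets seq_space" for n A
  proof -
    let ?L = "Pi\<^sub>M {..n} (\<lambda>_. seq_space)" and ?Z = "\<lambda>\<omega>. \<lambda>k\<in>{..n}. R k \<omega>"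
    have [measurable]: "?frag A \<in> borel_measurable seq_space" by (rule frag_meas[OF A])
    have Z: "?Z \<in> M \<rightarrow>\<^sub>M ?L" by (rule measurable_restrict) (rule R)
    have Z' [measurable]: "(\<lambda>a. \<lambda>k\<in>{..n}. masses k a) \<in> seqs \<rightarrow>\<^sub>M ?L" by (rule measurable_restrict) measurable
    have f: "(\<lambda>z. ?frag A (z n)) \<in> borel_measurable ?L"
      by (rule measurable_compose[OF _ frag_meas[OF A]]) (rule measurable_component_singleton, simp)
    have "AE \<omega> in M. real_cond_exp M (vimage_algebra (space M) ?Z ?L)
        (\<lambda>\<omega>. indicator A (R (Suc n) \<omega>)) \<omega> = ?frag A (?Z \<omega> n)"
    proof (rule real_cond_exp_indicator_eq[OF Z R A f])
      show "\<forall>z. 0 \<le> ?frag A (z n) \<and> ?frag A (z n) \<le> 1" using frag_eq(2)[OF A] by simp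
      fix B assume B [measurable]: "B \<in> sets ?L"
      have "(\<integral>\<^sup>+\<omega>. indicator B (?Z \<omega>) * indicator A (R (Suc n) \<omega>) \<partial>M) =
          (\<integral>\<^sup>+\<omega>. (\<lambda>a. indicator B (\<lambda>k\<in>{..n}. masses k a) * indicator A (masses (Suc n) a)) (a \<omega>) \<partial>M)"
        by (rule nn_integral_cong) (simp add: R_def ranks)
      also have "\<dots> = (\<integral>\<^sup>+a. indicator B (\<lambda>k\<in>{..n}. masses k a) * indicator A (masses (Suc n) a) \<partial>tree_law \<alpha> \<theta>)"
        unfolding a_law[symmetric] by (rule nn_integral_distr[symmetric]) measurable
      also have "\<dots> = (\<integral>\<^sup>+a. indicator B (\<lambda>k\<in>{..n}. masses k a) * ennreal (?frag A (masses n a)) \<partial>tree_law \<alpha> \<theta>)"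
        by (subst masses_markov[OF \<alpha> \<theta> _ _ B]) (auto simp: frag_eq indicator_def)
      also have "\<dots> = (\<integral>\<^sup>+\<omega>. (\<lambda>a. indicator B (\<lambda>k\<in>{..n}. masses k a) * ennreal (?frag A (masses n a))) (a \<omega>) \<partial>M)"
        unfolding a_law[symmetric] by (rule nn_integral_distr) measurable
      also have "\<dots> = (\<integral>\<^sup>+\<omega>. indicator B (?Z \<omega>) * ennreal (?frag A (?Z \<omega> n)) \<partial>M)"
        by (rule nn_integral_cong) (simp add: R_def ranks)
      finally show "(\<integral>\<^sup>+\<omega>. indicator B (?Z \<omega>) * indicator A (R (Suc n) \<omega>) \<partial>M) =
          (\<integral>\<^sup>+\<omega>. indicator B (?Z \<omega>) * ennreal (?frag A (?Z \<omega> n)) \<partial>M)" .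
    qed
    then show ?thesis by simp
  qed
  have chain: "markov_chain M seq_space R"
    unfolding markov_chain_def
  proof (intro conjI allI ballI R)
    fix n and A :: "(nat \<Rightarrow> real) set" assume A: "A \<in> sets seq_space"
    show "AE \<omega> in M. real_cond_exp M
        (vimage_algebra (space M) (\<lambda>\<omega>. \<lambda>k\<in>{..n}. R k \<omega>) (Pi\<^sub>M {..n} (\<lambda>_. seq_space)))
        (\<lambda>\<omega>. indicator A (R (Suc n) \<omega>)) \<omega> =
      real_cond_exp M (vimage_algebra (space M) (R n) seq_space) (\<lambda>\<omega>. indicator A (R (Suc n) \<omega>)) \<omega>"
      using markov[OF A, of n] fragmentation[OF A, of n] by eventually_elim simp
  qed
  have frag: "regular_conditional_law M seq_space ranked_simplex (R i) seq_space (R (Suc i)) (Frag_law \<alpha>)" for i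
    unfolding regular_conditional_law_def
    using R R_simplex measurable_restrict_space1[OF Frag] fragmentation by simp
  have coag: "regular_conditional_law M seq_space ranked_simplex (R (Suc i)) seq_space (R i) (Coag_law \<alpha> (\<theta> + real i))" for i
    unfolding regular_conditional_law_def
    using R R_simplex measurable_restrict_space1[OF Coag] coagulation by simp
  note R_facts = R_simplex[unfolded R_def] chain[unfolded R_def[abs_def]] frag[unfolded R_def[abs_def]] coag[unfolded R_def[abs_def]]
  show ?thesis
    by (intro conjI allI)
       (rule partition[THEN conjunct1] partition[THEN conjunct2] asymptotic
          size_biased[THEN conjunct1] size_biased[THEN conjunct2] R_facts)+
qed

end
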